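(* There exists a locally $5$-arc transitive $H$-graph $\Gamma$ of pushing up type, containing a $1$-arc $(x_1,x_2)$ with $|\Gamma(x_1)|=10$ and $|\Gamma(x_2)|=9$, such that, for the group $L_1:=\langle O_3(H_u^{[1]})\mid u\in\Gamma(x_1)\rangle O_3(H_{x_1}^{[1]})$, the vertex stabilizer amalgam $\mathfrak A=(H_{x_1},H_{x_2};H_{x_1,x_2})$ and its core $\mathfrak A^*:H_1^*\leftarrow B\rightarrow H_2^*$ (with $T_2$ the largest subgroup of $H_{x_1,x_2}$ normal in $H_{x_2}$), the following hold: (i) $L_1\cong E_3\times\mathrm{ASL}_2(9)$, $Z(L_1)\cong E_3$ and $O_3(B)=O_3(L_1\cap B)=O_3(T_2)\in\mathrm{Syl}_3(L_1)$; (ii) $B=(L_1\cap B)T_2$ with $L_1\cap B\cong E_3\times\mathrm{ASL}_2(9,S_0)$ and $T_2/Z(L_1)\cong K_2(9,S_0)^{(2)}$; (iii) $H_1^*\cong E_{243}\rtimes\mathrm{GL}_2(9)^{(2)}$ and $C_{H_1^*}(Z(L_1))\cong E_3\times\mathrm{AGL}_2(9)^{(4)}$; (iv) $H_2^*\cong O_3(T_2)\rtimes(\mathrm{GL}_1(9)^{(2)}\times\mathrm{AGL}_1(9))$ and $C_{H_2^*}(Z(O_3(T_2)))\cong E_3\times K_2(9,S_0)^{(4)}$; (v) $|H_{x_1}:H_1^*|=|H_{x_2}:H_2^*|=|H_{x_1,x_2}:B|=2$ and $H_{x_1}/L_1\cong Q_8$.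
   Context: Graph terminology. Graphs are finite, connected, undirected, without loops or multiple edges. An $H$-graph is a graph $\Gamma$ together with a subgroup $H\le\mathrm{Aut}(\Gamma)$. $\Gamma(z)$ is the set of neighbours of $z$, $H_z$ the stabilizer of $z$, $H_{x_1,x_2}=H_{x_1}\cap H_{x_2}$, and $H_z^{[1]}$ the kernel of $H_z$ acting on $\Gamma(z)$. An $s$-arc originating at $y_0$ is a path $(y_0,\dots,y_s)$ with $y_{i-1}\neq y_{i+1}$ for $1\le i\le s-1$; the $H$-graph is locally $s$-arc transitive if for each vertex $z$ the group $H_z$ is transitive on the $s$-arcs originating at $z$. It is of local characteristic $p$ ($p$ prime) if $C_{H_z}(O_p(H_z^{[1]}))\le O_p(H_z^{[1]})$ for all vertices $z$, and of pushing up type with respect to the $1$-arc $(y_1,y_2)$ and the prime $p$ if it is of local characteristic $p$ and $O_p(H_{y_1}^{[1]})\le O_p(H_{y_2}^{[1]})$; it is of pushing up type if this holds for some $1$-arc and some prime (here $p=3$). Core. Given the amalgam $(H_{x_1},H_{x_2};H_{x_1,x_2})$, let $T_i$ be the largest subgroup of $H_{x_1,x_2}$ with $T_i\trianglelefteq H_{x_i}$. There is a unique inclusion-minimal subgroup $B$ of $H_{x_1,x_2}$ such that $T_1T_2\le B$ and $B=H_{x_1,x_2}\cap\langle B^{H_{x_i}}\rangle$ for $i=1,2$. Put $H_i^*=\langle B^{H_{x_i}}\rangle$. The amalgam $H_1^*\leftarrow B\rightarrow H_2^*$ is the core. Group notation. $E_n$ is the elementary abelian group of order $n$, $Q_8$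 the quaternion group of order $8$. $\mathrm{ASL}_2(9)$ is the semidirect product of $\mathrm{SL}_2(9)$ with its natural module. Let $S_0\in\mathrm{Syl}_3(\mathrm{ASL}_2(9))$, $\mathrm{ASL}_2(9,S_0)=N_{\mathrm{ASL}_2(9)}(S_0)$, $\mathrm{AGL}_2(9,S_0)=N_{\mathrm{AGL}_2(9)}(S_0)$, and let $K_2(9,S_0)$ be the kernel of the (conjugation) action of $\mathrm{AGL}_2(9,S_0)$ on the set of elementary abelian subgroups of $S_0$ of order $81$. For a divisor $d$ of $8$, $\mathrm{GL}_1(9)^{(d)}$, $\mathrm{GL}_2(9)^{(d)}$, $\mathrm{AGL}_2(9)^{(d)}$, $K_2(9,S_0)^{(d)}$ denote the unique normal subgroup of index $d$ in the respective group. *)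

theory Defs
  imports
    "HOL-Analysis.Determinants"
    "HOL-Computational_Algebra.Primes"
    "HOL-Algebra.Elementary_Groups"
    "HOL-Algebra.Product_Groups"
    "HOL-Algebra.Group_Action"
    "Graph_Theory.Pair_Digraph"
    "Graph_Theory.Digraph_Component"
begin

section \<open>The field with nine elements\<close>

text \<open>\<open>GF9 a b\<close> stands for \<open>a + b i\<close> with \<open>i\<^sup>2 = -1\<close>, over the integers modulo 3
  (the type \<open>3\<close> of \<^theory>\<open>HOL-Library.Numeral_Type\<close>).\<close>

datatype gf9 = GF9 (gf9_re: "3") (gf9_im: "3")

lemma three_cases: "x = 0 \<or> x = 1 \<or> x = -1" for x :: 3
proof (cases x rule: bit1_cases)
  case (of_int z)
  then have "z = 0 \<or> z = 1 \<or> z = 2" by auto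
  then show ?thesis using of_int by auto
qed

instantiation gf9 :: field
begin

definition "0 = GF9 0 0"
definition "1 = GF9 1 0"
definition "x + y = GF9 (gf9_re x + gf9_re y) (gf9_im x + gf9_im y)"
definition "- x = GF9 (- gf9_re x) (- gf9_im x)"
definition "x - y = GF9 (gf9_re x - gf9_re y) (gf9_im x - gf9_im y)"
definition "x * y = GF9 (gf9_re x * gf9_re y - gf9_im x * gf9_im y)
                        (gf9_re x * gf9_im y + gf9_im x * gf9_re y)"
text \<open>\<open>(a + b i)\<inverse> = (a - b i) / (a\<^sup>2 + b\<^sup>2)\<close>, and every nonzero element of the prime field is its
  own inverse.\<close>
definition "inverse x = GF9 (gf9_re x * (gf9_re x * gf9_re x + gf9_im x * gf9_im x))
                            (- gf9_im x * (gf9_re x * gf9_re x + gf9_im x * gf9_im x))"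
definition "x div y = x * inverse y" for x y :: gf9

instance
proof
  fix x y z :: gf9
  show "x + y + z = x + (y + z)" "x + y = y + x" "0 + x = x" "- x + x = 0" "x - y = x + - y"
    by (simp_all add: plus_gf9_def zero_gf9_def uminus_gf9_def minus_gf9_def)
  show "x * y * z = x * (y * z)" "x * y = y * x" "1 * x = x" "(x + y) * z = x * z + y * z"
    by (simp_all add: plus_gf9_def times_gf9_def one_gf9_def algebra_simps)
  show "(0::gf9) \<noteq> 1"
    by (simp add: zero_gf9_def one_gf9_def)
  show "inverse (0::gf9) = 0"
    by (simp add: zero_gf9_def inverse_gf9_def)
  show "x div y = x * inverse y"
    by (rule divide_gf9_def)
  show "inverse x * x = 1" if "x \<noteq> 0"
  proof (cases x)
    case (GF9 a b)
    with that show ?thesis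
      using three_cases[of a] three_cases[of b]
      by (auto simp: zero_gf9_def one_gf9_def inverse_gf9_def times_gf9_def)
  qed
qed

end

lemma UNIV_gf9: "(UNIV :: gf9 set) = (\<lambda>(a, b). GF9 a b) ` UNIV"
  by (metis (no_types, lifting) UNIV_eq_I case_prod_conv gf9.exhaust rangeI)

instance gf9 :: finite
  by standard (simp add: UNIV_gf9)

lemma card_gf9: "CARD(gf9) = 9"
proof -
  have "inj (\<lambda>(a, b). GF9 a b)" by (auto intro: injI)
  then have "CARD(gf9) = CARD(3 \<times> 3)" unfolding UNIV_gf9 by (rule card_image)
  then show ?thesis by simp
qed


section \<open>Group theory\<close>

abbreviation sub :: "('a, 'b) monoid_scheme \<Rightarrow> 'a set \<Rightarrow> ('a, 'b) monoid_scheme" where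
  "sub G S \<equiv> G\<lparr>carrier := S\<rparr>"

text \<open>\<open>O\<^sub>p(G)\<close>, the largest normal \<open>p\<close>-subgroup of a finite group \<open>G\<close>.\<close>

definition Op :: "nat \<Rightarrow> ('a, 'b) monoid_scheme \<Rightarrow> 'a set" where
  "Op p G = (GREATEST N. N \<lhd> G \<and> (\<exists>n. card N = p ^ n))"

definition Syl :: "nat \<Rightarrow> ('a, 'b) monoid_scheme \<Rightarrow> 'a set set" where
  "Syl p G = {P. subgroup P G \<and> card P = p ^ multiplicity p (order G)}"

definition centralizer :: "('a, 'b) monoid_scheme \<Rightarrow> 'a set \<Rightarrow> 'a set" where
  "centralizer G S = {g \<in> carrier G. \<forall>s\<in>S. g \<otimes>\<^bsub>G\<^esub> s = s \<otimes>\<^bsub>G\<^esub> g}"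

abbreviation center :: "('a, 'b) monoid_scheme \<Rightarrow> 'a set" where
  "center G \<equiv> centralizer G (carrier G)"

definition index :: "('a, 'b) monoid_scheme \<Rightarrow> 'a set \<Rightarrow> nat" where
  "index G K = card (rcosets\<^bsub>G\<^esub> K)"

text \<open>\<open>\<langle>B\<^sup>K\<rangle>\<close>, the subgroup generated by the \<open>K\<close>-conjugates of \<open>B\<close>.\<close>

definition conj_closure :: "('a, 'b) monoid_scheme \<Rightarrow> 'a set \<Rightarrow> 'a set \<Rightarrow> 'a set" where
  "conj_closure G B K = generate G (\<Union>k\<in>K. k <#\<^bsub>G\<^esub> B #>\<^bsub>G\<^esub> inv\<^bsub>G\<^esub> k)"

text \<open>\<open>G\<^sup>(\<^sup>d\<^sup>)\<close>; meaningful only if \<open>G\<close> has a unique normal subgroup of index \<open>d\<close>.\<close>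

definition normal_of_index :: "('a, 'b) monoid_scheme \<Rightarrow> nat \<Rightarrow> ('a, 'b) monoid_scheme" where
  "normal_of_index G d = sub G (THE N. N \<lhd> G \<and> index G N = d)"

definition quotient_iso ::
    "('a, 'b) monoid_scheme \<Rightarrow> 'a set \<Rightarrow> ('c, 'd) monoid_scheme \<Rightarrow> bool" where
  "quotient_iso G N Q \<longleftrightarrow> N \<lhd> G \<and> (G Mod N) \<cong> Q"

definition semidirect ::
    "('a, 'c) monoid_scheme \<Rightarrow> ('b, 'd) monoid_scheme \<Rightarrow> ('b \<Rightarrow> 'a \<Rightarrow> 'a) \<Rightarrow> ('a \<times> 'b) monoid" where
  "semidirect N K \<phi> =
     \<lparr>carrier = carrier N \<times> carrier K,
      mult = (\<lambda>(n, k) (n', k'). (n \<otimes>\<^bsub>N\<^esub> \<phi> k n', k \<otimes>\<^bsub>K\<^esub> k')),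
      one = (\<one>\<^bsub>N\<^esub>, \<one>\<^bsub>K\<^esub>)\<rparr>"

text \<open>\<open>E\<^sub>n\<close> for \<open>n = p\<^sup>k\<close>.\<close>

definition elem_abelian :: "nat \<Rightarrow> nat \<Rightarrow> (nat \<Rightarrow> int) monoid" where
  "elem_abelian p k = product_group {..<k} (\<lambda>_. integer_mod_group p)"

text \<open>The quaternion group of order 8: the elements \<open>\<plusminus>1, \<plusminus>i, \<plusminus>j, \<plusminus>k\<close> are the integral quaternions
  \<open>a + b i + c j + d k\<close> of norm 1.\<close>

definition Q8 :: "(int \<times> int \<times> int \<times> int) monoid" where
  "Q8 = \<lparr>carrier = {(a, b, c, d). a\<^sup>2 + b\<^sup>2 + c\<^sup>2 + d\<^sup>2 = 1},
         mult = (\<lambda>(a, b, c, d) (a', b', c', d').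
           (a * a' - b * b' - c * c' - d * d',
            a * b' + b * a' + c * d' - d * c',
            a * c' - b * d' + c * a' + d * b',
            a * d' + b * c' - c * b' + d * a')),
         one = (1, 0, 0, 0)\<rparr>"


section \<open>Linear and affine groups\<close>

definition GL :: "('f::field ^ 'n ^ 'n) monoid" where
  "GL = \<lparr>carrier = {A. invertible A}, mult = (**), one = mat 1\<rparr>"

definition SL :: "('f::field ^ 'n ^ 'n) monoid" where
  "SL = sub GL {A. det A = 1}"

definition natural_module :: "('f::field ^ 'n) monoid" where
  "natural_module = \<lparr>carrier = UNIV, mult = (+), one = 0\<rparr>"

definition AGL :: "(('f::field ^ 'n) \<times> ('f ^ 'n ^ 'n)) monoid" where
  "AGL = semidirect natural_module GL (*v)"

definition ASL :: "(('f::field ^ 'n) \<times> ('f ^ 'n ^ 'n)) monoid" where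
  "ASL = semidirect natural_module SL (*v)"

type_synonym affine_2_9 = "(gf9 ^ 2) \<times> (gf9 ^ 2 ^ 2)"

abbreviation GL1_9 :: "(gf9 ^ 1 ^ 1) monoid" where "GL1_9 \<equiv> GL"
abbreviation GL2_9 :: "(gf9 ^ 2 ^ 2) monoid" where "GL2_9 \<equiv> GL"
abbreviation AGL1_9 :: "((gf9 ^ 1) \<times> (gf9 ^ 1 ^ 1)) monoid" where "AGL1_9 \<equiv> AGL"
abbreviation AGL2_9 :: "affine_2_9 monoid" where "AGL2_9 \<equiv> AGL"
abbreviation ASL2_9 :: "affine_2_9 monoid" where "ASL2_9 \<equiv> ASL"

definition ASL2_9_norm :: "affine_2_9 set \<Rightarrow> affine_2_9 monoid" where
  "ASL2_9_norm S\<^sub>0 = sub ASL2_9 (normalizer ASL2_9 S\<^sub>0)"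

definition AGL2_9_norm :: "affine_2_9 set \<Rightarrow> affine_2_9 monoid" where
  "AGL2_9_norm S\<^sub>0 = sub AGL2_9 (normalizer AGL2_9 S\<^sub>0)"

definition K2_9 :: "affine_2_9 set \<Rightarrow> affine_2_9 monoid" where
  "K2_9 S\<^sub>0 = sub AGL2_9 {g \<in> carrier (AGL2_9_norm S\<^sub>0).
     \<forall>E. subgroup E AGL2_9 \<and> E \<subseteq> S\<^sub>0 \<and> sub AGL2_9 E \<cong> elem_abelian 3 4
         \<longrightarrow> g <#\<^bsub>AGL2_9\<^esub> E #>\<^bsub>AGL2_9\<^esub> inv\<^bsub>AGL2_9\<^esub> g = E}"


section \<open>Graphs with a group of automorphisms\<close>

text \<open>An undirected graph is represented by its symmetric set of arcs. Automorphisms are, as elements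
  of \<^const>\<open>BijGroup\<close>, extensional functions on the vertex set.\<close>

definition graph_aut :: "'v pair_pre_digraph \<Rightarrow> ('v \<Rightarrow> 'v) monoid" where
  "graph_aut \<Gamma> = sub (BijGroup (pverts \<Gamma>))
     {f \<in> Bij (pverts \<Gamma>). \<forall>x\<in>pverts \<Gamma>. \<forall>y\<in>pverts \<Gamma>. (f x, f y) \<in> parcs \<Gamma> \<longleftrightarrow> (x, y) \<in> parcs \<Gamma>}"

definition H_graph :: "'v pair_pre_digraph \<Rightarrow> ('v \<Rightarrow> 'v) set \<Rightarrow> bool" where
  "H_graph \<Gamma> H \<longleftrightarrow>
     pair_graph \<Gamma> \<and> Digraph_Component.connected (with_proj \<Gamma>) \<and> subgroup H (graph_aut \<Gamma>)"

definition nbrs :: "'v pair_pre_digraph \<Rightarrow> 'v \<Rightarrow> 'v set" where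
  "nbrs \<Gamma> z = {y. (z, y) \<in> parcs \<Gamma>}"

definition vstab :: "('v \<Rightarrow> 'v) set \<Rightarrow> 'v \<Rightarrow> ('v \<Rightarrow> 'v) set" where
  "vstab H z = {h \<in> H. h z = z}"

definition vker :: "'v pair_pre_digraph \<Rightarrow> ('v \<Rightarrow> 'v) set \<Rightarrow> 'v \<Rightarrow> ('v \<Rightarrow> 'v) set" where
  "vker \<Gamma> H z = {h \<in> vstab H z. \<forall>y\<in>nbrs \<Gamma> z. h y = y}"

text \<open>\<open>O\<^sub>p(H\<^sub>z\<^sup>[\<^sup>1\<^sup>])\<close>\<close>

definition Op_ker :: "nat \<Rightarrow> 'v pair_pre_digraph \<Rightarrow> ('v \<Rightarrow> 'v) set \<Rightarrow> 'v \<Rightarrow> ('v \<Rightarrow> 'v) set" where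
  "Op_ker p \<Gamma> H z = Op p (sub (graph_aut \<Gamma>) (vker \<Gamma> H z))"

definition s_arcs :: "'v pair_pre_digraph \<Rightarrow> nat \<Rightarrow> 'v \<Rightarrow> 'v list set" where
  "s_arcs \<Gamma> s z = {ys. length ys = s + 1 \<and> ys ! 0 = z \<and>
     (\<forall>i<s. (ys ! i, ys ! (i + 1)) \<in> parcs \<Gamma>) \<and>
     (\<forall>i. 1 \<le> i \<and> i < s \<longrightarrow> ys ! (i - 1) \<noteq> ys ! (i + 1))}"

definition locally_s_arc_transitive ::
    "nat \<Rightarrow> 'v pair_pre_digraph \<Rightarrow> ('v \<Rightarrow> 'v) set \<Rightarrow> bool" where
  "locally_s_arc_transitive s \<Gamma> H \<longleftrightarrow>
     (\<forall>z\<in>pverts \<Gamma>. \<forall>\<alpha>\<in>s_arcs \<Gamma> s z. \<forall>\<beta>\<in>s_arcs \<Gamma> s z. \<exists>h\<in>vstab H z. map h \<alpha> = \<beta>)"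

definition local_characteristic :: "nat \<Rightarrow> 'v pair_pre_digraph \<Rightarrow> ('v \<Rightarrow> 'v) set \<Rightarrow> bool" where
  "local_characteristic p \<Gamma> H \<longleftrightarrow> prime p \<and>
     (\<forall>z\<in>pverts \<Gamma>. centralizer (sub (graph_aut \<Gamma>) (vstab H z)) (Op_ker p \<Gamma> H z) \<subseteq> Op_ker p \<Gamma> H z)"

definition pushing_up_type_wrt ::
    "nat \<Rightarrow> 'v pair_pre_digraph \<Rightarrow> ('v \<Rightarrow> 'v) set \<Rightarrow> 'v \<Rightarrow> 'v \<Rightarrow> bool" where
  "pushing_up_type_wrt p \<Gamma> H y\<^sub>1 y\<^sub>2 \<longleftrightarrow>
     (y\<^sub>1, y\<^sub>2) \<in> parcs \<Gamma> \<and> local_characteristic p \<Gamma> H \<and> Op_ker p \<Gamma> H y\<^sub>1 \<subseteq> Op_ker p \<Gamma> H y\<^sub>2"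

definition pushing_up_type :: "nat \<Rightarrow> 'v pair_pre_digraph \<Rightarrow> ('v \<Rightarrow> 'v) set \<Rightarrow> bool" where
  "pushing_up_type p \<Gamma> H \<longleftrightarrow> (\<exists>y\<^sub>1 y\<^sub>2. pushing_up_type_wrt p \<Gamma> H y\<^sub>1 y\<^sub>2)"


section \<open>The core of an amalgam\<close>

text \<open>The amalgam \<open>(H\<^sub>1, H\<^sub>2; H\<^sub>1\<^sub>2)\<close> is given by subgroups \<open>H\<^sub>1, H\<^sub>2\<close> of an ambient group \<open>G\<close>
  with \<open>H\<^sub>1\<^sub>2 = H\<^sub>1 \<inter> H\<^sub>2\<close>.\<close>

definition largest_normal_in :: "('a, 'b) monoid_scheme \<Rightarrow> 'a set \<Rightarrow> 'a set \<Rightarrow> 'a set" where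
  "largest_normal_in G K H\<^sub>1\<^sub>2 = (GREATEST T. T \<subseteq> H\<^sub>1\<^sub>2 \<and> T \<lhd> sub G K)"

definition core_candidate ::
    "('a, 'b) monoid_scheme \<Rightarrow> 'a set \<Rightarrow> 'a set \<Rightarrow> 'a set \<Rightarrow> bool" where
  "core_candidate G H\<^sub>1 H\<^sub>2 B \<longleftrightarrow>
     subgroup B (sub G (H\<^sub>1 \<inter> H\<^sub>2)) \<and>
     largest_normal_in G H\<^sub>1 (H\<^sub>1 \<inter> H\<^sub>2) <#>\<^bsub>G\<^esub> largest_normal_in G H\<^sub>2 (H\<^sub>1 \<inter> H\<^sub>2) \<subseteq> B \<and>
     B = (H\<^sub>1 \<inter> H\<^sub>2) \<inter> conj_closure G B H\<^sub>1 \<and>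
     B = (H\<^sub>1 \<inter> H\<^sub>2) \<inter> conj_closure G B H\<^sub>2"

definition core :: "('a, 'b) monoid_scheme \<Rightarrow> 'a set \<Rightarrow> 'a set \<Rightarrow> 'a set" where
  "core G H\<^sub>1 H\<^sub>2 = (THE B. core_candidate G H\<^sub>1 H\<^sub>2 B \<and>
     (\<forall>C. core_candidate G H\<^sub>1 H\<^sub>2 C \<and> C \<subseteq> B \<longrightarrow> C = B))"

end

theory Submission
  imports Defs "HOL-Algebra.Multiplicative_Group"
begin

text \<open>Let \<open>S\<close> be the product of \<open>E\<^sub>3\<close> and a Sylow 3-subgroup of \<open>ASL\<^sub>2(9)\<close>; it is the central product of
  its center \<open>E\<^sub>2\<^sub>7\<close> and a Heisenberg group over the field with nine elements. The vertex stabilizers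
  are explicit finite groups: \<open>K1\<close> consists of semilinear affine maps of \<open>E\<^sub>3 \<times> E\<^sub>8\<^sub>1\<close>, and \<open>K2\<close> of products
  of elements of \<open>S\<close>, of a torus with a field automorphism, and of automorphisms of \<open>S\<close> that do not respect
  the factor \<open>E\<^sub>3\<close>. They share the stabilizer \<open>C\<close> of a line, of index 10 in \<open>K1\<close> and 9 in \<open>K2\<close>, and
  no nontrivial subgroup of \<open>C\<close> is normal in both. Both \<open>K1\<close> and \<open>K2\<close> act freely on \<open>C \<times> I \<times> J\<close>,
  where \<open>I\<close> and \<open>J\<close> are the sets of cosets of \<open>C\<close>, and these actions agree on \<open>C\<close>; the coset graph of the
  permutation group generated by them realizes the amalgam. Transitivity on 5-arcs holds because, along
  one 5-arc of each kind, the pointwise stabilizer of every initial segment is transitive on its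
  continuations. The core is \<open>T\<^sub>1T\<^sub>2\<close>, consisting of the elements of \<open>C\<close> without field automorphism, and the
  isomorphism types are read off from the coordinates.\<close>

section \<open>Finite groups\<close>

text \<open>What drives the example is that \<open>S\<close> has automorphisms which do not come
  from \<open>K1\<close>. The maps indexed by \<open>c\<close> add \<open>c e\<close> to
  \<open>z\<close>, so they move \<open>Z(L1)\<close> inside \<open>Z(S)\<close>, and they permute
  the nine neighbors of \<open>x2\<close> regularly. An element of the torus with diagonal entries
  \<open>d g\<close> and \<open>d\<close>, sign \<open>\<epsilon>\<close> and field automorphism
  \<open>\<sigma>\<close> normalizes this family exactly when \<open>\<epsilon> (d^2 g)^2\<close> is
  the quotient of \<open>\<sigma>(\<omega>)\<close> by \<open>\<omega>\<close>. That quotient is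
  \<open>\<mu> s\<close>, and the relation is imposed on both stabilizers. The constant
  \<open>\<omega>\<close>, a generator of the multiplicative group, decides the isomorphism type of
  \<open>K1 / L1\<close>. With 1 in its place the quotient would be dihedral of order 8. With
  \<open>\<omega>\<close>, an element with field automorphism and determinant
  \<open>\<omega>\<close> has a square of determinant \<open>\<omega>^4 = -1\<close>, and the
  quotient is \<open>Q8\<close>. The field automorphism also carries the 5-arcs: the torus elements
  used to continue an arc at a vertex of valency nine multiply \<open>c\<close> by squares unless
  they involve it.\<close>

lemma (in group) finite_subgroupI:
  assumes "finite (carrier G)" "N \<subseteq> carrier G" "N \<noteq> {}"
    and closed: "\<And>x y. x \<in> N \<Longrightarrow> y \<in> N \<Longrightarrow> x \<otimes> y \<in> N"
  shows "subgroup N G"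
proof (rule subgroupI)
  fix x assume x: "x \<in> N"
  have pow: "x [^] n \<in> N" if "0 < n" for n :: nat
    using that
  proof (induction n rule: nat_induct_non_zero)
    case 1
    then show ?case using x assms by auto
  next
    case (Suc n)
    then show ?case using x closed by auto
  qed
  have xc: "x \<in> carrier G" using x assms by auto
  define m where "m = order G"
  have m: "x [^] m = \<one>" "0 < m"
    using xc pow_order_eq_1 assms(1) order_gt_0_iff_finite by (auto simp: m_def)
  have "x [^] (m + m - 1) \<otimes> x = \<one>"
  proof -
    have "x [^] (m + m - 1) \<otimes> x = x [^] (Suc (m + m - 1))" by simp
    also have "Suc (m + m - 1) = m + m" using m by simp
    also have "x [^] (m + m) = \<one>" using m xc by (simp flip: nat_pow_mult)
    finally show ?thesis .
  qed
  then have "inv x = x [^] (m + m - 1)"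
    using xc by (intro inv_equality) auto
  then show "inv x \<in> N" using pow m by auto
qed (use assms in auto)

text \<open>Left cancellation stands in for inverses: a left translation of a finite set is
  injective, hence onto. \<open>K1\<close> and \<open>K2\<close> thereby need no formula for the
  inverse.\<close>

lemma finite_groupI:
  fixes G (structure)
  assumes fin: "finite (carrier G)"
    and cl: "\<And>x y. x \<in> carrier G \<Longrightarrow> y \<in> carrier G \<Longrightarrow> x \<otimes> y \<in> carrier G"
    and one: "\<one> \<in> carrier G"
    and assoc: "\<And>x y z. x \<in> carrier G \<Longrightarrow> y \<in> carrier G \<Longrightarrow> z \<in> carrier G \<Longrightarrow> x \<otimes> y \<otimes> z = x \<otimes> (y \<otimes> z)"
    and l1: "\<And>x. x \<in> carrier G \<Longrightarrow> \<one> \<otimes> x = x"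
    and r1: "\<And>x. x \<in> carrier G \<Longrightarrow> x \<otimes> \<one> = x"
    and cancel: "\<And>x y z. x \<in> carrier G \<Longrightarrow> y \<in> carrier G \<Longrightarrow> z \<in> carrier G \<Longrightarrow> x \<otimes> y = x \<otimes> z \<Longrightarrow> y = z"
  shows "group G"
proof (rule groupI)
  fix x assume x: "x \<in> carrier G"
  have surj: "\<exists>y\<in>carrier G. z \<otimes> y = \<one>" if "z \<in> carrier G" for z
  proof -
    have "inj_on (\<lambda>y. z \<otimes> y) (carrier G)" using that cancel by (auto intro: inj_onI)
    then have "(\<lambda>y. z \<otimes> y) ` carrier G = carrier G"
      using fin cl that by (metis endo_inj_surj image_subsetI)
    then show ?thesis using one by (metis imageE)
  qed
  obtain y where y: "y \<in> carrier G" "x \<otimes> y = \<one>" using surj x by blast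
  obtain z where z: "z \<in> carrier G" "y \<otimes> z = \<one>" using surj y by blast
  have "x = x \<otimes> (y \<otimes> z)" using z x r1 by simp
  also have "\<dots> = z" using assoc[OF x y(1) z(1)] y z l1 by simp
  finally show "\<exists>y\<in>carrier G. y \<otimes> x = \<one>" using y z by blast
qed (use fin cl one assoc l1 in blast)+

lemma sub_carrier [simp]: "sub G (carrier G) = G" for G :: "('a, 'b) monoid_scheme"
  by simp

text \<open>Cosets are counted by an invariant that separates them. Later the invariant is the bit
  for the field automorphism, a row of a matrix, or a power of a determinant.\<close>

lemma (in group) index_eq_card_image:
  assumes N: "subgroup N G"
    and f: "\<And>x y. x \<in> carrier G \<Longrightarrow> y \<in> carrier G \<Longrightarrow> f x = f y \<longleftrightarrow> x \<otimes> inv y \<in> N"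
  shows "index G N = card (f ` carrier G)"
proof -
  have "x \<otimes> inv y \<in> N \<longleftrightarrow> N #> x = N #> y" if "x \<in> carrier G" "y \<in> carrier G" for x y
    using that N
    by (metis group.coset_join1 group.coset_join2 coset_mult_inv1 coset_mult_inv2 inv_closed m_closed
        subgroup.subset is_group)
  then have eq: "f x = f y \<longleftrightarrow> N #> x = N #> y" if "x \<in> carrier G" "y \<in> carrier G" for x y
    using f that by simp
  define g where "g C = f (SOME x. x \<in> carrier G \<and> C = N #> x)" for C
  have g: "g (N #> x) = f x" if "x \<in> carrier G" for x
    unfolding g_def using that eq by (metis (mono_tags, lifting) someI_ex)
  have "bij_betw g (rcosets N) (f ` carrier G)"
    unfolding bij_betw_def RCOSETS_def by (auto simp: g eq inj_on_def intro!: image_eqI)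
  then show ?thesis unfolding index_def by (rule bij_betw_same_card)
qed

lemma quotient_isoI:
  assumes "group X" "group Q" "f \<in> hom X Q" "f ` carrier X = carrier Q"
    and "N = {x \<in> carrier X. f x = \<one>\<^bsub>Q\<^esub>}"
  shows "quotient_iso X N Q"
proof -
  interpret group_hom X Q f using assms by (simp add: group_hom_def group_hom_axioms_def)
  have N: "N = kernel X Q f" using assms by (simp add: kernel_def)
  show ?thesis
    unfolding quotient_iso_def N using normal_kernel FactGroup_iso[OF assms(4)] by simp
qed

section \<open>The largest normal p-subgroup\<close>

text \<open>Unlike the \<open>GREATEST\<close> in \<open>Op\<close>, this predicate includes the
  existence of the largest subgroup, and so can be carried along isomorphisms.\<close>

definition is_Op :: "nat \<Rightarrow> ('a, 'b) monoid_scheme \<Rightarrow> 'a set \<Rightarrow> bool" where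
  "is_Op p G N \<longleftrightarrow> N \<lhd> G \<and> (\<exists>n. card N = p ^ n) \<and>
     (\<forall>M. M \<lhd> G \<and> (\<exists>n. card M = p ^ n) \<longrightarrow> M \<subseteq> N)"

lemma Op_eq: "is_Op p G N \<Longrightarrow> Op p G = N"
  unfolding Op_def is_Op_def by (rule Greatest_equality) auto

lemma (in group) coprime_pow_mem:
  assumes N: "subgroup N G" and x: "x \<in> carrier G"
    and "x [^] (k::nat) \<in> N" "x [^] (m::nat) \<in> N" "coprime k m"
  shows "x \<in> N"
proof -
  obtain a b where ab: "a * int k + b * int m = 1"
    using assms(5) by (metis bezout_int coprime_imp_gcd_eq_1 coprime_int_iff)
  have "x = x [^] (a * int k + b * int m)" using ab x by simp
  also have "\<dots> = (x [^] int k) [^] a \<otimes> (x [^] int m) [^] b"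
    using x by (simp add: int_pow_mult int_pow_pow mult.commute)
  also have "\<dots> = (x [^] k) [^] a \<otimes> (x [^] m) [^] b"
    by (simp add: int_pow_int)
  also have "\<dots> \<in> N"
    by (rule subgroup.m_closed[OF N subgroup_int_pow_closed[OF N assms(3)] subgroup_int_pow_closed[OF N assms(4)]])
  finally show ?thesis .
qed

text \<open>An element of a normal \<open>p\<close>-subgroup has order a power of \<open>p\<close>,
  while its \<open>k\<close>-th power lies in \<open>N\<close>. As \<open>k\<close> is prime to
  \<open>p\<close>, Bezout puts the element itself into \<open>N\<close>.\<close>

lemma is_OpI:
  fixes X (structure)
  assumes "group X" "N \<lhd> X" and p: "prime p" and n: "card N = p ^ n"
    and k: "coprime k p" "\<And>x. x \<in> carrier X \<Longrightarrow> x [^] (k::nat) \<in> N"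
  shows "is_Op p X N"
proof -
  interpret group X by fact
  have "x \<in> N" if M: "M \<lhd> X" "card M = p ^ m" and x: "x \<in> M" for M m x
  proof -
    have sM: "subgroup M X" using M by (simp add: normal_imp_subgroup)
    have xc: "x \<in> carrier X" using sM x by (auto dest: subgroup.mem_carrier)
    have "x [^] (p ^ m) = \<one>"
    proof -
      interpret M: group "sub X M" using sM by (rule subgroup_imp_group)
      have "x [^]\<^bsub>sub X M\<^esub> order (sub X M) = \<one>\<^bsub>sub X M\<^esub>"
        using x by (intro M.pow_order_eq_1) auto
      then show ?thesis using M by (simp add: order_def nat_pow_def)
    qed
    then show ?thesis
      using assms xc coprime_pow_mem[of N x k "p ^ m"]
      by (simp add: normal_imp_subgroup subgroup.one_closed)
  qed
  then show ?thesis unfolding is_Op_def using assms by auto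
qed

lemma is_Op_iso:
  assumes "group X" "group Y" "f \<in> iso X Y" "is_Op p X N"
  shows "is_Op p Y (f ` N)"
proof -
  let ?g = "inv_into (carrier X) f"
  have g: "?g \<in> iso Y X" using assms(1,3) by (simp add: group.iso_set_sym)
  have bij: "bij_betw f (carrier X) (carrier Y)" using assms(3) by (simp add: iso_def)
  have bijg: "bij_betw ?g (carrier Y) (carrier X)" using g by (simp add: iso_def)
  have N: "N \<lhd> X" and Nc: "N \<subseteq> carrier X"
    using assms(4) by (auto simp: is_Op_def normal_imp_subgroup subgroup.subset)
  have cN: "card (f ` N) = card N"
    using bij Nc by (metis bij_betw_imp_inj_on card_image inj_on_subset)
  have "M \<subseteq> f ` N" if M: "M \<lhd> Y" "card M = p ^ n" for M n
  proof -
    have Mc: "M \<subseteq> carrier Y" using M by (simp add: normal_imp_subgroup subgroup.subset)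
    have "?g ` M \<lhd> X" using iso_normal_subgroup g assms M by blast
    moreover have "card (?g ` M) = p ^ n"
      using bijg Mc M by (metis bij_betw_imp_inj_on card_image inj_on_subset)
    ultimately have "?g ` M \<subseteq> N" using assms(4) by (auto simp: is_Op_def)
    moreover have "f (?g y) = y" if "y \<in> M" for y
      using that Mc bij by (metis bij_betw_inv_into_right subsetD)
    ultimately show ?thesis by (metis image_eqI image_subset_iff subsetI)
  qed
  then show ?thesis
    using assms cN iso_normal_subgroup[OF assms(3,1,2) N] unfolding is_Op_def by auto
qed

section \<open>Subgroup constructions under injective homomorphisms\<close>

text \<open>The stabilizers in the graph are images of the explicit groups \<open>K1\<close> and
  \<open>K2\<close>. Centralizers, \<open>Op\<close>, conjugate closures, indices and quotients are
  computed there and carried over by this locale.\<close>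

locale inj_hom = group_hom +
  assumes inj: "inj_on h (carrier G)"
begin

lemma iso_sub:
  assumes "X \<subseteq> carrier G"
  shows "h \<in> iso (sub G X) (sub H (h ` X))"
  using assms inj by (auto simp: iso_def hom_def bij_betw_def inj_on_subset subset_iff)

lemma is_iso_sub:
  assumes "subgroup X G"
  shows "sub H (h ` X) \<cong> sub G X"
  using assms iso_sub group.iso_sym[of "sub G X"] G.subgroup_imp_group
  by (metis is_isoI subgroup.subset)

lemma is_Op_image:
  assumes "subgroup X G" "is_Op p (sub G X) N"
  shows "is_Op p (sub H (h ` X)) (h ` N)"
  by (rule is_Op_iso[OF _ _ iso_sub[OF subgroup.subset] assms(2)])
    (use assms in \<open>auto intro: G.subgroup_imp_group H.subgroup_imp_group subgroup_img_is_subgroup\<close>)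

lemma set_mult_image:
  assumes "X \<subseteq> carrier G" "Y \<subseteq> carrier G"
  shows "h ` X <#>\<^bsub>H\<^esub> h ` Y = h ` (X <#>\<^bsub>G\<^esub> Y)"
proof -
  have "h x \<otimes>\<^bsub>H\<^esub> h y = h (x \<otimes> y)" if "x \<in> X" "y \<in> Y" for x y
    using that assms by (simp add: subsetD)
  then show ?thesis unfolding set_mult_def by fastforce
qed

lemma conj_closure_image:
  assumes "X \<subseteq> carrier G" "Y \<subseteq> carrier G"
  shows "conj_closure H (h ` X) (h ` Y) = h ` conj_closure G X Y"
proof -
  have conj: "h y <#\<^bsub>H\<^esub> h ` X #>\<^bsub>H\<^esub> inv\<^bsub>H\<^esub> h y = h ` (y <# X #> inv y)" if "y \<in> Y" for y
  proof -
    have y: "y \<in> carrier G" using that assms by auto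
    have "h y \<otimes>\<^bsub>H\<^esub> h x \<otimes>\<^bsub>H\<^esub> inv\<^bsub>H\<^esub> h y = h (y \<otimes> x \<otimes> inv y)" if "x \<in> X" for x
      using that assms y by (simp add: subsetD)
    then show ?thesis unfolding l_coset_def r_coset_def by auto
  qed
  have "(\<Union>k\<in>h ` Y. k <#\<^bsub>H\<^esub> h ` X #>\<^bsub>H\<^esub> inv\<^bsub>H\<^esub> k) = h ` (\<Union>y\<in>Y. y <# X #> inv y)"
    by (simp add: conj image_UN)
  moreover have "(\<Union>y\<in>Y. y <# X #> inv y) \<subseteq> carrier G"
    using assms by (auto simp: l_coset_def r_coset_def)
  ultimately show ?thesis
    unfolding conj_closure_def using generate_img by simp
qed

lemma centralizer_image:
  assumes "X \<subseteq> carrier G" "Y \<subseteq> carrier G"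
  shows "centralizer (sub H (h ` X)) (h ` Y) = h ` centralizer (sub G X) Y"
proof -
  have "h x \<otimes>\<^bsub>H\<^esub> h y = h y \<otimes>\<^bsub>H\<^esub> h x \<longleftrightarrow> x \<otimes> y = y \<otimes> x" if "x \<in> X" "y \<in> Y" for x y
  proof -
    have c: "x \<in> carrier G" "y \<in> carrier G" using that assms by auto
    then have "h (x \<otimes> y) = h (y \<otimes> x) \<longleftrightarrow> x \<otimes> y = y \<otimes> x"
      by (intro inj_on_eq_iff[OF inj]) auto
    then show ?thesis using c by simp
  qed
  then show ?thesis unfolding centralizer_def by auto
qed

lemma center_image:
  assumes "X \<subseteq> carrier G"
  shows "center (sub H (h ` X)) = h ` center (sub G X)"
  using centralizer_image[OF assms assms] by simp

lemma index_image:
  assumes "subgroup X G" "subgroup Y G" "Y \<subseteq> X" "finite X"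
  shows "index (sub H (h ` X)) (h ` Y) = index (sub G X) Y"
proof -
  interpret X: group "sub G X" using assms(1) by (rule G.subgroup_imp_group)
  interpret hX: group "sub H (h ` X)" using assms(1)
    by (intro H.subgroup_imp_group subgroup_img_is_subgroup)
  have Y: "subgroup Y (sub G X)" using assms by (simp add: G.subgroup_incl)
  have hY: "subgroup (h ` Y) (sub H (h ` X))"
    using assms by (intro H.subgroup_incl subgroup_img_is_subgroup) auto
  have c: "card (h ` Y) = card Y" "card (h ` X) = card X"
    using assms inj by (meson card_image inj_on_subset subgroup.subset)+
  have "card Y \<noteq> 0" using assms by (metis card_0_eq finite_subset subgroup.one_closed empty_iff)
  moreover have "index (sub G X) Y * card Y = card X"
    using X.lagrange[OF Y] by (simp add: order_def index_def)
  moreover have "index (sub H (h ` X)) (h ` Y) * card Y = card X"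
    using hX.lagrange[OF hY] by (simp add: order_def index_def c)
  ultimately show ?thesis by (metis mult_cancel2)
qed

lemma quotient_iso_image:
  assumes X: "subgroup X G" and "group Q" and f: "f \<in> hom (sub G X) Q" "f ` X = carrier Q"
    and N: "N = {x \<in> X. f x = \<one>\<^bsub>Q\<^esub>}"
  shows "quotient_iso (sub H (h ` X)) (h ` N) Q"
proof -
  let ?g = "inv_into X h"
  have injX: "inj_on h X" using inj X by (meson inj_on_subset subgroup.subset)
  have "?g \<in> hom (sub H (h ` X)) (sub G X)"
  proof -
    have "inv_into (carrier (sub G X)) h \<in> iso (sub H (h ` X)) (sub G X)"
      using iso_sub[OF subgroup.subset[OF X]] G.subgroup_imp_group[OF X] group.iso_set_sym by blast
    then show ?thesis by (simp add: iso_def)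
  qed
  then have "f \<circ> ?g \<in> hom (sub H (h ` X)) Q"
    using f(1) by (auto simp: hom_def Pi_def)
  moreover have "(f \<circ> ?g) ` carrier (sub H (h ` X)) = carrier Q"
    using f(2) inv_into_image_cancel[OF injX order.refl] by (simp only: image_comp[symmetric]) simp
  moreover have "h ` N = {x \<in> carrier (sub H (h ` X)). (f \<circ> ?g) x = \<one>\<^bsub>Q\<^esub>}"
    using N injX by (auto simp: inv_into_f_f)
  ultimately show ?thesis
    using H.subgroup_imp_group[OF subgroup_img_is_subgroup[OF X]] \<open>group Q\<close>
    by (intro quotient_isoI)
qed

end

text \<open>The right-hand side is the intersection of the \<open>K\<close>-conjugates of
  \<open>C\<close>. In this form it coincides with the kernel of the action of \<open>K\<close> on
  the cosets of \<open>C\<close>.\<close>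

lemma (in group) largest_normal_in_eq:
  assumes K: "subgroup K G" and C: "subgroup C G" and "C \<subseteq> K"
  shows "largest_normal_in G K C = {x \<in> K. \<forall>k\<in>K. inv k \<otimes> x \<otimes> k \<in> C}" (is "_ = ?T")
  unfolding largest_normal_in_def
proof (rule Greatest_equality)
  interpret K: group "sub G K" using K by (rule subgroup_imp_group)
  have Kc: "K \<subseteq> carrier G" using K by (rule subgroup.subset)
  have TC: "?T \<subseteq> C"
  proof
    fix x assume x: "x \<in> ?T"
    then have "inv \<one> \<otimes> x \<otimes> \<one> \<in> C" using subgroup.one_closed[OF K] by blast
    then show "x \<in> C" using x Kc by auto
  qed
  have conj_mult: "inv k \<otimes> (x \<otimes> y) \<otimes> k = (inv k \<otimes> x \<otimes> k) \<otimes> (inv k \<otimes> y \<otimes> k)"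
    if "x \<in> carrier G" "y \<in> carrier G" "k \<in> carrier G" for x y k
  proof -
    have "k \<otimes> (inv k \<otimes> (y \<otimes> k)) = y \<otimes> k" using that by (simp add: m_assoc[symmetric])
    then show ?thesis using that by (simp add: m_assoc)
  qed
  have conj_inv: "inv k \<otimes> inv x \<otimes> k = inv (inv k \<otimes> x \<otimes> k)"
    if "x \<in> carrier G" "k \<in> carrier G" for x k
    using that by (simp add: inv_mult_group m_assoc)
  have T: "subgroup ?T G"
  proof (rule subgroupI)
    show "?T \<subseteq> carrier G" using Kc by auto
    have "\<one> \<in> ?T" using K C Kc by (auto simp: subgroup.one_closed subset_iff)
    then show "?T \<noteq> {}" by blast
  next
    fix x assume "x \<in> ?T"
    then show "inv x \<in> ?T"
      using K C Kc by (auto simp: conj_inv subset_iff subgroup.m_inv_closed)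
  next
    fix x y assume "x \<in> ?T" "y \<in> ?T"
    then show "x \<otimes> y \<in> ?T"
      using K C Kc by (auto simp: conj_mult subset_iff subgroup.m_closed)
  qed
  have "?T \<lhd> sub G K"
    unfolding K.normal_inv_iff
  proof (intro conjI ballI)
    show "subgroup ?T (sub G K)" using T K by (auto intro: subgroup_incl)
  next
    fix y x assume y: "y \<in> carrier (sub G K)" and x: "x \<in> ?T"
    have yc: "y \<in> carrier G" "y \<in> K" and xc: "x \<in> carrier G" using x y Kc by auto
    have "inv k \<otimes> (y \<otimes> x \<otimes> inv y) \<otimes> k \<in> C" if k: "k \<in> K" for k
    proof -
      have kc: "k \<in> carrier G" using k Kc by auto
      have "inv k \<otimes> (y \<otimes> x \<otimes> inv y) \<otimes> k = inv (inv y \<otimes> k) \<otimes> x \<otimes> (inv y \<otimes> k)"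
        using yc xc kc by (simp add: inv_mult_group m_assoc)
      moreover have "inv y \<otimes> k \<in> K" using K k yc by (simp add: subgroup.m_closed subgroup.m_inv_closed)
      ultimately show ?thesis using x by auto
    qed
    then have "y \<otimes> x \<otimes> inv y \<in> ?T"
      using x yc K by (auto simp: subgroup.m_closed subgroup.m_inv_closed)
    then show "y \<otimes>\<^bsub>sub G K\<^esub> x \<otimes>\<^bsub>sub G K\<^esub> inv\<^bsub>sub G K\<^esub> y \<in> ?T"
      using m_inv_consistent[OF K yc(2)] by simp
  qed
  then show "?T \<subseteq> C \<and> ?T \<lhd> sub G K" using TC by simp
next
  interpret K: group "sub G K" using K by (rule subgroup_imp_group)
  have Kc: "K \<subseteq> carrier G" using K by (rule subgroup.subset)
  fix N assume N: "N \<subseteq> C \<and> N \<lhd> sub G K"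
  show "N \<le> ?T"
  proof
    fix x assume x: "x \<in> N"
    have "inv k \<otimes> x \<otimes> k \<in> N" if "k \<in> K" for k
      using normal.inv_op_closed1[of N "sub G K" k x] N x that m_inv_consistent[OF K that] by simp
    then show "x \<in> ?T" using N x \<open>C \<subseteq> K\<close> by auto
  qed
qed

lemma (in inj_hom) largest_normal_in_image:
  assumes C: "subgroup C G"
  shows "largest_normal_in H (h ` carrier G) (h ` C) = h ` {x \<in> carrier G. \<forall>k\<in>carrier G. inv k \<otimes> x \<otimes> k \<in> C}"
proof -
  have *: "h x \<in> h ` C \<longleftrightarrow> x \<in> C" if "x \<in> carrier G" for x
    using inj subgroup.subset[OF C] that by (simp add: inj_on_image_mem_iff)
  have "inv\<^bsub>H\<^esub> h k \<otimes>\<^bsub>H\<^esub> h x \<otimes>\<^bsub>H\<^esub> h k \<in> h ` C \<longleftrightarrow> inv k \<otimes> x \<otimes> k \<in> C"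
    if "x \<in> carrier G" "k \<in> carrier G" for x k
    using *[of "inv k \<otimes> x \<otimes> k"] that by simp
  moreover have "largest_normal_in H (h ` carrier G) (h ` C) =
      {x \<in> h ` carrier G. \<forall>k\<in>h ` carrier G. inv\<^bsub>H\<^esub> k \<otimes>\<^bsub>H\<^esub> x \<otimes>\<^bsub>H\<^esub> k \<in> h ` C}"
    using C subgroup.subset[OF C]
    by (intro H.largest_normal_in_eq subgroup_img_is_subgroup G.subgroup_self) auto
  ultimately show ?thesis by auto
qed

text \<open>Every candidate contains \<open>T_1 T_2\<close> by definition. If this product is itself
  a candidate, it is the least one, and any minimal candidate must equal it.\<close>

lemma core_eqI:
  assumes "core_candidate G H1 H2 B"
    and "B = largest_normal_in G H1 (H1 \<inter> H2) <#>\<^bsub>G\<^esub> largest_normal_in G H2 (H1 \<inter> H2)"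
  shows "core G H1 H2 = B"
  unfolding core_def
proof (rule the_equality)
  show "core_candidate G H1 H2 B \<and> (\<forall>C. core_candidate G H1 H2 C \<and> C \<subseteq> B \<longrightarrow> C = B)"
    using assms unfolding core_candidate_def by blast
next
  fix C assume "core_candidate G H1 H2 C \<and> (\<forall>D. core_candidate G H1 H2 D \<and> D \<subseteq> C \<longrightarrow> D = C)"
  then show "C = B" using assms unfolding core_candidate_def by blast
qed

section \<open>Finite completions of amalgams\<close>

lemma hom_BijGroupI:
  assumes "group K"
    and cl: "\<And>k x. k \<in> carrier K \<Longrightarrow> x \<in> E \<Longrightarrow> act k x \<in> E"
    and one: "\<And>x. x \<in> E \<Longrightarrow> act \<one>\<^bsub>K\<^esub> x = x"
    and mult: "\<And>k l x. k \<in> carrier K \<Longrightarrow> l \<in> carrier K \<Longrightarrow> x \<in> E \<Longrightarrow> act (k \<otimes>\<^bsub>K\<^esub> l) x = act k (act l x)"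
  shows "(\<lambda>k. \<lambda>x\<in>E. act k x) \<in> hom K (BijGroup E)"
proof (rule homI)
  interpret group K by fact
  have Bij: "(\<lambda>x\<in>E. act k x) \<in> Bij E" if "k \<in> carrier K" for k
  proof -
    have "bij_betw (act k) E E"
      by (rule bij_betw_byWitness[where f' = "act (inv\<^bsub>K\<^esub> k)"])
        (use that cl one mult[symmetric] in auto)
    then show ?thesis by (simp add: Bij_def)
  qed
  fix k assume k: "k \<in> carrier K"
  show "(\<lambda>x\<in>E. act k x) \<in> carrier (BijGroup E)" using Bij[OF k] by (simp add: BijGroup_def)
  fix l assume l: "l \<in> carrier K"
  show "(\<lambda>x\<in>E. act (k \<otimes>\<^bsub>K\<^esub> l) x) = (\<lambda>x\<in>E. act k x) \<otimes>\<^bsub>BijGroup E\<^esub> (\<lambda>x\<in>E. act l x)"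
    using Bij k l cl mult by (auto simp: BijGroup_def compose_def fun_eq_iff)
qed

lemma finite_BijGroup: "finite E \<Longrightarrow> finite (carrier (BijGroup E))"
  unfolding BijGroup_def Bij_def
  by (rule finite_subset[of _ "PiE E (\<lambda>_. E)"])
    (auto simp: PiE_def bij_betw_def intro: finite_PiE[unfolded PiE_def])

text \<open>\<open>r\<close> picks a representative of the coset \<open>C x\<close> and
  \<open>c\<close> is the remaining factor in \<open>C\<close>. The coset \<open>C\<close> is
  represented by the identity, so that \<open>c\<close> restricts to the identity map of
  \<open>C\<close>.\<close>

lemma (in group) right_transversal:
  assumes C: "subgroup C G"
  obtains c r where
    "\<And>x. x \<in> carrier G \<Longrightarrow> c x \<in> C" "\<And>x. x \<in> carrier G \<Longrightarrow> r x \<in> carrier G"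
    "\<And>x. x \<in> carrier G \<Longrightarrow> x = c x \<otimes> r x"
    "\<And>a x. a \<in> C \<Longrightarrow> x \<in> carrier G \<Longrightarrow> c (a \<otimes> x) = a \<otimes> c x"
    "\<And>a x. a \<in> C \<Longrightarrow> x \<in> carrier G \<Longrightarrow> r (a \<otimes> x) = r x"
    "\<And>x. x \<in> carrier G \<Longrightarrow> c (r x) = \<one>"
    "r \<one> = \<one>"
proof -
  define r where "r x = (if x \<in> C then \<one> else SOME y. y \<in> C #> x)" for x
  have Cc: "C \<subseteq> carrier G" using C by (rule subgroup.subset)
  have coset_eq: "C #> (a \<otimes> x) = C #> x" if "a \<in> C" "x \<in> carrier G" for a x
    using that Cc C coset_join2[of a C] by (metis coset_mult_assoc subsetD)
  have mem_iff: "a \<otimes> x \<in> C \<longleftrightarrow> x \<in> C" if "a \<in> C" "x \<in> carrier G" for a x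
  proof
    assume "a \<otimes> x \<in> C"
    then have "inv a \<otimes> (a \<otimes> x) \<in> C" using that C by (meson subgroup.m_closed subgroup.m_inv_closed)
    moreover have "inv a \<otimes> (a \<otimes> x) = x" using that Cc by (auto simp: m_assoc[symmetric])
    ultimately show "x \<in> C" by simp
  qed (use that C in \<open>auto intro: subgroup.m_closed\<close>)
  have rx: "r x \<in> C #> x" if x: "x \<in> carrier G" for x
  proof (cases "x \<in> C")
    case True
    then have "C #> x = C" using C x by (simp add: coset_join2)
    then show ?thesis using True C by (simp add: r_def subgroup.one_closed)
  next
    case False
    have "x \<in> C #> x" using C x by (simp add: rcos_self)
    then show ?thesis using False unfolding r_def by (simp add: someI_ex[of "\<lambda>y. y \<in> C #> x"] exI[of _ x] someI[of "\<lambda>y. y \<in> C #> x"])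
  qed
  then have rc: "r x \<in> carrier G" if "x \<in> carrier G" for x
    using that Cc r_coset_subset_G by blast
  have ra: "r (a \<otimes> x) = r x" if "a \<in> C" "x \<in> carrier G" for a x
    using that by (simp add: r_def mem_iff coset_eq)
  have xr: "x \<otimes> inv (r x) \<in> C" if x: "x \<in> carrier G" for x
  proof -
    obtain a where a: "a \<in> C" "r x = a \<otimes> x" using rx[OF x] by (auto simp: r_coset_def)
    then have "x \<otimes> inv (r x) = inv a" using x Cc by (simp add: inv_mult_group m_assoc[symmetric] subsetD)
    then show ?thesis using a C by (simp add: subgroup.m_inv_closed)
  qed
  have rr: "r (r x) = r x" if x: "x \<in> carrier G" for x
  proof -
    obtain a where a: "a \<in> C" "r x = a \<otimes> x" using rx[OF x] by (auto simp: r_coset_def)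
    then show ?thesis using ra x by metis
  qed
  show thesis
  proof (rule that[of "\<lambda>x. x \<otimes> inv (r x)" r])
    fix x assume x: "x \<in> carrier G"
    show "x = x \<otimes> inv (r x) \<otimes> r x" using x rc by (simp add: m_assoc)
    show "r x \<otimes> inv (r (r x)) = \<one>" using x rc rr by simp
  next
    fix a x assume a: "a \<in> C" and x: "x \<in> carrier G"
    then show "a \<otimes> x \<otimes> inv (r (a \<otimes> x)) = a \<otimes> (x \<otimes> inv (r x))"
      using ra rc Cc by (simp add: m_assoc subsetD)
  next
    show "r \<one> = \<one>" using C by (simp add: r_def subgroup.one_closed)
  qed (use xr rc ra in auto)
qed

text \<open>The set is encoded as the pairs \<open>(x, y)\<close> whose factors in the common
  subgroup agree: one element of \<open>C\<close> and one representative on each side. An element of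
  \<open>K1\<close> multiplies \<open>x\<close>, while \<open>y\<close> keeps its representative and
  its factor in \<open>C\<close> follows that of \<open>x\<close>; \<open>K2\<close> acts the other
  way round. The pair of identities has trivial stabilizer in both groups.\<close>

lemma finite_completion:
  fixes K1 :: "('a, 'c) monoid_scheme" and K2 :: "('b, 'd) monoid_scheme"
  assumes K1: "group K1" and K2: "group K2" and fin: "finite (carrier K1)" "finite (carrier K2)"
    and C1: "subgroup C1 K1" and C2: "subgroup C2 K2" and \<theta>: "\<theta> \<in> iso (sub K2 C2) (sub K1 C1)"
  obtains E :: "('a \<times> 'b) set" and f1 f2 where "finite E"
    "f1 \<in> hom K1 (BijGroup E)" "inj_on f1 (carrier K1)" "f2 \<in> hom K2 (BijGroup E)" "inj_on f2 (carrier K2)"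
    "\<And>c. c \<in> C2 \<Longrightarrow> f1 (\<theta> c) = f2 c" "f1 ` carrier K1 \<inter> f2 ` carrier K2 = f2 ` C2"
proof -
  interpret K1: group K1 by fact
  interpret K2: group K2 by fact
  obtain c1 r1 where 1:
    "\<And>x. x \<in> carrier K1 \<Longrightarrow> c1 x \<in> C1" "\<And>x. x \<in> carrier K1 \<Longrightarrow> r1 x \<in> carrier K1"
    "\<And>x. x \<in> carrier K1 \<Longrightarrow> x = c1 x \<otimes>\<^bsub>K1\<^esub> r1 x"
    "\<And>a x. a \<in> C1 \<Longrightarrow> x \<in> carrier K1 \<Longrightarrow> c1 (a \<otimes>\<^bsub>K1\<^esub> x) = a \<otimes>\<^bsub>K1\<^esub> c1 x"
    "\<And>a x. a \<in> C1 \<Longrightarrow> x \<in> carrier K1 \<Longrightarrow> r1 (a \<otimes>\<^bsub>K1\<^esub> x) = r1 x"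
    "\<And>x. x \<in> carrier K1 \<Longrightarrow> c1 (r1 x) = \<one>\<^bsub>K1\<^esub>" "r1 \<one>\<^bsub>K1\<^esub> = \<one>\<^bsub>K1\<^esub>"
    using K1.right_transversal[OF C1] by blast
  obtain c2 r2 where 2:
    "\<And>x. x \<in> carrier K2 \<Longrightarrow> c2 x \<in> C2" "\<And>x. x \<in> carrier K2 \<Longrightarrow> r2 x \<in> carrier K2"
    "\<And>x. x \<in> carrier K2 \<Longrightarrow> x = c2 x \<otimes>\<^bsub>K2\<^esub> r2 x"
    "\<And>a x. a \<in> C2 \<Longrightarrow> x \<in> carrier K2 \<Longrightarrow> c2 (a \<otimes>\<^bsub>K2\<^esub> x) = a \<otimes>\<^bsub>K2\<^esub> c2 x"
    "\<And>a x. a \<in> C2 \<Longrightarrow> x \<in> carrier K2 \<Longrightarrow> r2 (a \<otimes>\<^bsub>K2\<^esub> x) = r2 x"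
    "\<And>x. x \<in> carrier K2 \<Longrightarrow> c2 (r2 x) = \<one>\<^bsub>K2\<^esub>" "r2 \<one>\<^bsub>K2\<^esub> = \<one>\<^bsub>K2\<^esub>"
    using K2.right_transversal[OF C2] by blast
  have C1c: "c \<in> carrier K1" if "c \<in> C1" for c using that C1 by (rule subgroup.mem_carrier[rotated])
  have C2c: "c \<in> carrier K2" if "c \<in> C2" for c using that C2 by (rule subgroup.mem_carrier[rotated])
  define \<tau> where "\<tau> = inv_into C2 \<theta>"
  have bij: "bij_betw \<theta> C2 C1" using \<theta> by (simp add: iso_def)
  have \<theta>C: "\<theta> c \<in> C1" if "c \<in> C2" for c using bij that by (auto simp: bij_betw_def)
  have \<tau>C: "\<tau> c \<in> C2" if "c \<in> C1" for c using bij that by (auto simp: bij_betw_def \<tau>_def inv_into_into)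
  have \<theta>\<tau>: "\<theta> (\<tau> c) = c" if "c \<in> C1" for c
    using bij that by (auto simp: bij_betw_def \<tau>_def f_inv_into_f)
  have \<tau>\<theta>: "\<tau> (\<theta> c) = c" if "c \<in> C2" for c
    using bij that by (auto simp: bij_betw_def \<tau>_def)
  have \<theta>m: "\<theta> (c \<otimes>\<^bsub>K2\<^esub> d) = \<theta> c \<otimes>\<^bsub>K1\<^esub> \<theta> d" if "c \<in> C2" "d \<in> C2" for c d
    using \<theta> that by (auto simp: iso_def hom_def)
  have one2: "\<one>\<^bsub>K2\<^esub> \<in> C2" and one1: "\<one>\<^bsub>K1\<^esub> \<in> C1" using C1 C2 by (auto simp: subgroup.one_closed)
  have \<theta>1: "\<theta> \<one>\<^bsub>K2\<^esub> = \<one>\<^bsub>K1\<^esub>"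
  proof -
    have "\<theta> \<one>\<^bsub>K2\<^esub> \<otimes>\<^bsub>K1\<^esub> \<theta> \<one>\<^bsub>K2\<^esub> = \<theta> \<one>\<^bsub>K2\<^esub>" using \<theta>m[OF one2 one2] by simp
    then show ?thesis using \<theta>C[OF one2] C1c by (metis K1.r_cancel_one')
  qed
  have c1C: "c1 c = c" "r1 c = \<one>\<^bsub>K1\<^esub>" if "c \<in> C1" for c
    using 1(4,5)[OF that, of "\<one>\<^bsub>K1\<^esub>"] 1(6)[of "\<one>\<^bsub>K1\<^esub>"] 1(7) C1c that by auto
  have c2C: "c2 c = c" "r2 c = \<one>\<^bsub>K2\<^esub>" if "c \<in> C2" for c
    using 2(4,5)[OF that, of "\<one>\<^bsub>K2\<^esub>"] 2(6)[of "\<one>\<^bsub>K2\<^esub>"] 2(7) C2c that by auto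
  have r1r: "r1 (r1 x) = r1 x" if "x \<in> carrier K1" for x
    using 1(3)[of "r1 x"] 1(2,6) that by (metis K1.l_one)
  have r2r: "r2 (r2 x) = r2 x" if "x \<in> carrier K2" for x
    using 2(3)[of "r2 x"] 2(2,6) that by (metis K2.l_one)
  define E where "E = {(x, y). x \<in> carrier K1 \<and> y \<in> carrier K2 \<and> c1 x = \<theta> (c2 y)}"
  define a1 where "a1 k = (\<lambda>(x, y). (k \<otimes>\<^bsub>K1\<^esub> x, \<tau> (c1 (k \<otimes>\<^bsub>K1\<^esub> x)) \<otimes>\<^bsub>K2\<^esub> r2 y))" for k
  define a2 where "a2 k = (\<lambda>(x, y). (\<theta> (c2 (k \<otimes>\<^bsub>K2\<^esub> y)) \<otimes>\<^bsub>K1\<^esub> r1 x, k \<otimes>\<^bsub>K2\<^esub> y))" for k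
  note [simp] = 1(1,2,4-6) 2(1,2,4-6) C1c C2c \<theta>C \<tau>C \<theta>\<tau> \<tau>\<theta> r1r r2r c1C c2C
  have h1: "(\<lambda>k. \<lambda>x\<in>E. a1 k x) \<in> hom K1 (BijGroup E)"
  proof (rule hom_BijGroupI[OF K1])
    fix x assume x: "x \<in> E"
    show "a1 \<one>\<^bsub>K1\<^esub> x = x" using x 2(3) by (auto simp: E_def a1_def)
    fix k assume k: "k \<in> carrier K1"
    show "a1 k x \<in> E" using x k by (auto simp: E_def a1_def)
    fix l assume l: "l \<in> carrier K1"
    show "a1 (k \<otimes>\<^bsub>K1\<^esub> l) x = a1 k (a1 l x)" using x k l by (auto simp: E_def a1_def K1.m_assoc)
  qed
  have h2: "(\<lambda>k. \<lambda>x\<in>E. a2 k x) \<in> hom K2 (BijGroup E)"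
  proof (rule hom_BijGroupI[OF K2])
    fix x assume x: "x \<in> E"
    show "a2 \<one>\<^bsub>K2\<^esub> x = x"
    proof -
      obtain u v where uv: "x = (u, v)" by (cases x)
      then show ?thesis using x 1(3)[of u] by (simp add: E_def a2_def)
    qed
    fix k assume k: "k \<in> carrier K2"
    show "a2 k x \<in> E" using x k by (auto simp: E_def a2_def)
    fix l assume l: "l \<in> carrier K2"
    show "a2 (k \<otimes>\<^bsub>K2\<^esub> l) x = a2 k (a2 l x)" using x k l by (auto simp: E_def a2_def K2.m_assoc)
  qed
  have pt: "(\<one>\<^bsub>K1\<^esub>, \<one>\<^bsub>K2\<^esub>) \<in> E" using one1 one2 \<theta>1 by (simp add: E_def)
  show thesis
  proof (rule that[of E "\<lambda>k. \<lambda>x\<in>E. a1 k x" "\<lambda>k. \<lambda>x\<in>E. a2 k x"])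
    show "finite E"
      by (rule finite_subset[of _ "carrier K1 \<times> carrier K2"]) (use fin in \<open>auto simp: E_def\<close>)
    have e1: "fst ((\<lambda>x\<in>E. a1 k x) (\<one>\<^bsub>K1\<^esub>, \<one>\<^bsub>K2\<^esub>)) = k" if "k \<in> carrier K1" for k
      using that pt by (simp add: a1_def)
    then show "inj_on (\<lambda>k. \<lambda>x\<in>E. a1 k x) (carrier K1)"
      by (rule inj_on_inverseI[where g = "\<lambda>f. fst (f (\<one>\<^bsub>K1\<^esub>, \<one>\<^bsub>K2\<^esub>))"])
    have e2: "snd ((\<lambda>x\<in>E. a2 k x) (\<one>\<^bsub>K1\<^esub>, \<one>\<^bsub>K2\<^esub>)) = k" if "k \<in> carrier K2" for k
      using that pt by (simp add: a2_def)
    then show "inj_on (\<lambda>k. \<lambda>x\<in>E. a2 k x) (carrier K2)"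
      by (rule inj_on_inverseI[where g = "\<lambda>f. snd (f (\<one>\<^bsub>K1\<^esub>, \<one>\<^bsub>K2\<^esub>))"])
    show eq: "(\<lambda>x\<in>E. a1 (\<theta> c) x) = (\<lambda>x\<in>E. a2 c x)" if c: "c \<in> C2" for c
    proof (rule restrict_ext)
      fix x assume x: "x \<in> E"
      obtain u v where uv: "x = (u, v)" by (cases x)
      have u: "u \<in> carrier K1" and v: "v \<in> carrier K2" and cuv: "c1 u = \<theta> (c2 v)"
        using x uv by (auto simp: E_def)
      have "\<tau> (\<theta> c \<otimes>\<^bsub>K1\<^esub> \<theta> (c2 v)) = c \<otimes>\<^bsub>K2\<^esub> c2 v"
        using c v C2 by (simp flip: \<theta>m add: subgroup.m_closed)
      moreover have "\<theta> c \<otimes>\<^bsub>K1\<^esub> u = \<theta> c \<otimes>\<^bsub>K1\<^esub> (\<theta> (c2 v) \<otimes>\<^bsub>K1\<^esub> r1 u)"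
        using 1(3)[OF u] cuv by simp
      moreover have "c \<otimes>\<^bsub>K2\<^esub> v = c \<otimes>\<^bsub>K2\<^esub> (c2 v \<otimes>\<^bsub>K2\<^esub> r2 v)"
        using 2(3)[OF v] by simp
      ultimately show "a1 (\<theta> c) x = a2 c x"
        using c u v cuv by (simp add: uv a1_def a2_def \<theta>m K1.m_assoc K2.m_assoc)
    qed
    show "(\<lambda>k. \<lambda>x\<in>E. a1 k x) ` carrier K1 \<inter> (\<lambda>k. \<lambda>x\<in>E. a2 k x) ` carrier K2 = (\<lambda>k. \<lambda>x\<in>E. a2 k x) ` C2"
    proof (intro equalityI subsetI)
      fix g assume "g \<in> (\<lambda>k. \<lambda>x\<in>E. a1 k x) ` carrier K1 \<inter> (\<lambda>k. \<lambda>x\<in>E. a2 k x) ` carrier K2"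
      then obtain k l where k: "k \<in> carrier K1" "g = (\<lambda>x\<in>E. a1 k x)"
        and l: "l \<in> carrier K2" "g = (\<lambda>x\<in>E. a2 l x)" by auto
      have "g (\<one>\<^bsub>K1\<^esub>, \<one>\<^bsub>K2\<^esub>) = g (\<one>\<^bsub>K1\<^esub>, \<one>\<^bsub>K2\<^esub>)" by simp
      then have "a1 k (\<one>\<^bsub>K1\<^esub>, \<one>\<^bsub>K2\<^esub>) = a2 l (\<one>\<^bsub>K1\<^esub>, \<one>\<^bsub>K2\<^esub>)" using pt k(2) l(2)
        by (metis restrict_apply')
      \<comment> \<open>These are the first components of the two images of the pair of identities;
        the representative on the right is the identity. So a permutation that comes from both sides
        comes from the common subgroup.\<close>
      then have "k = \<theta> (c2 l)" using k l 1(7) by (simp add: a1_def a2_def)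
      moreover have "c2 l \<in> C2" using l by simp
      ultimately show "g \<in> (\<lambda>k. \<lambda>x\<in>E. a2 k x) ` C2" using eq[of "c2 l"] k(2) by simp
    next
      fix g assume "g \<in> (\<lambda>k. \<lambda>x\<in>E. a2 k x) ` C2"
      then obtain c where c: "c \<in> C2" "g = (\<lambda>x\<in>E. a2 c x)" by auto
      then show "g \<in> (\<lambda>k. \<lambda>x\<in>E. a1 k x) ` carrier K1 \<inter> (\<lambda>k. \<lambda>x\<in>E. a2 k x) ` carrier K2"
        by (intro IntI image_eqI[of _ _ "\<theta> c"] image_eqI[of _ _ c]) (simp_all add: eq)
    qed
  qed (use h1 h2 in auto)
qed

section \<open>Coset graphs\<close>

lemma group_graph_aut: "group (graph_aut \<Gamma>)"
proof -
  interpret B: group "BijGroup (pverts \<Gamma>)" by (rule group_BijGroup)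
  let ?V = "pverts \<Gamma>"
  let ?A = "{f \<in> Bij ?V. \<forall>x\<in>?V. \<forall>y\<in>?V. (f x, f y) \<in> parcs \<Gamma> \<longleftrightarrow> (x, y) \<in> parcs \<Gamma>}"
  have "subgroup ?A (BijGroup ?V)"
  proof (rule B.subgroupI)
    show "?A \<subseteq> carrier (BijGroup ?V)" by (auto simp: BijGroup_def)
    have "(\<lambda>x\<in>?V. x) \<in> ?A" by (auto simp: id_Bij)
    then show "?A \<noteq> {}" by blast
  next
    fix f assume f: "f \<in> ?A"
    then have B: "f \<in> Bij ?V" by blast
    have i: "inv\<^bsub>BijGroup ?V\<^esub> f \<in> Bij ?V"
      unfolding inv_BijGroup[OF B] by (rule restrict_inv_into_Bij[OF B])
    have fi: "f ((inv\<^bsub>BijGroup ?V\<^esub> f) x) = x" "(inv\<^bsub>BijGroup ?V\<^esub> f) x \<in> ?V" if "x \<in> ?V" for x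
    proof -
      have "x \<in> f ` ?V" using \<open>x \<in> ?V\<close> B by (simp add: Bij_def bij_betw_def)
      then show "f ((inv\<^bsub>BijGroup ?V\<^esub> f) x) = x" "(inv\<^bsub>BijGroup ?V\<^esub> f) x \<in> ?V"
        using that inv_BijGroup[OF B] by (simp_all add: f_inv_into_f inv_into_into)
    qed
    have "((inv\<^bsub>BijGroup ?V\<^esub> f) x, (inv\<^bsub>BijGroup ?V\<^esub> f) y) \<in> parcs \<Gamma> \<longleftrightarrow> (x, y) \<in> parcs \<Gamma>"
      if "x \<in> ?V" "y \<in> ?V" for x y
    proof -
      have "\<forall>x\<in>?V. \<forall>y\<in>?V. (f x, f y) \<in> parcs \<Gamma> \<longleftrightarrow> (x, y) \<in> parcs \<Gamma>" using f by blast
      from this[rule_format, OF fi(2)[OF that(1)] fi(2)[OF that(2)]] show ?thesis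
        using fi(1) that by simp
    qed
    then show "inv\<^bsub>BijGroup ?V\<^esub> f \<in> ?A" using i by blast
  next
    fix f g assume f: "f \<in> ?A" and g: "g \<in> ?A"
    have "g x \<in> ?V" if "x \<in> ?V" for x using g that by (auto dest: Bij_imp_funcset)
    then show "f \<otimes>\<^bsub>BijGroup ?V\<^esub> g \<in> ?A"
      using f g by (auto simp: BijGroup_def compose_Bij) (simp_all add: compose_def)
  qed
  then show ?thesis unfolding graph_aut_def by (rule B.subgroup_imp_group)
qed

text \<open>\<open>generated\<close> yields connectedness of the coset graph,
  \<open>faithful\<close> makes the action on its vertices faithful, and \<open>proper\<close> keeps
  the two kinds of vertices apart.\<close>

locale coset_geometry = group G for G (structure) +
  fixes P1 P2
  assumes finite: "finite (carrier G)"
    and P1: "subgroup P1 G" and P2: "subgroup P2 G"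
    and generated: "generate G (P1 \<union> P2) = carrier G"
    and faithful: "\<And>N. N \<lhd> G \<Longrightarrow> N \<subseteq> P1 \<Longrightarrow> N \<subseteq> P2 \<Longrightarrow> N \<subseteq> {\<one>}"
    and proper: "P1 \<noteq> P2"
begin

definition "side i = (if i then P1 else P2)"

lemma side: "subgroup (side i) G"
  using P1 P2 by (simp add: side_def)

lemma lcos_eq_iff:
  assumes "g \<in> carrier G" "h \<in> carrier G"
  shows "g <# side i = h <# side i \<longleftrightarrow> inv g \<otimes> h \<in> side i"
proof
  assume "g <# side i = h <# side i"
  then have "h \<in> g <# side i" using assms(2) side subgroup.one_closed[OF side[of i]]
    by (force simp: l_coset_def)
  then obtain p where "p \<in> side i" "h = g \<otimes> p" by (auto simp: l_coset_def)
  then show "inv g \<otimes> h \<in> side i"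
    using assms subgroup.mem_carrier[OF side] by (simp add: m_assoc[symmetric])
next
  assume p: "inv g \<otimes> h \<in> side i"
  have "h = g \<otimes> (inv g \<otimes> h)" using assms by (simp add: m_assoc[symmetric])
  then have "h \<in> g <# side i" using p by (auto simp: l_coset_def)
  then show "g <# side i = h <# side i" using assms side by (intro l_repr_independence)
qed

text \<open>Translating a left coset back by a representative recovers the subgroup. The two
  families of vertices are therefore disjoint and the graph is bipartite.\<close>

lemma lcos_side:
  assumes g: "g \<in> carrier G" and h: "h \<in> carrier G" and eq: "g <# side i = h <# side j"
  shows "i = j"
proof -
  have "h \<in> h <# side j" using h subgroup.one_closed[OF side[of j]] by (force simp: l_coset_def)
  then have "g <# side i = h <# side i" using g side eq by (intro l_repr_independence) auto
  then have "inv h <# (h <# side i) = inv h <# (h <# side j)" using eq by simp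
  then have "side i = side j" using h side[THEN subgroup.subset] by (simp add: lcos_m_assoc lcos_mult_one)
  then show ?thesis using proper by (auto simp: side_def split: if_splits)
qed

definition "cosets = {g <# side i | g i. g \<in> carrier G}"

text \<open>The finitely many cosets are numbered, so that the vertices are natural numbers whatever
  the type of the group.\<close>

definition code :: "'a set \<Rightarrow> nat" where "code = (SOME f. inj_on f cosets)"

definition "vtx i g = code (g <# side i)"

definition "vertices = {vtx i g | i g. g \<in> carrier G}"

definition "cgraph = \<lparr>pverts = vertices, parcs = {(vtx i g, vtx (\<not> i) g) | i g. g \<in> carrier G}\<rparr>"

lemma inj_code: "inj_on code cosets"
proof -
  have "cosets \<subseteq> Pow (carrier G)"
    using side[THEN subgroup.subset] by (auto simp: cosets_def l_coset_def)
  then have "finite cosets" using finite by (meson finite_Pow_iff finite_subset)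
  then have "\<exists>f :: 'a set \<Rightarrow> nat. inj_on f cosets"
    by (meson finite_imp_inj_to_nat_seg)
  then show ?thesis unfolding code_def by (rule someI_ex)
qed

lemma vtx_eq_iff:
  assumes "g \<in> carrier G" "h \<in> carrier G"
  shows "vtx i g = vtx j h \<longleftrightarrow> i = j \<and> inv g \<otimes> h \<in> side i"
proof -
  have "vtx i g = vtx j h \<longleftrightarrow> g <# side i = h <# side j"
    unfolding vtx_def using assms by (intro inj_on_eq_iff[OF inj_code]) (auto simp: cosets_def)
  then show ?thesis using lcos_side lcos_eq_iff assms by blast
qed

lemma vtx_mem: "g \<in> carrier G \<Longrightarrow> vtx i g \<in> vertices"
  by (auto simp: vertices_def)

lemma verticesE:
  assumes "x \<in> vertices"
  obtains i g where "g \<in> carrier G" "x = vtx i g"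
  using assms by (auto simp: vertices_def)

definition act :: "'a \<Rightarrow> nat \<Rightarrow> nat" where
  "act m = (\<lambda>x\<in>vertices. let (i, g) = (SOME (i, g). g \<in> carrier G \<and> x = vtx i g) in vtx i (m \<otimes> g))"

lemma act_vtx [simp]:
  assumes "m \<in> carrier G" "g \<in> carrier G"
  shows "act m (vtx i g) = vtx i (m \<otimes> g)"
proof -
  have v: "vtx i g \<in> vertices" using assms by (auto simp: vertices_def)
  let ?P = "\<lambda>(j, h). h \<in> carrier G \<and> vtx i g = vtx j h"
  obtain j h where jh: "(SOME p. ?P p) = (j, h)" by fastforce
  have "?P (SOME p. ?P p)" using assms by (intro someI[of ?P "(i, g)"]) simp
  then have h: "h \<in> carrier G" "vtx i g = vtx j h" by (auto simp: jh)
  then have "act m (vtx i g) = vtx j (m \<otimes> h)" using v jh by (simp add: act_def)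
  also have "\<dots> = vtx i (m \<otimes> g)"
  proof -
    have j: "j = i" "inv h \<otimes> g \<in> side i" using h(2)[symmetric] h(1) assms by (auto simp: vtx_eq_iff)
    have "inv (m \<otimes> h) \<otimes> (m \<otimes> g) = inv h \<otimes> (inv m \<otimes> m \<otimes> g)"
      using h assms by (simp only: inv_mult_group m_assoc inv_closed m_closed)
    then show ?thesis using h assms j by (simp add: vtx_eq_iff)
  qed
  finally show ?thesis .
qed

lemma act_mult:
  assumes "m \<in> carrier G" "n \<in> carrier G" "x \<in> vertices"
  shows "act (m \<otimes> n) x = act m (act n x)"
  using assms by (auto elim!: verticesE simp: m_assoc)

lemma act_hom_Bij: "act \<in> hom G (BijGroup vertices)"
proof -
  have "(\<lambda>m. \<lambda>x\<in>vertices. act m x) \<in> hom G (BijGroup vertices)"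
    by (rule hom_BijGroupI[OF is_group]) (auto elim!: verticesE simp: m_assoc vtx_mem)
  moreover have "(\<lambda>m. \<lambda>x\<in>vertices. act m x) = act" by (auto simp: act_def fun_eq_iff)
  ultimately show ?thesis by simp
qed

lemma pverts_cgraph [simp]: "pverts cgraph = vertices"
  by (simp add: cgraph_def)

lemma arcI: "g \<in> carrier G \<Longrightarrow> (vtx i g, vtx (\<not> i) g) \<in> parcs cgraph"
  by (auto simp: cgraph_def)

lemma arcE:
  assumes "(x, y) \<in> parcs cgraph"
  obtains i g where "g \<in> carrier G" "x = vtx i g" "y = vtx (\<not> i) g"
  using assms by (auto simp: cgraph_def)

lemma act_arc:
  assumes "m \<in> carrier G" "(x, y) \<in> parcs cgraph"
  shows "(act m x, act m y) \<in> parcs cgraph"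
  using assms(2) by (rule arcE) (use assms(1) in \<open>simp add: arcI\<close>)

lemma act_inv:
  assumes "m \<in> carrier G" "x \<in> vertices"
  shows "act (inv m) (act m x) = x"
  using assms by (auto elim!: verticesE simp: m_assoc[symmetric])

lemma act_in_aut: "m \<in> carrier G \<Longrightarrow> act m \<in> carrier (graph_aut cgraph)"
proof -
  assume m: "m \<in> carrier G"
  have "act m \<in> Bij vertices" using act_hom_Bij m by (auto simp: hom_def BijGroup_def)
  moreover have "(act m x, act m y) \<in> parcs cgraph \<longleftrightarrow> (x, y) \<in> parcs cgraph"
    if "x \<in> vertices" "y \<in> vertices" for x y
    using act_arc[OF m, of x y] act_arc[of "inv m" "act m x" "act m y"] act_inv[OF m] that m by auto
  ultimately show ?thesis by (simp add: graph_aut_def)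
qed

text \<open>The kernel of the action fixes both base vertices, hence lies in \<open>P1\<close> and
  in \<open>P2\<close>, and is trivial by \<open>faithful\<close>.\<close>

lemma act_one: "g \<in> carrier G \<Longrightarrow> (\<forall>x\<in>vertices. act g x = x) \<Longrightarrow> g = \<one>"
proof -
  let ?N = "{g \<in> carrier G. \<forall>x\<in>vertices. act g x = x}"
  have "?N = kernel G (BijGroup vertices) act"
    using act_hom_Bij by (auto simp: kernel_def BijGroup_def fun_eq_iff act_def)
  then have "?N \<lhd> G"
    using group_hom.normal_kernel[of G "BijGroup vertices" act] act_hom_Bij is_group
      group_BijGroup[of vertices]
    by (simp add: group_hom_def group_hom_axioms_def)
  moreover have "g \<in> side i" if "g \<in> ?N" for g i
  proof -
    have "act g (vtx i \<one>) = vtx i \<one>" using that vtx_mem[OF one_closed] by blast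
    then have "vtx i \<one> = vtx i g" using that by simp
    then show ?thesis using that by (subst (asm) vtx_eq_iff) auto
  qed
  then have "?N \<subseteq> P1" "?N \<subseteq> P2" by (auto simp: side_def split: if_splits) (metis, metis)
  ultimately have "?N \<subseteq> {\<one>}" by (rule faithful)
  then show "g \<in> carrier G \<Longrightarrow> (\<forall>x\<in>vertices. act g x = x) \<Longrightarrow> g = \<one>" by blast
qed

lemma act_inj_hom: "inj_hom G (graph_aut cgraph) act"
proof -
  interpret gh: group_hom G "graph_aut cgraph" act
  proof -
    have "act \<in> hom G (graph_aut cgraph)"
    proof (rule homI)
      fix x y assume "x \<in> carrier G" "y \<in> carrier G"
      then show "act (x \<otimes> y) = act x \<otimes>\<^bsub>graph_aut cgraph\<^esub> act y"
        using act_hom_Bij by (simp add: hom_def graph_aut_def)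
    qed (rule act_in_aut)
    then show "group_hom G (graph_aut cgraph) act"
      using is_group group_graph_aut by (simp add: group_hom_def group_hom_axioms_def)
  qed
  have "inj_on act (carrier G)"
  proof (rule inj_onI)
    fix x y assume xy: "x \<in> carrier G" "y \<in> carrier G" "act x = act y"
    have "\<forall>v\<in>vertices. act (inv x \<otimes> y) v = v"
    proof
      fix v assume v: "v \<in> vertices"
      then show "act (inv x \<otimes> y) v = v" using xy act_inv[OF xy(1) v] act_mult[of "inv x" y v] by simp
    qed
    then have "inv x \<otimes> y = \<one>" using xy by (intro act_one) auto
    moreover have "x \<otimes> (inv x \<otimes> y) = y" by (metis xy(1,2) inv_closed l_one m_assoc r_inv)
    ultimately show "x = y" using xy by simp
  qed
  then show ?thesis by unfold_locales
qed

lemma vstab_vtx: "vstab (act ` carrier G) (vtx i \<one>) = act ` side i"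
proof -
  have "act g (vtx i \<one>) = vtx i \<one> \<longleftrightarrow> g \<in> side i" if g: "g \<in> carrier G" for g
  proof -
    have "vtx i \<one> = vtx i g \<longleftrightarrow> g \<in> side i" using g by (simp add: vtx_eq_iff)
    then show ?thesis using g by (auto simp: eq_commute[of "vtx i g"])
  qed
  moreover have "side i \<subseteq> carrier G" using side by (rule subgroup.subset)
  ultimately show ?thesis by (auto simp: vstab_def simp del: act_vtx intro!: imageI)
qed

lemma nbrs_vtx: "nbrs cgraph (vtx i \<one>) = (\<lambda>g. act g (vtx (\<not> i) \<one>)) ` side i"
proof -
  have "y \<in> nbrs cgraph (vtx i \<one>) \<longleftrightarrow> (\<exists>g\<in>side i. y = vtx (\<not> i) g)" for y
  proof
    assume "y \<in> nbrs cgraph (vtx i \<one>)"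
    then obtain g j where g: "g \<in> carrier G" "vtx i \<one> = vtx j g" "y = vtx (\<not> j) g"
      by (auto simp: nbrs_def cgraph_def)
    then show "\<exists>g\<in>side i. y = vtx (\<not> i) g" by (subst (asm) vtx_eq_iff) auto
  next
    assume "\<exists>g\<in>side i. y = vtx (\<not> i) g"
    then obtain g where g: "g \<in> side i" "y = vtx (\<not> i) g" by blast
    have gc: "g \<in> carrier G" using g side by (auto dest: subgroup.mem_carrier)
    have "vtx i \<one> = vtx i g" using g gc by (simp add: vtx_eq_iff)
    then show "y \<in> nbrs cgraph (vtx i \<one>)" using g gc by (auto simp: nbrs_def cgraph_def)
  qed
  moreover have "act g (vtx (\<not> i) \<one>) = vtx (\<not> i) g" if "g \<in> side i" for g
    using subgroup.mem_carrier[OF side that] by simp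
  ultimately show ?thesis by (auto simp: image_iff)
qed

text \<open>A generator from one side fixes the base vertex of that side. The other base vertex and
  its image are thus both adjacent to a common vertex. Translating these short paths along a word in
  the generators joins arbitrary vertices of one kind.\<close>

lemma reachable_vtx: "g \<in> carrier G \<Longrightarrow> (vtx i \<one>, vtx i g) \<in> (parcs cgraph)\<^sup>*"
proof -
  assume "g \<in> carrier G"
  then have "g \<in> generate G (P1 \<union> P2)" by (simp add: generated)
  have flip: "(vtx i g, vtx (\<not> i) g) \<in> parcs cgraph" if "g \<in> carrier G" for i g
    using that by (auto simp: cgraph_def)
  have base: "(vtx i \<one>, vtx i p) \<in> (parcs cgraph)\<^sup>*" if p: "p \<in> P1 \<union> P2" for i p
  proof -
    obtain j where pj: "p \<in> side j" using p by (metis UnE side_def)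
    have pc: "p \<in> carrier G" using pj side by (auto dest: subgroup.mem_carrier)
    have eq: "vtx j \<one> = vtx j p" using pj pc by (simp add: vtx_eq_iff)
    show ?thesis
    proof (cases "i = j")
      case False
      then have "i = (\<not> j)" by simp
      then have "(vtx i \<one>, vtx j \<one>) \<in> parcs cgraph" "(vtx j p, vtx i p) \<in> parcs cgraph"
        using flip[of \<one> i] flip[of p j] pc by auto
      then show ?thesis using eq by (metis converse_rtrancl_into_rtrancl r_into_rtrancl)
    qed (use eq in simp)
  qed
  have trans: "(vtx i g, vtx i (g \<otimes> h)) \<in> (parcs cgraph)\<^sup>*"
    if "(vtx i \<one>, vtx i h) \<in> (parcs cgraph)\<^sup>*" "g \<in> carrier G" "h \<in> carrier G" for g h
  proof -
    have "(act g x, act g y) \<in> (parcs cgraph)\<^sup>*" if "(x, y) \<in> (parcs cgraph)\<^sup>*" for x y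
      using that by (induction) (auto intro: rtrancl_into_rtrancl act_arc[OF \<open>g \<in> carrier G\<close>])
    from this[OF that(1)] show ?thesis using that by simp
  qed
  show ?thesis using \<open>g \<in> generate G (P1 \<union> P2)\<close>
  proof (induction rule: generate.induct)
    case one
    then show ?case by simp
  next
    case (incl h)
    then show ?case by (rule base)
  next
    case (inv h)
    then have "inv h \<in> P1 \<union> P2" using P1 P2 by (auto simp: subgroup.m_inv_closed)
    then show ?case by (rule base)
  next
    case (eng h1 h2)
    then have "h1 \<in> carrier G" "h2 \<in> carrier G" using generated by auto
    then show ?case using eng trans by (meson rtrancl_trans)
  qed
qed

lemma H_graph_graph: "H_graph cgraph (act ` carrier G)"
  unfolding H_graph_def
proof (intro conjI)
  have fin: "finite vertices"
  proof -
    have "vertices = (\<lambda>(i, g). vtx i g) ` (UNIV \<times> carrier G)" by (auto simp: vertices_def)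
    then show ?thesis using finite by simp
  qed
  have arcs: "parcs cgraph \<subseteq> vertices \<times> vertices" by (auto simp: cgraph_def intro: vtx_mem)
  have sym: "(y, x) \<in> parcs cgraph" if "(x, y) \<in> parcs cgraph" for x y
  proof -
    obtain i g where "g \<in> carrier G" "x = vtx i g" "y = vtx (\<not> i) g" using \<open>(x, y) \<in> parcs cgraph\<close> by (rule arcE)
    then show ?thesis using arcI[of g "\<not> i"] by simp
  qed
  show "pair_graph cgraph"
  proof
    show "symmetric (with_proj cgraph)"
      unfolding symmetric_def with_proj_simps using sym by (auto intro: symI)
    show "finite (parcs cgraph)" using arcs fin by (meson finite_SigmaI finite_subset)
    show "fst e \<noteq> snd e" if "e \<in> parcs cgraph" for e
      using that by (auto simp: cgraph_def vtx_eq_iff)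
  qed (use arcs fin in auto)
  then interpret pair_graph cgraph .
  have reach: "(vtx i g, vtx j h) \<in> (parcs cgraph)\<^sup>*" if "g \<in> carrier G" "h \<in> carrier G" for i j g h
  proof -
    have s: "sym ((parcs cgraph)\<^sup>*)" using sym by (intro sym_rtrancl symI)
    have "(vtx i g, vtx i \<one>) \<in> (parcs cgraph)\<^sup>*" using reachable_vtx[OF that(1)] s by (auto dest: symD)
    moreover have "(vtx i \<one>, vtx j \<one>) \<in> (parcs cgraph)\<^sup>*"
    proof (cases "i = j")
      case False
      then have "j = (\<not> i)" by simp
      then show ?thesis by (auto simp: cgraph_def intro!: r_into_rtrancl)
    qed simp
    ultimately show ?thesis using reachable_vtx[OF that(2), of j] by (meson rtrancl_trans)
  qed
  show "Digraph_Component.connected (with_proj cgraph)"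
    unfolding Digraph_Component.connected_def
  proof (rule strongly_connectedI)
    show "verts (with_proj (mk_symmetric (with_proj cgraph))) \<noteq> {}"
      using vtx_mem[OF one_closed] by (auto simp: cgraph_def)
  next
    fix u v assume uv: "u \<in> verts (with_proj (mk_symmetric (with_proj cgraph)))"
      "v \<in> verts (with_proj (mk_symmetric (with_proj cgraph)))"
    then have "u \<in> vertices" "v \<in> vertices" by (auto simp: cgraph_def)
    then have "(u, v) \<in> (parcs cgraph)\<^sup>*" using reach by (auto simp: vertices_def)
    moreover have "u \<in> pverts cgraph" using uv by simp
    ultimately have "u \<rightarrow>\<^sup>*\<^bsub>with_proj cgraph\<^esub> v"
      unfolding reachable_def using arcs \<open>v \<in> vertices\<close>
      by (intro rtrancl_consistent_rtrancl_on) auto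
    then show "u \<rightarrow>\<^sup>*\<^bsub>with_proj (mk_symmetric (with_proj cgraph))\<^esub> v"
      by (rule reachable_mk_symmetricI)
  qed
  interpret A: inj_hom G "graph_aut cgraph" act by (rule act_inj_hom)
  show "subgroup (act ` carrier G) (graph_aut cgraph)"
    by (rule A.img_is_subgroup)
qed

end

lemma (in group_hom) normal_vimage:
  assumes "N \<lhd> H"
  shows "{x \<in> carrier G. h x \<in> N} \<lhd> G"
proof -
  have N: "subgroup N H" using assms by (rule normal_imp_subgroup)
  have "subgroup {x \<in> carrier G. h x \<in> N} G"
  proof (rule G.subgroupI)
    have "\<one>\<^bsub>G\<^esub> \<in> {x \<in> carrier G. h x \<in> N}" using N by (simp add: subgroup.one_closed)
    then show "{x \<in> carrier G. h x \<in> N} \<noteq> {}" by blast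
  qed (use N in \<open>auto simp: subgroup.m_closed subgroup.m_inv_closed\<close>)
  then show ?thesis
    unfolding G.normal_inv_iff using assms by (auto simp: H.normal_inv_iff)
qed

text \<open>A normal subgroup of the completion inside both images pulls back to some
  \<open>N\<close> in \<open>C2\<close> that is normal in \<open>K2\<close> and has image under
  \<open>\<theta>\<close> normal in \<open>K1\<close>. So faithfulness of the amalgam yields that of
  the coset geometry.\<close>

theorem amalgam_graph:
  fixes K1 :: "('a, 'c) monoid_scheme" and K2 :: "('b, 'd) monoid_scheme"
  assumes K1: "group K1" and K2: "group K2" and fin: "finite (carrier K1)" "finite (carrier K2)"
    and C1: "subgroup C1 K1" and C2: "subgroup C2 K2" and \<theta>: "\<theta> \<in> iso (sub K2 C2) (sub K1 C1)"
    and faithful: "\<And>N. N \<subseteq> C2 \<Longrightarrow> N \<lhd> K2 \<Longrightarrow> \<theta> ` N \<lhd> K1 \<Longrightarrow> N \<subseteq> {\<one>\<^bsub>K2\<^esub>}"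
    and proper: "C1 \<noteq> carrier K1"
  obtains \<Gamma> :: "nat pair_pre_digraph" and H x1 x2 f1 f2 where
    "H_graph \<Gamma> H" "inj_hom K1 (graph_aut \<Gamma>) f1" "inj_hom K2 (graph_aut \<Gamma>) f2"
    "\<And>c. c \<in> C2 \<Longrightarrow> f1 (\<theta> c) = f2 c"
    "vstab H x1 = f1 ` carrier K1" "vstab H x2 = f2 ` carrier K2" "vstab H x1 \<inter> vstab H x2 = f2 ` C2"
    "(x1, x2) \<in> parcs \<Gamma>" "\<And>z. z \<in> pverts \<Gamma> \<Longrightarrow> \<exists>h\<in>H. z = h x1 \<or> z = h x2"
    "nbrs \<Gamma> x1 = (\<lambda>h. h x2) ` vstab H x1" "nbrs \<Gamma> x2 = (\<lambda>h. h x1) ` vstab H x2"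
proof -
  interpret K1: group K1 by fact
  interpret K2: group K2 by fact
  obtain E :: "('a \<times> 'b) set" and f1 f2 where E: "finite E" and
    f: "f1 \<in> hom K1 (BijGroup E)" "inj_on f1 (carrier K1)" "f2 \<in> hom K2 (BijGroup E)" "inj_on f2 (carrier K2)"
    and f\<theta>: "\<And>c. c \<in> C2 \<Longrightarrow> f1 (\<theta> c) = f2 c" and int: "f1 ` carrier K1 \<inter> f2 ` carrier K2 = f2 ` C2"
    using finite_completion[OF K1 K2 fin C1 C2 \<theta>] by blast
  interpret B: group "BijGroup E" by (rule group_BijGroup)
  interpret f1: group_hom K1 "BijGroup E" f1 using f by unfold_locales auto
  interpret f2: group_hom K2 "BijGroup E" f2 using f by unfold_locales auto
  define P1 where "P1 = f1 ` carrier K1"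
  define P2 where "P2 = f2 ` carrier K2"
  define X where "X = generate (BijGroup E) (P1 \<union> P2)"
  have P: "subgroup P1 (BijGroup E)" "subgroup P2 (BijGroup E)"
    unfolding P1_def P2_def using f1.img_is_subgroup f2.img_is_subgroup by auto
  then have Pc: "P1 \<union> P2 \<subseteq> carrier (BijGroup E)" by (auto dest: subgroup.subset)
  then have X: "subgroup X (BijGroup E)" unfolding X_def by (rule B.generate_is_subgroup)
  have PX: "P1 \<union> P2 \<subseteq> X" unfolding X_def by (auto intro: generate.incl)
  define M where "M = sub (BijGroup E) X"
  interpret M: group M unfolding M_def using X by (rule B.subgroup_imp_group)
  have g1: "f1 \<in> hom K1 M" and g2: "f2 \<in> hom K2 M"
    using f PX by (auto simp: hom_def M_def P1_def P2_def)
  interpret g1: group_hom K1 M f1 using g1 by unfold_locales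
  interpret g2: group_hom K2 M f2 using g2 by unfold_locales
  have \<theta>C: "\<theta> ` C2 = C1" using \<theta> by (auto simp: iso_def bij_betw_def)
  have C1c: "C1 \<subseteq> carrier K1" and C2c: "C2 \<subseteq> carrier K2"
    using C1 C2 by (auto simp: subgroup.subset)
  interpret coset_geometry M P1 P2
  proof (intro coset_geometry.intro coset_geometry_axioms.intro)
    show "group M" by (rule M.is_group)
    show "finite (carrier M)"
      using finite_BijGroup[OF E] subgroup.subset[OF X] by (auto simp: M_def finite_subset)
    show "subgroup P1 M" "subgroup P2 M"
      using P PX X by (auto simp: M_def B.subgroup_incl)
    show "generate M (P1 \<union> P2) = carrier M"
      unfolding M_def using B.generate_consistent[OF PX X] by (simp add: X_def)
    show "P1 \<noteq> P2"
    proof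
      assume "P1 = P2"
      then have "f1 ` carrier K1 = f2 ` C2" using int by (simp add: P1_def P2_def)
      also have "f2 ` C2 = f1 ` C1" using f\<theta> unfolding \<theta>C[symmetric] by (auto simp: image_image)
      finally have "carrier K1 = C1" using f(2) C1c by (metis inj_on_image_eq_iff subset_refl)
      then show False using proper by simp
    qed
  next
    fix N assume N: "N \<lhd> M" "N \<subseteq> P1" "N \<subseteq> P2"
    define N2 where "N2 = {x \<in> carrier K2. f2 x \<in> N}"
    have N2C: "N2 \<subseteq> C2"
    proof
      fix x assume x: "x \<in> N2"
      then have "f2 x \<in> f2 ` C2" using N int by (auto simp: N2_def P1_def P2_def)
      then show "x \<in> C2" using x f(4) C2c by (auto simp: N2_def inj_on_image_mem_iff)
    qed
    have "\<theta> ` N2 = {x \<in> carrier K1. f1 x \<in> N}"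
    proof (intro equalityI subsetI)
      fix x assume "x \<in> \<theta> ` N2"
      then obtain c where c: "c \<in> N2" "x = \<theta> c" by auto
      then have "c \<in> C2" using N2C by auto
      then have "x \<in> C1" "f1 x = f2 c" using c \<theta>C f\<theta> by auto
      then show "x \<in> {x \<in> carrier K1. f1 x \<in> N}" using C1c c by (auto simp: N2_def)
    next
      fix x assume x: "x \<in> {x \<in> carrier K1. f1 x \<in> N}"
      then have "f1 x \<in> f2 ` C2" using N int by (auto simp: P1_def P2_def)
      then obtain c where c: "c \<in> C2" "f1 x = f2 c" by auto
      then have "f1 x = f1 (\<theta> c)" using f\<theta> by simp
      moreover have "\<theta> c \<in> carrier K1" using c \<theta>C C1c by auto
      ultimately have "x = \<theta> c" using f(2) x by (auto dest: inj_onD)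
      moreover have "c \<in> N2" using c x C2c by (auto simp: N2_def)
      ultimately show "x \<in> \<theta> ` N2" by simp
    qed
    then have "\<theta> ` N2 \<lhd> K1" "N2 \<lhd> K2"
      using g1.normal_vimage[OF N(1)] g2.normal_vimage[OF N(1)] by (simp_all add: N2_def)
    then have "N2 \<subseteq> {\<one>\<^bsub>K2\<^esub>}" using faithful N2C by blast
    moreover have "x \<in> f2 ` N2" if "x \<in> N" for x using that N(3) by (auto simp: N2_def P2_def)
    ultimately show "N \<subseteq> {\<one>\<^bsub>M\<^esub>}" using g2.hom_one by fastforce
  qed
  interpret A: inj_hom M "graph_aut cgraph" act by (rule act_inj_hom)
  let ?x1 = "vtx True \<one>\<^bsub>M\<^esub>" and ?x2 = "vtx False \<one>\<^bsub>M\<^esub>"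
  have st: "vstab (act ` carrier M) ?x1 = act ` P1" "vstab (act ` carrier M) ?x2 = act ` P2"
    using vstab_vtx[of True] vstab_vtx[of False] by (simp_all add: side_def)
  have PM: "P1 \<subseteq> carrier M" "P2 \<subseteq> carrier M" using PX by (auto simp: M_def)
  show thesis
  proof (rule that[of cgraph "act ` carrier M" "act \<circ> f1" "act \<circ> f2" ?x1 ?x2])
    show "H_graph cgraph (act ` carrier M)" by (rule H_graph_graph)
    have *: "inj_hom K (graph_aut cgraph) (act \<circ> f)"
      if "group K" "f \<in> hom K M" "inj_on f (carrier K)" for K :: "('x, 'y) monoid_scheme" and f
    proof -
      interpret K: group K by fact
      have "act \<circ> f \<in> hom K (graph_aut cgraph)" using that(2) A.homh by (rule hom_compose)
      moreover have "inj_on (act \<circ> f) (carrier K)"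
        using that A.inj by (auto intro!: comp_inj_on inj_on_subset[OF A.inj] simp: hom_def)
      ultimately show ?thesis by unfold_locales
    qed
    show "inj_hom K1 (graph_aut cgraph) (act \<circ> f1)" using K1 g1 f(2) by (rule *)
    show "inj_hom K2 (graph_aut cgraph) (act \<circ> f2)" using K2 g2 f(4) by (rule *)
    show "(act \<circ> f1) (\<theta> c) = (act \<circ> f2) c" if "c \<in> C2" for c using f\<theta> that by simp
    show "vstab (act ` carrier M) ?x1 = (act \<circ> f1) ` carrier K1"
      "vstab (act ` carrier M) ?x2 = (act \<circ> f2) ` carrier K2"
      using st by (simp_all add: P1_def P2_def image_comp)
    show "vstab (act ` carrier M) ?x1 \<inter> vstab (act ` carrier M) ?x2 = (act \<circ> f2) ` C2"
    proof -
      have "act ` P1 \<inter> act ` P2 = act ` (P1 \<inter> P2)"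
        using PM A.inj by (intro inj_on_image_Int[symmetric]) auto
      then show ?thesis using int st by (simp add: P1_def P2_def image_comp)
    qed
    show "(?x1, ?x2) \<in> parcs cgraph" using arcI[OF M.one_closed, of True] by simp
    show "\<exists>h\<in>act ` carrier M. z = h ?x1 \<or> z = h ?x2" if z: "z \<in> pverts cgraph" for z
    proof -
      obtain i g where g: "g \<in> carrier M" "z = vtx i g" using z by (auto elim: verticesE)
      then have "z = act g (vtx i \<one>\<^bsub>M\<^esub>)" by simp
      then show ?thesis using g by (cases i) auto
    qed
    show "nbrs cgraph ?x1 = (\<lambda>h. h ?x2) ` vstab (act ` carrier M) ?x1"
      unfolding st using nbrs_vtx[of True] by (simp add: side_def image_image)
    show "nbrs cgraph ?x2 = (\<lambda>h. h ?x1) ` vstab (act ` carrier M) ?x2"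
      unfolding st using nbrs_vtx[of False] by (simp add: side_def image_image)
  qed
qed

section \<open>Local structure of graphs with a group of automorphisms\<close>

lemma s_arcs_0: "s_arcs \<Gamma> 0 z = {[z]}"
  by (auto simp: s_arcs_def length_Suc_conv)

text \<open>The guard \<open>s \<ge> 1\<close> matters: an arc of length 0 has no last but one
  vertex that the extension would have to avoid.\<close>

lemma s_arcs_Suc:
  assumes l: "length ys = Suc s"
  shows "ys @ [y] \<in> s_arcs \<Gamma> (Suc s) z \<longleftrightarrow>
    ys \<in> s_arcs \<Gamma> s z \<and> (ys ! s, y) \<in> parcs \<Gamma> \<and> (s \<ge> 1 \<longrightarrow> ys ! (s - 1) \<noteq> y)"
proof -
  let ?xs = "ys @ [y]"
  have nth: "?xs ! i = ys ! i" if "i \<le> s" for i using that l by (simp add: nth_append)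
  have last: "?xs ! Suc s = y" using l by (metis nth_append_length)
  have arcs: "(\<forall>i<Suc s. (?xs ! i, ?xs ! (i + 1)) \<in> parcs \<Gamma>) \<longleftrightarrow>
      (\<forall>i<s. (ys ! i, ys ! (i + 1)) \<in> parcs \<Gamma>) \<and> (ys ! s, y) \<in> parcs \<Gamma>"
    using nth last by (auto simp: All_less_Suc)
  have "(\<forall>i. 1 \<le> i \<and> i < Suc s \<longrightarrow> ?xs ! (i - 1) \<noteq> ?xs ! (i + 1)) \<longleftrightarrow>
      (\<forall>i<Suc s. 1 \<le> i \<longrightarrow> ?xs ! (i - 1) \<noteq> ?xs ! (i + 1))" by blast
  also have "\<dots> \<longleftrightarrow> (\<forall>i<s. 1 \<le> i \<longrightarrow> ys ! (i - 1) \<noteq> ys ! (i + 1)) \<and> (s \<ge> 1 \<longrightarrow> ys ! (s - 1) \<noteq> y)"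
    using nth last by (auto simp: All_less_Suc)
  finally show ?thesis
    unfolding s_arcs_def using arcs nth[of 0] l by auto
qed

lemma s_arcs_SucE:
  assumes "\<alpha> \<in> s_arcs \<Gamma> (Suc s) z"
  obtains ys y where "\<alpha> = ys @ [y]" "length ys = Suc s" "ys \<in> s_arcs \<Gamma> s z"
    "(ys ! s, y) \<in> parcs \<Gamma>" "s \<ge> 1 \<longrightarrow> ys ! (s - 1) \<noteq> y"
proof -
  have "length \<alpha> = Suc (Suc s)" using assms by (simp add: s_arcs_def)
  then obtain ys y where "\<alpha> = ys @ [y]" "length ys = Suc s" by (metis length_Suc_conv_rev)
  then show thesis using that assms s_arcs_Suc by metis
qed

text \<open>\<open>H\<close> is transitive on edges, and every vertex is a translate of
  \<open>x1\<close> or \<open>x2\<close>. Whatever is invariant under conjugation has to be checked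
  at these two vertices only.\<close>

locale graph_pair =
  fixes \<Gamma> :: "'v pair_pre_digraph" and H x1 x2
  assumes Hg: "H_graph \<Gamma> H"
    and arc: "(x1, x2) \<in> parcs \<Gamma>"
    and cover: "\<And>z. z \<in> pverts \<Gamma> \<Longrightarrow> \<exists>h\<in>H. z = h x1 \<or> z = h x2"
    and nbrs1: "nbrs \<Gamma> x1 = (\<lambda>h. h x2) ` vstab H x1"
    and nbrs2: "nbrs \<Gamma> x2 = (\<lambda>h. h x1) ` vstab H x2"
begin

abbreviation "A \<equiv> graph_aut \<Gamma>"
abbreviation "V \<equiv> pverts \<Gamma>"

sublocale A: group A by (rule group_graph_aut)

lemma H_sub: "subgroup H A" using Hg by (simp add: H_graph_def)

lemma H_mem: "h \<in> H \<Longrightarrow> h \<in> carrier A" using H_sub by (rule subgroup.mem_carrier)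

lemma arc_verts: "(x, y) \<in> parcs \<Gamma> \<Longrightarrow> x \<in> V \<and> y \<in> V"
proof -
  interpret pair_graph \<Gamma> using Hg by (simp add: H_graph_def)
  show "(x, y) \<in> parcs \<Gamma> \<Longrightarrow> x \<in> V \<and> y \<in> V" by (simp add: in_arcsD1 in_arcsD2)
qed

lemma arc_sym: "(x, y) \<in> parcs \<Gamma> \<Longrightarrow> (y, x) \<in> parcs \<Gamma>"
proof -
  interpret pair_graph \<Gamma> using Hg by (simp add: H_graph_def)
  show "(x, y) \<in> parcs \<Gamma> \<Longrightarrow> (y, x) \<in> parcs \<Gamma>" by (rule arcs_symmetric)
qed

lemma x1V: "x1 \<in> V" and x2V: "x2 \<in> V" using arc arc_verts by auto

lemma aut_Bij: "f \<in> carrier A \<Longrightarrow> f \<in> Bij V"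
  by (simp add: graph_aut_def)

lemma aut_closed: "f \<in> carrier A \<Longrightarrow> x \<in> V \<Longrightarrow> f x \<in> V"
  using aut_Bij Bij_imp_funcset by blast

lemma aut_arc: "f \<in> carrier A \<Longrightarrow> (x, y) \<in> parcs \<Gamma> \<Longrightarrow> (f x, f y) \<in> parcs \<Gamma>"
  using arc_verts[of x y] by (auto simp: graph_aut_def)

lemma aut_mult: "f \<in> carrier A \<Longrightarrow> g \<in> carrier A \<Longrightarrow> x \<in> V \<Longrightarrow> (f \<otimes>\<^bsub>A\<^esub> g) x = f (g x)"
  using aut_Bij[of f] aut_Bij[of g] by (simp add: graph_aut_def BijGroup_def compose_def)

lemma aut_one: "x \<in> V \<Longrightarrow> \<one>\<^bsub>A\<^esub> x = x"
  by (simp add: graph_aut_def BijGroup_def)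

lemma aut_inv: "f \<in> carrier A \<Longrightarrow> x \<in> V \<Longrightarrow> (inv\<^bsub>A\<^esub> f) (f x) = x"
  "f \<in> carrier A \<Longrightarrow> x \<in> V \<Longrightarrow> f ((inv\<^bsub>A\<^esub> f) x) = x"
  using aut_mult[of "inv\<^bsub>A\<^esub> f" f x] aut_mult[of f "inv\<^bsub>A\<^esub> f" x] aut_one by auto

lemma aut_inj: "f \<in> carrier A \<Longrightarrow> x \<in> V \<Longrightarrow> y \<in> V \<Longrightarrow> f x = f y \<longleftrightarrow> x = y"
  using aut_inv(1) by metis

lemma nbrs_image: "f \<in> carrier A \<Longrightarrow> x \<in> V \<Longrightarrow> nbrs \<Gamma> (f x) = f ` nbrs \<Gamma> x"
proof (intro equalityI subsetI)
  fix y assume f: "f \<in> carrier A" "x \<in> V" and "y \<in> nbrs \<Gamma> (f x)"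
  then have y: "(f x, y) \<in> parcs \<Gamma>" "y \<in> V" using arc_verts by (auto simp: nbrs_def)
  then have "((inv\<^bsub>A\<^esub> f) (f x), (inv\<^bsub>A\<^esub> f) y) \<in> parcs \<Gamma>"
    using aut_arc[OF A.inv_closed[OF f(1)]] by blast
  then have "(inv\<^bsub>A\<^esub> f) y \<in> nbrs \<Gamma> x" by (simp add: aut_inv(1)[OF f] nbrs_def)
  then show "y \<in> f ` nbrs \<Gamma> x" by (rule image_eqI[rotated]) (simp add: aut_inv(2)[OF f(1) y(2)])
qed (auto simp: nbrs_def dest: aut_arc)

lemma H_closed: "f \<in> H \<Longrightarrow> g \<in> H \<Longrightarrow> f \<otimes>\<^bsub>A\<^esub> g \<in> H" "f \<in> H \<Longrightarrow> inv\<^bsub>A\<^esub> f \<in> H" "\<one>\<^bsub>A\<^esub> \<in> H"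
  using H_sub by (auto simp: subgroup.m_closed subgroup.m_inv_closed subgroup.one_closed)

lemma nbrs_V: "y \<in> nbrs \<Gamma> x \<Longrightarrow> y \<in> V"
  using arc_verts by (auto simp: nbrs_def)

lemma vstab_sub: "z \<in> V \<Longrightarrow> subgroup (vstab H z) A"
proof (rule A.subgroupI)
  fix f assume "z \<in> V" "f \<in> vstab H z"
  then show "inv\<^bsub>A\<^esub> f \<in> vstab H z"
    using aut_inv(1)[of f z] H_mem H_closed by (auto simp: vstab_def)
next
  assume z: "z \<in> V"
  then have "\<one>\<^bsub>A\<^esub> \<in> vstab H z" using H_closed by (simp add: vstab_def aut_one)
  then show "vstab H z \<noteq> {}" by blast
qed (auto simp: vstab_def aut_mult H_mem H_closed)

lemma vker_sub: "z \<in> V \<Longrightarrow> subgroup (vker \<Gamma> H z) A"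
proof (rule A.subgroupI)
  note st = subgroup.m_closed[OF vstab_sub] subgroup.m_inv_closed[OF vstab_sub] subgroup.one_closed[OF vstab_sub]
    subgroup.mem_carrier[OF vstab_sub]
  {
    assume z: "z \<in> V"
    show "vker \<Gamma> H z \<subseteq> carrier A" using z st by (auto simp: vker_def)
    have "\<one>\<^bsub>A\<^esub> \<in> vker \<Gamma> H z" using z st by (auto simp: vker_def aut_one nbrs_V)
    then show "vker \<Gamma> H z \<noteq> {}" by blast
  next
    fix f assume z: "z \<in> V" and f: "f \<in> vker \<Gamma> H z"
    have fA: "f \<in> carrier A" using z f st by (auto simp: vker_def)
    have "(inv\<^bsub>A\<^esub> f) y = y" if "y \<in> nbrs \<Gamma> z" for y
      using aut_inv(1)[OF fA nbrs_V[OF that]] that f by (simp add: vker_def)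
    then show "inv\<^bsub>A\<^esub> f \<in> vker \<Gamma> H z" using z f st by (auto simp: vker_def)
  next
    fix f g assume z: "z \<in> V" and fg: "f \<in> vker \<Gamma> H z" "g \<in> vker \<Gamma> H z"
    then have "f \<in> carrier A" "g \<in> carrier A" using st by (auto simp: vker_def)
    then show "f \<otimes>\<^bsub>A\<^esub> g \<in> vker \<Gamma> H z"
      using z fg st by (auto simp: vker_def aut_mult nbrs_V)
  }
qed

section \<open>Conjugation and the local subgroups at translated vertices\<close>

definition cnjg :: "('v \<Rightarrow> 'v) \<Rightarrow> ('v \<Rightarrow> 'v) \<Rightarrow> 'v \<Rightarrow> 'v" where
  "cnjg f = (\<lambda>g. f \<otimes>\<^bsub>A\<^esub> g \<otimes>\<^bsub>A\<^esub> inv\<^bsub>A\<^esub> f)"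

lemma cnjg_inj_hom:
  assumes f: "f \<in> carrier A"
  shows "inj_hom A A (cnjg f)"
proof -
  have "f \<otimes>\<^bsub>A\<^esub> (g \<otimes>\<^bsub>A\<^esub> k) \<otimes>\<^bsub>A\<^esub> inv\<^bsub>A\<^esub> f = f \<otimes>\<^bsub>A\<^esub> g \<otimes>\<^bsub>A\<^esub> inv\<^bsub>A\<^esub> f \<otimes>\<^bsub>A\<^esub> (f \<otimes>\<^bsub>A\<^esub> k \<otimes>\<^bsub>A\<^esub> inv\<^bsub>A\<^esub> f)"
    if "g \<in> carrier A" "k \<in> carrier A" for g k
  proof -
    have "inv\<^bsub>A\<^esub> f \<otimes>\<^bsub>A\<^esub> (f \<otimes>\<^bsub>A\<^esub> (k \<otimes>\<^bsub>A\<^esub> inv\<^bsub>A\<^esub> f)) = k \<otimes>\<^bsub>A\<^esub> inv\<^bsub>A\<^esub> f"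
      using that f by (simp add: A.m_assoc[symmetric])
    then show ?thesis using that f by (simp add: A.m_assoc)
  qed
  then have "cnjg f \<in> hom A A" using f by (auto simp: hom_def cnjg_def)
  moreover have "inj_on (cnjg f) (carrier A)"
    using f by (auto simp: inj_on_def cnjg_def)
  ultimately show ?thesis by unfold_locales
qed

lemma cnjg_conj:
  assumes "f \<in> carrier A" "g \<in> carrier A"
  shows "cnjg f (cnjg (inv\<^bsub>A\<^esub> f) g) = g"
proof -
  have "f \<otimes>\<^bsub>A\<^esub> (inv\<^bsub>A\<^esub> f \<otimes>\<^bsub>A\<^esub> g \<otimes>\<^bsub>A\<^esub> f) \<otimes>\<^bsub>A\<^esub> inv\<^bsub>A\<^esub> f = (f \<otimes>\<^bsub>A\<^esub> inv\<^bsub>A\<^esub> f) \<otimes>\<^bsub>A\<^esub> g \<otimes>\<^bsub>A\<^esub> (f \<otimes>\<^bsub>A\<^esub> inv\<^bsub>A\<^esub> f)"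
    using assms by (simp only: A.m_assoc A.m_closed A.inv_closed)
  then show ?thesis using assms by (simp add: cnjg_def)
qed

lemma cnjg_apply: "f \<in> carrier A \<Longrightarrow> g \<in> carrier A \<Longrightarrow> x \<in> V \<Longrightarrow> cnjg f g (f x) = f (g x)"
  by (simp add: cnjg_def aut_mult aut_closed[of f] aut_closed[of g] aut_inv(1)[of f])

lemma vstab_conj:
  assumes f: "f \<in> H" and z: "z \<in> V"
  shows "vstab H (f z) = cnjg f ` vstab H z"
proof -
  have *: "cnjg f ` vstab H z \<subseteq> vstab H (f z)" if "f \<in> H" "z \<in> V" for f z
  proof
    fix k assume "k \<in> cnjg f ` vstab H z"
    then obtain g where g: "g \<in> H" "g z = z" "k = cnjg f g" by (auto simp: vstab_def)
    then show "k \<in> vstab H (f z)"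
      using cnjg_apply[of f g z] \<open>f \<in> H\<close> \<open>z \<in> V\<close> H_mem by (simp add: vstab_def) (simp add: cnjg_def H_closed)
  qed
  have fA: "f \<in> carrier A" using f by (rule H_mem)
  have "g \<in> cnjg f ` vstab H z" if g: "g \<in> vstab H (f z)" for g
  proof -
    have "cnjg (inv\<^bsub>A\<^esub> f) g \<in> vstab H z"
      using *[OF H_closed(2)[OF f] aut_closed[OF fA z]] g unfolding aut_inv(1)[OF fA z] by blast
    moreover have "g = cnjg f (cnjg (inv\<^bsub>A\<^esub> f) g)" using g f H_mem by (simp add: vstab_def cnjg_conj)
    ultimately show ?thesis by blast
  qed
  then show ?thesis using * f z by blast
qed

lemma vker_conj:
  assumes f: "f \<in> H" and z: "z \<in> V"
  shows "vker \<Gamma> H (f z) = cnjg f ` vker \<Gamma> H z"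
proof -
  have *: "cnjg f ` vker \<Gamma> H z \<subseteq> vker \<Gamma> H (f z)" if f: "f \<in> H" "z \<in> V" for f z
  proof -
    have "cnjg f g \<in> vker \<Gamma> H (f z)" if g: "g \<in> vker \<Gamma> H z" for g
    proof -
      have gA: "g \<in> carrier A" using g H_mem by (simp add: vker_def vstab_def)
      have fA: "f \<in> carrier A" using f by (blast intro: H_mem)
      have "cnjg f g \<in> vstab H (f z)" using g vstab_conj[OF f] by (auto simp: vker_def)
      moreover have "cnjg f g (f y) = f y" if y: "y \<in> nbrs \<Gamma> z" for y
        using y g cnjg_apply[OF fA gA nbrs_V[OF y]] by (simp add: vker_def)
      ultimately show ?thesis using nbrs_image[OF fA f(2)] by (auto simp: vker_def)
    qed
    then show ?thesis by blast
  qed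
  have fA: "f \<in> carrier A" using f by (rule H_mem)
  have "g \<in> cnjg f ` vker \<Gamma> H z" if g: "g \<in> vker \<Gamma> H (f z)" for g
  proof -
    have "cnjg (inv\<^bsub>A\<^esub> f) g \<in> vker \<Gamma> H z"
      using *[OF H_closed(2)[OF f] aut_closed[OF fA z]] g unfolding aut_inv(1)[OF fA z] by blast
    moreover have "g = cnjg f (cnjg (inv\<^bsub>A\<^esub> f) g)"
      using g f H_mem by (simp add: vker_def vstab_def cnjg_conj)
    ultimately show ?thesis by blast
  qed
  then show ?thesis using * f z by blast
qed

lemma is_Op_conj:
  assumes "f \<in> H" "z \<in> V" "is_Op p (sub A (vker \<Gamma> H z)) N"
  shows "is_Op p (sub A (vker \<Gamma> H (f z))) (cnjg f ` N)"
  unfolding vker_conj[OF assms(1,2)]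
  by (rule inj_hom.is_Op_image[OF cnjg_inj_hom[OF H_mem[OF assms(1)]] vker_sub[OF assms(2)] assms(3)])

text \<open>Stabilizers, kernels and their largest normal \<open>p\<close>-subgroups at
  \<open>h x\<close> are the conjugates by \<open>h\<close> of those at \<open>x\<close>, and
  centralizers are conjugated along with them.\<close>

lemma local_characteristicI:
  assumes p: "prime p"
    and N1: "is_Op p (sub A (vker \<Gamma> H x1)) N1" and N2: "is_Op p (sub A (vker \<Gamma> H x2)) N2"
    and c1: "centralizer (sub A (vstab H x1)) N1 \<subseteq> N1" and c2: "centralizer (sub A (vstab H x2)) N2 \<subseteq> N2"
  shows "local_characteristic p \<Gamma> H"
  unfolding local_characteristic_def
proof (intro conjI ballI p)
  have *: "centralizer (sub A (vstab H (h x))) (Op_ker p \<Gamma> H (h x)) \<subseteq> Op_ker p \<Gamma> H (h x)"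
    if h: "h \<in> H" and x: "x \<in> V" and N: "is_Op p (sub A (vker \<Gamma> H x)) N"
      and c: "centralizer (sub A (vstab H x)) N \<subseteq> N" for h x N
  proof -
    have hA: "h \<in> carrier A" using h by (rule H_mem)
    interpret h: inj_hom A A "cnjg h" using hA by (rule cnjg_inj_hom)
    have O: "Op_ker p \<Gamma> H (h x) = cnjg h ` N"
      unfolding Op_ker_def using is_Op_conj[OF h x N] by (rule Op_eq)
    have NV: "N \<subseteq> vker \<Gamma> H x" using N by (auto simp: is_Op_def dest!: normal_imp_subgroup subgroup.subset)
    have "N \<subseteq> carrier A" using NV subgroup.subset[OF vker_sub[OF x]] by blast
    then show ?thesis
      unfolding O vstab_conj[OF h x]
      using c subgroup.subset[OF vstab_sub[OF x]] by (simp add: h.centralizer_image image_mono)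
  qed
  fix z assume "z \<in> V"
  then obtain h where "h \<in> H" "z = h x1 \<or> z = h x2" using cover by blast
  then show "centralizer (sub A (vstab H z)) (Op_ker p \<Gamma> H z) \<subseteq> Op_ker p \<Gamma> H z"
    using *[OF _ x1V N1 c1] *[OF _ x2V N2 c2] by blast
qed

text \<open>The neighbors of \<open>x1\<close> are the translates of \<open>x2\<close> under the
  stabilizer of \<open>x1\<close>, so the subgroups joined on the left are conjugates of
  \<open>N\<close> under that stabilizer.\<close>

lemma Op_ker_nbrs:
  assumes N: "is_Op p (sub A (vker \<Gamma> H x2)) N"
  shows "generate A (\<Union>u\<in>nbrs \<Gamma> x1. Op_ker p \<Gamma> H u) = conj_closure A N (vstab H x1)"
proof -
  have NV: "N \<subseteq> vker \<Gamma> H x2" using N by (auto simp: is_Op_def dest!: normal_imp_subgroup subgroup.subset)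
  have "Op_ker p \<Gamma> H (h x2) = h <#\<^bsub>A\<^esub> N #>\<^bsub>A\<^esub> inv\<^bsub>A\<^esub> h" if "h \<in> vstab H x1" for h
  proof -
    have "h \<in> H" using that by (simp add: vstab_def)
    then have "Op_ker p \<Gamma> H (h x2) = cnjg h ` N"
      unfolding Op_ker_def using is_Op_conj[OF _ x2V N] by (intro Op_eq)
    then show ?thesis by (auto simp: cnjg_def l_coset_def r_coset_def)
  qed
  then show ?thesis unfolding conj_closure_def nbrs1 by simp
qed

subsection \<open>Transitivity on arcs\<close>

text \<open>Asking for elements of \<open>H\<close> is enough: all arcs concerned start at
  \<open>z\<close>, so an element that moves one to another fixes \<open>z\<close>.\<close>

definition "covers s z ys \<longleftrightarrow> length ys = Suc s \<and> ys \<in> s_arcs \<Gamma> s z \<and>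
  (\<forall>\<alpha>\<in>s_arcs \<Gamma> s z. \<exists>h\<in>H. map h ys = \<alpha>)"

text \<open>An arc of length \<open>s + 1\<close> can be moved so that it begins with
  \<open>ys\<close>; it remains to move its last vertex by elements that fix \<open>ys\<close>
  pointwise. The end of \<open>ys\<close> is written \<open>g x\<close> with \<open>x\<close> a base
  vertex and its predecessor \<open>g x'\<close>. Then \<open>q\<close> acts on the neighbors of
  \<open>x\<close>, and its conjugate \<open>t\<close> by \<open>g\<close> does the same work at the
  end of the arc.\<close>

lemma covers_Suc:
  assumes cov: "covers s z ys" and z: "z \<in> V"
    and g: "g \<in> H" and x: "x \<in> V" and gx: "ys ! s = g x" and gx': "s \<ge> 1 \<Longrightarrow> x' \<in> V \<and> ys ! (s - 1) = g x'"
    and y0: "y0 \<in> nbrs \<Gamma> x" "s \<ge> 1 \<Longrightarrow> y0 \<noteq> x'"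
    and step: "\<And>y. y \<in> nbrs \<Gamma> x \<Longrightarrow> (s \<ge> 1 \<Longrightarrow> y \<noteq> x') \<Longrightarrow>
      \<exists>q\<in>H. \<exists>t\<in>H. t \<otimes>\<^bsub>A\<^esub> g = g \<otimes>\<^bsub>A\<^esub> q \<and> q y0 = y \<and> (\<forall>v\<in>set ys. t v = v)"
  shows "covers (Suc s) z (ys @ [g y0])"
proof -
  have l: "length ys = Suc s" and ys: "ys \<in> s_arcs \<Gamma> s z"
    and tr: "\<And>\<alpha>. \<alpha> \<in> s_arcs \<Gamma> s z \<Longrightarrow> \<exists>h\<in>H. map h ys = \<alpha>" using cov by (auto simp: covers_def)
  have y0V: "y0 \<in> V" using y0 nbrs_V by blast
  have ysV: "set ys \<subseteq> V"
  proof (cases s)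
    case 0
    then show ?thesis using ys z by (simp add: s_arcs_0)
  next
    case (Suc s')
    have "ys ! i \<in> V" if "i < Suc s" for i
    proof (cases "i = 0")
      case True
      then show ?thesis using ys z by (simp add: s_arcs_def)
    next
      case False
      then obtain j where "i = Suc j" by (cases i) auto
      then show ?thesis using ys that arc_verts by (auto simp: s_arcs_def)
    qed
    then show ?thesis using l by (auto simp: in_set_conv_nth)
  qed
  have gA: "g \<in> carrier A" using g by (rule H_mem)
  have arc0: "(ys ! s, g y0) \<in> parcs \<Gamma>" using y0(1) aut_arc[OF gA, of x y0] gx by (simp add: nbrs_def)
  have "ys @ [g y0] \<in> s_arcs \<Gamma> (Suc s) z"
    unfolding s_arcs_Suc[OF l] using ys arc0 gx' y0(2) aut_inj[OF gA, of y0 x'] y0V by metis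
  moreover have "\<exists>h\<in>H. map h (ys @ [g y0]) = \<alpha>" if \<alpha>: "\<alpha> \<in> s_arcs \<Gamma> (Suc s) z" for \<alpha>
  proof -
    obtain zs y where zs: "\<alpha> = zs @ [y]" "length zs = Suc s" "zs \<in> s_arcs \<Gamma> s z"
      "(zs ! s, y) \<in> parcs \<Gamma>" "s \<ge> 1 \<longrightarrow> zs ! (s - 1) \<noteq> y"
      using \<alpha> by (rule s_arcs_SucE)
    obtain h where h: "h \<in> H" "map h ys = zs" using tr[OF zs(3)] by blast
    have hA: "h \<in> carrier A" using h H_mem by auto
    have yV: "y \<in> V" using zs(4) arc_verts by blast
    have "zs ! s = h (ys ! s)" using h(2) l by (metis lessI nth_map)
    then have "(h (g x), y) \<in> parcs \<Gamma>" using zs(4) gx by simp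
    then have "y \<in> nbrs \<Gamma> (h (g x))" by (simp add: nbrs_def)
    then obtain y1 where y1: "y1 \<in> nbrs \<Gamma> x" "y = h (g y1)"
      unfolding nbrs_image[OF hA aut_closed[OF gA x]] nbrs_image[OF gA x] by blast
    have "y1 \<noteq> x'" if "s \<ge> 1"
    proof -
      have "zs ! (s - 1) = h (ys ! (s - 1))" using h(2) l that by (metis diff_le_self le_imp_less_Suc nth_map)
      then show ?thesis using zs(5) gx' that y1 by auto
    qed
    then obtain q t where qt: "q \<in> H" "t \<in> H" "t \<otimes>\<^bsub>A\<^esub> g = g \<otimes>\<^bsub>A\<^esub> q" "q y0 = y1" "\<forall>v\<in>set ys. t v = v"
      using step[OF y1(1)] by blast
    have tA: "t \<in> carrier A" "q \<in> carrier A" using qt H_mem by auto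
    have "t (g y0) = (t \<otimes>\<^bsub>A\<^esub> g) y0" using tA gA y0V by (simp add: aut_mult)
    also have "\<dots> = g y1" using qt tA gA y0V by (simp add: aut_mult)
    finally have "(h \<otimes>\<^bsub>A\<^esub> t) (g y0) = y" using y1 aut_mult[OF hA tA(1) aut_closed[OF gA y0V]] by simp
    moreover have "map (h \<otimes>\<^bsub>A\<^esub> t) ys = zs"
      using h(2) qt(5) hA tA ysV by (auto simp: aut_mult subset_iff)
    ultimately show ?thesis using zs(1) h qt by (intro bexI[of _ "h \<otimes>\<^bsub>A\<^esub> t"]) (auto simp: H_closed)
  qed
  ultimately show ?thesis using l by (simp add: covers_def)
qed

lemma s_arcs_map:
  assumes "f \<in> H" "\<alpha> \<in> s_arcs \<Gamma> s z" "z \<in> V"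
  shows "map f \<alpha> \<in> s_arcs \<Gamma> s (f z)"
proof -
  have fA: "f \<in> carrier A" using assms H_mem by blast
  have l: "length \<alpha> = s + 1" and "\<alpha> ! 0 = z" and a: "\<And>i. i < s \<Longrightarrow> (\<alpha> ! i, \<alpha> ! (i + 1)) \<in> parcs \<Gamma>"
    and n: "\<And>i. 1 \<le> i \<Longrightarrow> i < s \<Longrightarrow> \<alpha> ! (i - 1) \<noteq> \<alpha> ! (i + 1)"
    using assms by (auto simp: s_arcs_def)
  have v: "\<alpha> ! i \<in> V" if "i \<le> s" for i
  proof (cases "i = 0")
    case False
    then obtain j where "i = j + 1" by (metis Suc_eq_plus1 not0_implies_Suc)
    then show ?thesis using a[of j] arc_verts that by auto
  qed (use assms \<open>\<alpha> ! 0 = z\<close> in simp)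
  have "f (\<alpha> ! (i - 1)) \<noteq> f (\<alpha> ! (i + 1))" if "1 \<le> i" "i < s" for i
    using n[OF that] v[of "i - 1"] v[of "i + 1"] that aut_inj[OF fA, of "\<alpha> ! (i - 1)" "\<alpha> ! (i + 1)"] by simp
  then show ?thesis
    unfolding s_arcs_def using l \<open>\<alpha> ! 0 = z\<close> aut_arc[OF fA a] by (auto simp: nth_map)
qed

lemma locally_s_arc_transitiveI:
  assumes "covers s x1 ys1" "covers s x2 ys2"
  shows "locally_s_arc_transitive s \<Gamma> H"
  unfolding locally_s_arc_transitive_def
proof (intro ballI)
  fix z \<alpha> \<beta> assume z: "z \<in> V" and \<alpha>: "\<alpha> \<in> s_arcs \<Gamma> s z" and \<beta>: "\<beta> \<in> s_arcs \<Gamma> s z"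
  obtain f x ys where f: "f \<in> H" and x: "x \<in> V" "z = f x" and cov: "covers s x ys"
    using cover[OF z] assms x1V x2V by metis
  have fA: "f \<in> carrier A" using f H_mem by blast
  have *: "\<exists>h\<in>H. map h ys = \<gamma>" if \<gamma>: "\<gamma> \<in> s_arcs \<Gamma> s z" for \<gamma>
  proof -
    have "map (inv\<^bsub>A\<^esub> f) \<gamma> \<in> s_arcs \<Gamma> s x"
      using s_arcs_map[OF H_closed(2)[OF f] \<gamma> z] x(2) aut_inv(1)[OF fA x(1)] by simp
    then obtain h where h: "h \<in> H" "map h ys = map (inv\<^bsub>A\<^esub> f) \<gamma>" using cov by (auto simp: covers_def)
    have V: "set \<delta> \<subseteq> V" if "\<delta> \<in> s_arcs \<Gamma> s y" "y \<in> V" for \<delta> y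
    proof -
      have "\<delta> ! i \<in> V" if "i < length \<delta>" for i
      proof (cases i)
        case (Suc j)
        then show ?thesis using that \<open>\<delta> \<in> s_arcs \<Gamma> s y\<close> arc_verts by (auto simp: s_arcs_def)
      qed (use \<open>\<delta> \<in> s_arcs \<Gamma> s y\<close> \<open>y \<in> V\<close> in \<open>simp add: s_arcs_def\<close>)
      then show ?thesis by (auto simp: in_set_conv_nth)
    qed
    have ysV: "set ys \<subseteq> V" using V[of ys x] cov x by (auto simp: covers_def)
    have "map (f \<otimes>\<^bsub>A\<^esub> h) ys = map f (map h ys)"
      using ysV aut_mult[OF fA H_mem[OF h(1)]] by (auto simp: subset_iff)
    also have "\<dots> = \<gamma>"
      unfolding h(2) map_map using V[OF \<gamma> z] aut_inv(2)[OF fA] by (intro map_idI) auto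
    finally show ?thesis using f h H_closed by blast
  qed
  obtain h k where h: "h \<in> H" "map h ys = \<alpha>" and k: "k \<in> H" "map k ys = \<beta>"
    using *[OF \<alpha>] *[OF \<beta>] by blast
  have kh: "(k \<otimes>\<^bsub>A\<^esub> inv\<^bsub>A\<^esub> h) (h v) = k v" if "v \<in> V" for v
  proof -
    have hA: "h \<in> carrier A" "k \<in> carrier A" using h k H_mem by auto
    show ?thesis
      using aut_mult[OF hA(2) A.inv_closed[OF hA(1)] aut_closed[OF hA(1) that]] aut_inv(1)[OF hA(1) that] by simp
  qed
  have ysV: "v \<in> V" if v: "v \<in> set ys" for v
  proof -
    obtain i where i: "i < length ys" "v = ys ! i" using v by (auto simp: in_set_conv_nth)
    show ?thesis
    proof (cases i)
      case (Suc j)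
      then show ?thesis using i cov arc_verts by (auto simp: covers_def s_arcs_def)
    qed (use i cov x in \<open>simp add: covers_def s_arcs_def\<close>)
  qed
  have m: "map (k \<otimes>\<^bsub>A\<^esub> inv\<^bsub>A\<^esub> h) \<alpha> = \<beta>"
    using h k kh ysV by auto
  moreover have "\<alpha> ! 0 = z" "\<beta> ! 0 = z" "0 < length \<alpha>" using \<alpha> \<beta> by (auto simp: s_arcs_def)
  ultimately have "(k \<otimes>\<^bsub>A\<^esub> inv\<^bsub>A\<^esub> h) z = z" by (metis nth_map)
  then show "\<exists>h\<in>vstab H z. map h \<alpha> = \<beta>"
    using m h k by (intro bexI[of _ "k \<otimes>\<^bsub>A\<^esub> inv\<^bsub>A\<^esub> h"]) (auto simp: vstab_def H_closed)
qed

lemma covers_0: "z \<in> V \<Longrightarrow> covers 0 z [z]"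
  using H_closed(3) by (auto simp: covers_def s_arcs_0 aut_one intro: bexI[of _ "\<one>\<^bsub>A\<^esub>"])

lemma vstab_fix: "h \<in> vstab H z \<Longrightarrow> h z = z" "h \<in> vstab H z \<Longrightarrow> h \<in> H" "h \<in> vstab H z \<Longrightarrow> h \<in> carrier A"
  using H_mem by (auto simp: vstab_def)

text \<open>The arc from \<open>x1\<close> runs through \<open>x2\<close>,
  \<open>\<alpha> x1\<close>, \<open>\<alpha> r x2\<close>, \<open>\<alpha> r \<alpha> x1\<close>,
  \<open>\<alpha> r \<alpha> r x2\<close>; the arc from \<open>x2\<close> exchanges the roles of
  \<open>\<alpha>\<close> and \<open>r\<close>. It is continued by \<open>Q\<close> at translates of
  \<open>x1\<close> and by \<open>T\<close> at translates of \<open>x2\<close>. Each conjugation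
  goes one step back along the arc. If the successive conjugates stay in \<open>C\<close>, which
  fixes \<open>x1\<close> and \<open>x2\<close>, then the last of them fixes all earlier
  vertices.\<close>

lemma five_arc_transitiveI:
  assumes \<alpha>: "\<alpha> \<in> vstab H x2" "\<alpha> x1 \<noteq> x1" and r: "r \<in> vstab H x1" "r x2 \<noteq> x2"
    and C: "C = vstab H x1 \<inter> vstab H x2"
    and Q: "\<And>y. y \<in> nbrs \<Gamma> x1 \<Longrightarrow> y \<noteq> x2 \<Longrightarrow> \<exists>q\<in>C. \<exists>w\<in>C. \<exists>w'\<in>C. \<exists>w''\<in>C. q (r x2) = y \<and>
      \<alpha> \<otimes>\<^bsub>A\<^esub> q = w \<otimes>\<^bsub>A\<^esub> \<alpha> \<and> r \<otimes>\<^bsub>A\<^esub> w = w' \<otimes>\<^bsub>A\<^esub> r \<and> \<alpha> \<otimes>\<^bsub>A\<^esub> w' = w'' \<otimes>\<^bsub>A\<^esub> \<alpha>"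
    and T: "\<And>y. y \<in> nbrs \<Gamma> x2 \<Longrightarrow> y \<noteq> x1 \<Longrightarrow> \<exists>q\<in>C. \<exists>t\<in>C. \<exists>t'\<in>C. q (\<alpha> x1) = y \<and>
      r \<otimes>\<^bsub>A\<^esub> q = t \<otimes>\<^bsub>A\<^esub> r \<and> \<alpha> \<otimes>\<^bsub>A\<^esub> t = t \<otimes>\<^bsub>A\<^esub> \<alpha> \<and> r \<otimes>\<^bsub>A\<^esub> t = t' \<otimes>\<^bsub>A\<^esub> r"
  shows "locally_s_arc_transitive 5 \<Gamma> H"
proof -
  note a = vstab_fix[OF \<alpha>(1)] and b = vstab_fix[OF r(1)]
  have Cf: "c x1 = x1" "c x2 = x2" "c \<in> H" "c \<in> carrier A" if "c \<in> C" for c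
    using that vstab_fix by (auto simp: C)
  have ev: "f (g x) = h (k x)"
    if "f \<otimes>\<^bsub>A\<^esub> g = h \<otimes>\<^bsub>A\<^esub> k" "f \<in> carrier A" "g \<in> carrier A" "h \<in> carrier A" "k \<in> carrier A" "x \<in> V"
    for f g h k x
    using aut_mult[of f g x] aut_mult[of h k x] that by metis
  have Va: "\<alpha> v \<in> V" "r v \<in> V" if "v \<in> V" for v using aut_closed[OF a(3) that] aut_closed[OF b(3) that] by auto
  have n1: "r x2 \<in> nbrs \<Gamma> x1" "x2 \<in> nbrs \<Gamma> x1" and n2: "\<alpha> x1 \<in> nbrs \<Gamma> x2" "x1 \<in> nbrs \<Gamma> x2"
    using nbrs1 nbrs2 r(1) \<alpha>(1) arc arc_sym[OF arc] by (auto simp: nbrs_def)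
  have g: "\<alpha> \<otimes>\<^bsub>A\<^esub> r \<in> H" "r \<otimes>\<^bsub>A\<^esub> \<alpha> \<in> H" "\<alpha> \<otimes>\<^bsub>A\<^esub> r \<otimes>\<^bsub>A\<^esub> \<alpha> \<in> H" "r \<otimes>\<^bsub>A\<^esub> \<alpha> \<otimes>\<^bsub>A\<^esub> r \<in> H"
    using a(2) b(2) by (auto simp: H_closed)
  have app: "(\<alpha> \<otimes>\<^bsub>A\<^esub> r) v = \<alpha> (r v)" "(r \<otimes>\<^bsub>A\<^esub> \<alpha>) v = r (\<alpha> v)"
    "(\<alpha> \<otimes>\<^bsub>A\<^esub> r \<otimes>\<^bsub>A\<^esub> \<alpha>) v = \<alpha> (r (\<alpha> v))" "(r \<otimes>\<^bsub>A\<^esub> \<alpha> \<otimes>\<^bsub>A\<^esub> r) v = r (\<alpha> (r v))" if "v \<in> V" for v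
    using that a(3) b(3) Va by (simp_all add: aut_mult)
  have comm: "w \<otimes>\<^bsub>A\<^esub> (f \<otimes>\<^bsub>A\<^esub> k) = (f \<otimes>\<^bsub>A\<^esub> k) \<otimes>\<^bsub>A\<^esub> u"
    if "f \<otimes>\<^bsub>A\<^esub> v = w \<otimes>\<^bsub>A\<^esub> f" "k \<otimes>\<^bsub>A\<^esub> u = v \<otimes>\<^bsub>A\<^esub> k" "f \<in> carrier A" "k \<in> carrier A" "u \<in> carrier A" "v \<in> carrier A" "w \<in> carrier A"
    for f k u v w
  proof -
    have "w \<otimes>\<^bsub>A\<^esub> (f \<otimes>\<^bsub>A\<^esub> k) = (w \<otimes>\<^bsub>A\<^esub> f) \<otimes>\<^bsub>A\<^esub> k" using that by (simp add: A.m_assoc)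
    also have "\<dots> = f \<otimes>\<^bsub>A\<^esub> (v \<otimes>\<^bsub>A\<^esub> k)" using that(3-) by (simp add: that(1)[symmetric] A.m_assoc)
    also have "\<dots> = (f \<otimes>\<^bsub>A\<^esub> k) \<otimes>\<^bsub>A\<^esub> u" using that(3-) by (simp add: that(2)[symmetric] A.m_assoc)
    finally show ?thesis .
  qed
  have 1: "covers (Suc 0) x1 ([x1] @ [\<one>\<^bsub>A\<^esub> x2])"
  proof (rule covers_Suc[OF covers_0[OF x1V] x1V H_closed(3) x1V])
    fix y assume "y \<in> nbrs \<Gamma> x1"
    then obtain q where q: "q \<in> vstab H x1" "y = q x2" unfolding nbrs1 by blast
    show "\<exists>q\<in>H. \<exists>t\<in>H. t \<otimes>\<^bsub>A\<^esub> \<one>\<^bsub>A\<^esub> = \<one>\<^bsub>A\<^esub> \<otimes>\<^bsub>A\<^esub> q \<and> q x2 = y \<and> (\<forall>v\<in>set [x1]. t v = v)"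
      by (intro bexI[of _ q]) (use q vstab_fix[OF q(1)] in auto)
  qed (use n1 x1V in \<open>auto simp: aut_one\<close>)
  have 2: "covers (Suc 1) x1 ([x1, x2] @ [\<one>\<^bsub>A\<^esub> (\<alpha> x1)])"
  proof (rule covers_Suc[OF _ x1V H_closed(3) x2V])
    fix y assume "y \<in> nbrs \<Gamma> x2" "1 \<le> (1::nat) \<Longrightarrow> y \<noteq> x1"
    then obtain q where q: "q \<in> C" "q (\<alpha> x1) = y" using T by force
    show "\<exists>q\<in>H. \<exists>t\<in>H. t \<otimes>\<^bsub>A\<^esub> \<one>\<^bsub>A\<^esub> = \<one>\<^bsub>A\<^esub> \<otimes>\<^bsub>A\<^esub> q \<and> q (\<alpha> x1) = y \<and> (\<forall>v\<in>set [x1, x2]. t v = v)"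
      by (intro bexI[of _ q]) (use q Cf[OF q(1)] in auto)
  qed (use 1 n2 x1V x2V \<alpha>(2) in \<open>auto simp: aut_one\<close>)
  have 3: "covers (Suc 2) x1 ([x1, x2, \<alpha> x1] @ [\<alpha> (r x2)])"
  proof (rule covers_Suc[OF _ x1V a(2) x1V, where x' = x2])
    fix y assume "y \<in> nbrs \<Gamma> x1" "1 \<le> (2::nat) \<Longrightarrow> y \<noteq> x2"
    then obtain q w where q: "q \<in> C" "w \<in> C" "q (r x2) = y" "\<alpha> \<otimes>\<^bsub>A\<^esub> q = w \<otimes>\<^bsub>A\<^esub> \<alpha>" using Q by force
    have "w (\<alpha> x1) = \<alpha> x1" using ev[OF q(4) _ _ _ _ x1V] Cf[OF q(1)] Cf[OF q(2)] a by simp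
    then show "\<exists>q\<in>H. \<exists>t\<in>H. t \<otimes>\<^bsub>A\<^esub> \<alpha> = \<alpha> \<otimes>\<^bsub>A\<^esub> q \<and> q (r x2) = y \<and> (\<forall>v\<in>set [x1, x2, \<alpha> x1]. t v = v)"
      by (intro bexI[of _ q] bexI[of _ w]) (use q Cf[OF q(1)] Cf[OF q(2)] in auto)
  qed (use 2 n1 x1V x2V r(2) a Va in \<open>auto simp: aut_one numeral_2_eq_2\<close>)
  have 4: "covers (Suc 3) x1 ([x1, x2, \<alpha> x1, \<alpha> (r x2)] @ [(\<alpha> \<otimes>\<^bsub>A\<^esub> r) (\<alpha> x1)])"
  proof (rule covers_Suc[OF _ x1V g(1) x2V, where x' = x1])
    fix y assume "y \<in> nbrs \<Gamma> x2" "1 \<le> (3::nat) \<Longrightarrow> y \<noteq> x1"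
    then obtain q t where q: "q \<in> C" "t \<in> C" "q (\<alpha> x1) = y" "r \<otimes>\<^bsub>A\<^esub> q = t \<otimes>\<^bsub>A\<^esub> r" "\<alpha> \<otimes>\<^bsub>A\<^esub> t = t \<otimes>\<^bsub>A\<^esub> \<alpha>"
      using T by force
    note c = Cf[OF q(1)] Cf[OF q(2)]
    have "t (\<alpha> x1) = \<alpha> x1" using ev[OF q(5) _ _ _ _ x1V] c a by simp
    moreover have "t (\<alpha> (r x2)) = \<alpha> (r x2)"
      using ev[OF q(5) _ _ _ _ Va(2)[OF x2V]] ev[OF q(4) _ _ _ _ x2V] c a b by simp
    moreover have "t \<otimes>\<^bsub>A\<^esub> (\<alpha> \<otimes>\<^bsub>A\<^esub> r) = (\<alpha> \<otimes>\<^bsub>A\<^esub> r) \<otimes>\<^bsub>A\<^esub> q" by (rule comm[OF q(5) q(4)]) (use c a b in auto)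
    ultimately show "\<exists>q\<in>H. \<exists>t\<in>H. t \<otimes>\<^bsub>A\<^esub> (\<alpha> \<otimes>\<^bsub>A\<^esub> r) = (\<alpha> \<otimes>\<^bsub>A\<^esub> r) \<otimes>\<^bsub>A\<^esub> q \<and> q (\<alpha> x1) = y \<and>
        (\<forall>v\<in>set [x1, x2, \<alpha> x1, \<alpha> (r x2)]. t v = v)"
      by (intro bexI[of _ q] bexI[of _ t]) (use q c in auto)
  qed (use 3 n2 x1V x2V \<alpha>(2) a b Va app in \<open>auto simp: numeral_3_eq_3 numeral_2_eq_2\<close>)
  \<comment> \<open>The whole chain in \<open>Q\<close> is used here: conjugation of
    \<open>q\<close> by \<open>\<alpha>\<close>, then \<open>r\<close>, then \<open>\<alpha>\<close>
    gives \<open>w\<close>, \<open>w'\<close> and finally \<open>t\<close>, all inside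
    \<open>C\<close>.\<close>
  have 5: "covers (Suc 4) x1 ([x1, x2, \<alpha> x1, \<alpha> (r x2), \<alpha> (r (\<alpha> x1))] @ [(\<alpha> \<otimes>\<^bsub>A\<^esub> r \<otimes>\<^bsub>A\<^esub> \<alpha>) (r x2)])"
  proof (rule covers_Suc[OF _ x1V g(3) x1V, where x' = x2])
    fix y assume "y \<in> nbrs \<Gamma> x1" "1 \<le> (4::nat) \<Longrightarrow> y \<noteq> x2"
    then obtain q w w' t where q: "q \<in> C" "w \<in> C" "w' \<in> C" "t \<in> C" "q (r x2) = y" "\<alpha> \<otimes>\<^bsub>A\<^esub> q = w \<otimes>\<^bsub>A\<^esub> \<alpha>"
      "r \<otimes>\<^bsub>A\<^esub> w = w' \<otimes>\<^bsub>A\<^esub> r" "\<alpha> \<otimes>\<^bsub>A\<^esub> w' = t \<otimes>\<^bsub>A\<^esub> \<alpha>" using Q by force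
    note c = Cf[OF q(1)] Cf[OF q(2)] Cf[OF q(3)] Cf[OF q(4)]
    have "t (\<alpha> x1) = \<alpha> x1" using ev[OF q(8) _ _ _ _ x1V] c a by simp
    moreover have w: "w (\<alpha> x1) = \<alpha> x1" using ev[OF q(6) _ _ _ _ x1V] c a by simp
    moreover have "t (\<alpha> (r x2)) = \<alpha> (r x2)"
      using ev[OF q(8) _ _ _ _ Va(2)[OF x2V]] ev[OF q(7) _ _ _ _ x2V] c a b by simp
    moreover have "t (\<alpha> (r (\<alpha> x1))) = \<alpha> (r (\<alpha> x1))"
      using ev[OF q(8) _ _ _ _ Va(2)[OF Va(1)[OF x1V]]] ev[OF q(7) _ _ _ _ Va(1)[OF x1V]] c a b w by simp
    moreover have "t \<otimes>\<^bsub>A\<^esub> (\<alpha> \<otimes>\<^bsub>A\<^esub> r \<otimes>\<^bsub>A\<^esub> \<alpha>) = (\<alpha> \<otimes>\<^bsub>A\<^esub> r \<otimes>\<^bsub>A\<^esub> \<alpha>) \<otimes>\<^bsub>A\<^esub> q"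
      by (rule comm[OF comm[OF q(8) q(7), symmetric] q(6)]) (use c a b in auto)
    ultimately show "\<exists>q\<in>H. \<exists>t\<in>H. t \<otimes>\<^bsub>A\<^esub> (\<alpha> \<otimes>\<^bsub>A\<^esub> r \<otimes>\<^bsub>A\<^esub> \<alpha>) = (\<alpha> \<otimes>\<^bsub>A\<^esub> r \<otimes>\<^bsub>A\<^esub> \<alpha>) \<otimes>\<^bsub>A\<^esub> q \<and> q (r x2) = y \<and>
        (\<forall>v\<in>set [x1, x2, \<alpha> x1, \<alpha> (r x2), \<alpha> (r (\<alpha> x1))]. t v = v)"
      by (intro bexI[of _ q] bexI[of _ t]) (use q c in auto)
  qed (use 4 n1 x1V x2V r(2) a b Va app in \<open>auto simp: eval_nat_numeral\<close>)
  have 6: "covers (Suc 0) x2 ([x2] @ [\<one>\<^bsub>A\<^esub> x1])"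
  proof (rule covers_Suc[OF covers_0[OF x2V] x2V H_closed(3) x2V])
    fix y assume "y \<in> nbrs \<Gamma> x2"
    then obtain q where q: "q \<in> vstab H x2" "y = q x1" unfolding nbrs2 by blast
    show "\<exists>q\<in>H. \<exists>t\<in>H. t \<otimes>\<^bsub>A\<^esub> \<one>\<^bsub>A\<^esub> = \<one>\<^bsub>A\<^esub> \<otimes>\<^bsub>A\<^esub> q \<and> q x1 = y \<and> (\<forall>v\<in>set [x2]. t v = v)"
      by (intro bexI[of _ q]) (use q vstab_fix[OF q(1)] in auto)
  qed (use n2 x2V in \<open>auto simp: aut_one\<close>)
  have 7: "covers (Suc 1) x2 ([x2, x1] @ [\<one>\<^bsub>A\<^esub> (r x2)])"
  proof (rule covers_Suc[OF _ x2V H_closed(3) x1V])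
    fix y assume "y \<in> nbrs \<Gamma> x1" "1 \<le> (1::nat) \<Longrightarrow> y \<noteq> x2"
    then obtain q where q: "q \<in> C" "q (r x2) = y" using Q by force
    show "\<exists>q\<in>H. \<exists>t\<in>H. t \<otimes>\<^bsub>A\<^esub> \<one>\<^bsub>A\<^esub> = \<one>\<^bsub>A\<^esub> \<otimes>\<^bsub>A\<^esub> q \<and> q (r x2) = y \<and> (\<forall>v\<in>set [x2, x1]. t v = v)"
      by (intro bexI[of _ q]) (use q Cf[OF q(1)] in auto)
  qed (use 6 n1 x1V x2V r(2) in \<open>auto simp: aut_one\<close>)
  have 8: "covers (Suc 2) x2 ([x2, x1, r x2] @ [r (\<alpha> x1)])"
  proof (rule covers_Suc[OF _ x2V b(2) x2V, where x' = x1])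
    fix y assume "y \<in> nbrs \<Gamma> x2" "1 \<le> (2::nat) \<Longrightarrow> y \<noteq> x1"
    then obtain q t where q: "q \<in> C" "t \<in> C" "q (\<alpha> x1) = y" "r \<otimes>\<^bsub>A\<^esub> q = t \<otimes>\<^bsub>A\<^esub> r" using T by force
    have "t (r x2) = r x2" using ev[OF q(4) _ _ _ _ x2V] Cf[OF q(1)] Cf[OF q(2)] b by simp
    then show "\<exists>q\<in>H. \<exists>t\<in>H. t \<otimes>\<^bsub>A\<^esub> r = r \<otimes>\<^bsub>A\<^esub> q \<and> q (\<alpha> x1) = y \<and> (\<forall>v\<in>set [x2, x1, r x2]. t v = v)"
      by (intro bexI[of _ q] bexI[of _ t]) (use q Cf[OF q(1)] Cf[OF q(2)] in auto)
  qed (use 7 n2 x1V x2V \<alpha>(2) b Va in \<open>auto simp: aut_one numeral_2_eq_2\<close>)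
  have 9: "covers (Suc 3) x2 ([x2, x1, r x2, r (\<alpha> x1)] @ [(r \<otimes>\<^bsub>A\<^esub> \<alpha>) (r x2)])"
  proof (rule covers_Suc[OF _ x2V g(2) x1V, where x' = x2])
    fix y assume "y \<in> nbrs \<Gamma> x1" "1 \<le> (3::nat) \<Longrightarrow> y \<noteq> x2"
    then obtain q w t where q: "q \<in> C" "w \<in> C" "t \<in> C" "q (r x2) = y" "\<alpha> \<otimes>\<^bsub>A\<^esub> q = w \<otimes>\<^bsub>A\<^esub> \<alpha>"
      "r \<otimes>\<^bsub>A\<^esub> w = t \<otimes>\<^bsub>A\<^esub> r" using Q by force
    note c = Cf[OF q(1)] Cf[OF q(2)] Cf[OF q(3)]
    have "t (r x2) = r x2" using ev[OF q(6) _ _ _ _ x2V] c b by simp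
    moreover have "t (r (\<alpha> x1)) = r (\<alpha> x1)"
      using ev[OF q(6) _ _ _ _ Va(1)[OF x1V]] ev[OF q(5) _ _ _ _ x1V] c a b by simp
    moreover have "t \<otimes>\<^bsub>A\<^esub> (r \<otimes>\<^bsub>A\<^esub> \<alpha>) = (r \<otimes>\<^bsub>A\<^esub> \<alpha>) \<otimes>\<^bsub>A\<^esub> q" by (rule comm[OF q(6) q(5)]) (use c a b in auto)
    ultimately show "\<exists>q\<in>H. \<exists>t\<in>H. t \<otimes>\<^bsub>A\<^esub> (r \<otimes>\<^bsub>A\<^esub> \<alpha>) = (r \<otimes>\<^bsub>A\<^esub> \<alpha>) \<otimes>\<^bsub>A\<^esub> q \<and> q (r x2) = y \<and>
        (\<forall>v\<in>set [x2, x1, r x2, r (\<alpha> x1)]. t v = v)"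
      by (intro bexI[of _ q] bexI[of _ t]) (use q c in auto)
  qed (use 8 n1 x1V x2V r(2) a b Va app in \<open>auto simp: numeral_3_eq_3 numeral_2_eq_2\<close>)
  \<comment> \<open>Here \<open>r\<close> conjugates \<open>q\<close> into \<open>s\<close>,
    \<open>\<alpha>\<close> commutes with \<open>s\<close>, and \<open>r\<close> conjugates
    \<open>s\<close> into \<open>t\<close>.\<close>
  have 10: "covers (Suc 4) x2 ([x2, x1, r x2, r (\<alpha> x1), r (\<alpha> (r x2))] @ [(r \<otimes>\<^bsub>A\<^esub> \<alpha> \<otimes>\<^bsub>A\<^esub> r) (\<alpha> x1)])"
  proof (rule covers_Suc[OF _ x2V g(4) x2V, where x' = x1])
    fix y assume "y \<in> nbrs \<Gamma> x2" "1 \<le> (4::nat) \<Longrightarrow> y \<noteq> x1"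
    then obtain q s t where q: "q \<in> C" "s \<in> C" "t \<in> C" "q (\<alpha> x1) = y" "r \<otimes>\<^bsub>A\<^esub> q = s \<otimes>\<^bsub>A\<^esub> r"
      "\<alpha> \<otimes>\<^bsub>A\<^esub> s = s \<otimes>\<^bsub>A\<^esub> \<alpha>" "r \<otimes>\<^bsub>A\<^esub> s = t \<otimes>\<^bsub>A\<^esub> r" using T by force
    note c = Cf[OF q(1)] Cf[OF q(2)] Cf[OF q(3)]
    have "t (r x2) = r x2" using ev[OF q(7) _ _ _ _ x2V] c b by simp
    moreover have "t (r (\<alpha> x1)) = r (\<alpha> x1)"
      using ev[OF q(7) _ _ _ _ Va(1)[OF x1V]] ev[OF q(6) _ _ _ _ x1V] c a b by simp
    moreover have "t (r (\<alpha> (r x2))) = r (\<alpha> (r x2))"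
      using ev[OF q(7) _ _ _ _ Va(1)[OF Va(2)[OF x2V]]] ev[OF q(6) _ _ _ _ Va(2)[OF x2V]]
        ev[OF q(5) _ _ _ _ x2V] c a b by simp
    moreover have "t \<otimes>\<^bsub>A\<^esub> (r \<otimes>\<^bsub>A\<^esub> \<alpha> \<otimes>\<^bsub>A\<^esub> r) = (r \<otimes>\<^bsub>A\<^esub> \<alpha> \<otimes>\<^bsub>A\<^esub> r) \<otimes>\<^bsub>A\<^esub> q"
      by (rule comm[OF comm[OF q(7) q(6), symmetric] q(5)]) (use c a b in auto)
    ultimately show "\<exists>q\<in>H. \<exists>t\<in>H. t \<otimes>\<^bsub>A\<^esub> (r \<otimes>\<^bsub>A\<^esub> \<alpha> \<otimes>\<^bsub>A\<^esub> r) = (r \<otimes>\<^bsub>A\<^esub> \<alpha> \<otimes>\<^bsub>A\<^esub> r) \<otimes>\<^bsub>A\<^esub> q \<and> q (\<alpha> x1) = y \<and>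
        (\<forall>v\<in>set [x2, x1, r x2, r (\<alpha> x1), r (\<alpha> (r x2))]. t v = v)"
      by (intro bexI[of _ q] bexI[of _ t]) (use q c in auto)
  qed (use 9 n2 x1V x2V \<alpha>(2) a b Va app in \<open>auto simp: eval_nat_numeral\<close>)
  show ?thesis
    using locally_s_arc_transitiveI[of "Suc 4"] 5 10 by (simp add: eval_nat_numeral)
qed

end

section \<open>Arithmetic in the field with nine elements\<close>

lemma all_3: "(\<forall>x::3. P x) \<longleftrightarrow> P 0 \<and> P 1 \<and> P (-1)"
  using three_cases by metis

text \<open>Together with \<open>all_3\<close> it unfolds a quantifier over the field into nine
  cases that the simplifier evaluates.\<close>

lemma all_gf9: "(\<forall>x. P x) \<longleftrightarrow> (\<forall>a b. P (GF9 a b))"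
  by (metis gf9.exhaust)

lemmas gf9_defs = zero_gf9_def one_gf9_def plus_gf9_def times_gf9_def uminus_gf9_def minus_gf9_def

definition cj :: "gf9 \<Rightarrow> gf9" where "cj x = GF9 (gf9_re x) (- gf9_im x)"

definition emb :: "3 \<Rightarrow> gf9" where "emb a = GF9 a 0"

lemma cj_simps [simp]: "cj (x + y) = cj x + cj y" "cj (x * y) = cj x * cj y" "cj (x - y) = cj x - cj y"
  "cj (- x) = - cj x" "cj 0 = 0" "cj 1 = 1" "cj (cj x) = x" "cj (emb a) = emb a"
  by (simp_all add: cj_def emb_def gf9_defs algebra_simps)

lemma emb_simps [simp]: "emb (a + b) = emb a + emb b" "emb (a * b) = emb a * emb b" "emb 0 = 0" "emb 1 = 1"
  "emb (- a) = - emb a"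
  by (simp_all add: emb_def gf9_defs)

lemma emb_inj [simp]: "emb a = emb b \<longleftrightarrow> a = b"
  by (simp add: emb_def)

lemma emb_eq_0_iff [simp]: "emb a = 0 \<longleftrightarrow> a = 0"
  by (simp add: emb_def gf9_defs)

lemma gf9_char: "x + x + x = 0" for x :: gf9
proof -
  have "\<forall>x::gf9. x + x + x = 0"
    unfolding all_gf9 all_3 by (simp add: gf9_defs)
  then show ?thesis by blast
qed

text \<open>The coordinatewise conjugation is the Frobenius map. Applying it twice yields
  \<open>x ^ 9 = x\<close>, the source of all exponent arithmetic below.\<close>

lemma gf9_cube: "x * x * x = cj x"
proof -
  have "\<forall>x. x * x * x = cj x"
    unfolding all_gf9 all_3 by (simp add: cj_def gf9_defs)
  then show ?thesis by blast
qed

lemma gf9_pow9: "x ^ 9 = x" for x :: gf9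
proof -
  have "x ^ 9 = (x * x * x) * (x * x * x) * (x * x * x)" by (simp add: eval_nat_numeral)
  also have "\<dots> = x" unfolding gf9_cube by (simp flip: cj_simps(2) add: gf9_cube)
  finally show ?thesis .
qed

lemma gf9_pow8: "x \<noteq> 0 \<Longrightarrow> x ^ 8 = 1" for x :: gf9
proof -
  assume "x \<noteq> 0"
  moreover have "x * x ^ 8 = x * 1" using gf9_pow9[of x] by (simp flip: power_Suc)
  ultimately show ?thesis by (metis mult_left_cancel)
qed

text \<open>The Galois group of order two is encoded by \<open>bool\<close>, with
  \<open>\<noteq>\<close> as its multiplication.\<close>

definition frob :: "bool \<Rightarrow> gf9 \<Rightarrow> gf9" where "frob s x = (if s then cj x else x)"

lemma frob_simps [simp]: "frob s (x + y) = frob s x + frob s y" "frob s (x * y) = frob s x * frob s y"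
  "frob s (x - y) = frob s x - frob s y" "frob s (- x) = - frob s x" "frob s 0 = 0" "frob s 1 = 1"
  "frob s (frob s' x) = frob (s \<noteq> s') x" "frob s (emb a) = emb a" "frob False x = x"
  by (auto simp: frob_def)

lemma frob_inj [simp]: "frob s x = frob s y \<longleftrightarrow> x = y"
  by (metis frob_simps(7,9))

lemma frob_eq_0 [simp]: "frob s x = 0 \<longleftrightarrow> x = 0"
  by (metis frob_inj frob_simps(5))

text \<open>A generator of the multiplicative group: its square is \<open>-i\<close>, of order
  4.\<close>

definition \<omega> :: gf9 where "\<omega> = GF9 1 1"

text \<open>The coboundary of \<open>\<omega>\<close>, namely the quotient of the image of
  \<open>\<omega>\<close> under the field automorphism by \<open>\<omega>\<close>; for the Frobenius
  map this is \<open>\<omega>^3 / \<omega>\<close>. The two identities that follow express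
  this.\<close>

definition \<mu> :: "bool \<Rightarrow> gf9" where "\<mu> s = (if s then \<omega> * \<omega> else 1)"

lemma \<mu>_xor: "\<mu> (s \<noteq> s') = \<mu> s * frob s (\<mu> s')"
  by (cases s; cases s') (auto simp: \<mu>_def frob_def cj_def \<omega>_def gf9_defs)

lemma \<mu>_nz [simp]: "\<mu> s \<noteq> 0" and \<omega>_nz [simp]: "\<omega> \<noteq> 0" and \<mu>_False [simp]: "\<mu> False = 1"
  by (auto simp: \<mu>_def \<omega>_def gf9_defs)

lemma \<omega>_\<mu>: "\<omega> * \<mu> s = frob s \<omega>"
  by (cases s) (auto simp: \<mu>_def frob_def cj_def \<omega>_def gf9_defs)

definition lam :: "gf9 \<Rightarrow> gf9" where "lam c = \<omega> * cj c"

lemma lam_simps [simp]: "lam (c + c') = lam c + lam c'" "lam 0 = 0" "lam (c - c') = lam c - lam c'"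
  by (simp_all add: lam_def algebra_simps)

lemma lam_eq_0 [simp]: "lam c = 0 \<longleftrightarrow> c = 0"
  using frob_eq_0[of True c] by (simp add: lam_def frob_def)

lemma cj_frob: "cj (frob s x) = frob s (cj x)"
  by (simp add: frob_def)

text \<open>The torus multiplies \<open>v\<close> by \<open>d\<close>, \<open>u\<close> by
  \<open>g\<close> and \<open>c\<close> by \<open>\<epsilon> d g\<close>. Cubing keeps
  \<open>\<epsilon>\<close>, and after collecting powers the surplus factor is
  \<open>\<epsilon> (d^2 g)^2\<close>. By hypothesis this is \<open>\<mu> s\<close>, which turns
  \<open>\<omega>\<close> into its image under the field automorphism. So the torus normalizes the
  automorphisms indexed by \<open>c\<close>.\<close>

lemma lam_twist:
  assumes "emb \<epsilon> * (d ^ 2 * g) ^ 2 = \<mu> s"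
  shows "lam (emb \<epsilon> * d * g * frob s c) * d = g * frob s (lam c)"
proof -
  have "lam (emb \<epsilon> * d * g * frob s c) * d = \<omega> * (emb \<epsilon> * (d * d * d) * (g * g * g) * frob s (cj c)) * d"
    by (simp add: lam_def gf9_cube cj_frob)
  also have "\<dots> = \<omega> * (emb \<epsilon> * (d ^ 2 * g) ^ 2) * g * frob s (cj c)"
    by (simp add: power2_eq_square algebra_simps)
  also have "\<dots> = g * frob s (lam c)"
    by (simp add: assms \<omega>_\<mu> lam_def)
  finally show ?thesis .
qed

section \<open>Two by two matrices\<close>

definition vec2 :: "gf9 \<Rightarrow> gf9 \<Rightarrow> gf9 ^ 2" where "vec2 x y = (\<chi> i. if i = 1 then x else y)"

definition mat2 :: "gf9 \<Rightarrow> gf9 \<Rightarrow> gf9 \<Rightarrow> gf9 \<Rightarrow> gf9 ^ 2 ^ 2" where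
  "mat2 a b c d = (\<chi> i j. if i = 1 then if j = 1 then a else b else if j = 1 then c else d)"

lemma vec2_nth [simp]: "vec2 x y $ 1 = x" "vec2 x y $ 2 = y"
  by (simp_all add: vec2_def)

lemma mat2_nth [simp]: "mat2 a b c d $ 1 $ 1 = a" "mat2 a b c d $ 1 $ 2 = b"
  "mat2 a b c d $ 2 $ 1 = c" "mat2 a b c d $ 2 $ 2 = d"
  by (simp_all add: mat2_def)

lemma vec_eq2: "v = w \<longleftrightarrow> v $ 1 = w $ 1 \<and> v $ 2 = w $ 2" for v w :: "'a ^ 2"
  by (simp add: vec_eq_iff forall_2)

lemma mat_nth2 [simp]: "(mat k :: 'a::zero ^ 2 ^ 2) $ 1 $ 1 = k" "(mat k :: 'a ^ 2 ^ 2) $ 1 $ 2 = 0"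
  "(mat k :: 'a ^ 2 ^ 2) $ 2 $ 1 = 0" "(mat k :: 'a ^ 2 ^ 2) $ 2 $ 2 = k"
  by (simp_all add: mat_def)

lemma mult_nth2 [simp]: "((A :: 'a::semiring_1 ^ 2 ^ 2) ** B) $ i $ j = A $ i $ 1 * B $ 1 $ j + A $ i $ 2 * B $ 2 $ j"
  by (simp add: matrix_matrix_mult_def sum_2)

lemma mult_vec_nth2 [simp]: "((A :: 'a::semiring_1 ^ 2 ^ 2) *v x) $ i = A $ i $ 1 * x $ 1 + A $ i $ 2 * x $ 2"
  by (simp add: matrix_vector_mult_def sum_2)

lemma det_mat2 [simp]: "det (mat2 a b c d) = a * d - b * c"
  by (simp add: det_2)

definition frobv :: "bool \<Rightarrow> gf9 ^ 2 \<Rightarrow> gf9 ^ 2" where "frobv s v = (\<chi> i. frob s (v $ i))"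

definition frobm :: "bool \<Rightarrow> gf9 ^ 2 ^ 2 \<Rightarrow> gf9 ^ 2 ^ 2" where "frobm s A = (\<chi> i j. frob s (A $ i $ j))"

lemma frobv_nth [simp]: "frobv s v $ i = frob s (v $ i)"
  by (simp add: frobv_def)

lemma frobm_nth [simp]: "frobm s A $ i $ j = frob s (A $ i $ j)"
  by (simp add: frobm_def)

lemma frobv_simps [simp]: "frobv s (v + w) = frobv s v + frobv s w" "frobv s 0 = 0"
  "frobv s (A *v v) = frobm s A *v frobv s v" "frobv s (frobv s' v) = frobv (s \<noteq> s') v" "frobv False v = v"
  by (simp_all add: vec_eq2)

lemma frobm_simps [simp]: "frobm s (A ** B) = frobm s A ** frobm s B" "frobm s (mat 1) = mat 1"
  "frobm s (frobm s' A) = frobm (s \<noteq> s') A" "det (frobm s A) = frob s (det A)" "frobm False A = A"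
  by (simp_all add: vec_eq2 det_2)

section \<open>The parabolic of the vertex of valency ten\<close>

text \<open>A tuple \<open>(e, v, \<epsilon>, A, s)\<close> stands for the map \<open>(x, y) \<mapsto> (\<epsilon> x + e, A y\<^sup>\<sigma> + v)\<close> of
  \<open>E\<^sub>3 \<times> E\<^sub>8\<^sub>1\<close>, where \<open>\<sigma>\<close> is the Frobenius map if \<open>s\<close> holds, and the identity otherwise. The relation
  between \<open>\<epsilon>\<close> and \<open>det A\<close> is the one that makes the stabilizer of a line normalize the group of
  automorphisms \<open>(e, z, v, u) \<mapsto> (e, z + c e, v, u + \<omega> c\<^sup>3 v)\<close> in the second parabolic.\<close>

type_synonym k1 = "3 \<times> (gf9 ^ 2) \<times> 3 \<times> (gf9 ^ 2 ^ 2) \<times> bool"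

definition K1 :: "k1 monoid" where
  "K1 = \<lparr>carrier = {(e, v, \<epsilon>, A, s). emb \<epsilon> * det A ^ 2 = \<mu> s},
     mult = (\<lambda>(e, v, \<epsilon>, A, s) (e', v', \<epsilon>', A', s').
       (e + \<epsilon> * e', v + A *v frobv s v', \<epsilon> * \<epsilon>', A ** frobm s A', s \<noteq> s')),
     one = (0, 0, 1, mat 1, False)\<rparr>"

lemma K1_mem [simp]: "(e, v, \<epsilon>, A, s) \<in> carrier K1 \<longleftrightarrow> emb \<epsilon> * det A ^ 2 = \<mu> s"
  and K1_mult [simp]: "(e, v, \<epsilon>, A, s) \<otimes>\<^bsub>K1\<^esub> (e', v', \<epsilon>', A', s') =
    (e + \<epsilon> * e', v + A *v frobv s v', \<epsilon> * \<epsilon>', A ** frobm s A', s \<noteq> s')"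
  and K1_one [simp]: "\<one>\<^bsub>K1\<^esub> = (0, 0, 1, mat 1, False)"
  by (simp_all add: K1_def)

lemma K1_nz:
  assumes "emb \<epsilon> * det A ^ 2 = \<mu> s"
  shows "\<epsilon> \<noteq> 0" "det A \<noteq> 0" "\<epsilon> * \<epsilon> = 1"
proof -
  show e: "\<epsilon> \<noteq> 0" "det A \<noteq> 0" using assms \<mu>_nz[of s] by auto
  then show "\<epsilon> * \<epsilon> = 1" using three_cases[of \<epsilon>] by auto
qed

lemma finite_K1: "finite (carrier K1)"
  by (rule finite_subset[OF subset_UNIV]) simp

lemma group_K1: "group K1"
proof (rule finite_groupI)
  show "finite (carrier K1)" by (rule finite_K1)
  show "\<one>\<^bsub>K1\<^esub> \<in> carrier K1" by simp
  fix x assume x: "x \<in> carrier K1"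
  obtain e v \<epsilon> A s where xe: "x = (e, v, \<epsilon>, A, s)" by (cases x)
  show "\<one>\<^bsub>K1\<^esub> \<otimes>\<^bsub>K1\<^esub> x = x" "x \<otimes>\<^bsub>K1\<^esub> \<one>\<^bsub>K1\<^esub> = x" by (simp_all add: xe)
  fix y assume y: "y \<in> carrier K1"
  obtain e' v' \<epsilon>' A' s' where ye: "y = (e', v', \<epsilon>', A', s')" by (cases y)
  show "x \<otimes>\<^bsub>K1\<^esub> y \<in> carrier K1"
  proof -
    have "emb (\<epsilon> * \<epsilon>') * det (A ** frobm s A') ^ 2 = (emb \<epsilon> * det A ^ 2) * frob s (emb \<epsilon>' * det A' ^ 2)"
      by (simp add: det_mul power2_eq_square algebra_simps)
    also have "\<dots> = \<mu> (s \<noteq> s')" using x y by (simp only: xe ye K1_mem \<mu>_xor)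
    finally show ?thesis by (simp only: xe ye K1_mult K1_mem)
  qed
  fix z assume z: "z \<in> carrier K1"
  obtain e'' v'' \<epsilon>'' A'' s'' where ze: "z = (e'', v'', \<epsilon>'', A'', s'')" by (cases z)
  show "x \<otimes>\<^bsub>K1\<^esub> y \<otimes>\<^bsub>K1\<^esub> z = x \<otimes>\<^bsub>K1\<^esub> (y \<otimes>\<^bsub>K1\<^esub> z)"
    by (auto simp: xe ye ze algebra_simps matrix_vector_right_distrib matrix_vector_mul_assoc matrix_mul_assoc)
  assume eq: "x \<otimes>\<^bsub>K1\<^esub> y = x \<otimes>\<^bsub>K1\<^esub> z"
  have "invertible A" using x K1_nz by (auto simp: xe invertible_det_nz)
  then obtain B where B: "B ** A = mat 1" by (auto simp: invertible_def)
  have "frobv s v' = frobv s v''"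
  proof -
    have "B *v (A *v frobv s v') = B *v (A *v frobv s v'')" using eq by (simp add: xe ye ze)
    then show ?thesis by (simp add: matrix_vector_mul_assoc B)
  qed
  moreover have "frobm s A' = frobm s A''"
  proof -
    have "B ** (A ** frobm s A') = B ** (A ** frobm s A'')" using eq by (simp add: xe ye ze)
    then show ?thesis by (simp add: matrix_mul_assoc B)
  qed
  ultimately have "v' = v''" "A' = A''" by (simp_all add: vec_eq2)
  moreover have "\<epsilon> * \<epsilon> = 1" using x K1_nz by (auto simp: xe)
  then have "e' = \<epsilon> * (\<epsilon> * e')" "\<epsilon>' = \<epsilon> * (\<epsilon> * \<epsilon>')" "e'' = \<epsilon> * (\<epsilon> * e'')" "\<epsilon>'' = \<epsilon> * (\<epsilon> * \<epsilon>'')"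
    by (simp_all add: mult.assoc[symmetric])
  then have "e' = e''" "\<epsilon>' = \<epsilon>''" using eq by (simp_all add: xe ye ze)
  ultimately show "y = z"
    using eq by (auto simp: xe ye ze)
qed

section \<open>The parabolic of the vertex of valency nine\<close>

text \<open>A tuple \<open>(e, z, v, u, c, \<epsilon>, d, g, s)\<close> stands for the product of an element \<open>(e, z, v, u)\<close> of
  a Sylow subgroup of \<open>E\<^sub>3 \<times> ASL\<^sub>2(9)\<close> with the automorphism \<open>(e, z, v, u) \<mapsto> (e, z + c e, v, u + \<omega> c\<^sup>3 v)\<close>
  and the automorphism \<open>(e, z, v, u) \<mapsto> (\<epsilon> e, d g z\<^sup>\<sigma>, d v\<^sup>\<sigma>, g u\<^sup>\<sigma>)\<close>. The Sylow subgroup is the central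
  product of \<open>E\<^sub>3\<close> and the Heisenberg group over the field with nine elements, in coordinates
  in which these automorphisms are linear; \<open>to_K1\<close> is the identification with matrices.\<close>

type_synonym k2 = "3 \<times> gf9 \<times> gf9 \<times> gf9 \<times> gf9 \<times> 3 \<times> gf9 \<times> gf9 \<times> bool"

definition K2 :: "k2 monoid" where
  "K2 = \<lparr>carrier = {(e, z, v, u, c, \<epsilon>, d, g, s). emb \<epsilon> * (d ^ 2 * g) ^ 2 = \<mu> s},
     mult = (\<lambda>(e, z, v, u, c, \<epsilon>, d, g, s) (e', z', v', u', c', \<epsilon>', d', g', s').
       (e + \<epsilon> * e',
        z + (d * g * frob s z' + c * emb (\<epsilon> * e')) + (g * frob s u' + lam c * (d * frob s v')) * v
          - u * (d * frob s v'),
        v + d * frob s v',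
        u + (g * frob s u' + lam c * (d * frob s v')),
        c + emb \<epsilon> * d * g * frob s c', \<epsilon> * \<epsilon>', d * frob s d', g * frob s g', s \<noteq> s')),
     one = (0, 0, 0, 0, 0, 1, 1, 1, False)\<rparr>"

lemma K2_mem [simp]: "(e, z, v, u, c, \<epsilon>, d, g, s) \<in> carrier K2 \<longleftrightarrow> emb \<epsilon> * (d ^ 2 * g) ^ 2 = \<mu> s"
  and K2_mult [simp]: "(e, z, v, u, c, \<epsilon>, d, g, s) \<otimes>\<^bsub>K2\<^esub> (e', z', v', u', c', \<epsilon>', d', g', s') =
       (e + \<epsilon> * e',
        z + (d * g * frob s z' + c * emb (\<epsilon> * e')) + (g * frob s u' + lam c * (d * frob s v')) * v
          - u * (d * frob s v'),
        v + d * frob s v',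
        u + (g * frob s u' + lam c * (d * frob s v')),
        c + emb \<epsilon> * d * g * frob s c', \<epsilon> * \<epsilon>', d * frob s d', g * frob s g', s \<noteq> s')"
  and K2_one [simp]: "\<one>\<^bsub>K2\<^esub> = (0, 0, 0, 0, 0, 1, 1, 1, False)"
  by (simp_all add: K2_def)

lemma k2_cases:
  fixes x :: k2
  obtains e z v u c \<epsilon> d g s where "x = (e, z, v, u, c, \<epsilon>, d, g, s)"
  by (metis prod.exhaust)

lemma K2_nz:
  assumes "emb \<epsilon> * (d ^ 2 * g) ^ 2 = \<mu> s"
  shows "\<epsilon> \<noteq> 0" "d \<noteq> 0" "g \<noteq> 0" "\<epsilon> * \<epsilon> = 1"
proof -
  show e: "\<epsilon> \<noteq> 0" "d \<noteq> 0" "g \<noteq> 0" using assms \<mu>_nz[of s] by auto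
  then show "\<epsilon> * \<epsilon> = 1" using three_cases[of \<epsilon>] by auto
qed

lemma finite_K2: "finite (carrier K2)"
  by (rule finite_subset[OF subset_UNIV]) simp

text \<open>Associativity is reduced to ring identities. Images under the field automorphism become
  independent variables, and \<open>L\<close>, \<open>L'\<close> stand for the two values of
  \<open>lam\<close>, tied together by \<open>lam_twist\<close>.\<close>

lemma K2_assoc_u:
  fixes u :: gf9
  assumes "L * d = g * L'"
  shows "u + (g * u' + l * (d * v')) + (g * g' * u'' + (l + L) * (d * d' * v'')) =
    u + (g * (u' + (g' * u'' + L' * (d' * v''))) + l * (d * (v' + d' * v'')))"
proof -
  have k: "L * (d * x) = g * (L' * x)" for x using assms by (metis mult.assoc)
  show ?thesis by (simp add: ring_distribs mult.assoc k)
qed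

text \<open>Since \<open>z\<close> is scaled by \<open>d g\<close> and \<open>e\<close> by
  \<open>\<epsilon>\<close>, the label \<open>c\<close> is scaled by \<open>\<epsilon> d g\<close>.
  In the composite, \<open>\<epsilon>\<close> then meets a second copy of itself and
  cancels.\<close>

lemma K2_assoc_z:
  fixes z :: gf9
  assumes "L * d = g * L'" "\<epsilon> * \<epsilon> = 1"
  shows "z + (d * g * z' + c * (\<epsilon> * e')) + (g * u' + l * (d * v')) * v - u * (d * v') +
      (d * d' * (g * g') * z'' + (c + \<epsilon> * d * g * c') * (\<epsilon> * \<epsilon>' * e'')) +
      (g * g' * u'' + (l + L) * (d * d' * v'')) * (v + d * v') - (u + (g * u' + l * (d * v'))) * (d * d' * v'') =
    z + (d * g * (z' + (d' * g' * z'' + c' * (\<epsilon>' * e'')) + (g' * u'' + L' * (d' * v'')) * v' - u' * (d' * v'')) +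
      c * (\<epsilon> * (e' + \<epsilon>' * e''))) +
      (g * (u' + (g' * u'' + L' * (d' * v''))) + l * (d * (v' + d' * v''))) * v - u * (d * (v' + d' * v''))"
proof -
  have k: "L * (d * x) = g * (L' * x)" "\<epsilon> * (\<epsilon> * x) = x" for x
    using assms by (metis mult.assoc, metis mult.assoc mult_1)
  have "\<epsilon> * d * g * c' * (\<epsilon> * \<epsilon>' * e'') = \<epsilon> * (\<epsilon> * (d * g * c' * \<epsilon>' * e''))" by (simp add: ac_simps)
  then have "\<epsilon> * d * g * c' * (\<epsilon> * \<epsilon>' * e'') = d * g * c' * \<epsilon>' * e''" by (simp only: k)
  then show ?thesis by (simp add: ring_distribs mult.assoc k)
qed

lemma group_K2: "group K2"
proof (rule finite_groupI)
  show "finite (carrier K2)" by (rule finite_K2)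
  show "\<one>\<^bsub>K2\<^esub> \<in> carrier K2" by simp
  fix x assume x: "x \<in> carrier K2"
  obtain e z v u c \<epsilon> d g s where xe: "x = (e, z, v, u, c, \<epsilon>, d, g, s)" by (cases x rule: k2_cases)
  show "\<one>\<^bsub>K2\<^esub> \<otimes>\<^bsub>K2\<^esub> x = x" "x \<otimes>\<^bsub>K2\<^esub> \<one>\<^bsub>K2\<^esub> = x" by (simp_all add: xe)
  fix y assume y: "y \<in> carrier K2"
  obtain e' z' v' u' c' \<epsilon>' d' g' s' where ye: "y = (e', z', v', u', c', \<epsilon>', d', g', s')" by (cases y rule: k2_cases)
  have "emb (\<epsilon> * \<epsilon>') * ((d * frob s d') ^ 2 * (g * frob s g')) ^ 2 =
      (emb \<epsilon> * (d ^ 2 * g) ^ 2) * frob s (emb \<epsilon>' * (d' ^ 2 * g') ^ 2)"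
    by (simp add: power2_eq_square algebra_simps)
  also have "\<dots> = \<mu> (s \<noteq> s')" using x y by (simp only: xe ye K2_mem \<mu>_xor)
  finally show "x \<otimes>\<^bsub>K2\<^esub> y \<in> carrier K2" by (simp only: xe ye K2_mult K2_mem)
  fix w assume w: "w \<in> carrier K2"
  obtain e'' z'' v'' u'' c'' \<epsilon>'' d'' g'' s'' where we: "w = (e'', z'', v'', u'', c'', \<epsilon>'', d'', g'', s'')" by (cases w rule: k2_cases)
  have key: "lam (emb \<epsilon> * d * g * frob s c') * d = g * frob s (lam c')"
    using x by (intro lam_twist) (simp add: xe)
  define L where "L = lam (emb \<epsilon> * d * g * frob s c')"
  define L' where "L' = frob s (lam c')"
  have \<epsilon>1: "emb \<epsilon> * emb \<epsilon> = 1" using x K2_nz(4) by (metis K2_mem emb_simps(2,4) xe)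
  have key: "L * d = g * L'" using key by (simp add: L_def L'_def)
  define X where "X = frob s d' * frob (s \<noteq> s') v''"
  have ass_u: "L * (d * X) = g * (L' * X)"
    using key by (simp add: mult.assoc[symmetric])
  show "x \<otimes>\<^bsub>K2\<^esub> y \<otimes>\<^bsub>K2\<^esub> w = x \<otimes>\<^bsub>K2\<^esub> (y \<otimes>\<^bsub>K2\<^esub> w)"
  proof -
    have u: "u + (g * frob s u' + lam c * (d * frob s v')) +
          (g * frob s g' * frob (s \<noteq> s') u'' + (lam c + L) * (d * frob s d' * frob (s \<noteq> s') v'')) =
        u + (g * (frob s u' + (frob s g' * frob (s \<noteq> s') u'' + L' * (frob s d' * frob (s \<noteq> s') v''))) +
          lam c * (d * (frob s v' + frob s d' * frob (s \<noteq> s') v'')))"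
      using key by (rule K2_assoc_u)
    have z: "z + (d * g * frob s z' + c * emb (\<epsilon> * e')) + (g * frob s u' + lam c * (d * frob s v')) * v
          - u * (d * frob s v') + (d * frob s d' * (g * frob s g') * frob (s \<noteq> s') z'' +
          (c + emb \<epsilon> * d * g * frob s c') * emb (\<epsilon> * \<epsilon>' * e'')) +
          (g * frob s g' * frob (s \<noteq> s') u'' + (lam c + L) * (d * frob s d' * frob (s \<noteq> s') v'')) * (v + d * frob s v') -
          (u + (g * frob s u' + lam c * (d * frob s v'))) * (d * frob s d' * frob (s \<noteq> s') v'') =
        z + (d * g * (frob s z' + (frob s d' * frob s g' * frob (s \<noteq> s') z'' + frob s c' * emb (\<epsilon>' * e'')) +
            (frob s g' * frob (s \<noteq> s') u'' + L' * (frob s d' * frob (s \<noteq> s') v'')) * frob s v' -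
            frob s u' * (frob s d' * frob (s \<noteq> s') v'')) + c * emb (\<epsilon> * (e' + \<epsilon>' * e''))) +
          (g * (frob s u' + (frob s g' * frob (s \<noteq> s') u'' + L' * (frob s d' * frob (s \<noteq> s') v''))) +
            lam c * (d * (frob s v' + frob s d' * frob (s \<noteq> s') v''))) * v -
          u * (d * (frob s v' + frob s d' * frob (s \<noteq> s') v''))"
      unfolding emb_simps using key \<epsilon>1 by (rule K2_assoc_z)
    show ?thesis
      using u z by (auto simp: xe ye we L_def L'_def algebra_simps)
  qed
  assume eq: "x \<otimes>\<^bsub>K2\<^esub> y = x \<otimes>\<^bsub>K2\<^esub> w"
  have nz: "\<epsilon> \<noteq> 0" "d \<noteq> 0" "g \<noteq> 0" "\<epsilon> * \<epsilon> = 1" using x K2_nz by (auto simp: xe)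
  have "e' = \<epsilon> * (\<epsilon> * e')" "\<epsilon>' = \<epsilon> * (\<epsilon> * \<epsilon>')" "e'' = \<epsilon> * (\<epsilon> * e'')" "\<epsilon>'' = \<epsilon> * (\<epsilon> * \<epsilon>'')"
    using nz by (simp_all add: mult.assoc[symmetric])
  then have 1: "e' = e''" "\<epsilon>' = \<epsilon>''" using eq by (simp_all add: xe ye we)
  have 2: "v' = v''" "d' = d''" "g' = g''" "c' = c''" "s' = s''" using eq nz by (auto simp: xe ye we)
  have 3: "u' = u''" using eq nz 2 by (simp add: xe ye we)
  have "z' = z''" using eq nz 1 2 3 by (simp add: xe ye we)
  then show "y = w" using 1 2 3 by (simp add: ye we)
qed

text \<open>The commutator term and the correction \<open>- u v\<close> each contribute
  \<open>- u d v'\<close>. In characteristic 3 their sum is \<open>u d v'\<close>, the term produced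
  by the action of the matrix on the vector.\<close>

lemma to_K1_aux:
  fixes z :: gf9
  assumes "u * d * v' + u * d * v' + u * d * v' = 0"
  shows "z + d * g * z' + g * u' * v - u * (d * v') - (u + g * u') * (v + d * v') =
    z - u * v + (d * g * (z' - u' * v') + u * d * v')"
proof -
  have "u * d * v' = - (u * d * v') - u * d * v'" using assms by (simp add: add_eq_0_iff)
  moreover have "z + d * g * z' + g * u' * v - u * (d * v') - (u + g * u') * (v + d * v') =
    z - u * v + (d * g * (z' - u' * v') + (- (u * d * v') - u * d * v'))"
    by (simp add: algebra_simps)
  ultimately show ?thesis by metis
qed

section \<open>The common subgroup in both coordinate systems\<close>

definition C1 :: "k1 set" where "C1 = {(e, v, \<epsilon>, A, s) \<in> carrier K1. A $ 2 $ 1 = 0}"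

definition C2 :: "k2 set" where "C2 = {(e, z, v, u, c, \<epsilon>, d, g, s) \<in> carrier K2. c = 0}"

text \<open>In \<open>K2\<close> the Heisenberg group is written with the alternating form
  \<open>u' v - u v'\<close>; subtracting \<open>u v\<close> returns to matrix coordinates. The
  torus element with parameters \<open>d\<close> and \<open>g\<close> becomes the diagonal matrix
  with entries \<open>d g\<close> and \<open>d\<close>.\<close>

definition to_K1 :: "k2 \<Rightarrow> k1" where
  "to_K1 = (\<lambda>(e, z, v, u, c, \<epsilon>, d, g, s). (e, vec2 (z - u * v) v, \<epsilon>, mat2 (d * g) (u * d) 0 d, s))"

lemma C1_mem [simp]: "(e, v, \<epsilon>, A, s) \<in> C1 \<longleftrightarrow> emb \<epsilon> * det A ^ 2 = \<mu> s \<and> A $ 2 $ 1 = 0"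
  by (simp add: C1_def)

lemma C2_mem [simp]: "(e, z, v, u, c, \<epsilon>, d, g, s) \<in> C2 \<longleftrightarrow> emb \<epsilon> * (d ^ 2 * g) ^ 2 = \<mu> s \<and> c = 0"
  by (simp add: C2_def)

lemma to_K1_eq [simp]: "to_K1 (e, z, v, u, c, \<epsilon>, d, g, s) = (e, vec2 (z - u * v) v, \<epsilon>, mat2 (d * g) (u * d) 0 d, s)"
  by (simp add: to_K1_def)

lemma subgroup_C1: "subgroup C1 K1"
proof -
  interpret group K1 by (rule group_K1)
  show ?thesis
  proof (rule finite_subgroupI[OF finite_K1])
    have "(0, 0, 1, mat 1, False) \<in> C1" by simp
    then show "C1 \<noteq> {}" by blast
    fix x y assume x: "x \<in> C1" and y: "y \<in> C1"
    then have "x \<otimes>\<^bsub>K1\<^esub> y \<in> carrier K1" by (intro m_closed) (auto simp: C1_def)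
    then show "x \<otimes>\<^bsub>K1\<^esub> y \<in> C1" using x y by (cases x; cases y) (auto simp: C1_def)
  qed (auto simp: C1_def)
qed

lemma subgroup_C2: "subgroup C2 K2"
proof -
  interpret group K2 by (rule group_K2)
  show ?thesis
  proof (rule finite_subgroupI[OF finite_K2])
    have "(0, 0, 0, 0, 0, 1, 1, 1, False) \<in> C2" by simp
    then show "C2 \<noteq> {}" by blast
    fix x y assume x: "x \<in> C2" and y: "y \<in> C2"
    then have "x \<otimes>\<^bsub>K2\<^esub> y \<in> carrier K2" by (intro m_closed) (auto simp: C2_def)
    then show "x \<otimes>\<^bsub>K2\<^esub> y \<in> C2" using x y by (cases x rule: k2_cases; cases y rule: k2_cases) (auto simp: C2_def)
  qed (auto simp: C2_def)
qed

lemma to_K1_iso: "to_K1 \<in> iso (sub K2 C2) (sub K1 C1)"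
proof (rule isoI)
  have mem: "to_K1 x \<in> C1" if "x \<in> C2" for x
    using that by (cases x rule: k2_cases) (simp add: power2_eq_square algebra_simps)
  show "to_K1 \<in> hom (sub K2 C2) (sub K1 C1)"
  proof (rule homI)
    fix x assume x: "x \<in> carrier (sub K2 C2)"
    then show "to_K1 x \<in> carrier (sub K1 C1)" using mem by simp
    fix y assume y: "y \<in> carrier (sub K2 C2)"
    have [simp]: "- X - X = X" for X :: gf9 using gf9_char[of X] by (simp add: algebra_simps add_eq_0_iff)
    obtain e z v u c \<epsilon> d g s where xe: "x = (e, z, v, u, c, \<epsilon>, d, g, s)" by (cases x rule: k2_cases)
    obtain e' z' v' u' c' \<epsilon>' d' g' s' where ye: "y = (e', z', v', u', c', \<epsilon>', d', g', s')" by (cases y rule: k2_cases)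
    have "u * d * frob s v' + u * d * frob s v' + u * d * frob s v' = 0" by (rule gf9_char)
    then have "z + d * g * frob s z' + g * frob s u' * v - u * (d * frob s v') - (u + g * frob s u') * (v + d * frob s v') =
      z - u * v + (d * g * (frob s z' - frob s u' * frob s v') + u * d * frob s v')"
      by (rule to_K1_aux)
    then show "to_K1 (x \<otimes>\<^bsub>sub K2 C2\<^esub> y) = to_K1 x \<otimes>\<^bsub>sub K1 C1\<^esub> to_K1 y"
      using x y by (simp add: xe ye vec_eq2) (simp add: algebra_simps)
  qed
  show "bij_betw to_K1 (carrier (sub K2 C2)) (carrier (sub K1 C1))"
  proof -
    have "inj_on to_K1 C2"
    proof (rule inj_onI)
      fix x y assume "x \<in> C2" "y \<in> C2" "to_K1 x = to_K1 y"
      then show "x = y" using K2_nz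
        by (cases x rule: k2_cases; cases y rule: k2_cases) (fastforce simp: vec_eq2)
    qed
    moreover have "y \<in> to_K1 ` C2" if "y \<in> C1" for y
    proof -
      obtain e v \<epsilon> A s where ye: "y = (e, v, \<epsilon>, A, s)" by (cases y)
      define d where "d = A $ 2 $ 2"
      have A: "A $ 2 $ 1 = 0" "emb \<epsilon> * det A ^ 2 = \<mu> s" using that by (simp_all add: ye)
      have det: "det A = A $ 1 $ 1 * d" using A by (simp add: det_2 d_def)
      have d: "d \<noteq> 0" using K1_nz(2)[OF A(2)] det by auto
      let ?x = "(e, v $ 1 + A $ 1 $ 2 / d * v $ 2, v $ 2, A $ 1 $ 2 / d, 0, \<epsilon>, d, A $ 1 $ 1 / d, s)"
      have "d ^ 2 * (A $ 1 $ 1 / d) = det A" using d det by (simp add: power2_eq_square)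
      then have "?x \<in> C2" using A(2) by simp
      moreover have "to_K1 ?x = y" using A(1) d by (simp add: ye vec_eq2 d_def)
      ultimately show ?thesis by (metis image_eqI)
    qed
    ultimately show ?thesis using mem by (auto simp: bij_betw_def)
  qed
qed

text \<open>The values of \<open>f\<close> need not form a group: it is enough that \<open>f\<close>
  respects some binary operation \<open>m\<close>. Torus coordinates with their Frobenius twist can
  thus be used directly, without constructing a quotient.\<close>

lemma (in group) normal_kernel_fun:
  assumes X: "subgroup X G" and f: "\<And>x y. x \<in> X \<Longrightarrow> y \<in> X \<Longrightarrow> f (x \<otimes> y) = m (f x) (f y)"
    and N: "N = {x \<in> X. f x = f \<one>}"
  shows "N \<lhd> sub G X" "subgroup N G"
proof -
  interpret X: group "sub G X" using X by (rule subgroup_imp_group)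
  have Xc: "x \<in> carrier G" if "x \<in> X" for x using that X by (rule subgroup.mem_carrier[rotated])
  have one: "\<one> \<in> X" using X by (rule subgroup.one_closed)
  have inv: "inv x \<in> X" if "x \<in> X" for x using X that by (rule subgroup.m_inv_closed)
  have mult: "x \<otimes> y \<in> X" if "x \<in> X" "y \<in> X" for x y using X that by (rule subgroup.m_closed)
  have m1: "m (f \<one>) (f x) = f x" if "x \<in> X" for x using f[OF one that] Xc[OF that] by simp
  have conj: "x \<otimes> n \<otimes> inv x \<in> N" if "x \<in> X" "n \<in> N" for x n
  proof -
    have n: "n \<in> X" "f n = f \<one>" using that N by auto
    have "f (x \<otimes> n \<otimes> inv x) = m (m (f x) (f \<one>)) (f (inv x))"
      using that n by (simp add: f mult inv)
    also have "\<dots> = f (x \<otimes> \<one> \<otimes> inv x)" using that one by (simp only: f mult inv)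
    also have "\<dots> = f \<one>" using that Xc by simp
    finally show ?thesis using that n N mult inv by simp
  qed
  show sN: "subgroup N G"
  proof (rule subgroupI)
    show "N \<subseteq> carrier G" using N Xc by auto
    show "N \<noteq> {}" using N one by auto
  next
    fix x assume x: "x \<in> N"
    then have xX: "x \<in> X" and fx: "f x = f \<one>" using N by auto
    have "f (inv x) = m (f x) (f (inv x))" using m1[OF inv[OF xX]] fx by simp
    also have "\<dots> = f (x \<otimes> inv x)" using f[OF xX inv[OF xX]] by simp
    finally show "inv x \<in> N" using xX N inv Xc by simp
  next
    fix x y assume "x \<in> N" "y \<in> N"
    then show "x \<otimes> y \<in> N" using N mult f m1[OF one] by auto
  qed
  show "N \<lhd> sub G X"
    unfolding X.normal_inv_iff using conj sN X N by (auto simp: subgroup_incl simp flip: m_inv_consistent)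
qed

text \<open>Conjugacy is phrased as \<open>k x = y k\<close>, so that in coordinates only products
  have to be evaluated.\<close>

lemma (in group) normal_comm_mem:
  assumes "N \<lhd> G" "x \<in> N" "k \<in> carrier G" "y \<in> carrier G" "k \<otimes> x = y \<otimes> k"
  shows "y \<in> N"
proof -
  have "y = y \<otimes> k \<otimes> inv k" using assms(3,4) by (simp add: m_assoc)
  also have "\<dots> = k \<otimes> x \<otimes> inv k" using assms(5) by simp
  also have "\<dots> \<in> N" using assms(1-3) by (simp add: normal.inv_op_closed2)
  finally show ?thesis .
qed

lemma (in group) conj_closure_subgroup:
  assumes "S \<subseteq> carrier G" "K \<subseteq> carrier G"
  shows "subgroup (conj_closure G S K) G"
  unfolding conj_closure_def using assms
  by (intro generate_is_subgroup) (auto simp: l_coset_def r_coset_def)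

lemma (in group) conj_closure_mem:
  assumes "S \<subseteq> carrier G" "k \<in> K" "K \<subseteq> carrier G" "b \<in> S" "y \<in> carrier G" "k \<otimes> b = y \<otimes> k"
  shows "y \<in> conj_closure G S K"
proof -
  have kb: "k \<in> carrier G" "b \<in> carrier G" using assms by auto
  have "y = y \<otimes> k \<otimes> inv k" using kb assms(5) by (simp add: m_assoc)
  then have "y = k \<otimes> b \<otimes> inv k" using assms(6) by simp
  then have "y \<in> k <# S #> inv k" using assms(4) unfolding l_coset_def r_coset_def by blast
  then show ?thesis unfolding conj_closure_def using assms by (auto intro: generate.incl)
qed

lemma (in group) conj_closure_minimal:
  assumes "X \<lhd> G" "S \<subseteq> X" "K \<subseteq> carrier G"
  shows "conj_closure G S K \<subseteq> X"
  unfolding conj_closure_def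
proof (rule generate_subgroup_incl)
  show "(\<Union>k\<in>K. k <# S #> inv k) \<subseteq> X"
    using assms by (auto simp: l_coset_def r_coset_def intro: normal.inv_op_closed2)
  show "subgroup X G" using assms by (simp add: normal_imp_subgroup)
qed

lemma (in group) subgroup_nat_pow_closed: "subgroup X G \<Longrightarrow> x \<in> X \<Longrightarrow> x [^] (n::nat) \<in> X"
  by (induction n) (auto simp: subgroup.one_closed subgroup.m_closed)

lemma bool_image: "f a = False \<Longrightarrow> f b = True \<Longrightarrow> a \<in> X \<Longrightarrow> b \<in> X \<Longrightarrow> f ` X = {False, True}"
  by (metis (full_types) UNIV_bool UNIV_eq_I image_eqI)

lemma three_gf9 [simp]: "(3::gf9) = 0"
  using gf9_char[of 1] by simp

lemma cj_GF9 [simp]: "cj (GF9 a b) = GF9 a (- b)"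
  by (simp add: cj_def)

interpretation K1: group K1 by (rule group_K1)
interpretation K2: group K2 by (rule group_K2)

lemma fin1 [simp]: "finite (X :: k1 set)" by (rule finite_subset[OF subset_UNIV]) simp
lemma fin2 [simp]: "finite (X :: k2 set)" by (rule finite_subset[OF subset_UNIV]) simp

section \<open>Subgroups of the first parabolic\<close>

text \<open>In the graph, \<open>T1\<close> and \<open>T21\<close> become the kernels of the local
  actions at \<open>x1\<close> and \<open>x2\<close>, with \<open>W1\<close> and \<open>S1\<close>
  as their largest normal 3-subgroups. \<open>Z1\<close> is the center of \<open>L1\<close>,
  \<open>B1\<close> is the core, and \<open>H1\<close> is its conjugate closure in
  \<open>K1\<close>.\<close>

definition "W1 = {(e, v, \<epsilon>, A, s) \<in> carrier K1. A = mat 1 \<and> \<not> s}"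
definition "Z1 = {(e, v, \<epsilon>, A, s) \<in> carrier K1. v = 0 \<and> A = mat 1 \<and> \<not> s}"
definition "S1 = {(e, v, \<epsilon>, A, s) \<in> C1. A $ 1 $ 1 = 1 \<and> A $ 2 $ 2 = 1 \<and> \<not> s}"
definition "L1 = {(e, v, \<epsilon>, A, s) \<in> carrier K1. det A = 1 \<and> \<not> s}"
definition "T1 = {(e, v, \<epsilon>, A, s) \<in> C1. A $ 1 $ 2 = 0 \<and> A $ 1 $ 1 = A $ 2 $ 2 \<and> \<not> s}"
definition "H1 = {(e, v, \<epsilon>, A, s) \<in> carrier K1. \<not> s}"
definition "B1 = H1 \<inter> C1"
text \<open>The matrix form of \<open>T2\<close>: there \<open>g = d\<close> and
  \<open>emb \<epsilon> = d ^ 2\<close>, so the diagonal entries \<open>d g\<close> and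
  \<open>d\<close> are \<open>d ^ 2\<close> and \<open>d\<close>.\<close>

definition "T21 = {(e, v, \<epsilon>, A, s) \<in> C1. A $ 1 $ 1 = A $ 2 $ 2 ^ 2 \<and> emb \<epsilon> = A $ 2 $ 2 ^ 2 \<and> \<not> s}"

lemma emb_eq_1 [simp]: "emb x = 1 \<longleftrightarrow> x = 1" "1 = emb x \<longleftrightarrow> x = 1"
  by (metis emb_inj emb_simps(4))+

lemma mem_simps [simp]:
  "(e, v, \<epsilon>, A, s) \<in> W1 \<longleftrightarrow> \<epsilon> = 1 \<and> A = mat 1 \<and> \<not> s"
  "(e, v, \<epsilon>, A, s) \<in> Z1 \<longleftrightarrow> v = 0 \<and> \<epsilon> = 1 \<and> A = mat 1 \<and> \<not> s"
  "(e, v, \<epsilon>, A, s) \<in> S1 \<longleftrightarrow> \<epsilon> = 1 \<and> A $ 2 $ 1 = 0 \<and> A $ 1 $ 1 = 1 \<and> A $ 2 $ 2 = 1 \<and> \<not> s"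
  "(e, v, \<epsilon>, A, s) \<in> L1 \<longleftrightarrow> \<epsilon> = 1 \<and> det A = 1 \<and> \<not> s"
  "(e, v, \<epsilon>, A, s) \<in> T1 \<longleftrightarrow> emb \<epsilon> * det A ^ 2 = 1 \<and> A $ 2 $ 1 = 0 \<and> A $ 1 $ 2 = 0 \<and> A $ 1 $ 1 = A $ 2 $ 2 \<and> \<not> s"
  "(e, v, \<epsilon>, A, s) \<in> H1 \<longleftrightarrow> emb \<epsilon> * det A ^ 2 = 1 \<and> \<not> s"
  "(e, v, \<epsilon>, A, s) \<in> B1 \<longleftrightarrow> emb \<epsilon> * det A ^ 2 = 1 \<and> A $ 2 $ 1 = 0 \<and> \<not> s"
  by (auto simp: W1_def Z1_def S1_def L1_def T1_def H1_def B1_def det_2)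

lemma mem_T21 [simp]: "(e, v, \<epsilon>, A, s) \<in> T21 \<longleftrightarrow>
    A $ 2 $ 1 = 0 \<and> A $ 2 $ 2 ^ 4 = emb (\<epsilon> ^ 2) \<and> A $ 1 $ 1 = A $ 2 $ 2 ^ 2 \<and> emb \<epsilon> = A $ 2 $ 2 ^ 2 \<and> \<epsilon> \<noteq> 0 \<and> \<not> s"
proof -
  have "emb \<epsilon> * det A ^ 2 = 1 \<longleftrightarrow> \<epsilon> \<noteq> 0" if "A $ 2 $ 1 = 0" "A $ 1 $ 1 = A $ 2 $ 2 ^ 2" "emb \<epsilon> = A $ 2 $ 2 ^ 2"
  proof -
    have "emb \<epsilon> * det A ^ 2 = (A $ 2 $ 2) ^ 8" using that by (simp add: det_2 eval_nat_numeral)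
    moreover have "\<epsilon> \<noteq> 0 \<longleftrightarrow> A $ 2 $ 2 \<noteq> 0" using that(3) emb_eq_0_iff[of \<epsilon>] by auto
    ultimately show ?thesis using gf9_pow8[of "A $ 2 $ 2"] by auto
  qed
  moreover have "A $ 2 $ 2 ^ 4 = emb (\<epsilon> ^ 2)" if "emb \<epsilon> = A $ 2 $ 2 ^ 2"
    using that by (simp add: power2_eq_square eval_nat_numeral)
  ultimately show ?thesis by (auto simp: T21_def)
qed

definition diag_part :: "k1 \<Rightarrow> 3 \<times> gf9 \<times> gf9 \<times> bool" where
  "diag_part = (\<lambda>(e, v, \<epsilon>, A, s). (\<epsilon>, A $ 1 $ 1, A $ 2 $ 2, s))"

definition det_part :: "k1 \<Rightarrow> 3 \<times> gf9 \<times> bool" where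
  "det_part = (\<lambda>(e, v, \<epsilon>, A, s). (\<epsilon>, det A, s))"

lemma part_simps [simp]: "diag_part (e, v, \<epsilon>, A, s) = (\<epsilon>, A $ 1 $ 1, A $ 2 $ 2, s)"
  "det_part (e, v, \<epsilon>, A, s) = (\<epsilon>, det A, s)"
  by (simp_all add: diag_part_def det_part_def)

lemma diag_part_mult:
  assumes "x \<in> C1" "y \<in> C1"
  shows "diag_part (x \<otimes>\<^bsub>K1\<^esub> y) =
    (\<lambda>(\<epsilon>, a, d, s) (\<epsilon>', a', d', s'). (\<epsilon> * \<epsilon>', a * frob s a', d * frob s d', s \<noteq> s')) (diag_part x) (diag_part y)"
  using assms by (cases x; cases y) simp

lemma det_part_mult:
  "det_part (x \<otimes>\<^bsub>K1\<^esub> y) =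
    (\<lambda>(\<epsilon>, a, s) (\<epsilon>', a', s'). (\<epsilon> * \<epsilon>', a * frob s a', s \<noteq> s')) (det_part x) (det_part y)"
  by (cases x; cases y) (simp add: det_mul)

lemma H1_normal: "H1 \<lhd> K1" and H1_sub: "subgroup H1 K1"
proof -
  let ?f = "\<lambda>x. snd (snd (det_part x))"
  have H: "H1 = {x \<in> carrier K1. ?f x = ?f \<one>\<^bsub>K1\<^esub>}" by (auto simp: H1_def)
  have "?f (x \<otimes>\<^bsub>K1\<^esub> y) = (?f x \<noteq> ?f y)" for x y
    by (simp add: det_part_mult split: prod.splits)
  from K1.normal_kernel_fun[OF K1.subgroup_self this H] show "H1 \<lhd> K1" "subgroup H1 K1" by auto
qed

lemma L1_normal: "L1 \<lhd> K1" and L1_sub: "subgroup L1 K1"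
proof -
  have L: "L1 = {x \<in> carrier K1. det_part x = det_part \<one>\<^bsub>K1\<^esub>}" by (auto simp: L1_def)
  show "L1 \<lhd> K1" "subgroup L1 K1"
    using K1.normal_kernel_fun[OF K1.subgroup_self det_part_mult L] by auto
qed

lemma W1_normal_sub:
  assumes X: "subgroup X K1" "W1 \<subseteq> X"
  shows "W1 \<lhd> sub K1 X" "subgroup W1 K1"
proof -
  let ?f = "\<lambda>(e::3, v::gf9^2, \<epsilon>::3, A::gf9^2^2, s). (\<epsilon>, A, s)"
  have W: "W1 = {x \<in> X. ?f x = ?f \<one>\<^bsub>K1\<^esub>}" using X(2) subgroup.subset[OF X(1)] by (auto simp: subset_iff) 
  have "?f (x \<otimes>\<^bsub>K1\<^esub> y) = (\<lambda>(\<epsilon>, A, s) (\<epsilon>', A', s'). (\<epsilon> * \<epsilon>', A ** frobm s A', s \<noteq> s')) (?f x) (?f y)" for x y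
    by (cases x; cases y) simp
  from K1.normal_kernel_fun[OF X(1) this W] show "W1 \<lhd> sub K1 X" "subgroup W1 K1" by auto
qed

lemma B1_sub: "subgroup B1 K1"
  unfolding B1_def using H1_sub subgroup_C1 by (rule K1.subgroups_Inter_pair)

lemma T1_sub: "subgroup T1 K1"
proof (rule K1.finite_subgroupI[OF fin1])
  have "\<one>\<^bsub>K1\<^esub> \<in> T1" by simp
  then show "T1 \<noteq> {}" by blast
  fix x y assume x: "x \<in> T1" and y: "y \<in> T1"
  then have "x \<otimes>\<^bsub>K1\<^esub> y \<in> B1" by (intro subgroup.m_closed[OF B1_sub]) (auto simp: T1_def B1_def H1_def C1_def)
  then show "x \<otimes>\<^bsub>K1\<^esub> y \<in> T1" using x y by (cases x; cases y) auto
qed (auto simp: T1_def C1_def)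

lemma T21_sub: "subgroup T21 K1"
proof (rule K1.finite_subgroupI[OF fin1])
  have "\<one>\<^bsub>K1\<^esub> \<in> T21" by simp
  then show "T21 \<noteq> {}" by blast
  fix x y assume x: "x \<in> T21" and y: "y \<in> T21"
  then have "x \<otimes>\<^bsub>K1\<^esub> y \<in> C1" by (intro subgroup.m_closed[OF subgroup_C1]) (auto simp: T21_def C1_def)
  then show "x \<otimes>\<^bsub>K1\<^esub> y \<in> T21"
    using x y by (cases x; cases y) (auto simp: T21_def power_mult_distrib)
qed (auto simp: T21_def C1_def)

lemma LB_sub: "subgroup (L1 \<inter> B1) K1"
  using L1_sub B1_sub by (rule K1.subgroups_Inter_pair)

lemma S1_normal:
  assumes "subgroup X K1" "S1 \<subseteq> X" "X \<subseteq> C1"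
  shows "S1 \<lhd> sub K1 X" "subgroup S1 K1"
proof -
  have S: "S1 = {x \<in> X. diag_part x = diag_part \<one>\<^bsub>K1\<^esub>}"
    using assms(2,3) by (auto simp: subset_iff) (auto simp: S1_def)
  show "S1 \<lhd> sub K1 X" "subgroup S1 K1"
    using K1.normal_kernel_fun[OF assms(1) diag_part_mult S] assms(3) by auto
qed

lemma subsets1:
  "S1 \<subseteq> T21" "T21 \<subseteq> B1" "S1 \<subseteq> L1 \<inter> B1" "S1 \<subseteq> B1" "W1 \<subseteq> S1" "W1 \<subseteq> T1" "T1 \<subseteq> B1" "B1 \<subseteq> C1" "B1 \<subseteq> H1"
  "L1 \<subseteq> H1" "Z1 \<subseteq> W1" "C1 \<subseteq> carrier K1" "L1 \<subseteq> carrier K1" "H1 \<subseteq> carrier K1" "W1 \<subseteq> carrier K1" "S1 \<subseteq> carrier K1"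
  "B1 \<subseteq> carrier K1" "T21 \<subseteq> carrier K1" "T1 \<subseteq> carrier K1" "Z1 \<subseteq> carrier K1"
  by (auto simp: T21_def C1_def det_2 power2_eq_square)

lemmas S1_sub = S1_normal(2)[OF B1_sub subsets1(4,8)]

lemma Z1_sub: "subgroup Z1 K1"
proof (rule K1.finite_subgroupI[OF fin1])
  have "\<one>\<^bsub>K1\<^esub> \<in> Z1" by simp
  then show "Z1 \<noteq> {}" by blast
  fix x y assume x: "x \<in> Z1" and y: "y \<in> Z1"
  then show "x \<otimes>\<^bsub>K1\<^esub> y \<in> Z1" by (cases x; cases y) (auto)
qed (rule subsets1)

lemma card_S1: "card S1 = 3 ^ 7"
proof -
  let ?f = "\<lambda>(e, v, u). (e, v, 1, mat2 1 u 0 1, False) :: k1"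
  have "S1 = ?f ` (UNIV :: (3 \<times> (gf9 ^ 2) \<times> gf9) set)"
  proof (intro equalityI subsetI)
    fix x assume x: "x \<in> S1"
    obtain e v \<epsilon> A s where xe: "x = (e, v, \<epsilon>, A, s)" by (cases x)
    have "x = ?f (e, v, A $ 1 $ 2)" using x by (auto simp: xe vec_eq2)
    then show "x \<in> ?f ` (UNIV :: (3 \<times> (gf9 ^ 2) \<times> gf9) set)" by blast
  qed auto
  then have "card S1 = card (?f ` (UNIV :: (3 \<times> (gf9 ^ 2) \<times> gf9) set))" by (rule arg_cong[where f = card])
  also have "\<dots> = CARD(3 \<times> (gf9 ^ 2) \<times> gf9)" by (rule card_image) (auto simp: inj_on_def vec_eq2)
  finally show ?thesis by (simp add: card_gf9)
qed

lemma card_W1: "card W1 = 3 ^ 5"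
proof -
  let ?f = "\<lambda>(e, v). (e, v, 1, mat 1, False) :: k1"
  have "W1 = ?f ` (UNIV :: (3 \<times> (gf9 ^ 2)) set)" by (auto simp: image_iff)
  then have "card W1 = card (?f ` (UNIV :: (3 \<times> (gf9 ^ 2)) set))" by (rule arg_cong[where f = card])
  also have "\<dots> = CARD(3 \<times> (gf9 ^ 2))" by (rule card_image) (auto simp: inj_on_def)
  finally show ?thesis by (simp add: card_gf9)
qed

lemma diag_part_pow:
  assumes "x \<in> B1" "diag_part x = (\<epsilon>, a, d, s)"
  shows "diag_part (x [^]\<^bsub>K1\<^esub> n) = (\<epsilon> ^ n, a ^ n, d ^ n, False)"
proof (induction n)
  case (Suc n)
  have x: "x \<in> C1" and s: "\<not> s" using assms subsets1(8) by (cases x; auto)+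
  have "x [^]\<^bsub>K1\<^esub> n \<in> C1"
    using x K1.subgroup_nat_pow_closed[OF subgroup_C1] by simp
  then show ?case using x s Suc by (simp add: diag_part_mult assms mult.commute)
qed simp

lemma pow8_mem:
  assumes x: "x \<in> B1"
  shows "diag_part (x [^]\<^bsub>K1\<^esub> (8::nat)) = (1, 1, 1, False)"
proof -
  obtain e v \<epsilon> A s where xe: "x = (e, v, \<epsilon>, A, s)" by (cases x)
  have h: "emb \<epsilon> * det A ^ 2 = \<mu> False" "A $ 2 $ 1 = 0" using x by (auto simp: xe)
  note nz = K1_nz[OF h(1)]
  have "A $ 1 $ 1 \<noteq> 0" "A $ 2 $ 2 \<noteq> 0" using nz h(2) by (auto simp: det_2)
  moreover have "\<epsilon> ^ 8 = (\<epsilon> * \<epsilon>) ^ 4" by (simp add: eval_nat_numeral)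
  ultimately show ?thesis
    using diag_part_pow[OF x, of \<epsilon> "A $ 1 $ 1" "A $ 2 $ 2" s 8] nz by (simp add: xe gf9_pow8)
qed

lemma nat_pow_sub: "x [^]\<^bsub>sub G X\<^esub> (n::nat) = x [^]\<^bsub>G\<^esub> n"
  by (simp add: nat_pow_def)

lemma coprime_8_3: "coprime (8::nat) 3"
  by (subst coprime_commute) (rule prime_imp_coprime; simp)

text \<open>Modulo \<open>S1\<close> only the diagonal entries and the sign remain, and they have
  exponent 8. Leaving \<open>X\<close> open covers \<open>B1\<close>, \<open>L1 \<inter> B1\<close>
  and \<open>T21\<close> at once; this is why the three groups have the same
  \<open>O_3\<close>.\<close>

lemma S1_is_Op:
  assumes X: "subgroup X K1" "S1 \<subseteq> X" "X \<subseteq> B1"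
  shows "is_Op 3 (sub K1 X) S1"
proof (rule is_OpI)
  show "group (sub K1 X)" using X(1) by (rule K1.subgroup_imp_group)
  show "S1 \<lhd> sub K1 X" using S1_normal(1)[OF X(1,2)] X(3) subsets1 by blast
  show "card S1 = 3 ^ 7" by (rule card_S1)
  fix x assume x: "x \<in> carrier (sub K1 X)"
  then have "x [^]\<^bsub>K1\<^esub> (8::nat) \<in> X"
    using K1.subgroup_nat_pow_closed[OF X(1)] by simp
  moreover have "diag_part (x [^]\<^bsub>K1\<^esub> (8::nat)) = (1, 1, 1, False)" using x X(3) by (intro pow8_mem) auto
  ultimately show "x [^]\<^bsub>sub K1 X\<^esub> (8::nat) \<in> S1"
    unfolding nat_pow_sub using X(3) subsets1(8) by (cases "x [^]\<^bsub>K1\<^esub> (8::nat)") (auto simp: S1_def)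
qed (simp_all add: coprime_8_3)

lemma W1_is_Op: "is_Op 3 (sub K1 T1) W1"
proof (rule is_OpI)
  show g: "group (sub K1 T1)" using T1_sub by (rule K1.subgroup_imp_group)
  show "W1 \<lhd> sub K1 T1"
    using T1_sub subsets1(6) by (rule W1_normal_sub)
  show "card W1 = 3 ^ 5" by (rule card_W1)
  fix x assume x: "x \<in> carrier (sub K1 T1)"
  then have "x [^]\<^bsub>K1\<^esub> (8::nat) \<in> T1"
    using K1.subgroup_nat_pow_closed[OF T1_sub] by simp
  moreover have "diag_part (x [^]\<^bsub>K1\<^esub> (8::nat)) = (1, 1, 1, False)" using x subsets1(7) by (intro pow8_mem) auto
  ultimately show "x [^]\<^bsub>sub K1 T1\<^esub> (8::nat) \<in> W1"
    unfolding nat_pow_sub by (cases "x [^]\<^bsub>K1\<^esub> (8::nat)") (auto simp: vec_eq2)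
qed (simp_all add: coprime_8_3)

text \<open>\<open>C1\<close> is the stabilizer of the line spanned by the first basis vector. A
  coset is the line spanned by the first column, and two columns are proportional when their
  determinant vanishes.\<close>

lemma C1_coset_iff:
  assumes "(e, v, \<epsilon>, A, s) \<in> carrier K1" "(e', v', \<epsilon>', A', s') \<in> carrier K1"
  shows "inv\<^bsub>K1\<^esub> (e, v, \<epsilon>, A, s) \<otimes>\<^bsub>K1\<^esub> (e', v', \<epsilon>', A', s') \<in> C1 \<longleftrightarrow> A $ 1 $ 1 * A' $ 2 $ 1 = A $ 2 $ 1 * A' $ 1 $ 1"
proof -
  let ?x = "(e, v, \<epsilon>, A, s)" and ?y = "(e', v', \<epsilon>', A', s')"
  define z where "z = inv\<^bsub>K1\<^esub> ?x \<otimes>\<^bsub>K1\<^esub> ?y"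
  have z: "z \<in> carrier K1" unfolding z_def using assms by (intro K1.m_closed K1.inv_closed)
  have y: "?y = ?x \<otimes>\<^bsub>K1\<^esub> z" unfolding z_def by (simp only: K1.m_assoc[symmetric] assms K1.inv_closed K1.r_inv K1.l_one)
  obtain e'' v'' \<epsilon>'' A'' s'' where ze: "z = (e'', v'', \<epsilon>'', A'', s'')" by (cases z)
  have "A' = A ** frobm s A''" using y by (simp add: ze)
  then have "A $ 1 $ 1 * A' $ 2 $ 1 - A $ 2 $ 1 * A' $ 1 $ 1 = det A * frob s (A'' $ 2 $ 1)"
    by (simp add: det_2 algebra_simps)
  moreover have "det A \<noteq> 0" using assms K1_nz by auto
  ultimately show ?thesis using z by (auto simp: z_def[symmetric] ze)
qed

definition "weyl = (0, 0, 1, mat2 0 1 (-1) 0, False)"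

lemma weyl_mem: "weyl \<in> carrier K1" by (simp add: weyl_def)

text \<open>The core fixes all ten lines. The lines of the basis vectors make \<open>A\<close>
  diagonal, the line of slope 1 makes it scalar, and the line of slope \<open>i\<close> excludes the
  Frobenius map.\<close>

lemma core_C1: "{x \<in> carrier K1. \<forall>k\<in>carrier K1. inv\<^bsub>K1\<^esub> k \<otimes>\<^bsub>K1\<^esub> x \<otimes>\<^bsub>K1\<^esub> k \<in> C1} = T1"
proof (intro equalityI subsetI)
  fix x assume "x \<in> {x \<in> carrier K1. \<forall>k\<in>carrier K1. inv\<^bsub>K1\<^esub> k \<otimes>\<^bsub>K1\<^esub> x \<otimes>\<^bsub>K1\<^esub> k \<in> C1}"
  then have x: "x \<in> carrier K1" and k: "\<And>k. k \<in> carrier K1 \<Longrightarrow> inv\<^bsub>K1\<^esub> k \<otimes>\<^bsub>K1\<^esub> (x \<otimes>\<^bsub>K1\<^esub> k) \<in> C1"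
    by (auto simp: K1.m_assoc)
  obtain e v \<epsilon> A s where xe: "x = (e, v, \<epsilon>, A, s)" by (cases x)
  have col: "K $ 1 $ 1 * (A ** frobm s K) $ 2 $ 1 = K $ 2 $ 1 * (A ** frobm s K) $ 1 $ 1" if "det K = 1" for K
  proof -
    have kc: "(0, 0, 1, K, False) \<in> carrier K1" using that by simp
    have xk: "x \<otimes>\<^bsub>K1\<^esub> (0, 0, 1, K, False) \<in> carrier K1" using x kc by (intro K1.m_closed)
    show ?thesis using k[OF kc] xk unfolding xe K1_mult by (subst (asm) C1_coset_iff[OF kc]) auto
  qed
  have A21: "A $ 2 $ 1 = 0" using col[of "mat 1"] by simp
  have A12: "A $ 1 $ 2 = 0" using col[of "mat2 0 1 (-1) 0"] by simp
  have 1: "A $ 2 $ 2 = A $ 1 $ 1" using col[of "mat2 1 0 1 1"] A12 A21 by simp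
  have 2: "A $ 2 $ 2 * frob s (GF9 0 1) = GF9 0 1 * A $ 1 $ 1" using col[of "mat2 1 0 (GF9 0 1) 1"] A12 A21 by simp
  have "A $ 1 $ 1 \<noteq> 0" using K1_nz(2)[of \<epsilon> A s] x A12 A21 by (auto simp: xe det_2)
  then have "frob s (GF9 0 1) = GF9 0 1" using 1 2 by simp
  then have "\<not> s" by (auto simp: frob_def cj_def)
  then show "x \<in> T1" using x A12 A21 1 by (simp add: xe)
next
  fix x assume x: "x \<in> T1"
  have xc: "x \<in> carrier K1" using x subsets1 by blast
  obtain e v \<epsilon> A s where xe: "x = (e, v, \<epsilon>, A, s)" by (cases x)
  have "inv\<^bsub>K1\<^esub> k \<otimes>\<^bsub>K1\<^esub> (x \<otimes>\<^bsub>K1\<^esub> k) \<in> C1" if k: "k \<in> carrier K1" for k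
  proof -
    obtain e' v' \<epsilon>' A' s' where ke: "k = (e', v', \<epsilon>', A', s')" by (cases k)
    have "x \<otimes>\<^bsub>K1\<^esub> k \<in> carrier K1" using xc k by simp
    then show ?thesis using k x unfolding ke xe K1_mult
      by (subst C1_coset_iff) auto
  qed
  then show "x \<in> {x \<in> carrier K1. \<forall>k\<in>carrier K1. inv\<^bsub>K1\<^esub> k \<otimes>\<^bsub>K1\<^esub> x \<otimes>\<^bsub>K1\<^esub> k \<in> C1}"
    using xc by (auto simp: K1.m_assoc)
qed

subsection \<open>Generation by unipotent matrices\<close>

abbreviation "upper t \<equiv> mat2 1 t 0 1"
abbreviation "lower t \<equiv> mat2 1 0 t 1"

text \<open>If the lower left entry is nonzero, upper, lower and upper factors with explicit entries
  suffice. Otherwise a multiplication by \<open>lower 1\<close> first makes this entry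
  nonzero.\<close>

lemma SL2_unipotent:
  assumes "det A = 1"
  shows "\<exists>k a b c. A = lower k ** upper a ** lower b ** upper c"
proof -
  have *: "A = upper ((A $ 1 $ 1 - 1) / A $ 2 $ 1) ** lower (A $ 2 $ 1) ** upper ((A $ 2 $ 2 - 1) / A $ 2 $ 1)"
    if "A $ 2 $ 1 \<noteq> 0" "det A = 1" for A
  proof -
    have b: "A $ 1 $ 2 = (A $ 1 $ 1 * A $ 2 $ 2 - 1) / A $ 2 $ 1" using that by (simp add: det_2 field_simps)
    show ?thesis using that(1) by (simp add: vec_eq2 b field_simps)
  qed
  show ?thesis
  proof (cases "A $ 2 $ 1 = 0")
    case False
    then have "A = lower 0 ** upper ((A $ 1 $ 1 - 1) / A $ 2 $ 1) ** lower (A $ 2 $ 1) ** upper ((A $ 2 $ 2 - 1) / A $ 2 $ 1)"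
      using *[OF False assms] by (simp add: vec_eq2)
    then show ?thesis by blast
  next
    case True
    let ?B = "lower 1 ** A"
    have "det ?B = 1" by (simp add: det_mul assms)
    moreover have "?B $ 2 $ 1 \<noteq> 0" using assms True by (auto simp: det_2)
    ultimately obtain a b c where "?B = upper a ** lower b ** upper c" using * by blast
    moreover have "A = lower (-1) ** ?B" by (simp add: vec_eq2)
    ultimately have "A = lower (-1) ** (upper a ** lower b ** upper c)" by simp
    then show ?thesis by (metis matrix_mul_assoc)
  qed
qed

lemma L1_decomp:
  assumes "x \<in> L1"
  obtains w k a b c where "x = (fst x, fst (snd x), 1, lower k, False) \<otimes>\<^bsub>K1\<^esub> (0, 0, 1, upper a, False) \<otimes>\<^bsub>K1\<^esub>
    (0, 0, 1, lower b, False) \<otimes>\<^bsub>K1\<^esub> (0, 0, 1, upper c, False)"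
proof -
  obtain e v \<epsilon> A s where xe: "x = (e, v, \<epsilon>, A, s)" by (cases x)
  have "det A = 1" using assms by (simp add: xe)
  then obtain k a b c where "A = lower k ** upper a ** lower b ** upper c" using SL2_unipotent by blast
  then show thesis using that[of k a b c] assms by (simp add: xe)
qed

text \<open>\<open>S1\<close> contains all upper unipotent matrices with arbitrary translation part,
  and \<open>weyl\<close> conjugates them to the lower ones; these generate \<open>SL_2(9)\<close>
  together with the translations.\<close>

lemma conj_closure_S1_L1: "L1 \<subseteq> conj_closure K1 S1 (carrier K1)"
proof
  let ?X = "conj_closure K1 S1 (carrier K1)"
  have X: "subgroup ?X K1" by (rule K1.conj_closure_subgroup) (use subsets1 in auto)
  have U: "(e, v, 1, upper t, False) \<in> ?X" for e v t
    by (rule K1.conj_closure_mem[of _ "\<one>\<^bsub>K1\<^esub>" _ "(e, v, 1, upper t, False)"]) (use subsets1 in auto)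
  have L: "(e, v, 1, lower t, False) \<in> ?X" for e v t
  proof (rule K1.conj_closure_mem[of _ weyl _ "(e, vec2 (- v $ 2) (v $ 1), 1, upper (-t), False)"])
    show "weyl \<otimes>\<^bsub>K1\<^esub> (e, vec2 (- v $ 2) (v $ 1), 1, upper (- t), False) = (e, v, 1, lower t, False) \<otimes>\<^bsub>K1\<^esub> weyl"
      by (simp add: weyl_def vec_eq2)
  qed (use subsets1 weyl_mem in auto)
  fix x assume "x \<in> L1"
  then obtain k a b c where x: "x = (fst x, fst (snd x), 1, lower k, False) \<otimes>\<^bsub>K1\<^esub> (0, 0, 1, upper a, False) \<otimes>\<^bsub>K1\<^esub>
    (0, 0, 1, lower b, False) \<otimes>\<^bsub>K1\<^esub> (0, 0, 1, upper c, False)" by (rule L1_decomp)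
  show "x \<in> ?X" by (subst x) (intro subgroup.m_closed[OF X] U L)
qed

lemma conj_closure_S1: "conj_closure K1 S1 (carrier K1) <#>\<^bsub>K1\<^esub> W1 = L1"
proof -
  have "conj_closure K1 S1 (carrier K1) \<subseteq> L1"
    using L1_normal subsets1 by (intro K1.conj_closure_minimal) auto
  then have c: "conj_closure K1 S1 (carrier K1) = L1" using conj_closure_S1_L1 by blast
  show ?thesis unfolding c
  proof (intro equalityI subsetI)
    fix x assume "x \<in> L1 <#>\<^bsub>K1\<^esub> W1"
    then show "x \<in> L1" using subgroup.m_closed[OF L1_sub] subsets1 by (auto simp: set_mult_def)
  next
    fix x assume x: "x \<in> L1"
    then have "x = x \<otimes>\<^bsub>K1\<^esub> \<one>\<^bsub>K1\<^esub>" using subsets1 by (intro K1.r_one[symmetric]) auto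
    moreover have "\<one>\<^bsub>K1\<^esub> \<in> W1" by simp
    ultimately show "x \<in> L1 <#>\<^bsub>K1\<^esub> W1" unfolding set_mult_def using x by blast
  qed
qed

lemma conj_closure_B1: "conj_closure K1 B1 (carrier K1) = H1"
proof
  show "conj_closure K1 B1 (carrier K1) \<subseteq> H1"
    using H1_normal subsets1 by (intro K1.conj_closure_minimal) auto
  let ?X = "conj_closure K1 B1 (carrier K1)"
  have X: "subgroup ?X K1" by (rule K1.conj_closure_subgroup) (use subsets1 in auto)
  have "conj_closure K1 S1 (carrier K1) \<subseteq> ?X"
    unfolding conj_closure_def
  proof (intro K1.mono_generate UN_mono order.refl)
    fix k show "k <#\<^bsub>K1\<^esub> S1 #>\<^bsub>K1\<^esub> inv\<^bsub>K1\<^esub> k \<subseteq> k <#\<^bsub>K1\<^esub> B1 #>\<^bsub>K1\<^esub> inv\<^bsub>K1\<^esub> k"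
      using subsets1(4) unfolding l_coset_def r_coset_def by blast
  qed
  then have L: "L1 \<subseteq> ?X" using conj_closure_S1_L1 by blast
  show "H1 \<subseteq> ?X"
  proof
    fix x assume x: "x \<in> H1"
    obtain e v \<epsilon> A s where xe: "x = (e, v, \<epsilon>, A, s)" by (cases x)
    define \<delta> where "\<delta> = det A"
    have e: "emb \<epsilon> * \<delta> ^ 2 = 1" "\<not> s" using x by (simp_all add: xe \<delta>_def)
    then have \<delta>: "\<delta> \<noteq> 0" by auto
    \<comment> \<open>The determinant is split off by a diagonal matrix which, taken with the sign
      \<open>\<epsilon>\<close>, already lies in \<open>B1\<close>.\<close>
    define A' where "A' = A ** mat2 (inverse \<delta>) 0 0 1"
    have A': "det A' = 1" "A = A' ** mat2 \<delta> 0 0 1"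
      using \<delta> by (simp_all add: A'_def det_mul vec_eq2) (simp add: \<delta>_def)
    have "x = (e, v, 1, A', False) \<otimes>\<^bsub>K1\<^esub> (0, 0, \<epsilon>, mat2 \<delta> 0 0 1, False)"
      using e A'(2) by (simp add: xe)
    moreover have "(e, v, 1, A', False) \<in> ?X" using A'(1) L by auto
    moreover have "(0, 0, \<epsilon>, mat2 \<delta> 0 0 1, False) \<in> ?X"
      by (rule K1.conj_closure_mem[of _ "\<one>\<^bsub>K1\<^esub>" _ "(0, 0, \<epsilon>, mat2 \<delta> 0 0 1, False)"]) (use subsets1 e in auto)
    ultimately show "x \<in> ?X" using subgroup.m_closed[OF X] by metis
  qed
qed

text \<open>Commuting with translations means that the semilinear part fixes every vector. The basis
  vectors give \<open>A = 1\<close>, and \<open>i\<close> times the first one rules out the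
  Frobenius map.\<close>

lemma centralizer_W1: "centralizer K1 W1 \<subseteq> W1"
proof
  fix x assume x: "x \<in> centralizer K1 W1"
  obtain e v \<epsilon> A s where xe: "x = (e, v, \<epsilon>, A, s)" by (cases x)
  have c: "x \<otimes>\<^bsub>K1\<^esub> y = y \<otimes>\<^bsub>K1\<^esub> x" if "y \<in> W1" for y using x that by (simp add: centralizer_def)
  have Av: "A *v frobv s w = w" for w using c[of "(0, w, 1, mat 1, False)"] by (simp add: xe add.commute)
  have "A $ 1 $ 1 = 1" "A $ 2 $ 1 = 0" using Av[of "vec2 1 0"] by (simp_all add: vec_eq2)
  moreover have "A $ 1 $ 2 = 0" "A $ 2 $ 2 = 1" using Av[of "vec2 0 1"] by (simp_all add: vec_eq2)
  moreover have "\<not> s" using Av[of "vec2 (GF9 0 1) 0"] \<open>A $ 1 $ 1 = 1\<close> by (auto simp: vec_eq2 frob_def)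
  ultimately show "x \<in> W1" using x by (simp add: xe centralizer_def vec_eq2 det_2)
qed

text \<open>A central element centralizes \<open>W1\<close> and so lies in \<open>W1\<close>. The
  scalar \<open>-1\<close> of \<open>SL_2(9)\<close> inverts the translations of the plane, and none
  of these is its own inverse except 0.\<close>

lemma center_L1: "center (sub K1 L1) = Z1"
proof (intro equalityI subsetI)
  fix x assume x: "x \<in> center (sub K1 L1)"
  then have "x \<in> centralizer K1 W1" using subsets1 by (auto simp: centralizer_def)
  then have xW: "x \<in> W1" using centralizer_W1 by blast
  obtain e v \<epsilon> A s where xe: "x = (e, v, \<epsilon>, A, s)" by (cases x)
  have "x \<otimes>\<^bsub>K1\<^esub> (0, 0, 1, - mat 1, False) = (0, 0, 1, - mat 1, False) \<otimes>\<^bsub>K1\<^esub> x"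
    using x by (simp add: centralizer_def det_2)
  then have "v = - v" using xW by (simp add: xe vec_eq2)
  then have "v + v + v = v" by (metis add.left_inverse add_0)
  moreover have "v + v + v = 0" by (simp add: vec_eq2 gf9_char)
  ultimately show "x \<in> Z1" using xW by (simp add: xe)
next
  fix x assume x: "x \<in> Z1"
  then show "x \<in> center (sub K1 L1)" by (cases x) (auto simp: centralizer_def add.commute)
qed

lemma pow4_emb: "x ^ 2 = emb \<eta> \<Longrightarrow> x ^ 4 = emb (\<eta> ^ 2)"
  by (metis emb_simps(2) power2_eq_square power_add numeral_Bit0)

lemma prod_B1: "T1 <#>\<^bsub>K1\<^esub> T21 = B1" "(L1 \<inter> B1) <#>\<^bsub>K1\<^esub> T21 = B1"
proof -
  have m: "x \<otimes>\<^bsub>K1\<^esub> y \<in> B1" if "x \<in> B1" "y \<in> B1" for x y using that B1_sub by (simp add: subgroup.m_closed)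
  have pow9: "(\<delta>::gf9) ^ 9 = \<delta>" for \<delta> by (rule gf9_pow9)
  have "x \<in> T1 <#>\<^bsub>K1\<^esub> T21 \<and> x \<in> (L1 \<inter> B1) <#>\<^bsub>K1\<^esub> T21" if x: "x \<in> B1" for x
  proof -
    obtain e v \<epsilon> A s where xe: "x = (e, v, \<epsilon>, A, s)" by (cases x)
    define a d b where "a = A $ 1 $ 1" "d = A $ 2 $ 2" "b = A $ 1 $ 2"
    have h: "emb \<epsilon> * (a * d) ^ 2 = 1" "A $ 2 $ 1 = 0" "\<not> s" using x by (auto simp: xe a_d_b_def det_2)
    have nz: "a \<noteq> 0" "d \<noteq> 0" using h(1) by auto
    have \<epsilon>2: "\<epsilon> * \<epsilon> = 1" using K1_nz(3)[of \<epsilon> A False] h x by (simp add: xe)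
    have \<epsilon>: "emb \<epsilon> = (a * d) ^ 2"
    proof -
      have "emb \<epsilon> * emb \<epsilon> = 1" using \<epsilon>2 by (metis emb_simps(2,4))
      then show ?thesis using h(1) by (metis mult.assoc mult_1 mult.commute)
    qed
    have ad4: "(a * d) ^ 4 = 1"
    proof -
      have "(a * d) ^ 4 = (a * d) ^ 2 * (a * d) ^ 2" by (simp add: eval_nat_numeral)
      then show ?thesis using h(1) \<epsilon> by simp
    qed
    have A: "A = mat2 a b 0 d" using h(2) by (simp add: vec_eq2 a_d_b_def)
    text \<open>The torus is the product of the scalars and the matrices \<open>diag(b\<^sup>2, b)\<close>.\<close>
    define q where "q = a / d"
    define p where "p = d / q"
    have q4: "q ^ 2 = emb (if q ^ 2 = 1 then 1 else -1)"
    proof -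
      have "q ^ 4 = (a * d) ^ 4 / d ^ 8" using nz by (simp add: q_def power_mult_distrib power_divide eval_nat_numeral)
      also have "\<dots> = 1" using ad4 nz gf9_pow8 by simp
      finally have "(q ^ 2 - 1) * (q ^ 2 + 1) = 0" by (simp add: algebra_simps eval_nat_numeral)
      then show ?thesis by (auto simp: eq_neg_iff_add_eq_0)
    qed
    define \<eta> where "\<eta> = (if q ^ 2 = 1 then 1 else -1 :: 3)"
    have q\<eta>: "q ^ 2 = emb \<eta>" and \<eta>2: "\<eta> * \<eta> = 1" "\<eta> \<noteq> 0" using q4 by (auto simp: \<eta>_def)
    have qnz: "q \<noteq> 0" using nz by (simp add: q_def)
    let ?t = "(0, 0, \<eta>, mat2 (q ^ 2) (b / p) 0 q, False)"
    have t: "?t \<in> T21" using q\<eta> \<eta>2 pow4_emb[OF q\<eta>] by simp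
    have p: "p \<noteq> 0" "p * q ^ 2 = a" "p * q = d" using nz by (simp_all add: p_def q_def power2_eq_square field_simps)
    have 1: "x = (e, v, \<epsilon> * \<eta>, mat2 p 0 0 p, False) \<otimes>\<^bsub>K1\<^esub> ?t"
      using h p \<eta>2 by (simp add: xe A vec_eq2 mult.assoc)
    have "emb (\<epsilon> * \<eta>) * (p * p) ^ 2 = 1"
    proof -
      have "emb (\<epsilon> * \<eta>) * (p * p) ^ 2 = (p * q ^ 2 * (p * q)) ^ 2 * q ^ 2 * (p * p) ^ 2" using \<epsilon> p q\<eta> by simp
      also have "\<dots> = p ^ 8 * q ^ 8" by (simp add: eval_nat_numeral algebra_simps)
      finally show ?thesis using p(1) qnz gf9_pow8 by simp
    qed
    then have 2: "(e, v, \<epsilon> * \<eta>, mat2 p 0 0 p, False) \<in> T1" by simp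
    \<comment> \<open>The exponent solves \<open>r ^ 3 = a * d\<close>, because
      \<open>x ^ 9 = x\<close>. Thus the matrix with diagonal \<open>r ^ 2\<close> and
      \<open>r\<close> has the determinant of \<open>A\<close>. Moreover
      \<open>r ^ 2 = (a * d) ^ 6 = (a * d) ^ 2\<close> is the sign.\<close>
    define r where "r = (a * d) ^ 3"
    have r: "r \<noteq> 0" "r ^ 2 = emb \<epsilon>" "r ^ 3 = a * d"
    proof -
      show "r \<noteq> 0" using nz by (simp add: r_def)
      have "r ^ 2 = (a * d) ^ 4 * (a * d) ^ 2" unfolding r_def by (simp only: power_mult[symmetric] power_add[symmetric]) simp
      then show "r ^ 2 = emb \<epsilon>" using ad4 \<epsilon> by simp
      have "r ^ 3 = (a * d) ^ 9" unfolding r_def by (simp only: power_mult[symmetric]) simp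
      then show "r ^ 3 = a * d" by (simp only: pow9)
    qed
    let ?s = "(0, 0, \<epsilon>, mat2 (r ^ 2) 0 0 r, False)"
    have \<epsilon>nz: "\<epsilon> \<noteq> 0" using \<epsilon>2 by auto
    have s: "?s \<in> T21" using r \<epsilon>nz pow4_emb[OF r(2)] by simp
    have 3: "x = (e, v, 1, mat2 (a / r ^ 2) (b / r) 0 (d / r), False) \<otimes>\<^bsub>K1\<^esub> ?s"
      using h r \<epsilon>nz by (simp add: xe A vec_eq2)
    have "a / r ^ 2 * (d / r) = 1" using r nz by (simp add: field_simps eval_nat_numeral)
    then have 4: "(e, v, 1, mat2 (a / r ^ 2) (b / r) 0 (d / r), False) \<in> L1 \<inter> B1" by simp
    show ?thesis unfolding set_mult_def using 1 2 3 4 t s by blast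
  qed
  moreover have "X <#>\<^bsub>K1\<^esub> T21 \<subseteq> B1" if "X \<subseteq> B1" for X
    using that m subsets1(2) unfolding set_mult_def by blast
  ultimately show "T1 <#>\<^bsub>K1\<^esub> T21 = B1" "(L1 \<inter> B1) <#>\<^bsub>K1\<^esub> T21 = B1"
    using subsets1(7) by (meson Int_lower2 equalityI subsetI)+
qed

lemma s_inv: "x \<in> carrier K1 \<Longrightarrow> y \<in> carrier K1 \<Longrightarrow>
  snd (snd (det_part x)) = snd (snd (det_part y)) \<longleftrightarrow> x \<otimes>\<^bsub>K1\<^esub> inv\<^bsub>K1\<^esub> y \<in> H1"
proof -
  assume x: "x \<in> carrier K1" and y: "y \<in> carrier K1"
  define z where "z = x \<otimes>\<^bsub>K1\<^esub> inv\<^bsub>K1\<^esub> y"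
  have z: "z \<in> carrier K1" "x = z \<otimes>\<^bsub>K1\<^esub> y" using x y by (simp_all add: z_def K1.m_assoc)
  have "snd (snd (det_part x)) = (snd (snd (det_part z)) \<noteq> snd (snd (det_part y)))"
    unfolding z(2) det_part_mult by (simp split: prod.splits)
  then show ?thesis using z(1) unfolding z_def[symmetric] by (cases z) auto
qed

text \<open>An element of the common subgroup with field automorphism: determinant
  \<open>\<omega>\<close> and sign 1 satisfy the relation, as \<open>\<mu> True\<close> is the
  square of \<open>\<omega>\<close>.\<close>

definition "swap1 = (0, 0, 1, mat2 \<omega> 0 0 1, True)"

lemma swap1_mem: "swap1 \<in> C1" by (simp add: swap1_def \<mu>_def power2_eq_square)

lemma index_H1: "index K1 H1 = 2"
proof -
  have "index K1 H1 = card ((\<lambda>x. snd (snd (det_part x))) ` carrier K1)"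
    using H1_sub s_inv by (rule K1.index_eq_card_image)
  also have "(\<lambda>x. snd (snd (det_part x))) ` carrier K1 = {False, True}"
    by (rule bool_image[where a = "\<one>\<^bsub>K1\<^esub>" and b = swap1])
      (use swap1_mem subsets1(12) in \<open>auto simp: swap1_def\<close>)
  finally show ?thesis by simp
qed

lemma index_B1: "index (sub K1 C1) B1 = 2"
proof -
  interpret C: group "sub K1 C1" using subgroup_C1 by (rule K1.subgroup_imp_group)
  have "index (sub K1 C1) B1 = card ((\<lambda>x. snd (snd (det_part x))) ` carrier (sub K1 C1))"
  proof (rule C.index_eq_card_image)
    show "subgroup B1 (sub K1 C1)" using B1_sub subgroup_C1 subsets1 by (intro K1.subgroup_incl)
    fix x y assume xy: "x \<in> carrier (sub K1 C1)" "y \<in> carrier (sub K1 C1)"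
    then have "x \<otimes>\<^bsub>K1\<^esub> inv\<^bsub>K1\<^esub> y \<in> C1" using subgroup_C1 by (simp add: subgroup.m_closed subgroup.m_inv_closed)
    then show "snd (snd (det_part x)) = snd (snd (det_part y)) \<longleftrightarrow> x \<otimes>\<^bsub>sub K1 C1\<^esub> inv\<^bsub>sub K1 C1\<^esub> y \<in> B1"
      using s_inv[of x y] xy subsets1(12) K1.m_inv_consistent[OF subgroup_C1, of y] by (auto simp: B1_def)
  qed
  also have "(\<lambda>x. snd (snd (det_part x))) ` carrier (sub K1 C1) = {False, True}"
    by (rule bool_image[where a = "\<one>\<^bsub>K1\<^esub>" and b = swap1])
      (use swap1_mem in \<open>auto simp: swap1_def\<close>)
  finally show ?thesis by simp
qed

section \<open>Subgroups of the second parabolic\<close>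

definition "S2 = {(e, z, v, u, c, \<epsilon>, d, g, s) \<in> C2. d = 1 \<and> g = 1 \<and> \<not> s}"
definition "Z2 = {(e, z, v, u, c, \<epsilon>, d, g, s) \<in> C2. v = 0 \<and> u = 0 \<and> d = 1 \<and> g = 1 \<and> \<not> s}"
text \<open>The factor \<open>emb \<epsilon> * d * g\<close> is the one by which the torus acts on
  the coordinate \<open>c\<close>; it must be 1 for a trivial action on the nine cosets.\<close>

definition "T2 = {(e, z, v, u, c, \<epsilon>, d, g, s) \<in> C2. emb \<epsilon> * d * g = 1 \<and> \<not> s}"
definition "H2 = {(e, z, v, u, c, \<epsilon>, d, g, s) \<in> carrier K2. \<not> s}"
definition "B2 = H2 \<inter> C2"

text \<open>Squaring the second relation gives \<open>(d g)^2 = 1\<close>. The first one then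
  reduces to \<open>\<epsilon> d^2 = 1\<close>, and comparison with the second shows
  \<open>g = d\<close>.\<close>

lemma K2_torus:
  assumes "emb \<epsilon> * (d ^ 2 * g) ^ 2 = 1" "emb \<epsilon> * d * g = 1"
  shows "g = d" "emb \<epsilon> = d ^ 2" "\<epsilon> \<noteq> 0" "\<epsilon> * \<epsilon> = 1"
proof -
  show nz: "\<epsilon> \<noteq> 0" "\<epsilon> * \<epsilon> = 1" using K2_nz[of \<epsilon> d g False] assms by auto
  have d: "d \<noteq> 0" using assms by auto
  have e2: "emb \<epsilon> * emb \<epsilon> = 1" using nz by (metis emb_simps(2,4))
  have "emb \<epsilon> * (d ^ 2 * g) ^ 2 = emb \<epsilon> * d ^ 2 * (d * g) ^ 2" by (simp add: power2_eq_square algebra_simps)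
  moreover have "(d * g) ^ 2 = 1"
  proof -
    have "(d * g) ^ 2 = (emb \<epsilon> * emb \<epsilon>) * (d * g) ^ 2" using e2 by simp
    also have "\<dots> = (emb \<epsilon> * d * g) ^ 2" by (simp add: power2_eq_square algebra_simps)
    finally show ?thesis using assms by simp
  qed
  ultimately have "emb \<epsilon> * d ^ 2 = 1" using assms(1) by simp
  then show ed: "emb \<epsilon> = d ^ 2" using e2 by (metis mult.assoc mult.commute mult_1)
  have "d * (emb \<epsilon> * g) = d * (emb \<epsilon> * d)" using assms(2) \<open>emb \<epsilon> * d ^ 2 = 1\<close>
    by (simp add: power2_eq_square ac_simps)
  then have "emb \<epsilon> * g = emb \<epsilon> * d" using d by simp
  then show "g = d" using nz by simp
qed

lemma K2_torus':
  assumes "\<epsilon> \<noteq> 0" "emb \<epsilon> = d ^ 2"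
  shows "emb \<epsilon> * (d ^ 2 * d) ^ 2 = 1" "emb \<epsilon> * d * d = 1"
proof -
  have d: "d \<noteq> 0" using assms emb_eq_0_iff[of \<epsilon>] by auto
  have "emb \<epsilon> * (d ^ 2 * d) ^ 2 = d ^ 8" using assms(2) by (simp add: eval_nat_numeral)
  then show "emb \<epsilon> * (d ^ 2 * d) ^ 2 = 1" using d gf9_pow8 by simp
  have "\<epsilon> * \<epsilon> = 1" using three_cases[of \<epsilon>] assms(1) by auto
  then have "emb \<epsilon> * emb \<epsilon> = 1" by (metis emb_simps(2,4))
  then show "emb \<epsilon> * d * d = 1" using assms(2) by (simp add: power2_eq_square mult.assoc)
qed

lemma mem2_simps [simp]:
  "(e, z, v, u, c, \<epsilon>, d, g, s) \<in> S2 \<longleftrightarrow> c = 0 \<and> \<epsilon> = 1 \<and> d = 1 \<and> g = 1 \<and> \<not> s"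
  "(e, z, v, u, c, \<epsilon>, d, g, s) \<in> Z2 \<longleftrightarrow> v = 0 \<and> u = 0 \<and> c = 0 \<and> \<epsilon> = 1 \<and> d = 1 \<and> g = 1 \<and> \<not> s"
  "(e, z, v, u, c, \<epsilon>, d, g, s) \<in> T2 \<longleftrightarrow> c = 0 \<and> g = d \<and> emb \<epsilon> = d ^ 2 \<and> \<epsilon> \<noteq> 0 \<and> \<not> s"
  "(e, z, v, u, c, \<epsilon>, d, g, s) \<in> H2 \<longleftrightarrow> emb \<epsilon> * (d ^ 2 * g) ^ 2 = 1 \<and> \<not> s"
  "(e, z, v, u, c, \<epsilon>, d, g, s) \<in> B2 \<longleftrightarrow> emb \<epsilon> * (d ^ 2 * g) ^ 2 = 1 \<and> c = 0 \<and> \<not> s"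
proof -
  show "(e, z, v, u, c, \<epsilon>, d, g, s) \<in> T2 \<longleftrightarrow> c = 0 \<and> g = d \<and> emb \<epsilon> = d ^ 2 \<and> \<epsilon> \<noteq> 0 \<and> \<not> s"
    using K2_torus[of \<epsilon> d g] K2_torus'[of \<epsilon> d] by (auto simp: T2_def)
qed (auto simp: S2_def Z2_def H2_def B2_def)

lemma subsets2: "S2 \<subseteq> T2" "T2 \<subseteq> B2" "B2 \<subseteq> C2" "B2 \<subseteq> H2" "Z2 \<subseteq> S2" "S2 \<subseteq> C2" "T2 \<subseteq> C2" "S2 \<subseteq> B2"
  "C2 \<subseteq> carrier K2" "H2 \<subseteq> carrier K2" "B2 \<subseteq> carrier K2" "T2 \<subseteq> carrier K2" "S2 \<subseteq> carrier K2" "Z2 \<subseteq> carrier K2"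
proof -
  show "S2 \<subseteq> T2" by (auto simp: S2_def)
  show "T2 \<subseteq> B2" by (auto simp: T2_def B2_def H2_def C2_def)
  show "B2 \<subseteq> C2" "B2 \<subseteq> H2" by (auto simp: B2_def)
  show "Z2 \<subseteq> S2" by (auto simp: Z2_def S2_def)
  show "S2 \<subseteq> C2" "T2 \<subseteq> C2" by (auto simp: S2_def T2_def)
  show "S2 \<subseteq> B2" by (auto simp: S2_def B2_def H2_def C2_def)
  show "C2 \<subseteq> carrier K2" "H2 \<subseteq> carrier K2" by (auto simp: C2_def H2_def)
  then show "B2 \<subseteq> carrier K2" "T2 \<subseteq> carrier K2" "S2 \<subseteq> carrier K2" "Z2 \<subseteq> carrier K2"
    by (auto simp: B2_def T2_def S2_def Z2_def)
qed

definition torus_part :: "k2 \<Rightarrow> 3 \<times> gf9 \<times> gf9 \<times> bool" where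
  "torus_part = (\<lambda>(e, z, v, u, c, \<epsilon>, d, g, s). (\<epsilon>, d, g, s))"

lemma torus_part_simp [simp]: "torus_part (e, z, v, u, c, \<epsilon>, d, g, s) = (\<epsilon>, d, g, s)"
  by (simp add: torus_part_def)

lemma torus_part_mult:
  "torus_part (x \<otimes>\<^bsub>K2\<^esub> y) =
    (\<lambda>(\<epsilon>, a, d, s) (\<epsilon>', a', d', s'). (\<epsilon> * \<epsilon>', a * frob s a', d * frob s d', s \<noteq> s')) (torus_part x) (torus_part y)"
  by (cases x rule: k2_cases; cases y rule: k2_cases) simp

lemma H2_normal: "H2 \<lhd> K2" and H2_sub: "subgroup H2 K2"
proof -
  let ?f = "\<lambda>x. snd (snd (snd (torus_part x)))"
  have H: "H2 = {x \<in> carrier K2. ?f x = ?f \<one>\<^bsub>K2\<^esub>}" by (auto simp: H2_def)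
  have "?f (x \<otimes>\<^bsub>K2\<^esub> y) = (?f x \<noteq> ?f y)" for x y
    by (simp add: torus_part_mult split: prod.splits)
  from K2.normal_kernel_fun[OF K2.subgroup_self this H] show "H2 \<lhd> K2" "subgroup H2 K2" by auto
qed

lemma B2_sub: "subgroup B2 K2"
  unfolding B2_def using H2_sub subgroup_C2 by (rule K2.subgroups_Inter_pair)

text \<open>Right multiplication by an element with label 0 does not change the label
  \<open>c\<close>, so the labels name the nine cosets.\<close>

lemma C2_coset_iff:
  assumes "(e, z, v, u, c, \<epsilon>, d, g, s) \<in> carrier K2" "(e', z', v', u', c', \<epsilon>', d', g', s') \<in> carrier K2"
  shows "inv\<^bsub>K2\<^esub> (e, z, v, u, c, \<epsilon>, d, g, s) \<otimes>\<^bsub>K2\<^esub> (e', z', v', u', c', \<epsilon>', d', g', s') \<in> C2 \<longleftrightarrow> c = c'"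
proof -
  let ?x = "(e, z, v, u, c, \<epsilon>, d, g, s)" and ?y = "(e', z', v', u', c', \<epsilon>', d', g', s')"
  define w where "w = inv\<^bsub>K2\<^esub> ?x \<otimes>\<^bsub>K2\<^esub> ?y"
  have w: "w \<in> carrier K2" unfolding w_def using assms by (intro K2.m_closed K2.inv_closed)
  have y: "?y = ?x \<otimes>\<^bsub>K2\<^esub> w" unfolding w_def by (simp only: K2.m_assoc[symmetric] assms K2.inv_closed K2.r_inv K2.l_one)
  obtain e'' z'' v'' u'' c'' \<epsilon>'' d'' g'' s'' where we: "w = (e'', z'', v'', u'', c'', \<epsilon>'', d'', g'', s'')"
    by (cases w rule: k2_cases)
  have "c' = c + emb \<epsilon> * d * g * frob s c''" using y by (simp add: we)
  moreover have "\<epsilon> \<noteq> 0" "d \<noteq> 0" "g \<noteq> 0" using assms K2_nz by auto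
  ultimately have "c = c' \<longleftrightarrow> c'' = 0" by auto
  moreover have "w \<in> C2 \<longleftrightarrow> c'' = 0" using w by (simp add: we)
  ultimately show ?thesis by (simp only: w_def[symmetric])
qed

text \<open>An element acts on labels by a semilinear affine map. Fixing the labels 0, 1 and
  \<open>i\<close> forces a zero shift, the factor 1 and no Frobenius map.\<close>

lemma core_C2: "{x \<in> carrier K2. \<forall>k\<in>carrier K2. inv\<^bsub>K2\<^esub> k \<otimes>\<^bsub>K2\<^esub> x \<otimes>\<^bsub>K2\<^esub> k \<in> C2} = T2"
proof (intro equalityI subsetI)
  fix x assume "x \<in> {x \<in> carrier K2. \<forall>k\<in>carrier K2. inv\<^bsub>K2\<^esub> k \<otimes>\<^bsub>K2\<^esub> x \<otimes>\<^bsub>K2\<^esub> k \<in> C2}"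
  then have x: "x \<in> carrier K2" and k: "\<And>k. k \<in> carrier K2 \<Longrightarrow> inv\<^bsub>K2\<^esub> k \<otimes>\<^bsub>K2\<^esub> (x \<otimes>\<^bsub>K2\<^esub> k) \<in> C2"
    by (auto simp: K2.m_assoc)
  obtain e z v u c \<epsilon> d g s where xe: "x = (e, z, v, u, c, \<epsilon>, d, g, s)" by (cases x rule: k2_cases)
  have fx: "c + emb \<epsilon> * d * g * frob s c' = c'" for c'
  proof -
    have kc: "(0, 0, 0, 0, c', 1, 1, 1, False) \<in> carrier K2" by simp
    have xk: "x \<otimes>\<^bsub>K2\<^esub> (0, 0, 0, 0, c', 1, 1, 1, False) \<in> carrier K2" using x kc by (intro K2.m_closed)
    show ?thesis using k[OF kc] xk unfolding xe K2_mult by (subst (asm) C2_coset_iff[OF kc]) auto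
  qed
  have c: "c = 0" using fx[of 0] by simp
  have 1: "emb \<epsilon> * d * g = 1" using fx[of 1] c by simp
  have "frob s (GF9 0 1) = GF9 0 1" using fx[of "GF9 0 1"] c 1 by simp
  then have "\<not> s" by (auto simp: frob_def)
  then show "x \<in> T2" using x c 1 by (simp add: xe T2_def)
next
  fix x assume x: "x \<in> T2"
  have xc: "x \<in> carrier K2" using x subsets2 by blast
  obtain e z v u c \<epsilon> d g s where xe: "x = (e, z, v, u, c, \<epsilon>, d, g, s)" by (cases x rule: k2_cases)
  have x': "c = 0" "emb \<epsilon> * d * g = 1" "\<not> s" using x by (auto simp: xe T2_def)
  have "inv\<^bsub>K2\<^esub> k \<otimes>\<^bsub>K2\<^esub> (x \<otimes>\<^bsub>K2\<^esub> k) \<in> C2" if k: "k \<in> carrier K2" for k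
  proof -
    obtain e' z' v' u' c' \<epsilon>' d' g' s' where ke: "k = (e', z', v', u', c', \<epsilon>', d', g', s')" by (cases k rule: k2_cases)
    have "x \<otimes>\<^bsub>K2\<^esub> k \<in> carrier K2" using xc k by simp
    then show ?thesis using k x' unfolding ke xe K2_mult
      by (subst C2_coset_iff) auto
  qed
  then show "x \<in> {x \<in> carrier K2. \<forall>k\<in>carrier K2. inv\<^bsub>K2\<^esub> k \<otimes>\<^bsub>K2\<^esub> x \<otimes>\<^bsub>K2\<^esub> k \<in> C2}"
    using xc by (auto simp: K2.m_assoc)
qed

lemma T2_sub: "subgroup T2 K2"
proof -
  have T: "T2 = {x \<in> B2. (\<lambda>(\<epsilon>, d, g, s). emb \<epsilon> * d * g) (torus_part x) = (\<lambda>(\<epsilon>, d, g, s). emb \<epsilon> * d * g) (torus_part \<one>\<^bsub>K2\<^esub>)}"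
    by (auto simp: T2_def B2_def H2_def C2_def)
  have "(\<lambda>(\<epsilon>, d, g, s). emb \<epsilon> * d * g) (torus_part (x \<otimes>\<^bsub>K2\<^esub> y)) =
      (\<lambda>(\<epsilon>, d, g, s). emb \<epsilon> * d * g) (torus_part x) * (\<lambda>(\<epsilon>, d, g, s). emb \<epsilon> * d * g) (torus_part y)"
    if "x \<in> B2" "y \<in> B2" for x y
    using that by (cases x rule: k2_cases; cases y rule: k2_cases) (simp add: algebra_simps)
  from K2.normal_kernel_fun[OF B2_sub this T] show ?thesis by auto
qed

lemma S2_normal_sub:
  assumes X: "subgroup X K2" "S2 \<subseteq> X" "X \<subseteq> C2"
  shows "S2 \<lhd> sub K2 X" "subgroup S2 K2"
proof -
  have S: "S2 = {x \<in> X. torus_part x = torus_part \<one>\<^bsub>K2\<^esub>}"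
    using X by (auto simp: subset_iff)
  from K2.normal_kernel_fun[OF X(1) torus_part_mult this] show "S2 \<lhd> sub K2 X" "subgroup S2 K2" by auto
qed

lemmas S2_sub = S2_normal_sub(2)[OF B2_sub subsets2(8,3)]

lemma to_K1_image: "to_K1 ` C2 = C1" "to_K1 ` S2 = S1" "to_K1 ` T2 = T21" "to_K1 ` B2 = B1"
proof -
  have bij: "bij_betw to_K1 C2 C1" using to_K1_iso by (simp add: iso_def)
  then show C: "to_K1 ` C2 = C1" by (simp add: bij_betw_def)
  have *: "to_K1 ` X = Y" if XY: "X \<subseteq> C2" "Y \<subseteq> C1" "\<And>x. x \<in> C2 \<Longrightarrow> x \<in> X \<longleftrightarrow> to_K1 x \<in> Y" for X Y
  proof (intro equalityI subsetI)
    fix y assume y: "y \<in> Y"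
    then have "y \<in> to_K1 ` C2" using XY(2) C by blast
    then obtain x where x: "x \<in> C2" "y = to_K1 x" by blast
    then show "y \<in> to_K1 ` X" using XY(3)[OF x(1)] y by blast
  qed (use XY in auto)
  have nz: "\<epsilon> \<noteq> 0" "d \<noteq> 0" "g \<noteq> 0" "\<epsilon> * \<epsilon> = 1" if "(e, z, v, u, c, \<epsilon>, d, g, s) \<in> C2" for e z v u c \<epsilon> d g s
    using that K2_nz by auto
  show "to_K1 ` S2 = S1"
  proof (rule *)
    fix x assume x: "x \<in> C2"
    then show "x \<in> S2 \<longleftrightarrow> to_K1 x \<in> S1" by (cases x rule: k2_cases) auto
  qed (use subsets1 subsets2 in auto)
  show "to_K1 ` T2 = T21"
  proof (rule *)
    fix x assume x: "x \<in> C2"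
    obtain e z v u c \<epsilon> d g s where xe: "x = (e, z, v, u, c, \<epsilon>, d, g, s)" by (cases x rule: k2_cases)
    show "x \<in> T2 \<longleftrightarrow> to_K1 x \<in> T21"
      using x nz[of e z v u c \<epsilon> d g s] pow4_emb[of d \<epsilon>] by (auto simp: xe power2_eq_square)
  qed (use subsets1 subsets2 in auto)
  show "to_K1 ` B2 = B1"
  proof (rule *)
    fix x assume x: "x \<in> C2"
    then show "x \<in> B2 \<longleftrightarrow> to_K1 x \<in> B1"
      by (cases x rule: k2_cases) (auto simp: power2_eq_square ac_simps)
  qed (use subsets1 subsets2 in auto)
qed

text \<open>Commuting with the directions \<open>e\<close>, \<open>v\<close> and \<open>u\<close>
  detects sign and torus, and the direction \<open>v\<close> also gives \<open>lam c = 0\<close>. A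
  multiple by \<open>i\<close> detects the Frobenius map. The alternating form then yields
  \<open>2 v = 2 u = 0\<close>.\<close>

lemma centralizer_S2: "centralizer K2 S2 \<subseteq> Z2" and center_S2: "center (sub K2 S2) = Z2"
proof -
  have *: "v = 0 \<and> u = 0 \<and> (c = 0 \<and> d = 1 \<and> g = 1 \<and> \<not> s \<and> \<epsilon> = 1)"
    if x: "(e, z, v, u, c, \<epsilon>, d, g, s) \<in> carrier K2"
      and com: "\<And>y. y \<in> S2 \<Longrightarrow> (e, z, v, u, c, \<epsilon>, d, g, s) \<otimes>\<^bsub>K2\<^esub> y = y \<otimes>\<^bsub>K2\<^esub> (e, z, v, u, c, \<epsilon>, d, g, s)"
    for e z v u c \<epsilon> d g s
  proof -
    have d: "d = 1" using com[of "(0, 0, 1, 0, 0, 1, 1, 1, False)"] by (simp add: add.commute)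
    have "d * frob s (GF9 0 1) = GF9 0 1"
      using com[of "(0, 0, GF9 0 1, 0, 0, 1, 1, 1, False)"] by (simp add: add.commute)
    then have s: "\<not> s" using d by (auto simp: frob_def)
    have g: "g = 1" using com[of "(0, 0, 0, 1, 0, 1, 1, 1, False)"] by (simp add: add.commute)
    have \<epsilon>: "\<epsilon> = 1" using com[of "(1, 0, 0, 0, 0, 1, 1, 1, False)"] by (simp add: add.commute)
    have c: "c = 0" using com[of "(0, 0, 1, 0, 0, 1, 1, 1, False)"] d by simp
    have "z + v = z - v" using com[of "(0, 0, 0, 1, 0, 1, 1, 1, False)"] g c by simp
    then have "(z + v) - (z - v) = 0" by simp
    then have "v + v = 0" by (simp only: add_diff_cancel_left diff_minus_eq_add diff_conv_add_uminus minus_add_distrib minus_minus) (simp add: algebra_simps)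
    then have "v = 0" using gf9_char[of v] by (metis add_0)
    moreover have "z - u = z + u" using com[of "(0, 0, 1, 0, 0, 1, 1, 1, False)"] d c by simp
    then have "(z + u) - (z - u) = 0" by simp
    then have "u + u = 0" by (simp only: add_diff_cancel_left diff_minus_eq_add diff_conv_add_uminus minus_add_distrib minus_minus) (simp add: algebra_simps)
    then have "u = 0" using gf9_char[of u] by (metis add_0)
    ultimately show ?thesis using d s g \<epsilon> c by simp
  qed
  show "centralizer K2 S2 \<subseteq> Z2"
  proof
    fix x assume x: "x \<in> centralizer K2 S2"
    obtain e z v u c \<epsilon> d g s where xe: "x = (e, z, v, u, c, \<epsilon>, d, g, s)" by (cases x rule: k2_cases)
    then show "x \<in> Z2" using x *[of e z v u c \<epsilon> d g s] by (simp add: centralizer_def)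
  qed
  then have "center (sub K2 S2) \<subseteq> Z2" using subsets2 by (auto simp: centralizer_def)
  moreover have "x \<in> center (sub K2 S2)" if "x \<in> Z2" for x
    using that subsets2(5) by (cases x rule: k2_cases) (auto simp: centralizer_def S2_def add.commute)
  ultimately show "center (sub K2 S2) = Z2" by blast
qed

lemma conj_closure_B2: "conj_closure K2 B2 (carrier K2) = H2"
proof
  show "conj_closure K2 B2 (carrier K2) \<subseteq> H2"
    using H2_normal subsets2 by (intro K2.conj_closure_minimal) auto
  let ?X = "conj_closure K2 B2 (carrier K2)"
  have X: "subgroup ?X K2" by (rule K2.conj_closure_subgroup) (use subsets2 in auto)
  have B: "b \<in> ?X" if "b \<in> B2" for b
    by (rule K2.conj_closure_mem[of _ "\<one>\<^bsub>K2\<^esub>" _ b])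
      (use that subsets2(11) K2.l_one K2.r_one K2.one_closed in \<open>auto simp del: K2_one\<close>)
  \<comment> \<open>The torus element with \<open>g = -1\<close> lies in \<open>B2\<close> and
    negates labels. Conjugating it by the element with label \<open>- c\<close> produces the label
    \<open>- 2 c\<close>, which is \<open>c\<close>.\<close>
  have n: "(0, 0, 0, 0, c, 1, 1, -1, False) \<in> ?X" for c
  proof (rule K2.conj_closure_mem[of _ "(0, 0, 0, 0, - c, 1, 1, 1, False)" _ "(0, 0, 0, 0, 0, 1, 1, -1, False)"])
    have "- c = c + c" using gf9_char[of c] by (simp add: eq_neg_iff_add_eq_0 add.commute)
    then show "(0, 0, 0, 0, - c, 1, 1, 1, False) \<otimes>\<^bsub>K2\<^esub> (0, 0, 0, 0, 0, 1, 1, - 1, False) =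
      (0, 0, 0, 0, c, 1, 1, - 1, False) \<otimes>\<^bsub>K2\<^esub> (0, 0, 0, 0, - c, 1, 1, 1, False)" by simp
  qed (use subsets2 in auto)
  show "H2 \<subseteq> ?X"
  proof
    fix h assume h: "h \<in> H2"
    then have hc: "h \<in> carrier K2" using subsets2 by blast
    obtain e z v u c \<epsilon> d g s where he: "h = (e, z, v, u, c, \<epsilon>, d, g, s)" by (cases h rule: k2_cases)
    \<comment> \<open>An element of the closure with the label of \<open>h\<close>: the quotient of
      \<open>h\<close> by it lies in \<open>H2 \<inter> C2 = B2\<close>.\<close>
    let ?y = "(0, 0, 0, 0, c, 1, 1, -1, False)"
    have yc: "?y \<in> carrier K2" by simp
    have "?y \<in> H2" by simp
    then have "inv\<^bsub>K2\<^esub> ?y \<otimes>\<^bsub>K2\<^esub> h \<in> H2" using h H2_sub by (meson subgroup.m_closed subgroup.m_inv_closed)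
    moreover have "inv\<^bsub>K2\<^esub> ?y \<otimes>\<^bsub>K2\<^esub> h \<in> C2" unfolding he using hc yc by (subst C2_coset_iff) (auto simp: he)
    ultimately have "inv\<^bsub>K2\<^esub> ?y \<otimes>\<^bsub>K2\<^esub> h \<in> ?X" using B by (simp add: B2_def)
    then have "?y \<otimes>\<^bsub>K2\<^esub> (inv\<^bsub>K2\<^esub> ?y \<otimes>\<^bsub>K2\<^esub> h) \<in> ?X" by (rule subgroup.m_closed[OF X n])
    moreover have "?y \<otimes>\<^bsub>K2\<^esub> (inv\<^bsub>K2\<^esub> ?y \<otimes>\<^bsub>K2\<^esub> h) = h"
      by (simp only: K2.m_assoc[symmetric] yc hc K2.inv_closed K2.r_inv K2.l_one)
    ultimately show "h \<in> ?X" by simp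
  qed
qed

definition "swap2 = (0, 0, 0, 0, 0, 1, 1, \<omega>, True)"

lemma index_H2: "index K2 H2 = 2"
proof -
  let ?f = "\<lambda>x. snd (snd (snd (torus_part x)))"
  have "index K2 H2 = card (?f ` carrier K2)"
    using H2_sub
  proof (rule K2.index_eq_card_image)
    fix x y assume x: "x \<in> carrier K2" and y: "y \<in> carrier K2"
    define z where "z = x \<otimes>\<^bsub>K2\<^esub> inv\<^bsub>K2\<^esub> y"
    have z: "z \<in> carrier K2" "x = z \<otimes>\<^bsub>K2\<^esub> y" using x y by (simp_all add: z_def K2.m_assoc)
    have "?f x = (?f z \<noteq> ?f y)"
      unfolding z(2) torus_part_mult by (simp split: prod.splits)
    then show "?f x = ?f y \<longleftrightarrow> x \<otimes>\<^bsub>K2\<^esub> inv\<^bsub>K2\<^esub> y \<in> H2"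
      using z(1) unfolding z_def[symmetric] by (cases z rule: k2_cases) auto
  qed
  also have "?f ` carrier K2 = {False, True}"
    by (rule bool_image[where a = "\<one>\<^bsub>K2\<^esub>" and b = swap2])
      (auto simp: swap2_def \<mu>_def power2_eq_square)
  finally show ?thesis by simp
qed

section \<open>Faithfulness of the amalgam, and transitivity elements\<close>

text \<open>The automorphism of \<open>S\<close> with label 1. It moves \<open>x1\<close> to another
  neighbor of \<open>x2\<close>, as \<open>weyl\<close> moves \<open>x2\<close> to another neighbor
  of \<open>x1\<close>; products of the two trace out the 5-arcs.\<close>

definition "move = (0, 0, 0, 0, 1, 1, 1, 1, False)"

lemma move_mem: "move \<in> carrier K2" by (simp add: move_def)

text \<open>\<open>N\<close> lies in the cores of both embeddings of the common subgroup, which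
  leaves only \<open>e\<close>, \<open>z\<close> and \<open>v\<close>. Conjugation by
  \<open>move\<close> creates the matrix entry \<open>lam 1 * v\<close>, so \<open>v = 0\<close>.
  Conjugation by \<open>weyl\<close> brings \<open>z\<close> to the place of \<open>v\<close>, so
  \<open>z = 0\<close>. Another conjugation by \<open>move\<close> adds \<open>e\<close> to
  \<open>z\<close>, so \<open>e = 0\<close>.\<close>

lemma amalgam_faithful:
  assumes "N \<subseteq> C2" "N \<lhd> K2" "to_K1 ` N \<lhd> K1"
  shows "N \<subseteq> {\<one>\<^bsub>K2\<^esub>}"
proof
  fix x assume x: "x \<in> N"
  have inj: "inj_on to_K1 C2" using to_K1_iso by (simp add: iso_def bij_betw_def)
  have NT: "N \<subseteq> T2"
    unfolding core_C2[symmetric] using assms(1,2) subsets2(9) normal.inv_op_closed1[OF assms(2)] by blast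
  have NT1: "to_K1 ` N \<subseteq> T1"
    unfolding core_C1[symmetric] using assms(1,3) to_K1_image(1) subsets1(12) normal.inv_op_closed1[OF assms(3)] by blast
  have torus: "u = 0 \<and> \<epsilon> = 1 \<and> d = 1 \<and> g = 1 \<and> c = 0 \<and> \<not> s" if "(e, z, v, u, c, \<epsilon>, d, g, s) \<in> N" for e z v u c \<epsilon> d g s
  proof -
    have t: "(e, z, v, u, c, \<epsilon>, d, g, s) \<in> T2" using that NT by auto
    have t1: "to_K1 (e, z, v, u, c, \<epsilon>, d, g, s) \<in> T1" using that NT1 by blast
    have d: "d \<noteq> 0" using t emb_eq_0_iff[of \<epsilon>] by auto
    have "u = 0" "d = 1" using t1 t d by auto
    then show ?thesis using t by auto
  qed
  have conj2: "y \<in> N" if "w \<in> N" "move \<otimes>\<^bsub>K2\<^esub> w = y \<otimes>\<^bsub>K2\<^esub> move" "y \<in> carrier K2" for w y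
    by (rule K2.normal_comm_mem[OF assms(2) that(1) move_mem that(3,2)])
  have v0: "v = 0" if N: "(e, z, v, u, c, \<epsilon>, d, g, s) \<in> N" for e z v u c \<epsilon> d g s
  proof -
    have "(e, z + emb e, v, lam 1 * v, 0, 1, 1, 1, False) \<in> N"
      using torus[OF N] by (intro conj2[OF N]) (auto simp: move_def)
    then show ?thesis using torus[of e _ v "lam 1 * v"] by auto
  qed
  have z0: "z = 0" if N: "(e, z, v, u, c, \<epsilon>, d, g, s) \<in> N" for e z v u c \<epsilon> d g s
  proof -
    have "to_K1 (e, z, v, u, c, \<epsilon>, d, g, s) \<in> to_K1 ` N" using N by blast
    then have "(e, vec2 0 (- z), 1, mat 1, False) \<in> to_K1 ` N"
      by (rule K1.normal_comm_mem[OF assms(3) _ weyl_mem])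
        (use torus[OF N] v0[OF N] in \<open>auto simp: weyl_def vec_eq2\<close>)
    then obtain y where y: "y \<in> N" "(e, vec2 0 (- z), 1, mat 1, False) = to_K1 y" by blast
    obtain e' z' v' u' c' \<epsilon>' d' g' s' where ye: "y = (e', z', v', u', c', \<epsilon>', d', g', s')" by (cases y rule: k2_cases)
    have "v' = - z" using y(2) by (simp add: ye vec_eq2)
    moreover have "v' = 0" using v0 y(1) unfolding ye by blast
    ultimately show ?thesis by simp
  qed
  obtain e z v u c \<epsilon> d g s where xe: "x = (e, z, v, u, c, \<epsilon>, d, g, s)" by (cases x rule: k2_cases)
  note N = x[unfolded xe]
  have "(e, z + emb e, v, lam 1 * v, 0, 1, 1, 1, False) \<in> N"
    using torus[OF N] by (intro conj2[OF N]) (auto simp: move_def)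
  then have "z + emb e = 0" by (rule z0)
  then show "x \<in> {\<one>\<^bsub>K2\<^esub>}" using torus[OF N] v0[OF N] z0[OF N] by (simp add: xe)
qed

text \<open>The entry \<open>u\<close> alone takes the line of \<open>weyl\<close> to that of
  \<open>k\<close>, but \<open>weyl\<close> would conjugate it out of the common subgroup. A
  component \<open>v\<close> is added whose image under \<open>move\<close> cancels
  \<open>u\<close>. What is left is a translation that \<open>weyl\<close> sends into the center of
  \<open>S\<close>, and with \<open>e = 0\<close> this commutes with \<open>move\<close>.\<close>

lemma unipotent_step:
  assumes k: "k \<in> carrier K1" "k \<notin> C1"
  shows "\<exists>q\<in>C2. \<exists>w\<in>C2. \<exists>w'\<in>C2. \<exists>w''\<in>C2. inv\<^bsub>K1\<^esub> (to_K1 q \<otimes>\<^bsub>K1\<^esub> weyl) \<otimes>\<^bsub>K1\<^esub> k \<in> C1 \<and>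
    move \<otimes>\<^bsub>K2\<^esub> q = w \<otimes>\<^bsub>K2\<^esub> move \<and> weyl \<otimes>\<^bsub>K1\<^esub> to_K1 w = to_K1 w' \<otimes>\<^bsub>K1\<^esub> weyl \<and>
    move \<otimes>\<^bsub>K2\<^esub> w' = w'' \<otimes>\<^bsub>K2\<^esub> move"
proof -
  obtain e v \<epsilon> A s where ke: "k = (e, v, \<epsilon>, A, s)" by (cases k)
  have A: "A $ 2 $ 1 \<noteq> 0" using k by (simp add: ke)
  define u where "u = A $ 1 $ 1 / A $ 2 $ 1"
  \<comment> \<open>Conjugation by \<open>move\<close> adds \<open>lam 1 * y\<close> to
    \<open>u\<close>; this choice makes the sum vanish.\<close>
  define y where "y = - u / lam 1"
  have l: "lam 1 * y = - u" by (simp add: y_def)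
  let ?q = "(0, 0, y, u, 0, 1, 1, 1, False)" and ?w = "(0, 0, y, 0, 0, 1, 1, 1, False)"
    and ?w' = "(0, y, 0, 0, 0, 1, 1, 1, False)"
  have "inv\<^bsub>K1\<^esub> (to_K1 ?q \<otimes>\<^bsub>K1\<^esub> weyl) \<otimes>\<^bsub>K1\<^esub> k \<in> C1"
  proof -
    have c: "to_K1 ?q \<otimes>\<^bsub>K1\<^esub> weyl \<in> carrier K1" by (intro K1.m_closed weyl_mem) simp
    show ?thesis using k(1) c unfolding ke weyl_def to_K1_eq K1_mult
      by (subst C1_coset_iff) (use A in \<open>auto simp: u_def\<close>)
  qed
  moreover have "move \<otimes>\<^bsub>K2\<^esub> ?q = ?w \<otimes>\<^bsub>K2\<^esub> move" by (simp add: move_def l)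
  moreover have "weyl \<otimes>\<^bsub>K1\<^esub> to_K1 ?w = to_K1 ?w' \<otimes>\<^bsub>K1\<^esub> weyl" by (simp add: weyl_def vec_eq2)
  moreover have "move \<otimes>\<^bsub>K2\<^esub> ?w' = ?w' \<otimes>\<^bsub>K2\<^esub> move" by (simp add: move_def)
  moreover have "?q \<in> C2" "?w \<in> C2" "?w' \<in> C2" by simp_all
  ultimately show ?thesis by blast
qed

text \<open>The nonzero squares are the fourth roots of unity, that is, the signs and the signs
  times the square of \<open>\<omega>\<close>. Which of the two kinds \<open>c ^ 2\<close> is
  decides whether a field automorphism is needed.\<close>

lemma square_classes: "c \<noteq> 0 \<Longrightarrow> \<exists>\<epsilon> s. \<epsilon> * \<epsilon> = 1 \<and> emb \<epsilon> * c ^ 2 = \<mu> s"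
proof -
  have "\<forall>c. c \<noteq> 0 \<longrightarrow> (\<exists>\<epsilon>\<in>{1,-1}. \<exists>s\<in>{True, False}. emb \<epsilon> * c ^ 2 = \<mu> s)"
    unfolding all_gf9 all_3 by (simp add: emb_def gf9_defs \<mu>_def \<omega>_def power2_eq_square) blast
  moreover assume "c \<noteq> 0"
  ultimately obtain \<epsilon> s where "\<epsilon> \<in> {1, -1}" "emb \<epsilon> * c ^ 2 = \<mu> s" by blast
  then show ?thesis by (intro exI[of _ \<epsilon>] exI[of _ s]) auto
qed

text \<open>The matrix of \<open>q\<close> has diagonal \<open>\<eta> c\<close>,
  \<open>\<eta>\<close>, and \<open>weyl\<close> interchanges the two entries. So \<open>q\<close>
  multiplies labels by \<open>c\<close>, up to field automorphism, and takes 1 to \<open>c\<close>.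
  Its conjugate \<open>t\<close> multiplies them by \<open>\<eta> (\<eta> c) / c = 1\<close> and
  commutes with \<open>move\<close>. Membership in the group is the condition
  \<open>emb \<eta> * c ^ 2 = \<mu> r\<close>, which for nonsquare \<open>c\<close> requires the
  field automorphism.\<close>

lemma torus_step:
  assumes k: "k \<in> carrier K2" "k \<notin> C2"
  shows "\<exists>q\<in>C2. \<exists>t\<in>C2. \<exists>t'\<in>C2. inv\<^bsub>K2\<^esub> (q \<otimes>\<^bsub>K2\<^esub> move) \<otimes>\<^bsub>K2\<^esub> k \<in> C2 \<and>
    weyl \<otimes>\<^bsub>K1\<^esub> to_K1 q = to_K1 t \<otimes>\<^bsub>K1\<^esub> weyl \<and> move \<otimes>\<^bsub>K2\<^esub> t = t \<otimes>\<^bsub>K2\<^esub> move \<and>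
    weyl \<otimes>\<^bsub>K1\<^esub> to_K1 t = to_K1 t' \<otimes>\<^bsub>K1\<^esub> weyl"
proof -
  obtain e z v u c \<epsilon> d g s where ke: "k = (e, z, v, u, c, \<epsilon>, d, g, s)" by (cases k rule: k2_cases)
  have c: "c \<noteq> 0" using k by (simp add: ke)
  obtain \<eta> r where \<eta>: "\<eta> * \<eta> = 1" "emb \<eta> * c ^ 2 = \<mu> r" using square_classes[OF c] by blast
  have \<eta>2: "emb \<eta> * emb \<eta> = 1" "emb \<eta> * (emb \<eta> * x) = x" for x
    using \<eta>(1) by (metis emb_simps(2,4), metis emb_simps(2,4) mult.assoc mult_1)
  let ?q = "(0, 0, 0, 0, 0, \<eta>, emb \<eta>, c, r)" and ?t = "(0, 0, 0, 0, 0, \<eta>, emb \<eta> * c, inverse c, r)"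
  have q: "?q \<in> C2" using \<eta> \<eta>2 by (simp add: power2_eq_square)
  have t: "?t \<in> C2"
  proof -
    have "(emb \<eta> * c) ^ 2 * inverse c = c" using \<eta>2 c by (simp add: power2_eq_square ac_simps)
    then show ?thesis using \<eta> by simp
  qed
  have f1: "frob r 1 = 1" "frob r (-1) = -1" by simp_all
  have "inv\<^bsub>K2\<^esub> (?q \<otimes>\<^bsub>K2\<^esub> move) \<otimes>\<^bsub>K2\<^esub> k \<in> C2"
  proof -
    have m: "?q \<otimes>\<^bsub>K2\<^esub> move \<in> carrier K2" using q subsets2(9) move_mem by blast
    show ?thesis using k(1) m unfolding ke move_def K2_mult
      by (subst C2_coset_iff) (use \<eta>2 in \<open>auto simp: mult.assoc\<close>)
  qed
  moreover have "weyl \<otimes>\<^bsub>K1\<^esub> to_K1 ?q = to_K1 ?t \<otimes>\<^bsub>K1\<^esub> weyl" "weyl \<otimes>\<^bsub>K1\<^esub> to_K1 ?t = to_K1 ?q \<otimes>\<^bsub>K1\<^esub> weyl"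
    using \<eta>2 c by (simp_all add: weyl_def vec_eq2 ac_simps)
  moreover have "move \<otimes>\<^bsub>K2\<^esub> ?t = ?t \<otimes>\<^bsub>K2\<^esub> move"
    using \<eta>2 c by (simp add: move_def mult.assoc)
  ultimately show ?thesis using q t by blast
qed

section \<open>Elementary abelian groups, semidirect products and Sylow subgroups\<close>

definition int3 :: "3 \<Rightarrow> int" where "int3 x = (if x = 0 then 0 else if x = 1 then 1 else 2)"

lemma int3_add: "int3 (x + y) = (int3 x + int3 y) mod 3"
  using three_cases[of x] three_cases[of y] by (auto simp: int3_def)

lemma int3_inj [simp]: "int3 x = int3 y \<longleftrightarrow> x = y"
  using three_cases[of x] three_cases[of y] by (auto simp: int3_def)

lemma int3_bounds: "0 \<le> int3 x" "int3 x < 3"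
  by (auto simp: int3_def)

lemma elem_abelian_simps:
  "carrier (elem_abelian 3 k) = {..<k} \<rightarrow>\<^sub>E {0..<3}"
  "x \<otimes>\<^bsub>elem_abelian 3 k\<^esub> y = (\<lambda>i\<in>{..<k}. (x i + y i) mod 3)"
  by (simp_all add: elem_abelian_def carrier_integer_mod_group)

lemma group_elem_abelian: "group (elem_abelian p k)"
  by (simp add: elem_abelian_def)

lemma card_elem_abelian: "card (carrier (elem_abelian 3 k)) = 3 ^ k"
  by (simp add: elem_abelian_simps card_PiE)

text \<open>Additive functions that jointly separate points embed the group into the product, and
  equal cardinality makes the embedding onto.\<close>

lemma elem_abelian_coordinates:
  fixes q :: "nat \<Rightarrow> 'a::{ab_group_add, finite} \<Rightarrow> 3"
  assumes add: "\<And>i x y. q i (x + y) = q i x + q i y"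
    and inj: "\<And>x y. (\<And>i. i < k \<Longrightarrow> q i x = q i y) \<Longrightarrow> x = y"
    and card: "CARD('a) = 3 ^ k"
  obtains f where "bij_betw f (UNIV :: 'a set) (carrier (elem_abelian 3 k))"
    "\<And>x y. f (x + y) = f x \<otimes>\<^bsub>elem_abelian 3 k\<^esub> f y"
proof -
  define f where "f x = (\<lambda>i\<in>{..<k}. int3 (q i x))" for x
  have "inj f"
  proof (rule injI)
    fix x y assume "f x = f y"
    then have "int3 (q i x) = int3 (q i y)" if "i < k" for i
      using that unfolding f_def by (metis lessThan_iff restrict_apply')
    then show "x = y" by (intro inj) simp
  qed
  moreover have "range f \<subseteq> carrier (elem_abelian 3 k)"
    by (auto simp: f_def elem_abelian_simps int3_bounds split: if_splits)
  moreover have "card (range f) = card (carrier (elem_abelian 3 k))"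
    using \<open>inj f\<close> card by (simp add: card_image card_elem_abelian)
  moreover have "finite (carrier (elem_abelian 3 k))" by (simp add: elem_abelian_simps finite_PiE)
  ultimately have "range f = carrier (elem_abelian 3 k)" by (intro card_subset_eq)
  then have "bij_betw f UNIV (carrier (elem_abelian 3 k))"
    using \<open>inj f\<close> by (simp add: bij_betw_def)
  moreover have "f (x + y) = f x \<otimes>\<^bsub>elem_abelian 3 k\<^esub> f y" for x y
    by (auto simp: f_def elem_abelian_simps add int3_add)
  ultimately show thesis using that by blast
qed

lemma elem_abelian_3:
  obtains f where "bij_betw f (UNIV :: 3 set) (carrier (elem_abelian 3 1))"
    "\<And>x y. f (x + y) = f x \<otimes>\<^bsub>elem_abelian 3 1\<^esub> f y"
  by (rule elem_abelian_coordinates[where q = "\<lambda>i x. x" and k = 1 and 'a = 3]) auto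

lemma elem_abelian_81:
  obtains f where "bij_betw f (UNIV :: (gf9 ^ 2) set) (carrier (elem_abelian 3 4))"
    "\<And>x y. f (x + y) = f x \<otimes>\<^bsub>elem_abelian 3 4\<^esub> f y"
proof (rule elem_abelian_coordinates[where 'a = "gf9 ^ 2" and k = 4 and q = "\<lambda>i v. if i = 0 then gf9_re (v $ 1)
    else if i = 1 then gf9_im (v $ 1) else if i = 2 then gf9_re (v $ 2) else gf9_im (v $ 2)"])
  fix x y :: "gf9 ^ 2"
  assume *: "\<And>i. i < 4 \<Longrightarrow> (if i = (0::nat) then gf9_re (x $ 1)
    else if i = 1 then gf9_im (x $ 1) else if i = 2 then gf9_re (x $ 2) else gf9_im (x $ 2)) =
    (if i = 0 then gf9_re (y $ 1)
    else if i = 1 then gf9_im (y $ 1) else if i = 2 then gf9_re (y $ 2) else gf9_im (y $ 2))"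
  show "x = y" using *[of 0] *[of 1] *[of 2] *[of 3] by (auto simp: vec_eq2 gf9.expand)
qed (auto simp: plus_gf9_def card_gf9)

lemma elem_abelian_243:
  obtains f where "bij_betw f (UNIV :: (3 \<times> (gf9 ^ 2)) set) (carrier (elem_abelian 3 5))"
    "\<And>x y. f (x + y) = f x \<otimes>\<^bsub>elem_abelian 3 5\<^esub> f y"
proof (rule elem_abelian_coordinates[where 'a = "3 \<times> (gf9 ^ 2)" and k = 5 and q = "\<lambda>i (e, v). if i = 0 then gf9_re (v $ 1)
    else if i = 1 then gf9_im (v $ 1) else if i = 2 then gf9_re (v $ 2) else if i = 3 then gf9_im (v $ 2) else e"])
  fix x y :: "3 \<times> (gf9 ^ 2)"
  assume *: "\<And>i. i < 5 \<Longrightarrow> (case x of (e, v) \<Rightarrow> if i = (0::nat) then gf9_re (v $ 1)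
    else if i = 1 then gf9_im (v $ 1) else if i = 2 then gf9_re (v $ 2) else if i = 3 then gf9_im (v $ 2) else e) =
    (case y of (e, v) \<Rightarrow> if i = 0 then gf9_re (v $ 1)
    else if i = 1 then gf9_im (v $ 1) else if i = 2 then gf9_re (v $ 2) else if i = 3 then gf9_im (v $ 2) else e)"
  show "x = y" using *[of 0] *[of 1] *[of 2] *[of 3] *[of 4] by (cases x; cases y) (auto simp: vec_eq2 gf9.expand)
qed (auto simp: plus_gf9_def card_gf9)

text \<open>The action \<open>\<phi>\<close> is conjugation, transported along \<open>f\<close> and
  \<open>h\<close>; \<open>F\<close> inverts the multiplication of a normal part with a complement
  part. The clause on \<open>F n\<close> records that the given normal subgroup, and not merely a
  copy of it, becomes the normal factor.\<close>

lemma (in group) internal_semidirect: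
  assumes N: "N \<lhd> G" and K: "subgroup K G" and NK: "N \<inter> K \<subseteq> {\<one>}"
    and gen: "\<And>g. g \<in> carrier G \<Longrightarrow> \<exists>n\<in>N. \<exists>k\<in>K. g = n \<otimes> k"
    and N': "group N'" and f: "f \<in> iso (sub G N) N'" and K': "group K'" and h: "h \<in> iso K' (sub G K)"
  shows "\<exists>\<phi> \<in> hom K' (AutoGroup N'). \<exists>F \<in> iso G (semidirect N' K' \<phi>). \<forall>n\<in>N. F n = (f n, \<one>\<^bsub>K'\<^esub>)"
proof -
  interpret N': group N' by fact
  interpret K': group K' by fact
  have sN: "subgroup N G" using N by (rule normal_imp_subgroup)
  have Nc: "n \<in> carrier G" if "n \<in> N" for n using that sN by (rule subgroup.mem_carrier[rotated])
  have Kc: "k \<in> carrier G" if "k \<in> K" for k using that K by (rule subgroup.mem_carrier[rotated])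
  define fi where "fi = inv_into N f"
  have fbij: "bij_betw f N (carrier N')" using f by (simp add: iso_def)
  have fm: "f (x \<otimes> y) = f x \<otimes>\<^bsub>N'\<^esub> f y" if "x \<in> N" "y \<in> N" for x y
    using f that by (auto simp: iso_def hom_def)
  have fi: "fi x \<in> N" "f (fi x) = x" if "x \<in> carrier N'" for x
    using fbij that by (auto simp: fi_def bij_betw_def inv_into_into f_inv_into_f)
  have fif: "fi (f n) = n" if "n \<in> N" for n using fbij that by (simp add: fi_def bij_betw_def)
  have fN: "f n \<in> carrier N'" if "n \<in> N" for n using fbij that by (auto simp: bij_betw_def)
  have hbij: "bij_betw h (carrier K') K" using h by (simp add: iso_def)
  have hK: "h k \<in> K" if "k \<in> carrier K'" for k using hbij that by (auto simp: bij_betw_def)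
  have hm: "h (x \<otimes>\<^bsub>K'\<^esub> y) = h x \<otimes> h y" if "x \<in> carrier K'" "y \<in> carrier K'" for x y
    using h that by (auto simp: iso_def hom_def)
  have h1: "h \<one>\<^bsub>K'\<^esub> = \<one>"
  proof -
    have "h \<one>\<^bsub>K'\<^esub> \<otimes> h \<one>\<^bsub>K'\<^esub> = h \<one>\<^bsub>K'\<^esub>" using hm[of "\<one>\<^bsub>K'\<^esub>" "\<one>\<^bsub>K'\<^esub>"] by simp
    then show ?thesis using hK[of "\<one>\<^bsub>K'\<^esub>"] Kc by (metis K'.one_closed r_cancel_one')
  qed
  note [simp] = Nc Kc fi fif fN hK
  have conjN: "h k \<otimes> n \<otimes> inv (h k) \<in> N" if "k \<in> carrier K'" "n \<in> N" for k n
    using that N by (intro normal.inv_op_closed2) auto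
  define \<phi> where "\<phi> k = (\<lambda>x\<in>carrier N'. f (h k \<otimes> fi x \<otimes> inv (h k)))" for k
  have \<phi>c: "\<phi> k x \<in> carrier N'" if "k \<in> carrier K'" "x \<in> carrier N'" for k x
    using that conjN by (simp add: \<phi>_def)
  have \<phi>fi: "fi (\<phi> k x) = h k \<otimes> fi x \<otimes> inv (h k)" if "k \<in> carrier K'" "x \<in> carrier N'" for k x
    using that conjN by (simp add: \<phi>_def)
  have fi_mult: "fi (x \<otimes>\<^bsub>N'\<^esub> y) = fi x \<otimes> fi y" if "x \<in> carrier N'" "y \<in> carrier N'" for x y
  proof -
    have "fi x \<otimes> fi y \<in> N" using that sN by (simp add: subgroup.m_closed)
    moreover have "f (fi x \<otimes> fi y) = x \<otimes>\<^bsub>N'\<^esub> y" using that by (simp add: fm)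
    ultimately show ?thesis using fif by metis
  qed
  have fi_inj: "x = y" if "fi x = fi y" "x \<in> carrier N'" "y \<in> carrier N'" for x y
    using that fi(2) by metis
  have \<phi>_hom: "\<phi> k (x \<otimes>\<^bsub>N'\<^esub> y) = \<phi> k x \<otimes>\<^bsub>N'\<^esub> \<phi> k y"
    if k: "k \<in> carrier K'" and xy: "x \<in> carrier N'" "y \<in> carrier N'" for k x y
  proof (rule fi_inj)
    have "inv (h k) \<otimes> (h k \<otimes> (fi y \<otimes> inv (h k))) = fi y \<otimes> inv (h k)"
      using k xy by (simp add: m_assoc[symmetric])
    then show "fi (\<phi> k (x \<otimes>\<^bsub>N'\<^esub> y)) = fi (\<phi> k x \<otimes>\<^bsub>N'\<^esub> \<phi> k y)"
      using k xy by (simp add: \<phi>fi fi_mult \<phi>c m_assoc)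
  qed (use k xy \<phi>c in auto)
  have \<phi>_mult: "\<phi> (k \<otimes>\<^bsub>K'\<^esub> l) x = \<phi> k (\<phi> l x)"
    if k: "k \<in> carrier K'" "l \<in> carrier K'" and x: "x \<in> carrier N'" for k l x
    by (rule fi_inj) (use k x \<phi>c in \<open>simp_all add: \<phi>fi hm inv_mult_group m_assoc\<close>)
  have \<phi>_one: "\<phi> \<one>\<^bsub>K'\<^esub> x = x" if x: "x \<in> carrier N'" for x
    by (rule fi_inj) (use x \<phi>c in \<open>simp_all add: \<phi>fi h1\<close>)
  have "(\<lambda>k. \<lambda>x\<in>carrier N'. \<phi> k x) \<in> hom K' (BijGroup (carrier N'))"
    using K' \<phi>c \<phi>_one \<phi>_mult by (intro hom_BijGroupI)
  moreover have "(\<lambda>k. \<lambda>x\<in>carrier N'. \<phi> k x) = \<phi>" by (auto simp: \<phi>_def fun_eq_iff)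
  ultimately have \<phi>B: "\<phi> \<in> hom K' (BijGroup (carrier N'))" by simp
  have "\<phi> k \<in> auto N'" if "k \<in> carrier K'" for k
    using that \<phi>B \<phi>_hom \<phi>c by (auto simp: auto_def hom_def BijGroup_def)
  then have \<phi>: "\<phi> \<in> hom K' (AutoGroup N')"
    using \<phi>B by (auto simp: AutoGroup_def hom_def)
  let ?P = "semidirect N' K' \<phi>"
  have Pc: "carrier ?P = carrier N' \<times> carrier K'" by (simp add: semidirect_def)
  have Pm: "(x, k) \<otimes>\<^bsub>?P\<^esub> (y, l) = (x \<otimes>\<^bsub>N'\<^esub> \<phi> k y, k \<otimes>\<^bsub>K'\<^esub> l)" for x k y l by (simp add: semidirect_def)
  define E where "E = (\<lambda>(x, k). fi x \<otimes> h k)"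
  have E_mult: "E (p \<otimes>\<^bsub>?P\<^esub> q) = E p \<otimes> E q" if pq: "p \<in> carrier ?P" "q \<in> carrier ?P" for p q
  proof -
    obtain x k y l where e: "p = (x, k)" "q = (y, l)" by (cases p; cases q)
    have m: "x \<in> carrier N'" "k \<in> carrier K'" "y \<in> carrier N'" "l \<in> carrier K'" using pq by (auto simp: Pc e)
    have "inv (h k) \<otimes> (h k \<otimes> h l) = h l" using m by (simp add: m_assoc[symmetric])
    then show ?thesis
      using m by (simp add: e Pm E_def fi_mult \<phi>c \<phi>fi hm m_assoc)
  qed
  have E_bij: "bij_betw E (carrier ?P) (carrier G)"
    unfolding bij_betw_def
  proof
    show "inj_on E (carrier ?P)"
    proof (rule inj_onI)
      fix p q assume pq: "p \<in> carrier ?P" "q \<in> carrier ?P" and eq: "E p = E q"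
      obtain x k y l where e: "p = (x, k)" "q = (y, l)" by (cases p; cases q)
      have m: "x \<in> carrier N'" "k \<in> carrier K'" "y \<in> carrier N'" "l \<in> carrier K'" using pq by (auto simp: Pc e)
      have eq': "fi x \<otimes> h k = fi y \<otimes> h l" using eq by (simp add: e E_def)
      have "inv (fi y) \<otimes> fi x = inv (fi y) \<otimes> (fi x \<otimes> h k) \<otimes> inv (h k)" using m by (simp add: m_assoc)
      also have "\<dots> = h l \<otimes> inv (h k)" unfolding eq' using m by (simp add: m_assoc[symmetric])
      finally have z: "inv (fi y) \<otimes> fi x = h l \<otimes> inv (h k)" .
      have "inv (fi y) \<otimes> fi x \<in> N" using m sN by (simp add: subgroup.m_closed subgroup.m_inv_closed)
      moreover have "h l \<otimes> inv (h k) \<in> K" using m K by (simp add: subgroup.m_closed subgroup.m_inv_closed)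
      ultimately have 1: "inv (fi y) \<otimes> fi x = \<one>" "h l \<otimes> inv (h k) = \<one>" using NK z by auto
      have "fi x = fi y \<otimes> (inv (fi y) \<otimes> fi x)" using m by (simp add: m_assoc[symmetric])
      then have "fi x = fi y" using 1 m by simp
      moreover have "h l = (h l \<otimes> inv (h k)) \<otimes> h k" using m by (simp add: m_assoc)
      then have "h l = h k" using 1 m by simp
      ultimately show "p = q" using m fi_inj hbij by (auto simp: e bij_betw_def dest: inj_onD)
    qed
    show "E ` carrier ?P = carrier G"
    proof (intro equalityI subsetI)
      fix g assume "g \<in> carrier G"
      then obtain n k where nk: "n \<in> N" "k \<in> K" "g = n \<otimes> k" using gen by blast
      obtain l where l: "l \<in> carrier K'" "k = h l" using hbij nk(2) by (auto simp: bij_betw_def)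
      have "g = E (f n, l)" using nk l by (simp add: E_def)
      moreover have "(f n, l) \<in> carrier ?P" using nk l by (simp add: Pc)
      ultimately show "g \<in> E ` carrier ?P" by blast
    qed (auto simp: Pc E_def)
  qed
  define F where "F = inv_into (carrier ?P) E"
  have F: "F g \<in> carrier ?P" "E (F g) = g" if "g \<in> carrier G" for g
    using E_bij that by (auto simp: F_def bij_betw_def inv_into_into f_inv_into_f)
  have P_closed: "p \<otimes>\<^bsub>?P\<^esub> q \<in> carrier ?P" if "p \<in> carrier ?P" "q \<in> carrier ?P" for p q
    using that by (cases p; cases q) (auto simp: Pc Pm \<phi>c)
  have FE: "F (E p) = p" if "p \<in> carrier ?P" for p
    using E_bij that by (simp add: F_def bij_betw_def)
  have "F \<in> hom G ?P"
  proof (rule homI)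
    fix x y assume xy: "x \<in> carrier G" "y \<in> carrier G"
    then have "E (F x \<otimes>\<^bsub>?P\<^esub> F y) = x \<otimes> y" using F by (simp add: E_mult)
    then show "F (x \<otimes> y) = F x \<otimes>\<^bsub>?P\<^esub> F y" using FE[OF P_closed] F xy by metis
  qed (use F in auto)
  moreover have "bij_betw F (carrier G) (carrier ?P)"
    unfolding F_def using E_bij by (rule bij_betw_inv_into)
  ultimately have "F \<in> iso G ?P" by (simp add: iso_def)
  moreover have "F n = (f n, \<one>\<^bsub>K'\<^esub>)" if "n \<in> N" for n
    using FE[of "(f n, \<one>\<^bsub>K'\<^esub>)"] that by (simp add: Pc E_def h1)
  ultimately show ?thesis using \<phi> by blast
qed

text \<open>Orbits have \<open>p\<close>-power size. If none were a single point, \<open>p\<close>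
  would divide the sum of their sizes.\<close>

lemma p_group_fixed_point:
  assumes "group_action P E \<phi>" "finite E" and p: "prime p" "order P = p ^ n" "\<not> p dvd card E"
  shows "\<exists>x\<in>E. \<forall>g\<in>carrier P. \<phi> g x = x"
proof (rule ccontr)
  interpret group_action P E \<phi> by fact
  assume neg: "\<not> ?thesis"
  have "p dvd card orb" if orb: "orb \<in> orbits P E \<phi>" for orb
  proof -
    obtain x where x: "x \<in> E" "orb = orbit P \<phi> x" using orb by (auto simp: orbits_def)
    have "card orb dvd p ^ n" using orbit_stabilizer_theorem[OF x(1)] x(2) p(2) by (metis dvd_triv_left)
    then obtain i where i: "card orb = p ^ i" using p(1) by (auto simp: divides_primepow_nat)
    have "i \<noteq> 0"
    proof
      assume "i = 0"
      then have "card orb = 1" using i by simp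
      then obtain y where y: "orb = {y}" by (rule card_1_singletonE)
      have "x \<in> orb" using orbit_refl x by simp
      then have "\<phi> g x = x" if "g \<in> carrier P" for g using that y x(2) by (auto simp: orbit_def)
      then show False using neg x(1) by blast
    qed
    then show ?thesis using i by simp
  qed
  then have "p dvd (\<Sum>orb\<in>orbits P E \<phi>. card orb)" by (rule dvd_sum)
  moreover have "(\<Sum>orb\<in>orbits P E \<phi>. card orb) = card E"
    using disjoint_sum[OF assms(2), of "\<lambda>_. 1 :: nat"] by simp
  ultimately show False using p(3) by simp
qed

text \<open>\<open>Q\<close> acts by right multiplication on the right cosets of \<open>P\<close>,
  whose number is prime to \<open>p\<close>. A fixed coset \<open>P x\<close> says that
  \<open>x\<close> conjugates \<open>Q\<close> into \<open>P\<close>, and the orders agree.\<close>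

lemma (in group) Sylow_conjugate:
  assumes fin: "finite (carrier G)" and p: "prime p" and P: "P \<in> Syl p G" and Q: "Q \<in> Syl p G"
  shows "\<exists>g\<in>carrier G. Q = g <# P #> inv g"
proof -
  have sP: "subgroup P G" and sQ: "subgroup Q G" and cP: "card P = p ^ multiplicity p (order G)"
    and cQ: "card Q = card P" using P Q by (auto simp: Syl_def)
  have Pc: "P \<subseteq> carrier G" and Qc: "Q \<subseteq> carrier G" using sP sQ by (auto dest: subgroup.subset)
  interpret Q: group "sub G Q" using sQ by (rule subgroup_imp_group)
  have ord: "order G \<noteq> 0" using fin order_gt_0_iff_finite by simp
  have rc: "\<exists>x\<in>carrier G. C = P #> x" if "C \<in> rcosets P" for C using that by (auto simp: RCOSETS_def)
  have "(\<lambda>k. \<lambda>C\<in>rcosets P. C #> inv k) \<in> hom (sub G Q) (BijGroup (rcosets P))"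
  proof (rule hom_BijGroupI)
    show "group (sub G Q)" by (rule Q.is_group)
    fix C assume C: "C \<in> rcosets P"
    obtain x where x: "x \<in> carrier G" "C = P #> x" using rc[OF C] by blast
    show "C #> inv \<one>\<^bsub>sub G Q\<^esub> = C" using x Pc by (simp add: coset_mult_assoc)
    fix k assume k: "k \<in> carrier (sub G Q)"
    then have kc: "k \<in> carrier G" using Qc by auto
    show "C #> inv k \<in> rcosets P" using x kc Pc by (simp add: coset_mult_assoc rcosetsI)
    fix l assume l: "l \<in> carrier (sub G Q)"
    then have lc: "l \<in> carrier G" using Qc by auto
    show "C #> inv (k \<otimes>\<^bsub>sub G Q\<^esub> l) = C #> inv l #> inv k"
      using x kc lc Pc by (simp add: coset_mult_assoc inv_mult_group m_assoc)
  qed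
  then have act: "group_action (sub G Q) (rcosets P) (\<lambda>k. \<lambda>C\<in>rcosets P. C #> inv k)"
    using group_BijGroup by (simp add: group_action_def group_hom_def group_hom_axioms_def Q.is_group)
  have "\<not> p dvd card (rcosets P)"
  proof
    assume "p dvd card (rcosets P)"
    then have "p ^ Suc (multiplicity p (order G)) dvd order G"
      using lagrange[OF sP] cP by (metis mult_dvd_mono dvd_refl power_Suc)
    then have "Suc (multiplicity p (order G)) \<le> multiplicity p (order G)"
      using ord p not_prime_unit[of p] by (intro multiplicity_geI) auto
    then show False by simp
  qed
  moreover have "finite (rcosets P)" using fin by (simp add: RCOSETS_def)
  moreover have "order (sub G Q) = p ^ multiplicity p (order G)" using cP cQ by (simp add: order_def)
  ultimately have "\<exists>C\<in>rcosets P. \<forall>k\<in>carrier (sub G Q). (\<lambda>C\<in>rcosets P. C #> inv k) C = C"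
    using p by (intro p_group_fixed_point[OF act])
  then obtain C where C: "C \<in> rcosets P" "\<And>k. k \<in> Q \<Longrightarrow> C #> inv k = C" by force
  obtain x where x: "x \<in> carrier G" "C = P #> x" using rc[OF C(1)] by blast
  have mem: "x \<otimes> k \<otimes> inv x \<in> P" if k: "k \<in> Q" for k
  proof -
    have kc: "k \<in> carrier G" and ik: "inv k \<in> Q" using k Qc sQ by (auto simp: subgroup.m_inv_closed)
    have "P #> (x \<otimes> k) = P #> x" using C(2)[OF ik] x kc Pc by (simp add: coset_mult_assoc)
    then show ?thesis
      using coset_mult_inv2[of P "x \<otimes> k" x] x kc Pc sP by (metis coset_join1 inv_closed m_closed)
  qed
  have "Q \<subseteq> inv x <# P #> inv (inv x)"
  proof
    fix k assume k: "k \<in> Q"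
    then have kc: "k \<in> carrier G" using Qc by auto
    have "k = inv x \<otimes> (x \<otimes> k \<otimes> inv x) \<otimes> inv (inv x)"
    proof -
      have "inv x \<otimes> (x \<otimes> k \<otimes> inv x) \<otimes> inv (inv x) = (inv x \<otimes> x) \<otimes> k \<otimes> (inv x \<otimes> x)"
        using x kc by (simp only: m_assoc inv_inv inv_closed m_closed)
      then show ?thesis using x kc by simp
    qed
    then show "k \<in> inv x <# P #> inv (inv x)" using mem[OF k] unfolding l_coset_def r_coset_def by blast
  qed
  moreover have "card (inv x <# P #> inv (inv x)) = card P"
  proof -
    have "inv x <# P #> inv (inv x) = (\<lambda>y. inv x \<otimes> y \<otimes> inv (inv x)) ` P"
      by (auto simp: l_coset_def r_coset_def)
    moreover have "inj_on (\<lambda>y. inv x \<otimes> y \<otimes> inv (inv x)) P"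
      using x Pc by (auto simp: inj_on_def subset_iff)
    ultimately show ?thesis by (simp add: card_image)
  qed
  moreover have "finite (inv x <# P #> inv (inv x))"
    using fin Pc by (auto simp: l_coset_def r_coset_def finite_subset)
  ultimately have "Q = inv x <# P #> inv (inv x)" using cQ by (metis card_subset_eq)
  then show ?thesis using x by blast
qed

section \<open>Normal subgroups of given index\<close>

lemma (in group) pow_index_mem:
  assumes N: "N \<lhd> G" and x: "x \<in> carrier G" and fin: "finite (carrier G)"
  shows "x [^] index G N \<in> N"
proof -
  interpret Q: group "G Mod N" using N by (rule normal.factorgroup_is_group)
  have xQ: "N #> x \<in> carrier (G Mod N)" using x N by (simp add: carrier_FactGroup)
  have "finite (carrier (G Mod N))" using fin by (simp add: carrier_FactGroup)
  then have "(N #> x) [^]\<^bsub>G Mod N\<^esub> order (G Mod N) = \<one>\<^bsub>G Mod N\<^esub>" using xQ by (intro Q.pow_order_eq_1)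
  then have "N #> (x [^] order (G Mod N)) = N" using normal.FactGroup_pow[OF N x] by simp
  moreover have "order (G Mod N) = index G N" by (simp add: order_def index_def FactGroup_def)
  ultimately have "N #> (x [^] index G N) = N" by simp
  then show ?thesis using N x by (metis coset_join1 nat_pow_closed normal_imp_subgroup subgroup.subset)
qed

text \<open>In a cyclic group of order \<open>8 = d m\<close>, the \<open>d\<close>-th powers are
  the elements killed by \<open>m\<close>, and there are \<open>d\<close> values of the
  \<open>m\<close>-th power.\<close>

lemma gf9_powers:
  assumes "d = 2 \<and> m = 4 \<or> d = 4 \<and> m = (2::nat)"
  shows "c ^ m = 1 \<Longrightarrow> \<exists>y. y \<noteq> 0 \<and> (c::gf9) = y ^ d" "card ((\<lambda>c. c ^ m) ` {c::gf9. c \<noteq> 0}) = d"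
proof -
  have ex: "(\<exists>y::gf9. P y) \<longleftrightarrow> \<not> (\<forall>y. \<not> P y)" for P by blast
  have "\<forall>c::gf9. c ^ 4 = 1 \<longrightarrow> (\<exists>y. y \<noteq> 0 \<and> c = y ^ 2)" "\<forall>c::gf9. c ^ 2 = 1 \<longrightarrow> (\<exists>y. y \<noteq> 0 \<and> c = y ^ 4)"
    unfolding ex all_gf9 all_3 by (simp_all add: gf9_defs eval_nat_numeral)
  then show "c ^ m = 1 \<Longrightarrow> \<exists>y. y \<noteq> 0 \<and> c = y ^ d" using assms by auto
  have "(\<lambda>c. c ^ 4) ` {c::gf9. c \<noteq> 0} = {GF9 1 0, GF9 (-1) 0}" (is "?A = ?B")
  proof
    have "\<forall>c::gf9. c \<noteq> 0 \<longrightarrow> c ^ 4 \<in> ?B"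
      unfolding all_gf9 all_3 by (simp add: gf9_defs eval_nat_numeral)
    then show "?A \<subseteq> ?B" by blast
    have "GF9 1 0 = (GF9 1 0) ^ 4 \<and> GF9 1 0 \<noteq> 0" "GF9 (-1) 0 = (GF9 1 1) ^ 4 \<and> GF9 1 1 \<noteq> 0"
      by (simp_all add: gf9_defs eval_nat_numeral)
    then show "?B \<subseteq> ?A" by blast
  qed
  then have 1: "card ?A = 2" by simp
  have "(\<lambda>c. c ^ 2) ` {c::gf9. c \<noteq> 0} = {GF9 1 0, GF9 (-1) 0, GF9 0 1, GF9 0 (-1)}" (is "?A' = ?B'")
  proof
    have "\<forall>c::gf9. c \<noteq> 0 \<longrightarrow> c ^ 2 \<in> ?B'"
      unfolding all_gf9 all_3 by (simp add: gf9_defs eval_nat_numeral)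
    then show "?A' \<subseteq> ?B'" by blast
    have "GF9 1 0 = (GF9 1 0) ^ 2 \<and> GF9 1 0 \<noteq> 0" "GF9 (-1) 0 = (GF9 0 1) ^ 2 \<and> GF9 0 1 \<noteq> 0"
      "GF9 0 (-1) = (GF9 1 1) ^ 2 \<and> GF9 1 1 \<noteq> 0" "GF9 0 1 = (GF9 1 (-1)) ^ 2 \<and> GF9 1 (-1) \<noteq> 0"
      by (simp_all add: gf9_defs eval_nat_numeral)
    then show "?B' \<subseteq> ?A'" by blast
  qed
  then have 2: "card ?A' = 4" by simp
  show "card ((\<lambda>c. c ^ m) ` {c::gf9. c \<noteq> 0}) = d" using assms 1 2 by auto
qed

text \<open>A normal subgroup of index \<open>d\<close> prime to 3 contains all elements of order 3 and all \<open>d\<close>-th powers.\<close>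

lemma (in group) normal_of_index_eq:
  fixes \<kappa> :: "'a \<Rightarrow> gf9"
  assumes fin: "finite (carrier G)" and dm: "d = 2 \<and> m = 4 \<or> d = 4 \<and> m = (2::nat)"
    and mult: "\<And>x y. x \<in> carrier G \<Longrightarrow> y \<in> carrier G \<Longrightarrow> \<kappa> (x \<otimes> y) = \<kappa> x * \<kappa> y"
    and img: "\<kappa> ` carrier G = {c. c \<noteq> 0}"
    and ker: "\<And>N x. subgroup N G \<Longrightarrow> (\<And>y. y \<in> carrier G \<Longrightarrow> y [^] (3::nat) = \<one> \<Longrightarrow> y \<in> N) \<Longrightarrow>
      x \<in> carrier G \<Longrightarrow> \<kappa> x = 1 \<Longrightarrow> x \<in> N"
  shows "normal_of_index G d = sub G {x \<in> carrier G. \<kappa> x ^ m = 1}"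
    "subgroup {x \<in> carrier G. \<kappa> x ^ m = 1} G"
proof -
  let ?M = "{x \<in> carrier G. \<kappa> x ^ m = 1}"
  have nz: "\<kappa> x \<noteq> 0" if "x \<in> carrier G" for x using img that by blast
  have one: "\<kappa> \<one> = 1" using mult[of \<one> \<one>] nz[of \<one>] by simp
  have M: "?M = {x \<in> carrier G. \<kappa> x ^ m = \<kappa> \<one> ^ m}" by (simp add: one)
  have M_normal: "?M \<lhd> G" and sM: "subgroup ?M G"
    using normal_kernel_fun[OF subgroup_self, of "\<lambda>x. \<kappa> x ^ m" "(*)" ?M] M mult
    by (auto simp: power_mult_distrib)
  have inv: "\<kappa> (x \<otimes> inv y) = \<kappa> x / \<kappa> y" if "x \<in> carrier G" "y \<in> carrier G" for x y
  proof -
    have "\<kappa> (x \<otimes> inv y) * \<kappa> y = \<kappa> x" using that by (simp flip: mult add: m_assoc)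
    then show ?thesis using nz that by (simp add: field_simps)
  qed
  have pow: "\<kappa> (x [^] n) = \<kappa> x ^ n" if "x \<in> carrier G" for x and n :: nat
    using that by (induction n) (auto simp: one mult)
  have index_M: "index G ?M = d"
  proof -
    have "index G ?M = card ((\<lambda>x. \<kappa> x ^ m) ` carrier G)"
    proof (rule index_eq_card_image[OF sM])
      fix x y assume xy: "x \<in> carrier G" "y \<in> carrier G"
      have "\<kappa> y ^ m \<noteq> 0" using nz xy by simp
      then show "\<kappa> x ^ m = \<kappa> y ^ m \<longleftrightarrow> x \<otimes> inv y \<in> ?M"
        using xy by (simp add: inv power_divide)
    qed
    also have "(\<lambda>x. \<kappa> x ^ m) ` carrier G = (\<lambda>c. c ^ m) ` {c. c \<noteq> 0}" unfolding img[symmetric] image_image ..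
    finally show ?thesis using gf9_powers(2)[OF dm] by simp
  qed
  have unique: "N = ?M" if N: "N \<lhd> G" "index G N = d" for N
  proof -
    have sN: "subgroup N G" using N by (simp add: normal_imp_subgroup)
    have dN: "x [^] d \<in> N" if "x \<in> carrier G" for x using pow_index_mem[OF N(1) that fin] N(2) by simp
    have "coprime 3 d" using dm by (auto simp: prime_imp_coprime)
    then have ord3: "y \<in> N" if "y \<in> carrier G" "y [^] (3::nat) = \<one>" for y
      using coprime_pow_mem[OF sN that(1), of 3 d] dN that subgroup.one_closed[OF sN] by simp
    have "?M \<subseteq> N"
    proof
      fix x assume x: "x \<in> ?M"
      then obtain c where c: "c \<noteq> 0" "\<kappa> x = c ^ d" using gf9_powers(1)[OF dm] by blast
      then have "c \<in> \<kappa> ` carrier G" using img by simp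
      then obtain t where t: "t \<in> carrier G" "\<kappa> t = c" by blast
      have td: "t [^] d \<in> carrier G" using t by simp
      have "\<kappa> (x \<otimes> inv (t [^] d)) = 1" using x t c td by (simp add: inv pow)
      then have "x \<otimes> inv (t [^] d) \<in> N" using ker[OF sN ord3] x td by simp
      then have "x \<otimes> inv (t [^] d) \<otimes> t [^] d \<in> N" using dN[OF t(1)] sN by (simp add: subgroup.m_closed)
      then show "x \<in> N" using x td by (simp add: m_assoc)
    qed
    moreover have "card N = card ?M"
    proof -
      have "d * card N = d * card ?M"
        using lagrange[OF sN] lagrange[OF sM] N(2) index_M by (simp add: index_def)
      then show ?thesis using dm by auto
    qed
    moreover have "finite N" using fin subgroup.subset[OF sN] by (rule finite_subset[rotated])
    ultimately show ?thesis by (metis card_subset_eq)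
  qed
  have "(THE N. N \<lhd> G \<and> index G N = d) = ?M"
    by (rule the_equality) (use M_normal index_M unique in blast)+
  then show "normal_of_index G d = sub G ?M" by (simp add: normal_of_index_def)
  show "subgroup ?M G" by (rule sM)
qed

section \<open>Linear and affine groups\<close>

lemma GL_simps [simp]: "carrier GL = {A. invertible A}" "A \<otimes>\<^bsub>GL\<^esub> B = A ** B" "\<one>\<^bsub>GL\<^esub> = mat 1"
  by (simp_all add: GL_def)

lemma AGL_simps [simp]: "carrier AGL = UNIV \<times> {A. invertible A}"
  "(v, A) \<otimes>\<^bsub>AGL\<^esub> (w, B) = (v + A *v w, A ** B)" "\<one>\<^bsub>AGL\<^esub> = (0, mat 1)"
  by (simp_all add: AGL_def semidirect_def natural_module_def)

lemma carrier_ASL: "carrier ASL = UNIV \<times> {A. det A = 1}"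
  by (simp add: ASL_def semidirect_def natural_module_def SL_def)

lemma ASL_eq: "ASL = sub AGL (UNIV \<times> {A. det A = 1})"
  by (simp add: ASL_def AGL_def semidirect_def natural_module_def SL_def)

lemma invertible_cancel:
  fixes A :: "'f::field ^ 'n ^ 'n"
  assumes "invertible A"
  shows "A *v x = A *v y \<longleftrightarrow> x = y" "A ** B = A ** C \<longleftrightarrow> B = C"
proof -
  obtain A' where A': "A' ** A = mat 1" using assms by (auto simp: invertible_def)
  show "A *v x = A *v y \<longleftrightarrow> x = y" by (metis A' matrix_vector_mul_assoc matrix_vector_mul_lid)
  show "A ** B = A ** C \<longleftrightarrow> B = C" by (metis A' matrix_mul_assoc matrix_mul_lid)
qed

lemma invertible_mat_1 [simp]: "invertible (mat 1 :: 'f::field ^ 'n ^ 'n)"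
  unfolding invertible_def by (rule exI[of _ "mat 1"]) simp

lemma group_GL: "group (GL :: ('f::{field, finite} ^ 'n ^ 'n) monoid)"
  by (rule finite_groupI) (auto simp: invertible_mult matrix_mul_assoc invertible_cancel
      intro: finite_subset[OF subset_UNIV])

lemma group_AGL: "group (AGL :: (('f::{field, finite} ^ 'n) \<times> ('f ^ 'n ^ 'n)) monoid)"
  by (rule finite_groupI) (auto simp: invertible_mult matrix_mul_assoc invertible_cancel
      matrix_vector_right_distrib matrix_vector_mul_assoc add.assoc intro: finite_subset[OF subset_UNIV])

section \<open>The groups over the field with nine elements and their normal subgroups of index 2
  and 4\<close>

interpretation AGL2: group AGL2_9 by (rule group_AGL)
interpretation AGL1: group AGL1_9 by (rule group_AGL)
interpretation GL2: group GL2_9 by (rule group_GL)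
interpretation GL1: group GL1_9 by (rule group_GL)

lemma fin_AGL [simp]: "finite (X :: affine_2_9 set)"
  by (rule finite_subset[OF subset_UNIV]) simp

lemma inv2 [simp]: "invertible A \<longleftrightarrow> det A \<noteq> 0" for A :: "gf9 ^ 2 ^ 2"
  by (simp add: invertible_det_nz)

lemma inv1 [simp]: "invertible A \<longleftrightarrow> A $ 1 $ 1 \<noteq> 0" for A :: "gf9 ^ 1 ^ 1"
  by (simp add: invertible_det_nz det_def sign_id UNIV_1)

lemma pow3: "group G \<Longrightarrow> x \<in> carrier G \<Longrightarrow> x [^]\<^bsub>G\<^esub> (3::nat) = x \<otimes>\<^bsub>G\<^esub> x \<otimes>\<^bsub>G\<^esub> x"
  by (simp add: numeral_3_eq_3 group.is_monoid monoid.nat_pow_Suc monoid.l_one)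

lemma unipotent_cube: "upper t ** upper t ** upper t = mat 1" "lower t ** lower t ** lower t = mat 1"
  using gf9_char[of t] by (simp_all add: vec_eq2 add.assoc)

text \<open>The kernel condition holds because \<open>SL_2(9)\<close> is generated by unipotent
  matrices, whose cubes are trivial.\<close>

lemma GL2_index: "normal_of_index GL2_9 2 = sub GL {A. det A \<noteq> 0 \<and> det A ^ 4 = 1}"
  "subgroup {A. det A \<noteq> 0 \<and> det A ^ 4 = 1} GL2_9"
proof -
  have ker: "A \<in> N" if N: "subgroup N GL2_9"
    and ord3: "\<And>y. y \<in> carrier GL2_9 \<Longrightarrow> y [^]\<^bsub>GL2_9\<^esub> (3::nat) = \<one>\<^bsub>GL2_9\<^esub> \<Longrightarrow> y \<in> N"
    and "A \<in> carrier GL2_9" and A: "det A = 1" for N A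
  proof -
    have u: "upper t \<in> N" "lower t \<in> N" for t
      by (rule ord3; simp add: pow3[OF group_GL] unipotent_cube)+
    obtain k a b c where "A = lower k ** upper a ** lower b ** upper c" using SL2_unipotent[OF A] by blast
    then show ?thesis using u subgroup.m_closed[OF N] by simp
  qed
  have img: "det ` carrier GL2_9 = {c. c \<noteq> 0}"
  proof (intro equalityI subsetI)
    fix c :: gf9 assume "c \<in> {c. c \<noteq> 0}"
    then show "c \<in> det ` carrier GL2_9" by (intro image_eqI[of _ _ "mat2 c 0 0 1"]) auto
  qed auto
  have mult: "det (A \<otimes>\<^bsub>GL2_9\<^esub> B) = det A * det B" for A B by (simp add: det_mul)
  have fin: "finite (carrier GL2_9)" by (rule finite_subset[OF subset_UNIV]) simp
  have e: "{A \<in> carrier GL2_9. det A ^ 4 = 1} = {A. det A \<noteq> 0 \<and> det A ^ 4 = 1}" by auto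
  note r = GL2.normal_of_index_eq[OF fin, of 2 4 det, OF _ mult img ker]
  show "normal_of_index GL2_9 2 = sub GL {A. det A \<noteq> 0 \<and> det A ^ 4 = 1}"
    by (rule r(1)[unfolded e]) simp_all
  show "subgroup {A. det A \<noteq> 0 \<and> det A ^ 4 = 1} GL2_9"
    by (rule r(2)[unfolded e]) simp_all
qed

lemma AGL2_index: "normal_of_index AGL2_9 4 = sub AGL {(v, A). det A \<noteq> 0 \<and> det A ^ 2 = 1}"
  "subgroup {(v, A). det A \<noteq> 0 \<and> det A ^ 2 = 1} AGL2_9"
proof -
  have ker: "x \<in> N" if N: "subgroup N AGL2_9"
    and ord3: "\<And>y. y \<in> carrier AGL2_9 \<Longrightarrow> y [^]\<^bsub>AGL2_9\<^esub> (3::nat) = \<one>\<^bsub>AGL2_9\<^esub> \<Longrightarrow> y \<in> N"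
    and "x \<in> carrier AGL2_9" and x: "det (snd x) = 1" for N x
  proof -
    obtain v A where xe: "x = (v, A)" by (cases x)
    have u: "(0, upper t) \<in> N" "(0, lower t) \<in> N" for t
      by (rule ord3; simp add: pow3[OF group_AGL] unipotent_cube)+
    have w: "(v, mat 1) \<in> N"
      by (rule ord3; simp add: pow3[OF group_AGL] vec_eq2 gf9_char)
    obtain k a b c where "A = lower k ** upper a ** lower b ** upper c"
      using SL2_unipotent[of A] x xe by auto
    then have "x = (v, mat 1) \<otimes>\<^bsub>AGL2_9\<^esub> ((0, lower k) \<otimes>\<^bsub>AGL2_9\<^esub> (0, upper a) \<otimes>\<^bsub>AGL2_9\<^esub> (0, lower b) \<otimes>\<^bsub>AGL2_9\<^esub> (0, upper c))"
      by (simp add: xe)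
    then show ?thesis using u w subgroup.m_closed[OF N] by metis
  qed
  have img: "(\<lambda>x. det (snd x)) ` carrier AGL2_9 = {c. c \<noteq> 0}"
  proof (intro equalityI subsetI)
    fix c :: gf9 assume "c \<in> {c. c \<noteq> 0}"
    then show "c \<in> (\<lambda>x. det (snd x)) ` carrier AGL2_9" by (intro image_eqI[of _ _ "(0, mat2 c 0 0 1)"]) auto
  qed auto
  have e: "{x \<in> carrier AGL2_9. det (snd x) ^ 2 = 1} = {(v, A). det A \<noteq> 0 \<and> det A ^ 2 = 1}" by auto
  have mult: "det (snd (x \<otimes>\<^bsub>AGL2_9\<^esub> y)) = det (snd x) * det (snd y)" for x y
    by (cases x; cases y) (simp add: det_mul)
  note r = AGL2.normal_of_index_eq[OF fin_AGL, of 4 2 "\<lambda>x. det (snd x)", OF _ mult img ker]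
  show "normal_of_index AGL2_9 4 = sub AGL {(v, A). det A \<noteq> 0 \<and> det A ^ 2 = 1}"
    by (rule r(1)[unfolded e]) simp_all
  show "subgroup {(v, A). det A \<noteq> 0 \<and> det A ^ 2 = 1} AGL2_9"
    by (rule r(2)[unfolded e]) simp_all
qed

lemma mult_nth1 [simp]: "((A :: gf9 ^ 1 ^ 1) ** B) $ 1 $ 1 = A $ 1 $ 1 * B $ 1 $ 1" "(A *v x) $ 1 = A $ 1 $ 1 * x $ 1"
  "(mat k :: gf9 ^ 1 ^ 1) $ 1 $ 1 = k"
  by (simp_all add: matrix_matrix_mult_def matrix_vector_mult_def sum_1 mat_def)

lemma vec_eq1: "v = w \<longleftrightarrow> v $ 1 = w $ 1" for v w :: "'a ^ 1"
  by (simp add: vec_eq_iff forall_1)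

lemma GL1_index: "normal_of_index GL1_9 2 = sub GL {A. A $ 1 $ 1 \<noteq> 0 \<and> (A $ 1 $ 1) ^ 4 = 1}"
  "subgroup {A. A $ 1 $ 1 \<noteq> 0 \<and> (A $ 1 $ 1) ^ 4 = 1} GL1_9"
proof -
  have fin: "finite (carrier GL1_9)" by (rule finite_subset[OF subset_UNIV]) simp
  have img: "(\<lambda>A. A $ 1 $ 1) ` carrier GL1_9 = {c. c \<noteq> 0}"
    by (auto intro!: image_eqI[of _ _ "mat _"])
  have ker: "A \<in> N" if "subgroup N GL1_9" "A $ 1 $ 1 = 1" for A N
  proof -
    have "A = mat 1" using that by (simp add: vec_eq1)
    then show ?thesis using subgroup.one_closed[OF that(1)] by simp
  qed
  have e: "{A \<in> carrier GL1_9. (A $ 1 $ 1) ^ 4 = 1} = {A. A $ 1 $ 1 \<noteq> 0 \<and> (A $ 1 $ 1) ^ 4 = 1}" by auto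
  have mult: "(A \<otimes>\<^bsub>GL1_9\<^esub> B) $ 1 $ 1 = A $ 1 $ 1 * B $ 1 $ 1" for A B by simp
  from GL1.normal_of_index_eq[OF fin, of 2 4 "\<lambda>A. A $ 1 $ 1", OF _ mult img ker]
  show "normal_of_index GL1_9 2 = sub GL {A. A $ 1 $ 1 \<noteq> 0 \<and> (A $ 1 $ 1) ^ 4 = 1}"
    "subgroup {A. A $ 1 $ 1 \<noteq> 0 \<and> (A $ 1 $ 1) ^ 4 = 1} GL1_9" unfolding e by auto
qed

section \<open>A Sylow 3-subgroup of \<open>ASL\<^sub>2(9)\<close>\<close>

abbreviation "AS \<equiv> (UNIV \<times> {A. det A = 1} :: affine_2_9 set)"

definition U0 :: "affine_2_9 set" where "U0 = {(v, A). A $ 2 $ 1 = 0 \<and> A $ 1 $ 1 = 1 \<and> A $ 2 $ 2 = 1}"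

definition tri :: "affine_2_9 set" where "tri = {(v, A). A $ 2 $ 1 = 0 \<and> A $ 1 $ 1 \<noteq> 0 \<and> A $ 2 $ 2 \<noteq> 0}"

lemma U0_mem [simp]: "(v, A) \<in> U0 \<longleftrightarrow> A $ 2 $ 1 = 0 \<and> A $ 1 $ 1 = 1 \<and> A $ 2 $ 2 = 1"
  and tri_mem [simp]: "(v, A) \<in> tri \<longleftrightarrow> A $ 2 $ 1 = 0 \<and> A $ 1 $ 1 \<noteq> 0 \<and> A $ 2 $ 2 \<noteq> 0"
  by (simp_all add: U0_def tri_def)

lemma AS_sub: "subgroup AS AGL2_9"
  by (rule AGL2.finite_subgroupI) (auto simp: det_mul intro!: exI[of _ "mat 1"])

interpretation ASL2: group ASL2_9 unfolding ASL_eq using AS_sub by (rule AGL2.subgroup_imp_group)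

lemma tri_sub: "subgroup tri AGL2_9"
  by (rule AGL2.finite_subgroupI) (auto simp: tri_def det_2 intro!: exI[of _ "mat 1"])

lemma U0_normal: "U0 \<lhd> sub AGL2_9 tri" and U0_sub: "subgroup U0 AGL2_9"
proof -
  let ?f = "\<lambda>(v::gf9^2, A::gf9^2^2). (A $ 1 $ 1, A $ 2 $ 2)"
  have U: "U0 = {x \<in> tri. ?f x = ?f \<one>\<^bsub>AGL2_9\<^esub>}" by (auto simp: U0_def)
  have "?f (x \<otimes>\<^bsub>AGL2_9\<^esub> y) = (\<lambda>(a, d) (a', d'). (a * a', d * d')) (?f x) (?f y)" if "x \<in> tri" "y \<in> tri" for x y
    using that by (cases x; cases y) simp
  from AGL2.normal_kernel_fun[OF tri_sub this U] show "U0 \<lhd> sub AGL2_9 tri" "subgroup U0 AGL2_9" by auto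
qed

lemma U0_AS: "U0 \<subseteq> AS" by (auto simp: det_2)

lemma (in group) normalizer_eq:
  "S \<subseteq> carrier G \<Longrightarrow> normalizer G S = {g \<in> carrier G. g <# S #> inv g = S}"
  by (auto simp: normalizer_def stabilizer_def)

text \<open>For a finite set, containment of the conjugate already gives equality, and membership of
  conjugates is again phrased by products alone.\<close>

lemma (in group) conj_eq_iff:
  assumes fin: "finite S" and S: "S \<subseteq> carrier G" and g: "g \<in> carrier G"
  shows "g <# S #> inv g = S \<longleftrightarrow> (\<forall>x\<in>S. \<exists>y\<in>S. g \<otimes> x = y \<otimes> g)"
proof -
  have im: "g <# S #> inv g = (\<lambda>x. g \<otimes> x \<otimes> inv g) ` S" by (auto simp: l_coset_def r_coset_def)
  have eq: "g \<otimes> x = y \<otimes> g \<longleftrightarrow> y = g \<otimes> x \<otimes> inv g" if "x \<in> S" "y \<in> S" for x y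
  proof -
    have "x \<in> carrier G" "y \<in> carrier G" using that S by auto
    then show ?thesis using g by (metis inv_solve_right m_closed)
  qed
  have inj: "inj_on (\<lambda>x. g \<otimes> x \<otimes> inv g) S" using S g by (auto simp: inj_on_def subset_iff)
  have "(\<lambda>x. g \<otimes> x \<otimes> inv g) ` S = S \<longleftrightarrow> (\<lambda>x. g \<otimes> x \<otimes> inv g) ` S \<subseteq> S"
    using endo_inj_surj[OF fin _ inj] by blast
  then show ?thesis unfolding im using eq by (auto simp: subset_iff image_iff)
qed

lemma U0_conj_iff:
  assumes "(v, A) \<in> carrier AGL2_9"
  shows "(v, A) <#\<^bsub>AGL2_9\<^esub> U0 #>\<^bsub>AGL2_9\<^esub> inv\<^bsub>AGL2_9\<^esub> (v, A) = U0 \<longleftrightarrow> A $ 2 $ 1 = 0"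
proof -
  have U: "U0 \<subseteq> carrier AGL2_9" by (auto simp: det_2)
  show ?thesis
    unfolding AGL2.conj_eq_iff[OF fin_AGL U assms]
  proof
    assume "\<forall>x\<in>U0. \<exists>y\<in>U0. (v, A) \<otimes>\<^bsub>AGL2_9\<^esub> x = y \<otimes>\<^bsub>AGL2_9\<^esub> (v, A)"
    then obtain w B where "(w, B) \<in> U0" "(v, A) \<otimes>\<^bsub>AGL2_9\<^esub> (0, upper 1) = (w, B) \<otimes>\<^bsub>AGL2_9\<^esub> (v, A)"
      by (metis (no_types, lifting) U0_mem mat2_nth surj_pair)
    then show "A $ 2 $ 1 = 0" by (simp add: vec_eq2)
  next
    assume A: "A $ 2 $ 1 = 0"
    then have t: "(v, A) \<in> tri" using assms by (simp add: det_2)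
    have "\<exists>y\<in>U0. (v, A) \<otimes>\<^bsub>AGL2_9\<^esub> x = y \<otimes>\<^bsub>AGL2_9\<^esub> (v, A)" if x: "x \<in> U0" for x
    proof (intro bexI)
      let ?y = "(v, A) \<otimes>\<^bsub>AGL2_9\<^esub> x \<otimes>\<^bsub>AGL2_9\<^esub> inv\<^bsub>AGL2_9\<^esub> (v, A)"
      have xc: "x \<in> carrier AGL2_9" using x U by blast
      show "(v, A) \<otimes>\<^bsub>AGL2_9\<^esub> x = ?y \<otimes>\<^bsub>AGL2_9\<^esub> (v, A)"
        using assms xc by (simp only: AGL2.m_assoc AGL2.inv_closed AGL2.m_closed AGL2.l_inv AGL2.r_one)
      have "(v, A) \<otimes>\<^bsub>sub AGL2_9 tri\<^esub> x \<otimes>\<^bsub>sub AGL2_9 tri\<^esub> inv\<^bsub>sub AGL2_9 tri\<^esub> (v, A) \<in> U0"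
        using t x by (intro normal.inv_op_closed2[OF U0_normal]) auto
      then show "?y \<in> U0" using AGL2.m_inv_consistent[OF tri_sub t] by simp
    qed
    then show "\<forall>x\<in>U0. \<exists>y\<in>U0. (v, A) \<otimes>\<^bsub>AGL2_9\<^esub> x = y \<otimes>\<^bsub>AGL2_9\<^esub> (v, A)" by blast
  qed
qed

lemma card_U0: "card U0 = 3 ^ 6"
proof -
  let ?f = "\<lambda>(v, u). (v, upper u) :: affine_2_9"
  have "U0 = ?f ` (UNIV :: ((gf9 ^ 2) \<times> gf9) set)"
  proof (intro equalityI subsetI)
    fix x assume x: "x \<in> U0"
    obtain v A where xe: "x = (v, A)" by (cases x)
    have "x = ?f (v, A $ 1 $ 2)" using x by (auto simp: xe vec_eq2)
    then show "x \<in> ?f ` (UNIV :: ((gf9 ^ 2) \<times> gf9) set)" by blast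
  qed auto
  then have "card U0 = card (?f ` (UNIV :: ((gf9 ^ 2) \<times> gf9) set))" by (rule arg_cong[where f = card])
  also have "\<dots> = CARD((gf9 ^ 2) \<times> gf9)" by (rule card_image) (auto simp: inj_on_def vec_eq2)
  finally show ?thesis by (simp add: card_gf9)
qed

text \<open>Left multiplication by \<open>U0\<close> changes everything but the second row of the
  matrix, and every nonzero row occurs for determinant 1. So there are 80 cosets.\<close>

lemma order_ASL2: "order ASL2_9 = 80 * 3 ^ 6"
proof -
  let ?f = "\<lambda>(v::gf9^2, A::gf9^2^2). A $ 2"
  have U: "subgroup U0 ASL2_9" unfolding ASL_eq using U0_sub AS_sub U0_AS by (intro AGL2.subgroup_incl)
  have "index ASL2_9 U0 = card (?f ` carrier ASL2_9)"
  proof (rule ASL2.index_eq_card_image[OF U])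
    fix x y assume xy: "x \<in> carrier ASL2_9" "y \<in> carrier ASL2_9"
    define z where "z = x \<otimes>\<^bsub>ASL2_9\<^esub> inv\<^bsub>ASL2_9\<^esub> y"
    have z: "z \<in> carrier ASL2_9" "x = z \<otimes>\<^bsub>ASL2_9\<^esub> y" using xy by (simp_all add: z_def ASL2.m_assoc)
    obtain v A where ye: "y = (v, A)" by (cases y)
    obtain w B where ze: "z = (w, B)" by (cases z)
    have d: "det A = 1" "det B = 1" using xy z by (simp_all add: ye ze carrier_ASL)
    have x: "x = (w + B *v v, B ** A)" using z(2) by (simp add: ze ye ASL_eq)
    have "B $ 2 $ 1 = 0 \<and> B $ 2 $ 2 = 1" if "(B ** A) $ 2 = A $ 2"
    proof -
      have e1: "B $ 2 $ 1 * A $ 1 $ 1 + B $ 2 $ 2 * A $ 2 $ 1 = A $ 2 $ 1"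
        and e2: "B $ 2 $ 1 * A $ 1 $ 2 + B $ 2 $ 2 * A $ 2 $ 2 = A $ 2 $ 2"
        using that by (metis mult_nth2)+
      have "B $ 2 $ 1 * det A = (B $ 2 $ 1 * A $ 1 $ 1 + B $ 2 $ 2 * A $ 2 $ 1) * A $ 2 $ 2 -
        (B $ 2 $ 1 * A $ 1 $ 2 + B $ 2 $ 2 * A $ 2 $ 2) * A $ 2 $ 1" by (simp add: det_2 algebra_simps)
      also have "\<dots> = 0" unfolding e1 e2 by (simp add: mult.commute)
      finally have 1: "B $ 2 $ 1 = 0" using d by simp
      have "A $ 2 $ 1 \<noteq> 0 \<or> A $ 2 $ 2 \<noteq> 0" using d by (auto simp: det_2)
      then show ?thesis using 1 e1 e2 by auto
    qed
    moreover have "(B ** A) $ 2 = A $ 2" if "B $ 2 $ 1 = 0" "B $ 2 $ 2 = 1"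
      using that by (simp add: vec_eq2)
    moreover have "B $ 1 $ 1 = 1" if "B $ 2 $ 1 = 0" "B $ 2 $ 2 = 1" using that d(2) by (simp add: det_2)
    ultimately have "?f x = ?f y \<longleftrightarrow> z \<in> U0"
      by (auto simp: x ye ze)
    then show "?f x = ?f y \<longleftrightarrow> x \<otimes>\<^bsub>ASL2_9\<^esub> inv\<^bsub>ASL2_9\<^esub> y \<in> U0" by (simp only: z_def)
  qed
  also have "?f ` carrier ASL2_9 = UNIV - {0}"
  proof (intro equalityI subsetI)
    fix r assume "r \<in> ?f ` carrier ASL2_9"
    then show "r \<in> UNIV - {0}" by (auto simp: carrier_ASL det_2)
  next
    fix r :: "gf9 ^ 2" assume "r \<in> UNIV - {0}"
    then have r: "r $ 1 \<noteq> 0 \<or> r $ 2 \<noteq> 0" by (auto simp: vec_eq2)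
    have "\<exists>A. det A = 1 \<and> A $ 2 = r"
    proof (cases "r $ 2 = 0")
      case True
      then have "r $ 1 \<noteq> 0" using r by simp
      then show ?thesis using True
        by (intro exI[of _ "mat2 0 (- inverse (r $ 1)) (r $ 1) 0"]) (simp add: vec_eq2)
    next
      case False
      then show ?thesis
        by (intro exI[of _ "mat2 (inverse (r $ 2)) 0 (r $ 1) (r $ 2)"]) (simp add: vec_eq2)
    qed
    then obtain A where "det A = 1" "A $ 2 = r" by blast
    then have "(0, A) \<in> carrier ASL2_9" "?f (0, A) = r" by (auto simp: carrier_ASL)
    then show "r \<in> ?f ` carrier ASL2_9" by (metis (no_types, lifting) image_eqI)
  qed
  also have "card (UNIV - {0 :: gf9 ^ 2}) = 80" by (simp add: card_Diff_singleton card_gf9)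
  finally show ?thesis
    using ASL2.lagrange[OF U] by (simp add: index_def card_U0)
qed

lemma multiplicity_3: "multiplicity 3 (80 * 3 ^ n :: nat) = n"
proof (rule multiplicity_eqI)
  show "\<not> (3::nat) ^ Suc n dvd 80 * 3 ^ n"
  proof
    assume "(3::nat) ^ Suc n dvd 80 * 3 ^ n"
    then have "(3::nat) dvd 80" by (simp add: dvd_mult_cancel2)
    then show False by simp
  qed
qed simp

lemma U0_Syl: "U0 \<in> Syl 3 ASL2_9"
  unfolding Syl_def order_ASL2 multiplicity_3 using card_U0 U0_sub U0_AS AS_sub
  by (simp add: ASL_eq AGL2.subgroup_incl)

section \<open>The kernel on elementary abelian subgroups\<close>

text \<open>The type \<open>X\<close> is left open so that one transport along automorphisms serves
  twice: for \<open>K2_9\<close> with \<open>X\<close> of order 81, and for normalizers with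
  \<open>X\<close> trivial, where the condition on \<open>E\<close> always holds.\<close>

definition fix_abelian :: "('a, 'b) monoid_scheme \<Rightarrow> 'c monoid \<Rightarrow> 'a set \<Rightarrow> 'a set" where
  "fix_abelian G X S = {g \<in> carrier G. g <#\<^bsub>G\<^esub> S #>\<^bsub>G\<^esub> inv\<^bsub>G\<^esub> g = S \<and>
     (\<forall>E. subgroup E G \<and> E \<subseteq> S \<and> sub G E \<cong> X \<longrightarrow> g <#\<^bsub>G\<^esub> E #>\<^bsub>G\<^esub> inv\<^bsub>G\<^esub> g = E)}"

lemma K2_9_eq: "S \<subseteq> carrier AGL2_9 \<Longrightarrow> K2_9 S = sub AGL2_9 (fix_abelian AGL2_9 (elem_abelian 3 4) S)"
  unfolding K2_9_def AGL2_9_norm_def fix_abelian_def AGL2.normalizer_eq by simp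

lemma conj_image:
  assumes "group_hom G H f" "S \<subseteq> carrier G" "g \<in> carrier G"
  shows "f ` (g <#\<^bsub>G\<^esub> S #>\<^bsub>G\<^esub> inv\<^bsub>G\<^esub> g) = f g <#\<^bsub>H\<^esub> f ` S #>\<^bsub>H\<^esub> inv\<^bsub>H\<^esub> f g"
proof -
  interpret group_hom G H f by fact
  have "f (g \<otimes>\<^bsub>G\<^esub> x \<otimes>\<^bsub>G\<^esub> inv\<^bsub>G\<^esub> g) = f g \<otimes>\<^bsub>H\<^esub> f x \<otimes>\<^bsub>H\<^esub> inv\<^bsub>H\<^esub> f g" if "x \<in> S" for x
    using that assms by (simp add: subset_iff)
  then have "f ` (\<lambda>x. g \<otimes>\<^bsub>G\<^esub> x \<otimes>\<^bsub>G\<^esub> inv\<^bsub>G\<^esub> g) ` S = (\<lambda>x. f g \<otimes>\<^bsub>H\<^esub> x \<otimes>\<^bsub>H\<^esub> inv\<^bsub>H\<^esub> f g) ` f ` S"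
    unfolding image_image by (intro image_cong) auto
  moreover have "g <#\<^bsub>G\<^esub> S #>\<^bsub>G\<^esub> inv\<^bsub>G\<^esub> g = (\<lambda>x. g \<otimes>\<^bsub>G\<^esub> x \<otimes>\<^bsub>G\<^esub> inv\<^bsub>G\<^esub> g) ` S"
    by (auto simp: l_coset_def r_coset_def)
  moreover have "f g <#\<^bsub>H\<^esub> f ` S #>\<^bsub>H\<^esub> inv\<^bsub>H\<^esub> f g = (\<lambda>x. f g \<otimes>\<^bsub>H\<^esub> x \<otimes>\<^bsub>H\<^esub> inv\<^bsub>H\<^esub> f g) ` f ` S"
    by (auto simp: l_coset_def r_coset_def)
  ultimately show ?thesis by simp
qed

lemma fix_abelian_iso:
  assumes G: "group G" and f: "f \<in> iso G G" and S: "S \<subseteq> carrier G" and x: "x \<in> fix_abelian G X S"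
  shows "f x \<in> fix_abelian G X (f ` S)"
proof -
  interpret G: group G by fact
  have fh: "group_hom G G f" using f by (simp add: group_hom_def group_hom_axioms_def iso_def G)
  let ?g = "inv_into (carrier G) f"
  have g: "?g \<in> iso G G" using G f by (simp add: group.iso_set_sym)
  then have gh: "group_hom G G ?g" by (simp add: group_hom_def group_hom_axioms_def iso_def G)
  have bij: "bij_betw f (carrier G) (carrier G)" using f by (simp add: iso_def)
  have fg: "f (?g y) = y" if "y \<in> carrier G" for y using bij that by (metis bij_betw_inv_into_right)
  have gf: "?g (f y) = y" if "y \<in> carrier G" for y using bij that by (metis bij_betw_inv_into_left)
  have xc: "x \<in> carrier G" using x by (simp add: fix_abelian_def)
  have "f x <#\<^bsub>G\<^esub> E #>\<^bsub>G\<^esub> inv\<^bsub>G\<^esub> f x = E" if E: "subgroup E G" "E \<subseteq> f ` S" "sub G E \<cong> X" for E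
  proof -
    have Ec: "E \<subseteq> carrier G" using E(1) by (rule subgroup.subset)
    have "f ` ?g ` E = (\<lambda>x. x) ` E" unfolding image_image by (rule image_cong) (use Ec fg in auto)
    then have fgE: "f ` ?g ` E = E" by simp
    have sg: "subgroup (?g ` E) G" using gh E(1) by (rule group_hom.subgroup_img_is_subgroup)
    have "inj_hom G G ?g" using gh g by (simp add: inj_hom_def inj_hom_axioms_def iso_def bij_betw_def)
    then have "sub G (?g ` E) \<cong> sub G E" using E(1) by (rule inj_hom.is_iso_sub)
    then have "sub G (?g ` E) \<cong> X" using E(3) iso_trans by blast
    moreover have "?g ` E \<subseteq> S" using E(2) S gf by force
    ultimately have "x <#\<^bsub>G\<^esub> ?g ` E #>\<^bsub>G\<^esub> inv\<^bsub>G\<^esub> x = ?g ` E" using x sg by (simp add: fix_abelian_def)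
    then show ?thesis using conj_image[OF fh subgroup.subset[OF sg] xc] fgE by simp
  qed
  moreover have "f x <#\<^bsub>G\<^esub> f ` S #>\<^bsub>G\<^esub> inv\<^bsub>G\<^esub> f x = f ` S"
    using conj_image[OF fh S xc] x by (simp add: fix_abelian_def)
  ultimately show ?thesis using bij xc by (auto simp: fix_abelian_def bij_betw_def)
qed

lemma fix_abelian_image:
  assumes G: "group G" and f: "f \<in> iso G G" and S: "S \<subseteq> carrier G"
  shows "fix_abelian G X (f ` S) = f ` fix_abelian G X S"
proof (intro equalityI subsetI)
  let ?g = "inv_into (carrier G) f"
  have g: "?g \<in> iso G G" using G f by (simp add: group.iso_set_sym)
  have bij: "bij_betw f (carrier G) (carrier G)" using f by (simp add: iso_def)
  have fg: "f (?g y) = y" if "y \<in> carrier G" for y using bij that by (metis bij_betw_inv_into_right)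
  have gf: "?g (f y) = y" if "y \<in> carrier G" for y using bij that by (metis bij_betw_inv_into_left)
  fix y assume y: "y \<in> fix_abelian G X (f ` S)"
  have "f ` S \<subseteq> carrier G" using S bij by (auto simp: bij_betw_def)
  then have "?g y \<in> fix_abelian G X (?g ` f ` S)" using G g y by (intro fix_abelian_iso)
  moreover have "?g ` f ` S = (\<lambda>x. x) ` S" unfolding image_image by (rule image_cong) (use S gf in auto)
  then have "?g ` f ` S = S" by simp
  moreover have "y \<in> carrier G" using y by (simp add: fix_abelian_def)
  ultimately show "y \<in> f ` fix_abelian G X S" using fg by (metis image_eqI)
qed (use fix_abelian_iso[OF G f S] in blast)

definition K0 :: "affine_2_9 set" where
  "K0 = {(v, A). A $ 2 $ 1 = 0 \<and> A $ 2 $ 2 \<noteq> 0 \<and> A $ 1 $ 1 = A $ 2 $ 2 ^ 2}"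

lemma K0_mem [simp]: "(v, A) \<in> K0 \<longleftrightarrow> A $ 2 $ 1 = 0 \<and> A $ 2 $ 2 \<noteq> 0 \<and> A $ 1 $ 1 = A $ 2 $ 2 ^ 2"
  by (simp add: K0_def)

text \<open>Commuting elements of \<open>U0\<close> have proportional images in \<open>U0 / Z(U0)\<close>, so an abelian subgroup of
  order 81 is the preimage of a line; \<open>K0\<close> acts on the plane \<open>U0 / Z(U0)\<close> by scalars.\<close>

lemma fix_abelian_U0: "fix_abelian AGL2_9 (elem_abelian 3 4) U0 = K0"
proof (intro equalityI subsetI)
  fix x assume x: "x \<in> fix_abelian AGL2_9 (elem_abelian 3 4) U0"
  obtain w A where xe: "x = (w, A)" by (cases x)
  have xc: "(w, A) \<in> carrier AGL2_9" using x by (simp add: fix_abelian_def xe)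
  then have A21: "A $ 2 $ 1 = 0" using x U0_conj_iff[OF xc] by (simp add: fix_abelian_def xe)
  then have nz: "A $ 1 $ 1 \<noteq> 0" "A $ 2 $ 2 \<noteq> 0" using xc by (auto simp: det_2)
  \<comment> \<open>The diagonal line of the plane \<open>U0 / Z(U0)\<close>. Conjugation by
    \<open>x\<close> scales its two coordinates by \<open>A $ 2 $ 2\<close> and by the quotient of
    \<open>A $ 1 $ 1\<close> by \<open>A $ 2 $ 2\<close>. Invariance of this one subgroup already
    equates the two.\<close>
  define E where "E = range (\<lambda>v::gf9^2. (v, upper (v $ 2)))"
  \<comment> \<open>A quadratic correction that turns the multiplication of \<open>E\<close> into
    addition of vectors; it works because \<open>-2 = 1\<close>.\<close>
  define p where "p v = vec2 (v $ 1 - (v $ 2) ^ 2) (v $ 2)" for v :: "gf9 ^ 2"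
  have pm: "(p (a + b), upper ((a + b) $ 2)) = (p a, upper (a $ 2)) \<otimes>\<^bsub>AGL2_9\<^esub> (p b, upper (b $ 2))" for a b
  proof -
    have "(a $ 2 + b $ 2) ^ 2 = (a $ 2) ^ 2 + (b $ 2) ^ 2 - a $ 2 * b $ 2 + (a $ 2 * b $ 2 + a $ 2 * b $ 2 + a $ 2 * b $ 2)"
      by (simp add: power2_eq_square algebra_simps)
    then have "(a $ 2 + b $ 2) ^ 2 = (a $ 2) ^ 2 + (b $ 2) ^ 2 - a $ 2 * b $ 2" by (simp only: gf9_char add_0_right)
    then show ?thesis by (simp add: p_def vec_eq2)
  qed
  have Ep: "E = range (\<lambda>v. (p v, upper (v $ 2)))"
  proof -
    have "(v, upper (v $ 2)) = (p (vec2 (v $ 1 + (v $ 2) ^ 2) (v $ 2)), upper ((vec2 (v $ 1 + (v $ 2) ^ 2) (v $ 2)) $ 2))" for v :: "gf9 ^ 2"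
      by (simp add: p_def vec_eq2)
    moreover have "(p v, upper (v $ 2)) = (p v, upper (p v $ 2))" for v by (simp add: p_def)
    ultimately show ?thesis unfolding E_def by (metis (mono_tags, lifting) rangeI image_subsetI subset_antisym)
  qed
  have sE: "subgroup E AGL2_9"
  proof (rule AGL2.finite_subgroupI)
    fix a b assume "a \<in> E" "b \<in> E"
    then show "a \<otimes>\<^bsub>AGL2_9\<^esub> b \<in> E" unfolding Ep by (auto simp only: pm[symmetric] image_iff)
  qed (auto simp: E_def)
  obtain f where f: "bij_betw f (UNIV :: (gf9 ^ 2) set) (carrier (elem_abelian 3 4))"
    "\<And>x y. f (x + y) = f x \<otimes>\<^bsub>elem_abelian 3 4\<^esub> f y" using elem_abelian_81 by blast
  let ?i = "\<lambda>v. (p v, upper (v $ 2))"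
  have inj_i: "inj ?i" by (rule injI) (auto simp: p_def vec_eq2)
  define q where "q = inv_into UNIV ?i"
  have q: "q (?i v) = v" for v unfolding q_def using inv_f_f[OF inj_i, of v] by simp
  have "f \<circ> q \<in> iso (sub AGL2_9 E) (elem_abelian 3 4)"
  proof (rule isoI)
    have bq: "bij_betw q E UNIV" unfolding Ep q_def using inj_i by (simp add: bij_betw_inv_into inj_imp_bij_betw_inv)
    show "bij_betw (f \<circ> q) (carrier (sub AGL2_9 E)) (carrier (elem_abelian 3 4))"
      using bij_betw_trans[OF bq f(1)] by simp
    show "f \<circ> q \<in> hom (sub AGL2_9 E) (elem_abelian 3 4)"
    proof (rule homI)
      fix a b assume ab: "a \<in> carrier (sub AGL2_9 E)" "b \<in> carrier (sub AGL2_9 E)"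
      show "(f \<circ> q) a \<in> carrier (elem_abelian 3 4)" using f(1) by (auto simp: bij_betw_def)
      obtain v v' where "a = ?i v" "b = ?i v'" using ab unfolding Ep by auto
      then show "(f \<circ> q) (a \<otimes>\<^bsub>sub AGL2_9 E\<^esub> b) = (f \<circ> q) a \<otimes>\<^bsub>elem_abelian 3 4\<^esub> (f \<circ> q) b"
        using q[of "v + v'"] unfolding pm by (simp add: q f(2))
    qed
  qed
  then have "sub AGL2_9 E \<cong> elem_abelian 3 4" by (rule is_isoI)
  moreover have "E \<subseteq> U0" by (auto simp: E_def)
  ultimately have "x <#\<^bsub>AGL2_9\<^esub> E #>\<^bsub>AGL2_9\<^esub> inv\<^bsub>AGL2_9\<^esub> x = E" using x sE by (simp add: fix_abelian_def)
  moreover have "E \<subseteq> carrier AGL2_9" using sE by (rule subgroup.subset)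
  ultimately have "\<forall>a\<in>E. \<exists>b\<in>E. x \<otimes>\<^bsub>AGL2_9\<^esub> a = b \<otimes>\<^bsub>AGL2_9\<^esub> x"
    using AGL2.conj_eq_iff[OF fin_AGL, of E x] xc xe by simp
  moreover have "(vec2 0 1, upper 1) \<in> E" unfolding E_def by (rule range_eqI[of _ _ "vec2 0 1"]) simp
  ultimately obtain v where "x \<otimes>\<^bsub>AGL2_9\<^esub> (vec2 0 1, upper 1) = (v, upper (v $ 2)) \<otimes>\<^bsub>AGL2_9\<^esub> x"
    unfolding E_def by blast
  then have "A $ 1 $ 1 + A $ 1 $ 2 = A $ 1 $ 2 + v $ 2 * A $ 2 $ 2" "w $ 2 + A $ 2 $ 2 = v $ 2 + w $ 2"
    using A21 by (simp_all add: xe vec_eq2)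
  then have "A $ 1 $ 1 = v $ 2 * A $ 2 $ 2" "A $ 2 $ 2 = v $ 2" by (simp_all add: add.commute)
  then show "x \<in> K0" using A21 nz by (simp add: xe power2_eq_square)
next
  fix x assume x: "x \<in> K0"
  obtain w A where xe: "x = (w, A)" by (cases x)
  have A: "A $ 2 $ 1 = 0" "A $ 2 $ 2 \<noteq> 0" "A $ 1 $ 1 = A $ 2 $ 2 ^ 2" using x by (auto simp: xe)
  have xc: "(w, A) \<in> carrier AGL2_9" using A by (simp add: det_2)
  have "x <#\<^bsub>AGL2_9\<^esub> E #>\<^bsub>AGL2_9\<^esub> inv\<^bsub>AGL2_9\<^esub> x = E"
    if E: "subgroup E AGL2_9" "E \<subseteq> U0" "sub AGL2_9 E \<cong> elem_abelian 3 4" for E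
  proof -
    have Ec: "E \<subseteq> carrier AGL2_9" using E(1) by (rule subgroup.subset)
    obtain f where f: "f \<in> iso (sub AGL2_9 E) (elem_abelian 3 4)" using E(3) by (auto simp: is_iso_def)
    have bij: "bij_betw f E (carrier (elem_abelian 3 4))" using f by (simp add: iso_def)
    then have cE: "card E = 81" using bij_betw_same_card[OF bij] by (simp add: card_elem_abelian)
    have com: "a \<otimes>\<^bsub>AGL2_9\<^esub> b = b \<otimes>\<^bsub>AGL2_9\<^esub> a" if ab: "a \<in> E" "b \<in> E" for a b
    proof -
      have m: "a \<otimes>\<^bsub>AGL2_9\<^esub> b \<in> E" "b \<otimes>\<^bsub>AGL2_9\<^esub> a \<in> E" using ab E(1) by (simp_all add: subgroup.m_closed)
      have "f (a \<otimes>\<^bsub>AGL2_9\<^esub> b) = f a \<otimes>\<^bsub>elem_abelian 3 4\<^esub> f b" "f (b \<otimes>\<^bsub>AGL2_9\<^esub> a) = f b \<otimes>\<^bsub>elem_abelian 3 4\<^esub> f a"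
        using f ab by (auto simp: iso_def hom_def)
      then have "f (a \<otimes>\<^bsub>AGL2_9\<^esub> b) = f (b \<otimes>\<^bsub>AGL2_9\<^esub> a)" by (simp add: elem_abelian_simps add.commute)
      then show ?thesis using bij m by (auto simp: bij_betw_def dest: inj_onD)
    qed
    have comm_eq: "B $ 1 $ 2 * v' $ 2 = B' $ 1 $ 2 * v $ 2" if "(v, B) \<in> E" "(v', B') \<in> E" for v B v' B'
    proof -
      have "(v, B) \<in> U0" "(v', B') \<in> U0" using that E(2) by auto
      then show ?thesis using com[OF that] by (simp add: vec_eq2 algebra_simps)
    qed
    \<comment> \<open>The center of \<open>U0\<close> has order 9, too small to contain
      \<open>E\<close>.\<close>
    have "\<exists>a\<in>E. \<not> (snd a $ 1 $ 2 = 0 \<and> fst a $ 2 = 0)"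
    proof (rule ccontr)
      assume "\<not> ?thesis"
      then have "E \<subseteq> (\<lambda>t. (vec2 t 0, mat 1)) ` UNIV"
        using E(2) by (force simp: image_iff vec_eq2)
      then have "card E \<le> card ((\<lambda>t. (vec2 t 0, mat 1 :: gf9 ^ 2 ^ 2)) ` (UNIV :: gf9 set))"
        by (intro card_mono) auto
      also have "\<dots> \<le> CARD(gf9)" by (rule card_image_le) simp
      finally show False using cE by (simp add: card_gf9)
    qed
    then obtain v0 B0 where a: "(v0, B0) \<in> E" "B0 $ 1 $ 2 \<noteq> 0 \<or> v0 $ 2 \<noteq> 0" by fastforce
    \<comment> \<open>The centralizer in \<open>U0\<close> of the chosen noncentral element. It
      contains the abelian group \<open>E\<close> and has at most 81 elements, so it equals
      \<open>E\<close>.\<close>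
    define L where "L = {(v, B). (v, B) \<in> U0 \<and> B0 $ 1 $ 2 * v $ 2 = B $ 1 $ 2 * v0 $ 2}"
    have "card L \<le> 81"
    proof -
      \<comment> \<open>On \<open>L\<close> the two plane coordinates are proportional to those of
        \<open>(v0, B0)\<close>. The one that belongs to a nonzero coordinate of this element
        determines the other.\<close>
      define h where "h = (\<lambda>(v::gf9^2, B::gf9^2^2). (v $ 1, if v0 $ 2 \<noteq> 0 then v $ 2 else B $ 1 $ 2))"
      have "inj_on h L"
      proof (rule inj_onI)
        fix a b assume "a \<in> L" "b \<in> L" "h a = h b"
        then show "a = b" using \<open>B0 $ 1 $ 2 \<noteq> 0 \<or> v0 $ 2 \<noteq> 0\<close>
          by (cases a; cases b) (auto simp: L_def h_def vec_eq2 split: if_splits)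
      qed
      then have "card L \<le> CARD(gf9 \<times> gf9)" by (intro card_inj_on_le[of h]) auto
      then show ?thesis by (simp add: card_gf9)
    qed
    moreover have "E \<subseteq> L" using comm_eq[OF a(1)] E(2) by (force simp: L_def)
    ultimately have EL: "E = L" using cE by (metis card_seteq fin_AGL)
    have "\<exists>b\<in>L. x \<otimes>\<^bsub>AGL2_9\<^esub> (v, B) = b \<otimes>\<^bsub>AGL2_9\<^esub> x" if vB: "(v, B) \<in> L" for v B
    proof
      let ?d = "A $ 2 $ 2"
      let ?b = "(vec2 (w $ 1 + ?d ^ 2 * v $ 1 + A $ 1 $ 2 * v $ 2 - w $ 1 - ?d * B $ 1 $ 2 * w $ 2) (?d * v $ 2), upper (?d * B $ 1 $ 2))"
      show "x \<otimes>\<^bsub>AGL2_9\<^esub> (v, B) = ?b \<otimes>\<^bsub>AGL2_9\<^esub> x"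
        using vB A by (simp add: xe L_def vec_eq2 power2_eq_square algebra_simps)
      show "?b \<in> L" using vB by (simp add: L_def ac_simps)
    qed
    then show ?thesis
      unfolding EL using AGL2.conj_eq_iff[OF fin_AGL, of L x] Ec xc xe EL by auto
  qed
  then show "x \<in> fix_abelian AGL2_9 (elem_abelian 3 4) U0"
    using U0_conj_iff[OF xc] A xc by (simp add: fix_abelian_def xe)
qed

section \<open>Identification of the subgroups\<close>

abbreviation "E3 \<equiv> elem_abelian 3 1"

lemma sub_sub: "sub (sub G X) Y = sub G Y"
  by simp

lemma DirProd_simps: "carrier (G \<times>\<times> H) = carrier G \<times> carrier H"
  "(x, y) \<otimes>\<^bsub>G \<times>\<times> H\<^esub> (x', y') = (x \<otimes>\<^bsub>G\<^esub> x', y \<otimes>\<^bsub>H\<^esub> y')"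
  by (simp_all add: DirProd_def)

text \<open>With sign 1 and no field automorphism, the coordinate \<open>e\<close> is simply added
  and splits off. The map \<open>\<kappa>\<close> allows comparison with subgroups attached to an
  arbitrary Sylow subgroup in place of \<open>U0\<close>.\<close>

lemma split_E3:
  assumes X: "X = {(e, v, \<epsilon>, A, s). \<epsilon> = 1 \<and> \<not> s \<and> (v, A) \<in> Y}"
    and \<kappa>: "inj_on \<kappa> Y" "\<And>x y. x \<in> Y \<Longrightarrow> y \<in> Y \<Longrightarrow> \<kappa> (x \<otimes>\<^bsub>AGL2_9\<^esub> y) = \<kappa> x \<otimes>\<^bsub>AGL2_9\<^esub> \<kappa> y"
  shows "sub K1 X \<cong> E3 \<times>\<times> sub AGL2_9 (\<kappa> ` Y)"
proof -
  obtain f where f: "bij_betw f (UNIV :: 3 set) (carrier E3)" "\<And>x y. f (x + y) = f x \<otimes>\<^bsub>E3\<^esub> f y"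
    using elem_abelian_3 by blast
  define F where "F = (\<lambda>(e, v, \<epsilon>::3, A, s::bool). (f e, \<kappa> (v, A)))"
  have fi: "f e = f e' \<longleftrightarrow> e = e'" for e e' using f(1) by (auto simp: bij_betw_def inj_eq)
  have "F \<in> iso (sub K1 X) (E3 \<times>\<times> sub AGL2_9 (\<kappa> ` Y))"
  proof (rule isoI)
    show "F \<in> hom (sub K1 X) (E3 \<times>\<times> sub AGL2_9 (\<kappa> ` Y))"
    proof (rule homI)
      fix x assume x: "x \<in> carrier (sub K1 X)"
      then show "F x \<in> carrier (E3 \<times>\<times> sub AGL2_9 (\<kappa> ` Y))"
        using f(1) by (cases x) (auto simp: X F_def DirProd_simps bij_betw_def)
      fix y assume y: "y \<in> carrier (sub K1 X)"
      obtain e v A where xe: "x = (e, v, 1, A, False)" "(v, A) \<in> Y" using x by (auto simp: X)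
      obtain e' v' A' where ye: "y = (e', v', 1, A', False)" "(v', A') \<in> Y" using y by (auto simp: X)
      have "\<kappa> (v + A *v v', A ** A') = \<kappa> (v, A) \<otimes>\<^bsub>AGL2_9\<^esub> \<kappa> (v', A')"
        using \<kappa>(2)[OF xe(2) ye(2)] by simp
      then show "F (x \<otimes>\<^bsub>sub K1 X\<^esub> y) = F x \<otimes>\<^bsub>E3 \<times>\<times> sub AGL2_9 (\<kappa> ` Y)\<^esub> F y"
        by (simp add: xe ye F_def DirProd_simps f(2))
    qed
    have "inj_on F X" using \<kappa>(1) by (auto simp: inj_on_def F_def X fi)
    moreover have "F ` X = carrier E3 \<times> \<kappa> ` Y"
    proof (intro equalityI subsetI)
      fix p assume "p \<in> carrier E3 \<times> \<kappa> ` Y"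
      then obtain a v A where p: "p = (a, \<kappa> (v, A))" "a \<in> carrier E3" "(v, A) \<in> Y" by auto
      then obtain e where "a = f e" using f(1) by (auto simp: bij_betw_def)
      then have "p = F (e, v, 1, A, False)" "(e, v, 1, A, False) \<in> X" using p by (auto simp: F_def X)
      then show "p \<in> F ` X" by blast
    qed (use f(1) in \<open>auto simp: F_def X bij_betw_def\<close>)
    ultimately show "bij_betw F (carrier (sub K1 X)) (carrier (E3 \<times>\<times> sub AGL2_9 (\<kappa> ` Y)))"
      by (simp add: bij_betw_def DirProd_simps)
  qed
  then show ?thesis by (rule is_isoI)
qed

lemma L1_iso: "sub K1 L1 \<cong> E3 \<times>\<times> ASL2_9"
proof -
  have L: "L1 = {(e, v, \<epsilon>, A, s). \<epsilon> = 1 \<and> \<not> s \<and> (v, A) \<in> AS}" by (auto simp: L1_def)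
  show ?thesis using split_E3[OF L, of id] by (simp add: ASL_eq)
qed

lemma Z1_iso: "sub K1 Z1 \<cong> E3"
proof -
  obtain f where f: "bij_betw f (UNIV :: 3 set) (carrier E3)" "\<And>x y. f (x + y) = f x \<otimes>\<^bsub>E3\<^esub> f y"
    using elem_abelian_3 by blast
  have fi: "f e = f e' \<longleftrightarrow> e = e'" for e e' using f(1) by (auto simp: bij_betw_def inj_eq)
  have "(\<lambda>x. f (fst x)) \<in> iso (sub K1 Z1) E3"
  proof (rule isoI)
    show "(\<lambda>x. f (fst x)) \<in> hom (sub K1 Z1) E3"
    proof (rule homI)
      fix x y assume "x \<in> carrier (sub K1 Z1)" "y \<in> carrier (sub K1 Z1)"
      then show "f (fst (x \<otimes>\<^bsub>sub K1 Z1\<^esub> y)) = f (fst x) \<otimes>\<^bsub>E3\<^esub> f (fst y)"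
        by (cases x; cases y) (simp add: f(2))
    qed (use f(1) in \<open>auto simp: bij_betw_def\<close>)
    have "inj_on (\<lambda>x. f (fst x)) Z1" by (rule inj_onI) (auto simp: fi Z1_def)
    moreover have "(\<lambda>x. f (fst x)) ` Z1 = range f"
    proof (intro equalityI subsetI)
      fix y assume "y \<in> range f"
      then obtain e where "y = f e" by blast
      then have "y = f (fst (e, 0 :: gf9 ^ 2, 1 :: 3, mat 1 :: gf9 ^ 2 ^ 2, False))" by simp
      moreover have "(e, 0, 1, mat 1, False) \<in> Z1" by simp
      ultimately show "y \<in> (\<lambda>x. f (fst x)) ` Z1" by blast
    qed auto
    ultimately show "bij_betw (\<lambda>x. f (fst x)) (carrier (sub K1 Z1)) (carrier E3)"
      using f(1) by (simp add: bij_betw_def)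
  qed
  then show ?thesis by (rule is_isoI)
qed

lemma S1_Syl: "order (sub K1 L1) = 80 * 3 ^ 7"
proof -
  have "card (carrier (sub K1 L1)) = card (carrier (E3 \<times>\<times> ASL2_9))"
    using L1_iso by (auto simp: is_iso_def iso_def intro: bij_betw_same_card)
  also have "\<dots> = 3 * order ASL2_9"
    using card_elem_abelian[of 1] by (simp add: DirProd_simps card_cartesian_product order_def)
  finally show ?thesis by (simp add: order_def[of "sub K1 L1"] order_ASL2)
qed

lemma conj_AGL_iso:
  assumes g: "g \<in> carrier G" and "group G"
  shows "(\<lambda>x. g \<otimes>\<^bsub>G\<^esub> x \<otimes>\<^bsub>G\<^esub> inv\<^bsub>G\<^esub> g) \<in> iso G G"
proof -
  interpret group G by fact
  have "(\<lambda>x. g \<otimes>\<^bsub>G\<^esub> x \<otimes>\<^bsub>G\<^esub> inv\<^bsub>G\<^esub> g) \<in> hom G G"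
  proof (rule homI)
    fix x y assume "x \<in> carrier G" "y \<in> carrier G"
    moreover from this have "inv\<^bsub>G\<^esub> g \<otimes>\<^bsub>G\<^esub> (g \<otimes>\<^bsub>G\<^esub> (y \<otimes>\<^bsub>G\<^esub> inv\<^bsub>G\<^esub> g)) = y \<otimes>\<^bsub>G\<^esub> inv\<^bsub>G\<^esub> g"
      using g by (simp add: m_assoc[symmetric])
    ultimately show "g \<otimes>\<^bsub>G\<^esub> (x \<otimes>\<^bsub>G\<^esub> y) \<otimes>\<^bsub>G\<^esub> inv\<^bsub>G\<^esub> g = g \<otimes>\<^bsub>G\<^esub> x \<otimes>\<^bsub>G\<^esub> inv\<^bsub>G\<^esub> g \<otimes>\<^bsub>G\<^esub> (g \<otimes>\<^bsub>G\<^esub> y \<otimes>\<^bsub>G\<^esub> inv\<^bsub>G\<^esub> g)"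
      using g by (simp add: m_assoc)
  qed (use g in auto)
  moreover have "bij_betw (\<lambda>x. g \<otimes>\<^bsub>G\<^esub> x \<otimes>\<^bsub>G\<^esub> inv\<^bsub>G\<^esub> g) (carrier G) (carrier G)"
  proof (rule bij_betw_byWitness[where f' = "\<lambda>x. inv\<^bsub>G\<^esub> g \<otimes>\<^bsub>G\<^esub> x \<otimes>\<^bsub>G\<^esub> g"])
    have *: "inv\<^bsub>G\<^esub> h \<otimes>\<^bsub>G\<^esub> (h \<otimes>\<^bsub>G\<^esub> x \<otimes>\<^bsub>G\<^esub> k) \<otimes>\<^bsub>G\<^esub> inv\<^bsub>G\<^esub> k = x" if "h \<in> carrier G" "k \<in> carrier G" "x \<in> carrier G" for h k x
    proof -
      have "inv\<^bsub>G\<^esub> h \<otimes>\<^bsub>G\<^esub> (h \<otimes>\<^bsub>G\<^esub> x \<otimes>\<^bsub>G\<^esub> k) \<otimes>\<^bsub>G\<^esub> inv\<^bsub>G\<^esub> k = (inv\<^bsub>G\<^esub> h \<otimes>\<^bsub>G\<^esub> h) \<otimes>\<^bsub>G\<^esub> x \<otimes>\<^bsub>G\<^esub> (k \<otimes>\<^bsub>G\<^esub> inv\<^bsub>G\<^esub> k)"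
        using that by (simp only: m_assoc m_closed inv_closed)
      then show ?thesis using that by simp
    qed
    show "\<forall>x\<in>carrier G. inv\<^bsub>G\<^esub> g \<otimes>\<^bsub>G\<^esub> (g \<otimes>\<^bsub>G\<^esub> x \<otimes>\<^bsub>G\<^esub> inv\<^bsub>G\<^esub> g) \<otimes>\<^bsub>G\<^esub> g = x"
      using *[of g "inv\<^bsub>G\<^esub> g"] g by simp
    show "\<forall>x\<in>carrier G. g \<otimes>\<^bsub>G\<^esub> (inv\<^bsub>G\<^esub> g \<otimes>\<^bsub>G\<^esub> x \<otimes>\<^bsub>G\<^esub> g) \<otimes>\<^bsub>G\<^esub> inv\<^bsub>G\<^esub> g = x"
      using *[of "inv\<^bsub>G\<^esub> g" g] g by simp
  qed (use g in auto)
  ultimately show ?thesis by (simp add: iso_def)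
qed

definition "D1 = {(e, v, \<epsilon>, A, s) \<in> T21. \<epsilon> = 1}"

text \<open>By Sylow's theorem, every Sylow 3-subgroup of \<open>ASL\<^sub>2(9)\<close> is the image of \<open>U0\<close> under an inner
  automorphism \<open>\<kappa>\<close> of \<open>AGL\<^sub>2(9)\<close> that leaves \<open>ASL\<^sub>2(9)\<close> invariant.\<close>

locale sylow_ASL =
  fixes S0 :: "affine_2_9 set" and \<kappa> :: "affine_2_9 \<Rightarrow> affine_2_9"
  assumes \<kappa>: "\<kappa> \<in> iso AGL2_9 AGL2_9" and \<kappa>_AS: "\<kappa> \<in> iso ASL2_9 ASL2_9" and S0: "S0 = \<kappa> ` U0"
begin

lemma \<kappa>_inj: "inj_on \<kappa> (carrier AGL2_9)"
  using \<kappa> by (simp add: iso_def bij_betw_def)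

lemma \<kappa>_mult: "x \<in> carrier AGL2_9 \<Longrightarrow> y \<in> carrier AGL2_9 \<Longrightarrow> \<kappa> (x \<otimes>\<^bsub>AGL2_9\<^esub> y) = \<kappa> x \<otimes>\<^bsub>AGL2_9\<^esub> \<kappa> y"
  using \<kappa> by (auto simp: iso_def hom_def)

lemma \<kappa>_hom: "group_hom AGL2_9 AGL2_9 \<kappa>"
  using \<kappa> group_AGL by (simp add: iso_def group_hom_def group_hom_axioms_def)

lemma U0_carrier: "U0 \<subseteq> carrier AGL2_9" "U0 \<subseteq> carrier ASL2_9"
  using U0_AS by (auto simp: carrier_ASL)

lemma K0_carrier: "K0 \<subseteq> carrier AGL2_9" by (auto simp: det_2)

lemma S0_carrier: "S0 \<subseteq> carrier AGL2_9" "S0 \<subseteq> carrier ASL2_9"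
proof -
  have "\<kappa> ` U0 \<subseteq> \<kappa> ` carrier AGL2_9" "\<kappa> ` U0 \<subseteq> \<kappa> ` carrier ASL2_9" using U0_carrier by blast+
  then show "S0 \<subseteq> carrier AGL2_9" "S0 \<subseteq> carrier ASL2_9"
    using \<kappa> \<kappa>_AS by (auto simp: S0 iso_def bij_betw_def)
qed

lemma K2_9_carrier: "K2_9 S0 = sub AGL2_9 (\<kappa> ` K0)"
  using K2_9_eq[OF S0_carrier(1)] fix_abelian_image[OF group_AGL \<kappa> U0_carrier(1), of "elem_abelian 3 4"]
  by (simp add: S0 fix_abelian_U0)

lemma K0_sub: "subgroup K0 AGL2_9"
  by (rule AGL2.finite_subgroupI)
    (auto simp: K0_def det_2 power_mult_distrib intro!: exI[of _ "mat 1"])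

text \<open>The character \<open>A $ 2 $ 2\<close> of \<open>K0\<close> takes all nonzero values,
  and its kernel \<open>U0\<close> has exponent 3. Hence the criterion for normal subgroups of given
  index applies to its transport along \<open>\<kappa>\<close>.\<close>

lemma K2_index:
  assumes dm: "d = 2 \<and> m = 4 \<or> d = 4 \<and> m = (2::nat)"
  shows "normal_of_index (K2_9 S0) d = sub AGL2_9 (\<kappa> ` {(v, A) \<in> K0. A $ 2 $ 2 ^ m = 1})"
    "subgroup (\<kappa> ` {(v, A) \<in> K0. A $ 2 $ 2 ^ m = 1}) AGL2_9"
proof -
  interpret \<kappa>: group_hom AGL2_9 AGL2_9 \<kappa> by (rule \<kappa>_hom)
  let ?K = "\<kappa> ` K0"
  have sK: "subgroup ?K AGL2_9" using K0_sub by (rule \<kappa>.subgroup_img_is_subgroup)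
  interpret K: group "sub AGL2_9 ?K" using sK by (rule AGL2.subgroup_imp_group)
  define ki where "ki = inv_into (carrier AGL2_9) \<kappa>"
  have inv: "ki (\<kappa> y) = y" if "y \<in> carrier AGL2_9" for y using that \<kappa>_inj by (simp add: ki_def)
  define \<chi>' where "\<chi>' x = snd (ki x) $ 2 $ 2" for x
  have \<chi>: "\<chi>' (\<kappa> (v, A)) = A $ 2 $ 2" if "(v, A) \<in> K0" for v A
  proof -
    have "(v, A) \<in> carrier AGL2_9" using that K0_carrier by blast
    then show ?thesis unfolding \<chi>'_def by (simp only: inv snd_conv)
  qed
  have mult: "\<chi>' (x \<otimes>\<^bsub>sub AGL2_9 ?K\<^esub> y) = \<chi>' x * \<chi>' y"
    if xy: "x \<in> carrier (sub AGL2_9 ?K)" "y \<in> carrier (sub AGL2_9 ?K)" for x y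
  proof -
    obtain v A w B where e: "x = \<kappa> (v, A)" "(v, A) \<in> K0" "y = \<kappa> (w, B)" "(w, B) \<in> K0" using xy by auto
    have c: "(v, A) \<in> carrier AGL2_9" "(w, B) \<in> carrier AGL2_9" using e K0_carrier by blast+
    have "x \<otimes>\<^bsub>AGL2_9\<^esub> y = \<kappa> ((v, A) \<otimes>\<^bsub>AGL2_9\<^esub> (w, B))" unfolding e by (rule \<kappa>_mult[OF c, symmetric])
    moreover have "(v, A) \<otimes>\<^bsub>AGL2_9\<^esub> (w, B) \<in> K0" using e K0_sub by (intro subgroup.m_closed)
    ultimately show ?thesis using e \<chi> by simp
  qed
  have img: "\<chi>' ` carrier (sub AGL2_9 ?K) = {c. c \<noteq> 0}"
  proof (intro equalityI subsetI)
    fix c assume "c \<in> \<chi>' ` carrier (sub AGL2_9 ?K)"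
    then show "c \<in> {c. c \<noteq> 0}" using \<chi> by auto
  next
    fix c :: gf9 assume "c \<in> {c. c \<noteq> 0}"
    then have k: "(0, mat2 (c ^ 2) 0 0 c) \<in> K0" by simp
    then have "c = \<chi>' (\<kappa> (0, mat2 (c ^ 2) 0 0 c))" using \<chi>[OF k] by simp
    then show "c \<in> \<chi>' ` carrier (sub AGL2_9 ?K)" using k by auto
  qed
  have ker: "x \<in> N" if "subgroup N (sub AGL2_9 ?K)"
    and ord3: "\<And>y. y \<in> carrier (sub AGL2_9 ?K) \<Longrightarrow> y [^]\<^bsub>sub AGL2_9 ?K\<^esub> (3::nat) = \<one>\<^bsub>sub AGL2_9 ?K\<^esub> \<Longrightarrow> y \<in> N"
    and x: "x \<in> carrier (sub AGL2_9 ?K)" "\<chi>' x = 1" for N x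
  proof (rule ord3[OF x(1)])
    obtain v A where e: "x = \<kappa> (v, A)" "(v, A) \<in> K0" using x by auto
    have c: "(v, A) \<in> carrier AGL2_9" using e K0_carrier by blast
    have A: "A $ 2 $ 2 = 1" "A $ 1 $ 1 = 1" "A $ 2 $ 1 = 0" using e \<chi>[OF e(2)] x(2) by auto
    then have "A = upper (A $ 1 $ 2)" by (simp add: vec_eq2)
    then obtain t where t: "A = upper t" by blast
    have "t * v $ 2 + t * v $ 2 + t * v $ 2 = 0" "v $ 1 + v $ 1 + v $ 1 = 0" "v $ 2 + v $ 2 + v $ 2 = 0" by (rule gf9_char)+
    then have "(v, A) \<otimes>\<^bsub>AGL2_9\<^esub> (v, A) \<otimes>\<^bsub>AGL2_9\<^esub> (v, A) = \<one>\<^bsub>AGL2_9\<^esub>"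
      using unipotent_cube(1)[of t] unfolding t by (simp add: vec_eq2 algebra_simps)
    then have "\<kappa> (v, A) \<otimes>\<^bsub>AGL2_9\<^esub> \<kappa> (v, A) \<otimes>\<^bsub>AGL2_9\<^esub> \<kappa> (v, A) = \<kappa> \<one>\<^bsub>AGL2_9\<^esub>"
      using c by (metis \<kappa>_mult AGL2.m_closed)
    then have "x \<otimes>\<^bsub>AGL2_9\<^esub> x \<otimes>\<^bsub>AGL2_9\<^esub> x = \<one>\<^bsub>AGL2_9\<^esub>" unfolding e(1) \<kappa>.hom_one .
    then show "x [^]\<^bsub>sub AGL2_9 ?K\<^esub> (3::nat) = \<one>\<^bsub>sub AGL2_9 ?K\<^esub>"
      unfolding pow3[OF K.is_group x(1)] by (simp del: AGL_simps)
  qed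
  have fin: "finite (carrier (sub AGL2_9 ?K))" by simp
  note r = K.normal_of_index_eq[OF fin dm mult img ker]
  have e: "{x \<in> carrier (sub AGL2_9 ?K). \<chi>' x ^ m = 1} = \<kappa> ` {(v, A) \<in> K0. A $ 2 $ 2 ^ m = 1}"
    using \<chi> by (auto simp del: K0_mem)
  show "normal_of_index (K2_9 S0) d = sub AGL2_9 (\<kappa> ` {(v, A) \<in> K0. A $ 2 $ 2 ^ m = 1})"
    using r(1) unfolding e K2_9_carrier sub_sub .
  have "subgroup (\<kappa> ` {(v, A) \<in> K0. A $ 2 $ 2 ^ m = 1}) (sub AGL2_9 ?K)" using r(2) unfolding e .
  then show "subgroup (\<kappa> ` {(v, A) \<in> K0. A $ 2 $ 2 ^ m = 1}) AGL2_9"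
    using sK by (rule AGL2.incl_subgroup[rotated])
qed

lemma normalizer_ASL: "normalizer ASL2_9 S0 = \<kappa> ` (tri \<inter> AS)"
proof -
  \<comment> \<open>Subgroups isomorphic to \<open>elem_abelian 3 0\<close> are trivial and always
    invariant, so the normalizer becomes a case of \<open>fix_abelian\<close>.\<close>
  have fa: "normalizer ASL2_9 S = fix_abelian ASL2_9 (elem_abelian 3 0) S" if "S \<subseteq> carrier ASL2_9" for S
  proof -
    have "E = {\<one>\<^bsub>ASL2_9\<^esub>}" if E: "subgroup E ASL2_9" "sub ASL2_9 E \<cong> elem_abelian 3 0" for E
    proof -
      have "card E = 1"
        using E(2) card_elem_abelian[of 0] by (auto simp: is_iso_def iso_def dest!: bij_betw_same_card)
      then show ?thesis using subgroup.one_closed[OF E(1)] by (metis card_1_singletonE singletonD)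
    qed
    moreover have "g <#\<^bsub>ASL2_9\<^esub> {\<one>\<^bsub>ASL2_9\<^esub>} #>\<^bsub>ASL2_9\<^esub> inv\<^bsub>ASL2_9\<^esub> g = {\<one>\<^bsub>ASL2_9\<^esub>}" if "g \<in> carrier ASL2_9" for g
      using that by (simp add: l_coset_def r_coset_def)
    ultimately show ?thesis
      unfolding ASL2.normalizer_eq[OF that] fix_abelian_def by blast
  qed
  have "normalizer ASL2_9 U0 = tri \<inter> AS"
  proof -
    have "g <#\<^bsub>ASL2_9\<^esub> U0 #>\<^bsub>ASL2_9\<^esub> inv\<^bsub>ASL2_9\<^esub> g = g <#\<^bsub>AGL2_9\<^esub> U0 #>\<^bsub>AGL2_9\<^esub> inv\<^bsub>AGL2_9\<^esub> g" if "g \<in> AS" for g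
      unfolding ASL_eq using AGL2.m_inv_consistent[OF AS_sub that] by (simp add: l_coset_def r_coset_def)
    note conj_eq = this
    have "g \<in> carrier ASL2_9 \<and> g <#\<^bsub>ASL2_9\<^esub> U0 #>\<^bsub>ASL2_9\<^esub> inv\<^bsub>ASL2_9\<^esub> g = U0 \<longleftrightarrow> g \<in> tri \<inter> AS" for g
    proof -
      obtain v A where ge: "g = (v, A)" by (cases g)
      show ?thesis
      proof (cases "det A = 1")
        case True
        have c: "(v, A) \<in> AS" using True by simp
        have "A $ 2 $ 1 = 0 \<longleftrightarrow> (v, A) \<in> tri" using True by (auto simp: det_2)
        moreover have "(v, A) \<in> carrier AGL2_9" using True by simp
        moreover have "g \<in> carrier ASL2_9" using True by (simp add: ge carrier_ASL)
        ultimately show ?thesis unfolding ge conj_eq[OF c] using U0_conj_iff c by blast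
      qed (simp add: ge carrier_ASL)
    qed
    then show ?thesis unfolding ASL2.normalizer_eq[OF U0_carrier(2)] by auto
  qed
  then show ?thesis
    using fix_abelian_image[OF ASL2.is_group \<kappa>_AS U0_carrier(2), of "elem_abelian 3 0"]
    unfolding fa[OF U0_carrier(2), symmetric] fa[OF S0_carrier(2), symmetric] S0[symmetric] by simp
qed

lemma LB_iso: "sub K1 (L1 \<inter> B1) \<cong> E3 \<times>\<times> ASL2_9_norm S0"
proof -
  have Y: "tri \<inter> AS \<subseteq> carrier AGL2_9" by auto
  have X: "L1 \<inter> B1 = {(e, v, \<epsilon>, A, s). \<epsilon> = 1 \<and> \<not> s \<and> (v, A) \<in> tri \<inter> AS}"
    by (auto simp: det_2)
  have "sub K1 (L1 \<inter> B1) \<cong> E3 \<times>\<times> sub AGL2_9 (\<kappa> ` (tri \<inter> AS))"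
    by (rule split_E3[OF X inj_on_subset[OF \<kappa>_inj Y] \<kappa>_mult[OF subsetD[OF Y] subsetD[OF Y]]])
  then show ?thesis unfolding ASL2_9_norm_def normalizer_ASL unfolding ASL_eq by simp
qed

lemma D1_iso: "sub K1 D1 \<cong> E3 \<times>\<times> normal_of_index (K2_9 S0) 4"
proof -
  let ?Y = "{(v, A) \<in> K0. A $ 2 $ 2 ^ 2 = 1}"
  have Y: "?Y \<subseteq> carrier AGL2_9" using K0_carrier by blast
  have X: "D1 = {(e, v, \<epsilon>, A, s). \<epsilon> = 1 \<and> \<not> s \<and> (v, A) \<in> ?Y}"
    by (auto simp: D1_def) (auto simp: eval_nat_numeral)
  have "sub K1 D1 \<cong> E3 \<times>\<times> sub AGL2_9 (\<kappa> ` ?Y)"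
    by (rule split_E3[OF X inj_on_subset[OF \<kappa>_inj Y] \<kappa>_mult[OF subsetD[OF Y] subsetD[OF Y]]])
  then show ?thesis using K2_index(1)[of 4 2] by simp
qed

text \<open>The map forgets \<open>e\<close> and the sign. In \<open>T21\<close> the sign equals
  \<open>A $ 2 $ 2 ^ 2\<close>, so only \<open>e\<close> is lost. That this square is a sign means
  \<open>A $ 2 $ 2 ^ 4 = 1\<close>, which cuts out index 2 in \<open>K0\<close>.\<close>

lemma T21_quotient:
  obtains f where "group (normal_of_index (K2_9 S0) 2)" "f \<in> hom (sub K1 T21) (normal_of_index (K2_9 S0) 2)"
    "f ` T21 = carrier (normal_of_index (K2_9 S0) 2)" "Z1 = {x \<in> T21. f x = \<one>\<^bsub>normal_of_index (K2_9 S0) 2\<^esub>}"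
proof -
  let ?Y = "{(v, A) \<in> K0. A $ 2 $ 2 ^ 4 = 1}"
  have Yc: "?Y \<subseteq> carrier AGL2_9" using K0_carrier by blast
  have N: "normal_of_index (K2_9 S0) 2 = sub AGL2_9 (\<kappa> ` ?Y)" and sY: "subgroup (\<kappa> ` ?Y) AGL2_9"
    using K2_index[of 2 4] by auto
  interpret \<kappa>: group_hom AGL2_9 AGL2_9 \<kappa> by (rule \<kappa>_hom)
  define f where "f = (\<lambda>(e::3, v, \<epsilon>::3, A, s::bool). \<kappa> (v, A))"
  have TY: "(v, A) \<in> ?Y" if T: "(e, v, \<epsilon>, A, s) \<in> T21" for e v \<epsilon> A s
  proof -
    have "\<epsilon> * \<epsilon> = 1" using three_cases[of \<epsilon>] T by auto
    then have "A $ 2 $ 2 ^ 4 = 1" using T by (simp add: power2_eq_square del: emb_simps(2))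
    moreover from this have "A $ 2 $ 2 \<noteq> 0" by auto
    ultimately show ?thesis using T by simp
  qed
  show thesis
  proof (rule that[of f])
    show "group (normal_of_index (K2_9 S0) 2)" unfolding N using sY by (rule AGL2.subgroup_imp_group)
    show "f \<in> hom (sub K1 T21) (normal_of_index (K2_9 S0) 2)"
      unfolding N
    proof (rule homI)
      fix x assume x: "x \<in> carrier (sub K1 T21)"
      obtain e v \<epsilon> A s where xe: "x = (e, v, \<epsilon>, A, s)" by (cases x)
      have 1: "(v, A) \<in> ?Y" "\<not> s" using x TY[of e v \<epsilon> A s] by (auto simp: xe)
      then show "f x \<in> carrier (sub AGL2_9 (\<kappa> ` ?Y))" unfolding xe f_def by simp
      fix y assume y: "y \<in> carrier (sub K1 T21)"
      obtain e' v' \<epsilon>' A' s' where ye: "y = (e', v', \<epsilon>', A', s')" by (cases y)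
      have 2: "(v', A') \<in> ?Y" using y TY[of e' v' \<epsilon>' A' s'] by (auto simp: ye)
      have "\<kappa> ((v, A) \<otimes>\<^bsub>AGL2_9\<^esub> (v', A')) = \<kappa> (v, A) \<otimes>\<^bsub>AGL2_9\<^esub> \<kappa> (v', A')"
        using 1(1) 2 Yc by (intro \<kappa>_mult) blast+
      then show "f (x \<otimes>\<^bsub>sub K1 T21\<^esub> y) = f x \<otimes>\<^bsub>sub AGL2_9 (\<kappa> ` ?Y)\<^esub> f y"
        using 1(2) by (simp add: xe ye f_def)
    qed
    show "f ` T21 = carrier (normal_of_index (K2_9 S0) 2)"
      unfolding N
    proof (intro equalityI subsetI)
      fix y assume "y \<in> f ` T21"
      then show "y \<in> carrier (sub AGL2_9 (\<kappa> ` ?Y))" using TY by (auto simp: f_def simp del: K0_mem mem_T21)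
    next
      fix y assume "y \<in> carrier (sub AGL2_9 (\<kappa> ` ?Y))"
      then obtain v A where y: "y = \<kappa> (v, A)" "(v, A) \<in> ?Y" by auto
      define d where "d = A $ 2 $ 2"
      have d: "d ^ 4 = 1" "A $ 2 $ 1 = 0" "A $ 1 $ 1 = d ^ 2" using y by (auto simp: d_def)
      have "(d ^ 2 - 1) * (d ^ 2 + 1) = 0" using d(1) by (simp add: algebra_simps eval_nat_numeral)
      then obtain \<epsilon> where e: "emb \<epsilon> = d ^ 2" "\<epsilon> = 1 \<or> \<epsilon> = -1"
        by (metis add_eq_0_iff2 emb_simps(4,5) mult_eq_0_iff right_minus_eq)
      have "(0, v, \<epsilon>, A, False) \<in> T21" using d e pow4_emb[of d \<epsilon>] by (auto simp: d_def)
      moreover have "y = f (0, v, \<epsilon>, A, False)" by (simp add: f_def y)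
      ultimately show "y \<in> f ` T21" by blast
    qed
    show "Z1 = {x \<in> T21. f x = \<one>\<^bsub>normal_of_index (K2_9 S0) 2\<^esub>}"
    proof -
      have *: "f (e, v, \<epsilon>, A, s) = \<one>\<^bsub>AGL2_9\<^esub> \<longleftrightarrow> (v, A) = \<one>\<^bsub>AGL2_9\<^esub>" if "(e, v, \<epsilon>, A, s) \<in> T21" for e v \<epsilon> A s
      proof -
        have "\<kappa> (v, A) = \<kappa> \<one>\<^bsub>AGL2_9\<^esub> \<longleftrightarrow> (v, A) = \<one>\<^bsub>AGL2_9\<^esub>"
          using TY[OF that] Yc by (intro inj_on_eq_iff[OF \<kappa>_inj]) blast+
        then show ?thesis unfolding \<kappa>.hom_one f_def by simp
      qed
      have "x \<in> Z1 \<longleftrightarrow> x \<in> T21 \<and> f x = \<one>\<^bsub>AGL2_9\<^esub>" for x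
      proof (cases "x \<in> T21")
        case True
        obtain e v \<epsilon> A s where xe: "x = (e, v, \<epsilon>, A, s)" by (cases x)
        have "x \<in> Z1 \<longleftrightarrow> (v, A) = \<one>\<^bsub>AGL2_9\<^esub>"
          using True emb_inj[of \<epsilon> 1] by (auto simp: xe simp del: emb_inj)
        then show ?thesis using True unfolding xe * [OF True[unfolded xe]] by blast
      next
        case False
        then show ?thesis using subsets1 by blast
      qed
      then show ?thesis unfolding N by (simp del: AGL_simps) blast
    qed
  qed
qed

end

subsection \<open>The first core parabolic\<close>

text \<open>The square of a fourth root of unity lies in the prime field and is recovered from its
  first coordinate. Signs \<open>\<epsilon>\<close> are reconstructed from determinants in this
  way.\<close>

lemma eps_square:
  fixes x :: gf9
  assumes "x ^ 4 = 1"
  shows "emb (gf9_re (x ^ 2)) = x ^ 2"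
proof -
  have "(x ^ 2 - 1) * (x ^ 2 + 1) = 0" using assms by (simp add: algebra_simps eval_nat_numeral)
  then have "x ^ 2 = 1 \<or> x ^ 2 = -1" by (auto simp: eq_neg_iff_add_eq_0)
  then show ?thesis by (auto simp: emb_def gf9_defs)
qed

text \<open>The complement to the translations consists of the tuples with \<open>e = 0\<close> and
  \<open>v = 0\<close>. There the sign is \<open>det A ^ 2\<close>, so a matrix extends to a tuple
  exactly when \<open>det A ^ 4 = 1\<close>.\<close>

lemma H1_semidirect:
  "\<exists>\<phi> \<in> hom (normal_of_index GL2_9 2) (AutoGroup (elem_abelian 3 5)).
    sub K1 H1 \<cong> semidirect (elem_abelian 3 5) (normal_of_index GL2_9 2) \<phi>"
proof -
  interpret H: group "sub K1 H1" using H1_sub by (rule K1.subgroup_imp_group)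
  let ?G = "{A :: gf9 ^ 2 ^ 2. det A \<noteq> 0 \<and> det A ^ 4 = 1}"
  define K where "K = {(e, v, \<epsilon>, A, s) \<in> H1. e = 0 \<and> v = 0}"
  have K_mem: "(e, v, \<epsilon>, A, s) \<in> K \<longleftrightarrow> e = 0 \<and> v = 0 \<and> emb \<epsilon> * det A ^ 2 = 1 \<and> \<not> s" for e v \<epsilon> A s
    by (auto simp: K_def)
  have KH: "K \<subseteq> H1" by (auto simp: K_def)
  have sK: "subgroup K K1"
  proof (rule K1.finite_subgroupI[OF fin1])
    have "\<one>\<^bsub>K1\<^esub> \<in> K" by (simp add: K_mem)
    then show "K \<noteq> {}" by blast
    fix x y assume x: "x \<in> K" and y: "y \<in> K"
    obtain \<epsilon> A where xe: "x = (0, 0, \<epsilon>, A, False)" using x by (cases x) (simp add: K_mem)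
    obtain \<epsilon>' A' where ye: "y = (0, 0, \<epsilon>', A', False)" using y by (cases y) (simp add: K_mem)
    have "x \<otimes>\<^bsub>K1\<^esub> y \<in> H1" using KH H1_sub x y by (blast intro: subgroup.m_closed)
    moreover have "x \<otimes>\<^bsub>K1\<^esub> y = (0, 0, \<epsilon> * \<epsilon>', A ** A', False)" by (simp add: xe ye)
    ultimately show "x \<otimes>\<^bsub>K1\<^esub> y \<in> K" unfolding K_def by simp
  qed (use KH subsets1 in blast)
  obtain f where f: "bij_betw f (UNIV :: (3 \<times> (gf9 ^ 2)) set) (carrier (elem_abelian 3 5))"
    "\<And>x y. f (x + y) = f x \<otimes>\<^bsub>elem_abelian 3 5\<^esub> f y" using elem_abelian_243 by blast
  have fi: "f a = f b \<longleftrightarrow> a = b" for a b using f(1) by (auto simp: bij_betw_def inj_eq)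
  define F where "F = (\<lambda>(e, v, \<epsilon>::3, A::gf9^2^2, s::bool). f (e, v))"
  have F: "F \<in> iso (sub (sub K1 H1) W1) (elem_abelian 3 5)"
  proof (rule isoI)
    show "F \<in> hom (sub (sub K1 H1) W1) (elem_abelian 3 5)"
    proof (rule homI)
      fix x y assume x: "x \<in> carrier (sub (sub K1 H1) W1)" and y: "y \<in> carrier (sub (sub K1 H1) W1)"
      show "F x \<in> carrier (elem_abelian 3 5)" using f(1) by (cases x) (auto simp: F_def bij_betw_def)
      show "F (x \<otimes>\<^bsub>sub (sub K1 H1) W1\<^esub> y) = F x \<otimes>\<^bsub>elem_abelian 3 5\<^esub> F y"
      proof -
        obtain e v where xe: "x = (e, v, 1, mat 1, False)" using x by (cases x) simp
        obtain e' v' where ye: "y = (e', v', 1, mat 1, False)" using y by (cases y) simp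
        show ?thesis by (simp add: xe ye F_def f(2)[symmetric])
      qed
    qed
    have "inj_on F W1" by (rule inj_onI) (auto simp: F_def W1_def fi)
    moreover have "F ` W1 = range f"
    proof (intro equalityI subsetI)
      fix y assume "y \<in> range f"
      then obtain e v where "y = f (e, v)" by auto
      then have "y = F (e, v, 1, mat 1, False)" by (simp add: F_def)
      moreover have "(e, v, 1, mat 1, False) \<in> W1" by simp
      ultimately show "y \<in> F ` W1" by blast
    qed (auto simp: F_def)
    ultimately show "bij_betw F (carrier (sub (sub K1 H1) W1)) (carrier (elem_abelian 3 5))"
      using f(1) by (simp add: bij_betw_def)
  qed
  define h where "h A = (0 :: 3, 0 :: gf9 ^ 2, gf9_re (det A ^ 2), A, False)" for A :: "gf9 ^ 2 ^ 2"
  have hK: "h A \<in> K" if "A \<in> ?G" for A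
  proof -
    have "emb (gf9_re (det A ^ 2)) * det A ^ 2 = det A ^ 2 * det A ^ 2" using that eps_square by simp
    also have "\<dots> = det A ^ 4" by (simp flip: power_add)
    finally show ?thesis using that by (simp add: h_def K_mem)
  qed
  have "h \<in> iso (sub GL ?G) (sub (sub K1 H1) K)"
  proof (rule isoI)
    show "h \<in> hom (sub GL ?G) (sub (sub K1 H1) K)"
    proof (rule homI)
      fix A B assume A: "A \<in> carrier (sub GL ?G)" and B: "B \<in> carrier (sub GL ?G)"
      show "h A \<in> carrier (sub (sub K1 H1) K)" using hK A by simp
      have AB: "det A ^ 4 = 1" "det B ^ 4 = 1" using A B by auto
      then have "det (A ** B) ^ 4 = 1" by (simp add: det_mul power_mult_distrib)
      then have "emb (gf9_re (det (A ** B) ^ 2)) = det (A ** B) ^ 2" by (rule eps_square)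
      also have "\<dots> = det A ^ 2 * det B ^ 2" by (simp add: det_mul power_mult_distrib)
      also have "\<dots> = emb (gf9_re (det A ^ 2) * gf9_re (det B ^ 2))"
        unfolding emb_simps eps_square[OF AB(1)] eps_square[OF AB(2)] ..
      finally have "gf9_re (det (A ** B) ^ 2) = gf9_re (det A ^ 2) * gf9_re (det B ^ 2)" by (simp only: emb_inj)
      then show "h (A \<otimes>\<^bsub>sub GL ?G\<^esub> B) = h A \<otimes>\<^bsub>sub (sub K1 H1) K\<^esub> h B" by (simp add: h_def)
    qed
    have "inj_on h ?G" by (auto simp: inj_on_def h_def)
    moreover have "h ` ?G = K"
    proof (intro equalityI subsetI)
      fix x assume x: "x \<in> K"
      obtain \<epsilon> A where xe: "x = (0, 0, \<epsilon>, A, False)" "emb \<epsilon> * det A ^ 2 = 1" using x by (cases x) (auto simp: K_mem)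
      note nz = K1_nz[of \<epsilon> A False, simplified, OF xe(2)]
      have "emb \<epsilon> = emb \<epsilon> * (emb \<epsilon> * det A ^ 2)" using xe(2) by simp
      also have "\<dots> = det A ^ 2" using nz(3) by (simp flip: emb_simps(2) mult.assoc)
      finally have e: "emb \<epsilon> = det A ^ 2" .
      have A4: "det A ^ 4 = 1" using xe(2) unfolding e by (simp flip: power_add)
      have "gf9_re (det A ^ 2) = \<epsilon>" using e by (metis emb_def gf9.sel(1))
      then have "x = h A" "A \<in> ?G" using xe A4 nz by (auto simp: h_def)
      then show "x \<in> h ` ?G" by blast
    qed (use hK in auto)
    ultimately show "bij_betw h (carrier (sub GL ?G)) (carrier (sub (sub K1 H1) K))" by (simp add: bij_betw_def)
  qed
  then have h: "h \<in> iso (normal_of_index GL2_9 2) (sub (sub K1 H1) K)" by (simp add: GL2_index(1))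
  have gG: "group (normal_of_index GL2_9 2)" unfolding GL2_index(1) using GL2_index(2) by (rule GL2.subgroup_imp_group)
  have "W1 \<lhd> sub K1 H1" using H1_sub subsets1 by (intro W1_normal_sub) auto
  moreover have "subgroup K (sub K1 H1)" using sK H1_sub KH by (rule K1.subgroup_incl)
  moreover have "W1 \<inter> K \<subseteq> {\<one>\<^bsub>sub K1 H1\<^esub>}" by (auto simp: K_mem)
  moreover have "\<exists>n\<in>W1. \<exists>k\<in>K. x = n \<otimes>\<^bsub>sub K1 H1\<^esub> k" if x: "x \<in> carrier (sub K1 H1)" for x
  proof -
    obtain e v \<epsilon> A where xe: "x = (e, v, \<epsilon>, A, False)" "emb \<epsilon> * det A ^ 2 = 1" using x by (cases x) auto
    show ?thesis
      by (rule bexI[of _ "(e, v, 1, mat 1, False)"], rule bexI[of _ "(0, 0, \<epsilon>, A, False)"])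
        (use xe in \<open>auto simp: K_mem\<close>)
  qed
  ultimately have "\<exists>\<phi>\<in>hom (normal_of_index GL2_9 2) (AutoGroup (elem_abelian 3 5)).
      \<exists>F'\<in>iso (sub K1 H1) (semidirect (elem_abelian 3 5) (normal_of_index GL2_9 2) \<phi>).
        \<forall>n\<in>W1. F' n = (F n, \<one>\<^bsub>normal_of_index GL2_9 2\<^esub>)"
    using group_elem_abelian F gG h by (intro H.internal_semidirect)
  then show ?thesis by (blast intro: is_isoI)
qed

definition "D0 = {(e, v, \<epsilon>, A, s) \<in> H1. \<epsilon> = 1}"

lemma D0_sub: "subgroup D0 K1" and D1_sub: "subgroup D1 K1"
proof -
  have D: "D0 = {x \<in> H1. fst (det_part x) = fst (det_part \<one>\<^bsub>K1\<^esub>)}"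
    "D1 = {x \<in> T21. fst (det_part x) = fst (det_part \<one>\<^bsub>K1\<^esub>)}"
    by (auto simp: D0_def D1_def)
  have m: "fst (det_part (x \<otimes>\<^bsub>K1\<^esub> y)) = fst (det_part x) * fst (det_part y)" for x y
    by (simp add: det_part_mult split: prod.splits)
  show "subgroup D0 K1" "subgroup D1 K1"
    using K1.normal_kernel_fun(2)[OF H1_sub m D(1)] K1.normal_kernel_fun(2)[OF T21_sub m D(2)] .
qed

lemma centralizer_Z1: "centralizer (sub K1 H1) Z1 = D0"
proof (intro equalityI subsetI)
  fix x assume x: "x \<in> centralizer (sub K1 H1) Z1"
  obtain e v \<epsilon> A s where xe: "x = (e, v, \<epsilon>, A, s)" by (cases x)
  have "x \<otimes>\<^bsub>K1\<^esub> (1, 0, 1, mat 1, False) = (1, 0, 1, mat 1, False) \<otimes>\<^bsub>K1\<^esub> x"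
    using x by (simp add: centralizer_def)
  then have "\<epsilon> = 1" by (simp add: xe add.commute)
  then show "x \<in> D0" using x by (simp add: D0_def centralizer_def xe)
next
  fix x assume "x \<in> D0"
  then show "x \<in> centralizer (sub K1 H1) Z1"
    by (cases x) (auto simp: D0_def centralizer_def add.commute)
qed

lemma D0_iso: "sub K1 D0 \<cong> E3 \<times>\<times> normal_of_index AGL2_9 4"
proof -
  let ?Y = "{(v, A). det A \<noteq> 0 \<and> det A ^ 2 = 1} :: affine_2_9 set"
  have X: "D0 = {(e, v, \<epsilon>, A, s). \<epsilon> = 1 \<and> \<not> s \<and> (v, A) \<in> ?Y}"
    by (auto simp: D0_def)
  show ?thesis unfolding AGL2_index(1) using split_E3[OF X, of id] by simp
qed

subsection \<open>The quaternion quotient\<close>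

lemma group_Q8: "group Q8"
proof (rule groupI)
  fix x y assume "x \<in> carrier Q8" "y \<in> carrier Q8"
  obtain a b c d where x: "x = (a, b, c, d)" by (cases x)
  obtain a' b' c' d' where y: "y = (a', b', c', d')" by (cases y)
  \<comment> \<open>Euler's four-square identity, the multiplicativity of the quaternion
    norm.\<close>
  have "(a * a' - b * b' - c * c' - d * d')\<^sup>2 + (a * b' + b * a' + c * d' - d * c')\<^sup>2 +
      (a * c' - b * d' + c * a' + d * b')\<^sup>2 + (a * d' + b * c' - c * b' + d * a')\<^sup>2 =
    (a\<^sup>2 + b\<^sup>2 + c\<^sup>2 + d\<^sup>2) * (a'\<^sup>2 + b'\<^sup>2 + c'\<^sup>2 + d'\<^sup>2)"
    by (simp add: power2_eq_square algebra_simps)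
  then show "x \<otimes>\<^bsub>Q8\<^esub> y \<in> carrier Q8"
    using \<open>x \<in> carrier Q8\<close> \<open>y \<in> carrier Q8\<close> by (simp add: Q8_def x y)
  fix z assume "z \<in> carrier Q8"
  obtain a'' b'' c'' d'' where z: "z = (a'', b'', c'', d'')" by (cases z)
  show "x \<otimes>\<^bsub>Q8\<^esub> y \<otimes>\<^bsub>Q8\<^esub> z = x \<otimes>\<^bsub>Q8\<^esub> (y \<otimes>\<^bsub>Q8\<^esub> z)"
    by (simp add: Q8_def x y z algebra_simps)
next
  fix x assume x: "x \<in> carrier Q8"
  obtain a b c d where xe: "x = (a, b, c, d)" by (cases x)
  show "\<one>\<^bsub>Q8\<^esub> \<otimes>\<^bsub>Q8\<^esub> x = x" by (simp add: Q8_def xe)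
  show "\<exists>y\<in>carrier Q8. y \<otimes>\<^bsub>Q8\<^esub> x = \<one>\<^bsub>Q8\<^esub>"
  proof (rule bexI)
    have s: "a * a + b * b + c * c + d * d = 1" using x by (simp add: Q8_def xe power2_eq_square)
    then show "(a, - b, - c, - d) \<otimes>\<^bsub>Q8\<^esub> x = \<one>\<^bsub>Q8\<^esub>" by (simp add: Q8_def xe)
    show "(a, - b, - c, - d) \<in> carrier Q8" using s by (simp add: Q8_def power2_eq_square)
  qed
qed (simp add: Q8_def)

lemma Q8_cases:
  assumes "(a, b, c, d) \<in> carrier Q8"
  shows "(a = 1 \<or> a = -1) \<and> b = 0 \<and> c = 0 \<and> d = 0 \<or> a = 0 \<and> (b = 1 \<or> b = -1) \<and> c = 0 \<and> d = 0 \<or>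
    a = 0 \<and> b = 0 \<and> (c = 1 \<or> c = -1) \<and> d = 0 \<or> a = 0 \<and> b = 0 \<and> c = 0 \<and> (d = 1 \<or> d = -1)"
proof -
  have s: "a\<^sup>2 + b\<^sup>2 + c\<^sup>2 + d\<^sup>2 = 1" using assms by (simp add: Q8_def)
  have nn: "0 \<le> a\<^sup>2" "0 \<le> b\<^sup>2" "0 \<le> c\<^sup>2" "0 \<le> d\<^sup>2" by simp_all
  have *: "x = 0 \<or> x = 1 \<or> x = -1" if "x\<^sup>2 \<le> 1" for x :: int
    using that abs_square_le_1[of x] by auto
  have "a = 0 \<or> a = 1 \<or> a = -1" "b = 0 \<or> b = 1 \<or> b = -1" "c = 0 \<or> c = 1 \<or> c = -1" "d = 0 \<or> d = 1 \<or> d = -1"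
    using s nn by (intro *; linarith)+
  then show ?thesis by (elim disjE) (use s in simp_all)
qed

definition sgn3 :: "3 \<Rightarrow> int" where "sgn3 x = (if x = 0 then 0 else if x = 1 then 1 else -1)"

text \<open>The determinants of the elements with \<open>s\<close> are \<open>\<omega>\<close> times those without, and \<open>\<omega>\<close>
  composed with Frobenius corresponds to the quaternion \<open>j\<close>; \<open>- (a + b) + (a - b) i\<close> is \<open>(a + b i) / \<omega>\<close>.\<close>

definition quat :: "gf9 \<Rightarrow> bool \<Rightarrow> int \<times> int \<times> int \<times> int" where
  "quat \<delta> s = (if s then (0, 0, sgn3 (- (gf9_re \<delta> + gf9_im \<delta>)), sgn3 (gf9_re \<delta> - gf9_im \<delta>))
    else (sgn3 (gf9_re \<delta>), sgn3 (gf9_im \<delta>), 0, 0))"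

text \<open>The determinants that the defining relation of \<open>K1\<close> permits: the fourth
  roots of unity, and their multiples by \<open>\<omega>\<close>.\<close>

definition dets :: "bool \<Rightarrow> gf9 set" where
  "dets s = (if s then {GF9 1 1, GF9 (-1) (-1), GF9 1 (-1), GF9 (-1) 1}
    else {GF9 1 0, GF9 (-1) 0, GF9 0 1, GF9 0 (-1)})"

lemma mem_dets:
  assumes h: "emb \<epsilon> * \<delta> ^ 2 = \<mu> s"
  shows "\<delta> \<in> dets s"
proof -
  have *: "\<forall>\<delta> \<epsilon>. emb \<epsilon> * \<delta> ^ 2 = \<mu> True \<longrightarrow> \<delta> \<in> dets True" "\<forall>\<delta> \<epsilon>. emb \<epsilon> * \<delta> ^ 2 = \<mu> False \<longrightarrow> \<delta> \<in> dets False"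
    unfolding all_gf9 all_3 by (simp_all add: dets_def \<mu>_def \<omega>_def emb_def gf9_defs power2_eq_square)
  show ?thesis
  proof (cases s)
    case True
    show ?thesis using *(1) h unfolding eqTrueI[OF True] by blast
  next
    case False
    then have "s = False" by simp
    show ?thesis using *(2) h unfolding \<open>s = False\<close> by blast
  qed
qed

lemma quat_mult:
  assumes "\<delta> \<in> dets s" "\<delta>' \<in> dets s'"
  shows "quat (\<delta> * frob s \<delta>') (s \<noteq> s') = quat \<delta> s \<otimes>\<^bsub>Q8\<^esub> quat \<delta>' s'"
proof -
  have "\<forall>\<delta>\<in>dets s. \<forall>\<delta>'\<in>dets s'. quat (\<delta> * frob s \<delta>') (s \<noteq> s') = quat \<delta> s \<otimes>\<^bsub>Q8\<^esub> quat \<delta>' s'"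
    by (cases s; cases s') (simp_all add: dets_def quat_def sgn3_def Q8_def frob_def gf9_defs)
  then show ?thesis using assms by blast
qed

definition to_Q8 :: "k1 \<Rightarrow> int \<times> int \<times> int \<times> int" where
  "to_Q8 = (\<lambda>(e, v, \<epsilon>, A, s). quat (det A) s)"

text \<open>Determinant and field automorphism determine the sign \<open>\<epsilon>\<close>. Hence
  an element with determinant 1 and no field automorphism has sign 1 and lies in
  \<open>L1\<close>.\<close>

lemma to_Q8: "to_Q8 \<in> hom K1 Q8" "to_Q8 ` carrier K1 = carrier Q8" "L1 = {x \<in> carrier K1. to_Q8 x = \<one>\<^bsub>Q8\<^esub>}"
proof -
  have "\<forall>\<delta>\<in>dets s. quat \<delta> s \<in> carrier Q8 \<and> (quat \<delta> s = \<one>\<^bsub>Q8\<^esub> \<longleftrightarrow> \<delta> = 1 \<and> \<not> s)" for s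
    by (cases s) (simp_all add: dets_def quat_def sgn3_def Q8_def one_gf9_def)
  then have q: "quat \<delta> s \<in> carrier Q8" "quat \<delta> s = \<one>\<^bsub>Q8\<^esub> \<longleftrightarrow> \<delta> = 1 \<and> \<not> s" if "\<delta> \<in> dets s" for \<delta> s
    using that by blast+
  show "to_Q8 \<in> hom K1 Q8"
  proof (rule homI)
    fix x assume x: "x \<in> carrier K1"
    obtain e v \<epsilon> A s where xe: "x = (e, v, \<epsilon>, A, s)" by (cases x)
    have 1: "det A \<in> dets s" using x by (auto simp: xe intro: mem_dets)
    then show "to_Q8 x \<in> carrier Q8" using q by (simp add: xe to_Q8_def)
    fix y assume y: "y \<in> carrier K1"
    obtain e' v' \<epsilon>' A' s' where ye: "y = (e', v', \<epsilon>', A', s')" by (cases y)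
    have 2: "det A' \<in> dets s'" using y by (auto simp: ye intro: mem_dets)
    show "to_Q8 (x \<otimes>\<^bsub>K1\<^esub> y) = to_Q8 x \<otimes>\<^bsub>Q8\<^esub> to_Q8 y"
      using quat_mult[OF 1 2] by (simp add: xe ye to_Q8_def det_mul)
  qed
  show "L1 = {x \<in> carrier K1. to_Q8 x = \<one>\<^bsub>Q8\<^esub>}"
  proof -
    have "x \<in> L1 \<longleftrightarrow> x \<in> carrier K1 \<and> to_Q8 x = \<one>\<^bsub>Q8\<^esub>" for x
    proof -
      obtain e v \<epsilon> A s where xe: "x = (e, v, \<epsilon>, A, s)" by (cases x)
      show ?thesis
      proof (cases "x \<in> carrier K1")
        case True
        then have "det A \<in> dets s" by (auto simp: xe intro: mem_dets)
        then show ?thesis using q(2) True by (auto simp: xe to_Q8_def)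
      qed (use subsets1 in blast)
    qed
    then show ?thesis by blast
  qed
  show "to_Q8 ` carrier K1 = carrier Q8"
  proof (intro equalityI subsetI)
    fix y assume "y \<in> to_Q8 ` carrier K1"
    then show "y \<in> carrier Q8" using \<open>to_Q8 \<in> hom K1 Q8\<close> by (auto simp: hom_def)
  next
    fix y assume y: "y \<in> carrier Q8"
    obtain a b c d where ye: "y = (a, b, c, d)" by (cases y)
    have "\<exists>s. \<exists>\<delta>. (\<exists>\<epsilon>. emb \<epsilon> * \<delta> ^ 2 = \<mu> s) \<and> quat \<delta> s = y"
    proof -
      have T: "emb 1 * (GF9 1 1) ^ 2 = \<mu> True" "emb 1 * (GF9 (-1) (-1)) ^ 2 = \<mu> True"
        "emb (-1) * (GF9 1 (-1)) ^ 2 = \<mu> True" "emb (-1) * (GF9 (-1) 1) ^ 2 = \<mu> True"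
        and F: "emb 1 * (GF9 1 0) ^ 2 = \<mu> False" "emb 1 * (GF9 (-1) 0) ^ 2 = \<mu> False"
        "emb (-1) * (GF9 0 1) ^ 2 = \<mu> False" "emb (-1) * (GF9 0 (-1)) ^ 2 = \<mu> False"
        by (simp_all add: \<mu>_def \<omega>_def emb_def gf9_defs power2_eq_square)
      have qT: "quat (GF9 1 1) True = (0, 0, 1, 0)" "quat (GF9 (-1) (-1)) True = (0, 0, -1, 0)"
        "quat (GF9 1 (-1)) True = (0, 0, 0, -1)" "quat (GF9 (-1) 1) True = (0, 0, 0, 1)"
        and qF: "quat (GF9 1 0) False = (1, 0, 0, 0)" "quat (GF9 (-1) 0) False = (-1, 0, 0, 0)"
        "quat (GF9 0 1) False = (0, 1, 0, 0)" "quat (GF9 0 (-1)) False = (0, -1, 0, 0)"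
        by (simp_all add: quat_def sgn3_def)
      from Q8_cases[OF y[unfolded ye]] consider
        "y = (1, 0, 0, 0)" | "y = (-1, 0, 0, 0)" | "y = (0, 1, 0, 0)" | "y = (0, -1, 0, 0)" |
        "y = (0, 0, 1, 0)" | "y = (0, 0, -1, 0)" | "y = (0, 0, 0, 1)" | "y = (0, 0, 0, -1)"
        unfolding ye by (elim disjE conjE) simp_all
      then show ?thesis by cases (use T F qT qF in blast)+
    qed
    then obtain s \<delta> \<epsilon> where "emb \<epsilon> * \<delta> ^ 2 = \<mu> s" "quat \<delta> s = y" by blast
    then have "(0, 0, \<epsilon>, mat2 \<delta> 0 0 1, s) \<in> carrier K1" "to_Q8 (0, 0, \<epsilon>, mat2 \<delta> 0 0 1, s) = y"
      by (simp_all add: to_Q8_def)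
    then show "y \<in> to_Q8 ` carrier K1" by blast
  qed
qed

subsection \<open>The second core parabolic\<close>

lemma S2_normal_H2: "S2 \<lhd> sub K2 H2"
proof -
  let ?f = "\<lambda>(e::3, z::gf9, v::gf9, u::gf9, c::gf9, \<epsilon>::3, d::gf9, g::gf9, s::bool). (c, \<epsilon>, d, g)"
  let ?m = "\<lambda>(c, \<epsilon>, d, g) (c', \<epsilon>', d', g'). (c + emb \<epsilon> * d * g * c', \<epsilon> * \<epsilon>', d * d', g * g')"
  have S: "S2 = {x \<in> H2. ?f x = ?f \<one>\<^bsub>K2\<^esub>}" by (auto simp: S2_def H2_def)
  have "?f (x \<otimes>\<^bsub>K2\<^esub> y) = ?m (?f x) (?f y)" if "x \<in> H2" "y \<in> H2" for x y
    using that by (cases x rule: k2_cases; cases y rule: k2_cases) simp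
  from K2.normal_kernel_fun[OF H2_sub this S] show ?thesis by auto
qed

abbreviation "K' \<equiv> normal_of_index GL1_9 2 \<times>\<times> AGL1_9"

definition Kc :: "k2 set" where
  "Kc = {(e, z, v, u, c, \<epsilon>, d, g, s) \<in> H2. e = 0 \<and> z = 0 \<and> v = 0 \<and> u = 0}"

lemma Kc_mem [simp]: "(e, z, v, u, c, \<epsilon>, d, g, s) \<in> Kc \<longleftrightarrow>
    e = 0 \<and> z = 0 \<and> v = 0 \<and> u = 0 \<and> emb \<epsilon> * (d ^ 2 * g) ^ 2 = 1 \<and> \<not> s"
  by (auto simp: Kc_def)

lemma Kc_sub: "subgroup Kc K2"
proof (rule K2.finite_subgroupI[OF fin2])
  have "\<one>\<^bsub>K2\<^esub> \<in> Kc" by simp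
  then show "Kc \<noteq> {}" by blast
  fix x y assume x: "x \<in> Kc" and y: "y \<in> Kc"
  then have "x \<otimes>\<^bsub>K2\<^esub> y \<in> H2" by (intro subgroup.m_closed[OF H2_sub]) (auto simp: Kc_def)
  then show "x \<otimes>\<^bsub>K2\<^esub> y \<in> Kc" using x y by (cases x rule: k2_cases; cases y rule: k2_cases) auto
qed (auto simp: Kc_def)

lemma group_K': "group K'"
  unfolding GL1_index(1) using GL1_index(2) by (intro DirProd_group GL1.subgroup_imp_group group_AGL)

text \<open>Put \<open>b = g\<close>, and let \<open>x = \<epsilon> d g\<close> be the factor acting
  on labels. The relation gives \<open>\<epsilon> = d^4 g^2\<close>, hence \<open>g^4 = 1\<close>
  and \<open>x = d^5 g^3\<close>. Solving for \<open>d\<close> with \<open>x^8 = 1\<close> yields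
  \<open>d = b x^5\<close> and \<open>\<epsilon> = b^2 x^4\<close>, the exponents in
  \<open>h\<close>. The factor with \<open>x = 1\<close> is the torus of \<open>T2\<close>; the
  other acts on the labels as \<open>AGL_1(9)\<close>.\<close>

lemma Kc_iso: "\<exists>h. h \<in> iso K' (sub K2 Kc)"
proof -
  define h :: "(gf9 ^ 1 ^ 1) \<times> (gf9 ^ 1) \<times> (gf9 ^ 1 ^ 1) \<Rightarrow> k2" where
    "h = (\<lambda>(B, w, X). (0, 0, 0, 0, w $ 1, gf9_re ((B $ 1 $ 1 * (X $ 1 $ 1) ^ 2) ^ 2),
      B $ 1 $ 1 * (X $ 1 $ 1) ^ 5, B $ 1 $ 1, False))"
  have K'_mem: "(B, w, X) \<in> carrier K' \<longleftrightarrow> (B $ 1 $ 1) ^ 4 = 1 \<and> B $ 1 $ 1 \<noteq> 0 \<and> X $ 1 $ 1 \<noteq> 0" for B w X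
    unfolding DirProd_simps GL1_index(1) by auto
  have eps: "emb (gf9_re ((b * x ^ 2) ^ 2)) = b ^ 2 * x ^ 4" if "b ^ 4 = 1" "x \<noteq> 0" for b x
  proof -
    have "(b * x ^ 2) ^ 4 = b ^ 4 * x ^ 8" by (simp add: power_mult_distrib flip: power_mult)
    then have "(b * x ^ 2) ^ 4 = 1" using that gf9_pow8 by simp
    then have "emb (gf9_re ((b * x ^ 2) ^ 2)) = (b * x ^ 2) ^ 2" by (rule eps_square)
    also have "\<dots> = b ^ 2 * x ^ 4" by (simp add: power_mult_distrib flip: power_mult)
    finally show ?thesis .
  qed
  have red: "b ^ 2 * x ^ 4 * (b * x ^ 5) * b = x" if "b ^ 4 = 1" for b x :: gf9
  proof -
    have "b ^ 2 * x ^ 4 * (b * x ^ 5) * b = b ^ 4 * x ^ 9" by (simp add: eval_nat_numeral ac_simps)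
    then show ?thesis using that gf9_pow9 by simp
  qed
  have hK: "h p \<in> Kc" if p: "p \<in> carrier K'" for p
  proof -
    obtain B w X where pe: "p = (B, w, X)" by (cases p)
    define b x where "b = B $ 1 $ 1" "x = X $ 1 $ 1"
    have bx: "b ^ 4 = 1" "x \<noteq> 0" using p unfolding pe K'_mem b_x_def by auto
    have "b ^ 2 * x ^ 4 * ((b * x ^ 5) ^ 2 * b) ^ 2 = (b ^ 4) ^ 2 * (x ^ 8) ^ 3"
      by (simp add: eval_nat_numeral ac_simps)
    then have "b ^ 2 * x ^ 4 * ((b * x ^ 5) ^ 2 * b) ^ 2 = 1" using bx gf9_pow8 by simp
    then show ?thesis using eps[OF bx] by (simp add: pe h_def b_x_def[symmetric])
  qed
  have "h \<in> iso K' (sub K2 Kc)"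
  proof (rule isoI)
    show "h \<in> hom K' (sub K2 Kc)"
    proof (rule homI)
      fix p q assume p: "p \<in> carrier K'" and q: "q \<in> carrier K'"
      show "h p \<in> carrier (sub K2 Kc)" using hK p by simp
      obtain B w X where pe: "p = (B, w, X)" by (cases p)
      obtain B' w' X' where qe: "q = (B', w', X')" by (cases q)
      define b x b' x' where bx: "b = B $ 1 $ 1" "x = X $ 1 $ 1" "b' = B' $ 1 $ 1" "x' = X' $ 1 $ 1"
      have 1: "b ^ 4 = 1" "x \<noteq> 0" "b' ^ 4 = 1" "x' \<noteq> 0" using p q unfolding pe qe K'_mem bx by auto
      have m: "(b * b') ^ 4 = 1" "x * x' \<noteq> 0" using 1 by (simp_all add: power_mult_distrib)
      have "emb (gf9_re ((b * b' * (x * x') ^ 2) ^ 2)) = emb (gf9_re ((b * x ^ 2) ^ 2) * gf9_re ((b' * x' ^ 2) ^ 2))"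
        unfolding emb_simps eps[OF m] eps[OF 1(1,2)] eps[OF 1(3,4)] by (simp add: power_mult_distrib ac_simps)
      then have e: "gf9_re ((b * b' * (x * x') ^ 2) ^ 2) = gf9_re ((b * x ^ 2) ^ 2) * gf9_re ((b' * x' ^ 2) ^ 2)"
        by (simp only: emb_inj)
      have c: "emb (gf9_re ((b * x ^ 2) ^ 2)) * (b * x ^ 5) * b = x" unfolding eps[OF 1(1,2)] using red[OF 1(1)] .
      have pq: "p \<otimes>\<^bsub>K'\<^esub> q = (B ** B', w + X *v w', X ** X')"
        by (simp add: pe qe DirProd_simps GL1_index(1))
      show "h (p \<otimes>\<^bsub>K'\<^esub> q) = h p \<otimes>\<^bsub>sub K2 Kc\<^esub> h q"
        unfolding pq unfolding pe qe h_def using e c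
        by (simp add: bx[symmetric] power_mult_distrib ac_simps del: emb_simps)
    qed
    have "inj_on h (carrier K')"
    proof (rule inj_onI)
      fix p q assume p: "p \<in> carrier K'" and q: "q \<in> carrier K'" and eq: "h p = h q"
      obtain B w X where pe: "p = (B, w, X)" by (cases p)
      obtain B' w' X' where qe: "q = (B', w', X')" by (cases q)
      have 1: "B $ 1 $ 1 = B' $ 1 $ 1" "w $ 1 = w' $ 1" "B $ 1 $ 1 * (X $ 1 $ 1) ^ 5 = B' $ 1 $ 1 * (X' $ 1 $ 1) ^ 5"
        using eq by (auto simp: pe qe h_def)
      have nz: "B $ 1 $ 1 \<noteq> 0" "X $ 1 $ 1 \<noteq> 0" "X' $ 1 $ 1 \<noteq> 0" using p q unfolding pe qe K'_mem by auto
      have x5: "(X $ 1 $ 1) ^ 5 = (X' $ 1 $ 1) ^ 5" using 1 nz by simp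
      \<comment> \<open>Fifth powers can be undone by fifth powers, since
        \<open>25 = 3 * 8 + 1\<close>.\<close>
      have "y = (y ^ 5) ^ 5" if "y \<noteq> 0" for y :: gf9
      proof -
        have "(y ^ 5) ^ 5 = (y ^ 8) ^ 3 * y" by (simp add: eval_nat_numeral ac_simps)
        then show ?thesis using gf9_pow8[OF that] by simp
      qed
      then have "X $ 1 $ 1 = X' $ 1 $ 1" using x5 nz by metis
      then show "p = q" using 1 by (simp add: pe qe vec_eq1)
    qed
    moreover have "h ` carrier K' = Kc"
    proof (intro equalityI subsetI)
      fix k assume k: "k \<in> Kc"
      obtain c \<epsilon> d g where ke: "k = (0, 0, 0, 0, c, \<epsilon>, d, g, False)" "emb \<epsilon> * (d ^ 2 * g) ^ 2 = 1"
        using k by (cases k rule: k2_cases) auto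
      note nz = K2_nz[of \<epsilon> d g False, simplified, OF ke(2)]
      have ee: "emb \<epsilon> * emb \<epsilon> = 1" using nz(4) by (metis emb_simps(2,4))
      define x where "x = emb \<epsilon> * d * g"
      have xnz: "x \<noteq> 0" using nz by (simp add: x_def)
      have d4: "emb \<epsilon> = d ^ 4 * g ^ 2"
      proof -
        have "emb \<epsilon> = emb \<epsilon> * (emb \<epsilon> * (d ^ 2 * g) ^ 2)" using ke(2) by simp
        also have "\<dots> = (emb \<epsilon> * emb \<epsilon>) * (d ^ 4 * g ^ 2)" by (simp add: power2_eq_square eval_nat_numeral ac_simps)
        finally show ?thesis using ee by simp
      qed
      have g4: "g ^ 4 = 1"
      proof -
        have "emb \<epsilon> * emb \<epsilon> = d ^ 8 * g ^ 4" unfolding d4 by (simp add: eval_nat_numeral ac_simps)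
        then show ?thesis using ee gf9_pow8[OF nz(2)] by simp
      qed
      have x4: "g ^ 2 * x ^ 4 = emb \<epsilon>"
      proof -
        have "g ^ 2 * x ^ 4 = (emb \<epsilon> * emb \<epsilon>) ^ 2 * (d ^ 4 * g ^ 2) * g ^ 4"
          by (simp add: x_def eval_nat_numeral ac_simps)
        then show ?thesis using ee g4 d4 by simp
      qed
      have x5: "g * x ^ 5 = d"
      proof -
        have "g * x ^ 5 = (g ^ 2 * x ^ 4) * emb \<epsilon> * d" by (simp add: x_def eval_nat_numeral ac_simps)
        then show ?thesis using x4 ee by simp
      qed
      have "gf9_re ((g * x ^ 2) ^ 2) = \<epsilon>"
        using eps[OF g4 xnz] x4 by (metis emb_inj)
      then have "k = h (mat g, mat2_1, mat x)" if "mat2_1 $ 1 = c" for mat2_1 :: "gf9 ^ 1"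
        using that x5 by (simp add: h_def ke)
      moreover have "(\<chi> i. c :: gf9 ^ 1) $ 1 = c" by simp
      ultimately have "k = h (mat g, (\<chi> i. c), mat x)" by blast
      moreover have "(mat g, (\<chi> i. c), mat x) \<in> carrier K'" unfolding K'_mem using g4 xnz nz by simp
      ultimately show "k \<in> h ` carrier K'" by blast
    qed (use hK in auto)
    ultimately show "bij_betw h (carrier K') (carrier (sub K2 Kc))" by (simp add: bij_betw_def)
  qed
  then show ?thesis by blast
qed

lemma (in inj_hom) normal_image:
  assumes X: "subgroup X G" and N: "N \<lhd> sub G X"
  shows "h ` N \<lhd> sub H (h ` X)"
  using iso_normal_subgroup[OF iso_sub[OF subgroup.subset[OF X]] _ _ N]
    G.subgroup_imp_group[OF X] H.subgroup_imp_group[OF subgroup_img_is_subgroup[OF X]] by simp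

text \<open>This is carried out for the images under \<open>f\<close>, because the isomorphism is to
  restrict to the identity on the normal factor inside the target group.\<close>

lemma H2_semidirect:
  assumes "inj_hom K2 A f"
  shows "\<exists>\<phi> \<in> hom K' (AutoGroup (sub A (f ` S2))). \<exists>F \<in> iso (sub A (f ` H2)) (semidirect (sub A (f ` S2)) K' \<phi>).
    \<forall>q\<in>f ` S2. F q = (q, \<one>\<^bsub>K'\<^esub>)"
proof -
  interpret f: inj_hom K2 A f by fact
  have sH: "subgroup (f ` H2) A" using H2_sub by (rule f.subgroup_img_is_subgroup)
  interpret H: group "sub A (f ` H2)" using sH by (rule f.H.subgroup_imp_group)
  obtain h where h: "h \<in> iso K' (sub K2 Kc)" using Kc_iso by blast
  have KH: "Kc \<subseteq> H2" by (auto simp: Kc_def)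
  have sK: "subgroup (f ` Kc) A" using Kc_sub by (rule f.subgroup_img_is_subgroup)
  have "f ` S2 \<lhd> sub A (f ` H2)" using H2_sub S2_normal_H2 by (rule f.normal_image)
  moreover have "subgroup (f ` Kc) (sub A (f ` H2))" using sK sH KH by (intro f.H.subgroup_incl) auto
  moreover have "f ` S2 \<inter> f ` Kc \<subseteq> {\<one>\<^bsub>sub A (f ` H2)\<^esub>}"
  proof -
    have "f ` S2 \<inter> f ` Kc = f ` (S2 \<inter> Kc)"
      using subsets2 KH by (intro inj_on_image_Int[OF f.inj, symmetric]) blast+
    moreover have "S2 \<inter> Kc \<subseteq> {\<one>\<^bsub>K2\<^esub>}" by (auto simp: S2_def)
    ultimately show ?thesis using f.hom_one by (auto simp del: K2_one)
  qed
  moreover have "\<exists>n\<in>f ` S2. \<exists>k\<in>f ` Kc. x = n \<otimes>\<^bsub>sub A (f ` H2)\<^esub> k" if x: "x \<in> carrier (sub A (f ` H2))" for x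
  proof -
    obtain y where y: "y \<in> H2" "x = f y" using x by auto
    obtain e z v u c \<epsilon> d g where ye: "y = (e, z, v, u, c, \<epsilon>, d, g, False)" "emb \<epsilon> * (d ^ 2 * g) ^ 2 = 1"
      using y(1) by (cases y rule: k2_cases) auto
    let ?n = "(e, z, v, u, 0, 1, 1, 1, False)" and ?k = "(0, 0, 0, 0, c, \<epsilon>, d, g, False)"
    have nk: "?n \<in> S2" "?k \<in> Kc" "y = ?n \<otimes>\<^bsub>K2\<^esub> ?k" using ye by auto
    then have "x = f ?n \<otimes>\<^bsub>A\<^esub> f ?k" using y(2) subsets2 KH by (subst f.hom_mult[symmetric]) auto
    then have "x = f ?n \<otimes>\<^bsub>sub A (f ` H2)\<^esub> f ?k" by simp
    then show ?thesis using imageI[OF nk(1), of f] imageI[OF nk(2), of f] by blast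
  qed
  moreover have "group (sub A (f ` S2))" using S2_sub by (intro f.H.subgroup_imp_group f.subgroup_img_is_subgroup)
  moreover have "(\<lambda>x. x) \<in> iso (sub (sub A (f ` H2)) (f ` S2)) (sub A (f ` S2))"
    by (simp add: iso_def hom_def bij_betw_def)
  moreover have "f \<circ> h \<in> iso K' (sub (sub A (f ` H2)) (f ` Kc))"
  proof -
    have "f \<in> iso (sub K2 Kc) (sub A (f ` Kc))" using Kc_sub by (intro f.iso_sub subgroup.subset)
    then have "f \<circ> h \<in> iso K' (sub A (f ` Kc))" using h by (rule iso_set_trans[rotated])
    then show ?thesis by simp
  qed
  ultimately show ?thesis
    using group_K' H.internal_semidirect[of "f ` S2" "f ` Kc" "sub A (f ` S2)" "\<lambda>x. x" K' "f \<circ> h"] by blast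
qed

definition "D2 = {(e, z, v, u, c, \<epsilon>, d, g, s) \<in> T2. \<epsilon> = 1}"

lemma D2_C2: "D2 \<subseteq> C2"
  using subsets2 by (auto simp: D2_def)

text \<open>Commuting with the direction \<open>e\<close> of the center forces sign 1 and label 0.
  Commuting with the direction \<open>z\<close> forces \<open>d g = 1\<close>, so that the element
  acts trivially on labels and lies in \<open>T2\<close>.\<close>

lemma centralizer_Z2: "centralizer (sub K2 H2) Z2 = D2"
proof (intro equalityI subsetI)
  fix x assume x: "x \<in> centralizer (sub K2 H2) Z2"
  obtain e z v u c \<epsilon> d g s where xe: "x = (e, z, v, u, c, \<epsilon>, d, g, s)" by (cases x rule: k2_cases)
  have com: "x \<otimes>\<^bsub>K2\<^esub> y = y \<otimes>\<^bsub>K2\<^esub> x" if "y \<in> Z2" for y using x that by (simp add: centralizer_def)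
  have h: "emb \<epsilon> * (d ^ 2 * g) ^ 2 = 1" "\<not> s" using x by (auto simp: centralizer_def xe)
  have eps: "\<epsilon> = 1" using com[of "(1, 0, 0, 0, 0, 1, 1, 1, False)"] by (simp add: xe add.commute)
  then have 1: "\<epsilon> = 1" "c = 0" using com[of "(1, 0, 0, 0, 0, 1, 1, 1, False)"] by (simp_all add: xe add.commute)
  have 2: "d * g = 1" using com[of "(0, 1, 0, 0, 0, 1, 1, 1, False)"] h(2) by (simp add: xe add.commute)
  show "x \<in> D2" using 1 2 h K2_torus[of \<epsilon> d g] by (auto simp: xe D2_def)
next
  fix x assume x: "x \<in> D2"
  obtain e z v u c \<epsilon> d g s where xe: "x = (e, z, v, u, c, \<epsilon>, d, g, s)" by (cases x rule: k2_cases)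
  have h: "\<epsilon> = 1" "c = 0" "g = d" "d ^ 2 = 1" "\<not> s" using x by (auto simp: xe D2_def)
  then have dd: "d * d = 1" by (simp add: power2_eq_square)
  have "x \<in> H2" using x subsets2 by (auto simp: D2_def)
  moreover have "x \<otimes>\<^bsub>K2\<^esub> y = y \<otimes>\<^bsub>K2\<^esub> x" if "y \<in> Z2" for y
    using that dd h by (cases y rule: k2_cases) (auto simp: xe add.commute)
  ultimately show "x \<in> centralizer (sub K2 H2) Z2" by (simp add: centralizer_def)
qed


lemma D2_image: "to_K1 ` D2 = D1"
proof -
  have *: "fst (snd (snd (to_K1 x))) = (\<lambda>(e, z, v, u, c, \<epsilon>, d, g, s). \<epsilon>) x" for x
    by (cases x rule: k2_cases) simp
  have "D2 = {x \<in> T2. fst (snd (snd (to_K1 x))) = 1}" unfolding * D2_def by auto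
  moreover have "D1 = {x \<in> T21. fst (snd (snd x)) = 1}" by (auto simp: D1_def)
  ultimately show ?thesis unfolding to_K1_image(3)[symmetric] by (simp only: Compr_image_eq)
qed

section \<open>The graph\<close>

lemma card_image_eq:
  assumes "\<And>x y. x \<in> X \<Longrightarrow> y \<in> X \<Longrightarrow> f x = f y \<longleftrightarrow> g x = g y"
  shows "card (f ` X) = card (g ` X)"
proof (rule bij_betw_same_card)
  have r: "inv_into X f (f x) \<in> X" "f (inv_into X f (f x)) = f x" if "x \<in> X" for x
    using that by (auto simp: inv_into_into f_inv_into_f)
  have e: "g (inv_into X f (f x)) = g x" if "x \<in> X" for x using assms r[OF that] that by blast
  show "bij_betw (\<lambda>z. g (inv_into X f z)) (f ` X) (g ` X)"
    unfolding bij_betw_def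
  proof
    show "inj_on (\<lambda>z. g (inv_into X f z)) (f ` X)"
      by (rule inj_onI) (auto simp: e assms)
    show "(\<lambda>z. g (inv_into X f z)) ` f ` X = g ` X"
      unfolding image_image using e by (rule image_cong[OF refl])
  qed
qed

lemma card_gf9_option: "card (UNIV :: gf9 option set) = 10"
proof -
  have "card (range (Some :: gf9 \<Rightarrow> gf9 option)) = 9" by (simp add: card_image card_gf9)
  then show ?thesis by (simp add: UNIV_option_conv)
qed

locale amalgam_model = graph_pair \<Gamma> H x1 x2 + f1: inj_hom K1 "graph_aut \<Gamma>" f1 + f2: inj_hom K2 "graph_aut \<Gamma>" f2
  for \<Gamma> :: "nat pair_pre_digraph" and H x1 x2 f1 f2 +
  assumes amalgam: "\<And>c. c \<in> C2 \<Longrightarrow> f1 (to_K1 c) = f2 c"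
    and V1: "vstab H x1 = f1 ` carrier K1" and V2: "vstab H x2 = f2 ` carrier K2"
    and V12': "vstab H x1 \<inter> vstab H x2 = f2 ` C2"
begin

lemma xV: "x1 \<in> V" "x2 \<in> V"
  using arc_verts[OF arc] by auto

text \<open>Subgroups of the common subgroup have a description in both parabolics; this allows each
  fact to be taken from the one where it is easier.\<close>

lemma image_f1_f2: "f1 ` C1 = f2 ` C2" "f1 ` S1 = f2 ` S2" "f1 ` T21 = f2 ` T2" "f1 ` B1 = f2 ` B2" "f1 ` D1 = f2 ` D2"
proof -
  have *: "f1 ` (to_K1 ` X) = f2 ` X" if "X \<subseteq> C2" for X
    unfolding image_image using that amalgam by (intro image_cong) auto
  show "f1 ` C1 = f2 ` C2" "f1 ` S1 = f2 ` S2" "f1 ` T21 = f2 ` T2" "f1 ` B1 = f2 ` B2" "f1 ` D1 = f2 ` D2"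
    using *[OF subset_refl] *[OF subsets2(6)] *[OF subsets2(7)] *[OF subsets2(3)] *[OF D2_C2]
    unfolding to_K1_image D2_image .
qed

lemma V12: "vstab H x1 \<inter> vstab H x2 = f1 ` C1"
  by (simp add: V12' image_f1_f2)

lemma sub1: "subgroup X K1 \<Longrightarrow> subgroup (f1 ` X) A"
  by (rule f1.subgroup_img_is_subgroup)

lemma f1_carrier: "k \<in> carrier K1 \<Longrightarrow> f1 k \<in> carrier A" and f2_carrier: "l \<in> carrier K2 \<Longrightarrow> f2 l \<in> carrier A"
  by simp_all

lemma f1_coset: 
  assumes k: "k \<in> carrier K1" "l \<in> carrier K1"
  shows "f1 k x2 = f1 l x2 \<longleftrightarrow> inv\<^bsub>K1\<^esub> k \<otimes>\<^bsub>K1\<^esub> l \<in> C1"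
proof -
  let ?m = "inv\<^bsub>K1\<^esub> k \<otimes>\<^bsub>K1\<^esub> l"
  have m: "?m \<in> carrier K1" using k by simp
  have "?m \<in> C1 \<longleftrightarrow> f1 ?m \<in> f1 ` C1"
    using f1.inj m subsets1(12) by (simp add: inj_on_image_mem_iff del: f1.hom_mult)
  also have "\<dots> \<longleftrightarrow> f1 ?m \<in> vstab H x1 \<and> f1 ?m \<in> vstab H x2" using V12 by blast
  also have "\<dots> \<longleftrightarrow> f1 ?m x2 = x2"
    using m V1 unfolding vstab_def by blast
  also have "f1 ?m = inv\<^bsub>A\<^esub> (f1 k) \<otimes>\<^bsub>A\<^esub> f1 l" using k by simp
  also have "(inv\<^bsub>A\<^esub> (f1 k) \<otimes>\<^bsub>A\<^esub> f1 l) x2 = (inv\<^bsub>A\<^esub> (f1 k)) (f1 l x2)"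
    using k xV by (intro aut_mult) simp_all
  also have "\<dots> = x2 \<longleftrightarrow> f1 k x2 = f1 l x2"
    using aut_inv[of "f1 k"] aut_closed[of "f1 l"] k xV by (metis f1_carrier)
  finally show ?thesis by blast
qed

lemma f2_coset: 
  assumes k: "k \<in> carrier K2" "l \<in> carrier K2"
  shows "f2 k x1 = f2 l x1 \<longleftrightarrow> inv\<^bsub>K2\<^esub> k \<otimes>\<^bsub>K2\<^esub> l \<in> C2"
proof -
  let ?m = "inv\<^bsub>K2\<^esub> k \<otimes>\<^bsub>K2\<^esub> l"
  have m: "?m \<in> carrier K2" using k by simp
  have "?m \<in> C2 \<longleftrightarrow> f2 ?m \<in> f2 ` C2"
    using f2.inj m subsets2(9) by (simp add: inj_on_image_mem_iff del: f2.hom_mult)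
  also have "\<dots> \<longleftrightarrow> f2 ?m \<in> vstab H x1 \<and> f2 ?m \<in> vstab H x2" using V12' by blast
  also have "\<dots> \<longleftrightarrow> f2 ?m x1 = x1"
    using m V2 unfolding vstab_def by blast
  also have "f2 ?m = inv\<^bsub>A\<^esub> (f2 k) \<otimes>\<^bsub>A\<^esub> f2 l" using k by simp
  also have "(inv\<^bsub>A\<^esub> (f2 k) \<otimes>\<^bsub>A\<^esub> f2 l) x1 = (inv\<^bsub>A\<^esub> (f2 k)) (f2 l x1)"
    using k xV by (intro aut_mult) simp_all
  also have "\<dots> = x1 \<longleftrightarrow> f2 k x1 = f2 l x1"
    using aut_inv[of "f2 k"] aut_closed[of "f2 l"] k xV by (metis f2_carrier)
  finally show ?thesis by blast
qed

lemma f1_app: "k \<in> carrier K1 \<Longrightarrow> l \<in> carrier K1 \<Longrightarrow> f1 k (f1 l x2) = f1 (k \<otimes>\<^bsub>K1\<^esub> l) x2"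
  using xV by (simp add: aut_mult)

lemma f2_app: "k \<in> carrier K2 \<Longrightarrow> l \<in> carrier K2 \<Longrightarrow> f2 k (f2 l x1) = f2 (k \<otimes>\<^bsub>K2\<^esub> l) x1"
  using xV by (simp add: aut_mult)

lemma nbrs_eq: "nbrs \<Gamma> x1 = (\<lambda>k. f1 k x2) ` carrier K1" "nbrs \<Gamma> x2 = (\<lambda>k. f2 k x1) ` carrier K2"
  unfolding nbrs1 nbrs2 V1 V2 by (simp_all only: image_image)

lemma card_nbrs: "card (nbrs \<Gamma> x1) = 10" "card (nbrs \<Gamma> x2) = 9"
proof -
  \<comment> \<open>The slope of the line spanned by the first column, with \<open>None\<close> for
    the line of the second basis vector; the values form a projective line of ten points.\<close>
  define d :: "k1 \<Rightarrow> gf9 option" where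
    "d = (\<lambda>(e, v, \<epsilon>, A, s). if A $ 1 $ 1 = 0 then None else Some (A $ 2 $ 1 / A $ 1 $ 1))"
  have "card ((\<lambda>k. f1 k x2) ` carrier K1) = card (d ` carrier K1)"
  proof (rule card_image_eq)
    fix k l assume kl: "k \<in> carrier K1" "l \<in> carrier K1"
    obtain e v \<epsilon> A s where ke: "k = (e, v, \<epsilon>, A, s)" by (cases k)
    obtain e' v' \<epsilon>' A' s' where le: "l = (e', v', \<epsilon>', A', s')" by (cases l)
    have "det A \<noteq> 0" "det A' \<noteq> 0" using kl K1_nz by (auto simp: ke le)
    then have "A $ 1 $ 1 \<noteq> 0 \<or> A $ 2 $ 1 \<noteq> 0" "A' $ 1 $ 1 \<noteq> 0 \<or> A' $ 2 $ 1 \<noteq> 0" by (auto simp: det_2)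
    then have "A $ 1 $ 1 * A' $ 2 $ 1 = A $ 2 $ 1 * A' $ 1 $ 1 \<longleftrightarrow> d k = d l"
      by (auto simp: d_def ke le field_simps)
    then show "f1 k x2 = f1 l x2 \<longleftrightarrow> d k = d l"
      unfolding f1_coset[OF kl] using C1_coset_iff kl unfolding ke le by blast
  qed
  also have "d ` carrier K1 = UNIV"
  proof -
    have "t \<in> d ` carrier K1" for t
    proof (cases t)
      case None
      then have "t = d weyl" by (simp add: d_def weyl_def)
      then show ?thesis using weyl_mem by blast
    next
      case (Some a)
      then have "t = d (0, 0, 1, lower a, False)" by (simp add: d_def)
      moreover have "(0, 0, 1, lower a, False) \<in> carrier K1" by simp
      ultimately show ?thesis by blast
    qed
    then show ?thesis by blast
  qed
  finally show "card (nbrs \<Gamma> x1) = 10" unfolding nbrs_eq card_gf9_option .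
next
  define d :: "k2 \<Rightarrow> gf9" where "d = (\<lambda>(e, z, v, u, c, \<epsilon>, d, g, s). c)"
  have "card ((\<lambda>k. f2 k x1) ` carrier K2) = card (d ` carrier K2)"
  proof (rule card_image_eq)
    fix k l assume kl: "k \<in> carrier K2" "l \<in> carrier K2"
    obtain e z v u c \<epsilon> a g s where ke: "k = (e, z, v, u, c, \<epsilon>, a, g, s)" by (cases k rule: k2_cases)
    obtain e' z' v' u' c' \<epsilon>' a' g' s' where le: "l = (e', z', v', u', c', \<epsilon>', a', g', s')" by (cases l rule: k2_cases)
    show "f2 k x1 = f2 l x1 \<longleftrightarrow> d k = d l"
      unfolding f2_coset[OF kl] using C2_coset_iff kl unfolding ke le d_def by simp
  qed
  also have "d ` carrier K2 = UNIV"
  proof -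
    have "t \<in> d ` carrier K2" for t
    proof -
      have "t = d (0, 0, 0, 0, t, 1, 1, 1, False)" by (simp add: d_def)
      moreover have "(0, 0, 0, 0, t, 1, 1, 1, False) \<in> carrier K2" by simp
      ultimately show ?thesis by blast
    qed
    then show ?thesis by blast
  qed
  finally show "card (nbrs \<Gamma> x2) = 9" unfolding nbrs_eq card_gf9 .
qed

text \<open>Fixing the neighbor \<open>f1 l x2\<close> means that the conjugate by \<open>l\<close>
  lies in \<open>C1\<close>. Over all \<open>l\<close> this is the core found in
  \<open>core_C1\<close>, and likewise at \<open>x2\<close>.\<close>

lemma vker_eq: "vker \<Gamma> H x1 = f1 ` T1" "vker \<Gamma> H x2 = f1 ` T21"
proof -
  have *: "f1 k (f1 l x2) = f1 l x2 \<longleftrightarrow> inv\<^bsub>K1\<^esub> l \<otimes>\<^bsub>K1\<^esub> k \<otimes>\<^bsub>K1\<^esub> l \<in> C1"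
    if "k \<in> carrier K1" "l \<in> carrier K1" for k l
    unfolding f1_app[OF that] using f1_coset[of l "k \<otimes>\<^bsub>K1\<^esub> l"] that by (auto simp: K1.m_assoc)
  show "vker \<Gamma> H x1 = f1 ` T1"
    unfolding vker_def V1 nbrs_eq core_C1[symmetric] using * by blast
  have *: "f2 k (f2 l x1) = f2 l x1 \<longleftrightarrow> inv\<^bsub>K2\<^esub> l \<otimes>\<^bsub>K2\<^esub> k \<otimes>\<^bsub>K2\<^esub> l \<in> C2"
    if "k \<in> carrier K2" "l \<in> carrier K2" for k l
    unfolding f2_app[OF that] using f2_coset[of l "k \<otimes>\<^bsub>K2\<^esub> l"] that by (auto simp: K2.m_assoc)
  show "vker \<Gamma> H x2 = f1 ` T21"
    unfolding vker_def V2 nbrs_eq image_f1_f2 core_C2[symmetric] using * by blast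
qed

lemma largest_normal_eq:
  "largest_normal_in A (vstab H x1) (vstab H x1 \<inter> vstab H x2) = f1 ` T1"
  "largest_normal_in A (vstab H x2) (vstab H x1 \<inter> vstab H x2) = f1 ` T21"
proof -
  show "largest_normal_in A (vstab H x1) (vstab H x1 \<inter> vstab H x2) = f1 ` T1"
    unfolding V12 unfolding V1 f1.largest_normal_in_image[OF subgroup_C1] core_C1 ..
  show "largest_normal_in A (vstab H x2) (vstab H x1 \<inter> vstab H x2) = f1 ` T21"
    unfolding V12' unfolding V2 f2.largest_normal_in_image[OF subgroup_C2] core_C2 image_f1_f2 ..
qed

lemma is_Op_vker: "is_Op 3 (sub A (vker \<Gamma> H x1)) (f1 ` W1)" "is_Op 3 (sub A (vker \<Gamma> H x2)) (f1 ` S1)"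
  unfolding vker_eq
  using f1.is_Op_image[OF T1_sub W1_is_Op] f1.is_Op_image[OF T21_sub S1_is_Op[OF T21_sub subsets1(1,2)]] .

lemma pushing_up: "pushing_up_type 3 \<Gamma> H"
proof -
  have "local_characteristic 3 \<Gamma> H"
  proof (rule local_characteristicI[OF _ is_Op_vker])
    have "centralizer (sub A (vstab H x1)) (f1 ` W1) = f1 ` centralizer K1 W1"
      using f1.centralizer_image[of "carrier K1" W1] subsets1 by (simp add: V1 sub_carrier)
    then show "centralizer (sub A (vstab H x1)) (f1 ` W1) \<subseteq> f1 ` W1"
      by (simp only: image_mono centralizer_W1)
    have "centralizer (sub A (vstab H x2)) (f2 ` S2) = f2 ` centralizer K2 S2"
      using f2.centralizer_image[of "carrier K2" S2] subsets2 by (simp add: V2 sub_carrier)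
    then show "centralizer (sub A (vstab H x2)) (f1 ` S1) \<subseteq> f1 ` S1"
      unfolding image_f1_f2 by (simp only: image_mono subset_trans[OF centralizer_S2 subsets2(5)])
  qed simp
  moreover have "Op_ker 3 \<Gamma> H x1 \<subseteq> Op_ker 3 \<Gamma> H x2"
    unfolding Op_ker_def Op_eq[OF is_Op_vker(1)] Op_eq[OF is_Op_vker(2)] using subsets1(5) by (rule image_mono)
  ultimately show ?thesis unfolding pushing_up_type_def pushing_up_type_wrt_def using arc by blast
qed

text \<open>\<open>move\<close> and \<open>weyl\<close> serve as \<open>\<alpha>\<close> and
  \<open>r\<close>; the commutation relations, proved separately inside \<open>K1\<close> and
  \<open>K2\<close>, meet in the automorphism group through \<open>to_K1\<close>.\<close>

lemma five_arc_transitive: "locally_s_arc_transitive 5 \<Gamma> H"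
proof (rule five_arc_transitiveI)
  have C1c: "to_K1 q \<in> carrier K1" and C2c: "q \<in> carrier K2" if "q \<in> C2" for q
    using that to_K1_image(1) subsets1(12) subsets2(9) by blast+
  have m1: "f1 a \<otimes>\<^bsub>A\<^esub> f2 b = f2 c \<otimes>\<^bsub>A\<^esub> f1 a" if "a \<otimes>\<^bsub>K1\<^esub> to_K1 b = to_K1 c \<otimes>\<^bsub>K1\<^esub> a" "a \<in> carrier K1" "b \<in> C2" "c \<in> C2" for a b c
  proof -
    have "f1 a \<otimes>\<^bsub>A\<^esub> f1 (to_K1 b) = f1 (to_K1 c) \<otimes>\<^bsub>A\<^esub> f1 a"
      using that C1c by (simp flip: f1.hom_mult)
    then show ?thesis using amalgam that by simp
  qed
  have m2: "f2 a \<otimes>\<^bsub>A\<^esub> f2 b = f2 c \<otimes>\<^bsub>A\<^esub> f2 a" if "a \<otimes>\<^bsub>K2\<^esub> b = c \<otimes>\<^bsub>K2\<^esub> a" "a \<in> carrier K2" "b \<in> C2" "c \<in> C2" for a b c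
    using that C2c by (simp flip: f2.hom_mult)
  have one: "f1 \<one>\<^bsub>K1\<^esub> x2 = x2" "f2 \<one>\<^bsub>K2\<^esub> x1 = x1" using xV by (simp_all only: f1.hom_one f2.hom_one aut_one)
  have fix1: "f1 k x2 = x2 \<longleftrightarrow> k \<in> C1" if "k \<in> carrier K1" for k
    using f1_coset[OF K1.one_closed that] unfolding one K1.inv_one K1.l_one[OF that] by metis
  have fix2: "f2 k x1 = x1 \<longleftrightarrow> k \<in> C2" if "k \<in> carrier K2" for k
    using f2_coset[OF K2.one_closed that] unfolding one K2.inv_one K2.l_one[OF that] by metis
  show "f2 move \<in> vstab H x2" "f1 weyl \<in> vstab H x1" unfolding V1 V2 using move_mem weyl_mem by blast+
  show "f2 move x1 \<noteq> x1" unfolding fix2[OF move_mem] by (simp add: move_def)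
  show "f1 weyl x2 \<noteq> x2" unfolding fix1[OF weyl_mem] by (simp add: weyl_def)
  show "f2 ` C2 = vstab H x1 \<inter> vstab H x2" by (simp add: V12')
  fix y
  {
    assume y: "y \<in> nbrs \<Gamma> x1" "y \<noteq> x2"
    then obtain k where k: "k \<in> carrier K1" "y = f1 k x2" by (auto simp: nbrs_eq)
    then have "k \<notin> C1" using fix1 y by auto
    then obtain q w w' w'' where q: "q \<in> C2" "w \<in> C2" "w' \<in> C2" "w'' \<in> C2"
      "inv\<^bsub>K1\<^esub> (to_K1 q \<otimes>\<^bsub>K1\<^esub> weyl) \<otimes>\<^bsub>K1\<^esub> k \<in> C1" "move \<otimes>\<^bsub>K2\<^esub> q = w \<otimes>\<^bsub>K2\<^esub> move"
      "weyl \<otimes>\<^bsub>K1\<^esub> to_K1 w = to_K1 w' \<otimes>\<^bsub>K1\<^esub> weyl" "move \<otimes>\<^bsub>K2\<^esub> w' = w'' \<otimes>\<^bsub>K2\<^esub> move"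
      using unipotent_step[OF k(1)] by blast
    have "f2 q (f1 weyl x2) = y"
      using f1_coset[OF K1.m_closed[OF C1c[OF q(1)] weyl_mem] k(1)] q(5) f1_app[OF C1c[OF q(1)] weyl_mem] amalgam[OF q(1)]
      by (simp add: k(2) del: f1.hom_mult)
    then show "\<exists>q\<in>f2 ` C2. \<exists>w\<in>f2 ` C2. \<exists>w'\<in>f2 ` C2. \<exists>w''\<in>f2 ` C2. q (f1 weyl x2) = y \<and>
      f2 move \<otimes>\<^bsub>A\<^esub> q = w \<otimes>\<^bsub>A\<^esub> f2 move \<and> f1 weyl \<otimes>\<^bsub>A\<^esub> w = w' \<otimes>\<^bsub>A\<^esub> f1 weyl \<and> f2 move \<otimes>\<^bsub>A\<^esub> w' = w'' \<otimes>\<^bsub>A\<^esub> f2 move"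
      using m1[OF q(7) weyl_mem q(2,3)] m2[OF q(6) move_mem q(1,2)] m2[OF q(8) move_mem q(3,4)] q(1-4) by blast
  next
    assume y: "y \<in> nbrs \<Gamma> x2" "y \<noteq> x1"
    then obtain k where k: "k \<in> carrier K2" "y = f2 k x1" by (auto simp: nbrs_eq)
    then have "k \<notin> C2" using fix2 y by auto
    then obtain q t t' where q: "q \<in> C2" "t \<in> C2" "t' \<in> C2"
      "inv\<^bsub>K2\<^esub> (q \<otimes>\<^bsub>K2\<^esub> move) \<otimes>\<^bsub>K2\<^esub> k \<in> C2" "weyl \<otimes>\<^bsub>K1\<^esub> to_K1 q = to_K1 t \<otimes>\<^bsub>K1\<^esub> weyl"
      "move \<otimes>\<^bsub>K2\<^esub> t = t \<otimes>\<^bsub>K2\<^esub> move" "weyl \<otimes>\<^bsub>K1\<^esub> to_K1 t = to_K1 t' \<otimes>\<^bsub>K1\<^esub> weyl"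
      using torus_step[OF k(1)] by blast
    have "f2 q (f2 move x1) = y"
      using f2_coset[OF K2.m_closed[OF C2c[OF q(1)] move_mem] k(1)] q(4) f2_app[OF C2c[OF q(1)] move_mem]
      by (simp add: k(2) del: f2.hom_mult)
    then show "\<exists>q\<in>f2 ` C2. \<exists>t\<in>f2 ` C2. \<exists>t'\<in>f2 ` C2. q (f2 move x1) = y \<and>
      f1 weyl \<otimes>\<^bsub>A\<^esub> q = t \<otimes>\<^bsub>A\<^esub> f1 weyl \<and> f2 move \<otimes>\<^bsub>A\<^esub> t = t \<otimes>\<^bsub>A\<^esub> f2 move \<and> f1 weyl \<otimes>\<^bsub>A\<^esub> t = t' \<otimes>\<^bsub>A\<^esub> f1 weyl"
      using m1[OF q(5) weyl_mem q(1,2)] m2[OF q(6) move_mem q(2,2)] m1[OF q(7) weyl_mem q(2,3)] q(1-3) by blast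
  }
qed

lemma L_eq: "generate A (\<Union>u\<in>nbrs \<Gamma> x1. Op_ker 3 \<Gamma> H u) <#>\<^bsub>A\<^esub> Op_ker 3 \<Gamma> H x1 = f1 ` L1"
proof -
  have "Op_ker 3 \<Gamma> H x1 = f1 ` W1" unfolding Op_ker_def using is_Op_vker(1) by (rule Op_eq)
  moreover have "conj_closure A (f1 ` S1) (vstab H x1) = f1 ` conj_closure K1 S1 (carrier K1)"
    unfolding V1 by (rule f1.conj_closure_image) (rule subsets1 subset_refl)+
  moreover have "conj_closure K1 S1 (carrier K1) \<subseteq> carrier K1"
    by (rule subgroup.subset[OF K1.conj_closure_subgroup]) (rule subsets1 subset_refl)+
  ultimately show ?thesis
    unfolding Op_ker_nbrs[OF is_Op_vker(2)] using f1.set_mult_image[of "conj_closure K1 S1 (carrier K1)" W1] subsets1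
    by (simp add: conj_closure_S1)
qed

lemma conj_closures: "conj_closure A (f1 ` B1) (vstab H x1) = f1 ` H1" "conj_closure A (f1 ` B1) (vstab H x2) = f2 ` H2"
proof -
  show "conj_closure A (f1 ` B1) (vstab H x1) = f1 ` H1"
    unfolding V1 conj_closure_B1[symmetric] by (rule f1.conj_closure_image) (rule subsets1 subset_refl)+
  show "conj_closure A (f1 ` B1) (vstab H x2) = f2 ` H2"
    unfolding V2 image_f1_f2 conj_closure_B2[symmetric] by (rule f2.conj_closure_image) (rule subsets2 subset_refl)+
qed

lemma core_eq: "core A (vstab H x1) (vstab H x2) = f1 ` B1"
proof (rule core_eqI)
  have p: "f1 ` T1 <#>\<^bsub>A\<^esub> f1 ` T21 = f1 ` B1"
    using f1.set_mult_image[OF subsets1(19,18)] prod_B1 by simp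
  then show "f1 ` B1 = largest_normal_in A (vstab H x1) (vstab H x1 \<inter> vstab H x2) <#>\<^bsub>A\<^esub>
      largest_normal_in A (vstab H x2) (vstab H x1 \<inter> vstab H x2)" unfolding largest_normal_eq ..
  have "f1 ` B1 = f1 ` C1 \<inter> f1 ` H1"
    unfolding B1_def using subsets1 by (subst inj_on_image_Int[OF f1.inj, symmetric]) blast+
  moreover have "f1 ` B1 = f1 ` C1 \<inter> f2 ` H2"
    unfolding image_f1_f2 B2_def using subsets2 by (subst inj_on_image_Int[OF f2.inj, symmetric]) blast+
  moreover have "subgroup (f1 ` B1) (sub A (f1 ` C1))"
    using sub1[OF B1_sub] sub1[OF subgroup_C1] subsets1(8) by (intro A.subgroup_incl image_mono)
  ultimately show "core_candidate A (vstab H x1) (vstab H x2) (f1 ` B1)"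
    unfolding core_candidate_def largest_normal_eq p conj_closures unfolding V12 by (intro conjI subset_refl) assumption+
qed

lemma indices: "index (sub A (vstab H x1)) (f1 ` H1) = 2" "index (sub A (vstab H x2)) (f2 ` H2) = 2"
  "index (sub A (vstab H x1 \<inter> vstab H x2)) (f1 ` B1) = 2"
proof -
  show "index (sub A (vstab H x1)) (f1 ` H1) = 2"
    using f1.index_image[OF K1.subgroup_self H1_sub subsets1(14)] by (simp add: V1 sub_carrier index_H1)
  show "index (sub A (vstab H x2)) (f2 ` H2) = 2"
    using f2.index_image[OF K2.subgroup_self H2_sub subsets2(10)] by (simp add: V2 sub_carrier index_H2)
  show "index (sub A (vstab H x1 \<inter> vstab H x2)) (f1 ` B1) = 2"
    using f1.index_image[OF subgroup_C1 B1_sub subsets1(8)] by (simp add: V12 index_B1)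
qed

section \<open>The clauses of the theorem, transported to the graph\<close>

lemma iso1: "subgroup X K1 \<Longrightarrow> sub K1 X \<cong> Y \<Longrightarrow> sub A (f1 ` X) \<cong> Y"
  by (rule iso_trans[OF f1.is_iso_sub])

lemma inter_LB: "f1 ` L1 \<inter> f1 ` B1 = f1 ` (L1 \<inter> B1)"
  using subsets1 by (intro inj_on_image_Int[OF f1.inj, symmetric]) blast+

lemma Op_eqs: "Op 3 (sub A (f1 ` B1)) = f1 ` S1" "Op 3 (sub A (f1 ` (L1 \<inter> B1))) = f1 ` S1"
  "Op 3 (sub A (f1 ` T21)) = f1 ` S1"
  by (rule Op_eq, rule f1.is_Op_image, rule B1_sub LB_sub T21_sub, rule S1_is_Op,
      (rule B1_sub LB_sub T21_sub subsets1 subset_refl Int_lower2)+)+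

lemma centers: "center (sub A (f1 ` L1)) = f1 ` Z1" "center (sub A (f1 ` S1)) = f2 ` Z2"
  unfolding f1.center_image[OF subsets1(13)] center_L1 image_f1_f2 f2.center_image[OF subsets2(13)] center_S2
  by (rule refl)+

lemma centralizers: "centralizer (sub A (f1 ` H1)) (f1 ` Z1) = f1 ` D0"
  "centralizer (sub A (f2 ` H2)) (f2 ` Z2) = f1 ` D1"
  unfolding f1.centralizer_image[OF subsets1(14,20)] centralizer_Z1
    f2.centralizer_image[OF subsets2(10,14)] centralizer_Z2 image_f1_f2 by (rule refl)+

lemma Syl_S1: "f1 ` S1 \<in> Syl 3 (sub A (f1 ` L1))"
proof -
  have c: "card (f1 ` X) = card X" if "X \<subseteq> carrier K1" for X
    using f1.inj that by (meson card_image inj_on_subset)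
  have o: "order (sub A (f1 ` L1)) = 80 * 3 ^ 7"
    using S1_Syl by (simp add: order_def c subsets1)
  have "S1 \<subseteq> L1" using subsets1 by blast
  then have "subgroup (f1 ` S1) (sub A (f1 ` L1))"
    using sub1[OF S1_sub] sub1[OF L1_sub] by (intro A.subgroup_incl image_mono)
  then show ?thesis unfolding Syl_def o multiplicity_3 using card_S1 c[OF subsets1(16)] by simp
qed

lemma conclusion:
  assumes "sylow_ASL S0 \<kappa>"
  shows "H_graph \<Gamma> H \<and> locally_s_arc_transitive 5 \<Gamma> H \<and> pushing_up_type 3 \<Gamma> H \<and>
    (x1, x2) \<in> parcs \<Gamma> \<and> card (nbrs \<Gamma> x1) = 10 \<and> card (nbrs \<Gamma> x2) = 9 \<and>
    (let G = graph_aut \<Gamma>;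
         H\<^sub>1 = vstab H x1;
         H\<^sub>2 = vstab H x2;
         H\<^sub>1\<^sub>2 = H\<^sub>1 \<inter> H\<^sub>2;
         L\<^sub>1 = generate G (\<Union>u\<in>nbrs \<Gamma> x1. Op_ker 3 \<Gamma> H u) <#>\<^bsub>G\<^esub> Op_ker 3 \<Gamma> H x1;
         T\<^sub>2 = largest_normal_in G H\<^sub>2 H\<^sub>1\<^sub>2;
         B = core G H\<^sub>1 H\<^sub>2;
         H\<^sub>1s = conj_closure G B H\<^sub>1;
         H\<^sub>2s = conj_closure G B H\<^sub>2;
         Z = center (sub G L\<^sub>1);
         Q = Op 3 (sub G T\<^sub>2);
         E3 = elem_abelian 3 1;
         E243 = elem_abelian 3 5
     in
      (sub G L\<^sub>1 \<cong> E3 \<times>\<times> ASL2_9 \<and> sub G Z \<cong> E3 \<and>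
       Op 3 (sub G B) = Op 3 (sub G (L\<^sub>1 \<inter> B)) \<and> Op 3 (sub G (L\<^sub>1 \<inter> B)) = Q \<and> Q \<in> Syl 3 (sub G L\<^sub>1)) \<and>
      (B = (L\<^sub>1 \<inter> B) <#>\<^bsub>G\<^esub> T\<^sub>2 \<and>
       sub G (L\<^sub>1 \<inter> B) \<cong> E3 \<times>\<times> ASL2_9_norm S0 \<and>
       quotient_iso (sub G T\<^sub>2) Z (normal_of_index (K2_9 S0) 2)) \<and>
      ((\<exists>\<phi> \<in> hom (normal_of_index GL2_9 2) (AutoGroup E243).
          sub G H\<^sub>1s \<cong> semidirect E243 (normal_of_index GL2_9 2) \<phi>) \<and>
       sub G (centralizer (sub G H\<^sub>1s) Z) \<cong> E3 \<times>\<times> normal_of_index AGL2_9 4) \<and>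
      ((\<exists>\<phi> \<in> hom (normal_of_index GL1_9 2 \<times>\<times> AGL1_9) (AutoGroup (sub G Q)).
          \<exists>f \<in> iso (sub G H\<^sub>2s) (semidirect (sub G Q) (normal_of_index GL1_9 2 \<times>\<times> AGL1_9) \<phi>).
            \<forall>q\<in>Q. f q = (q, \<one>\<^bsub>normal_of_index GL1_9 2 \<times>\<times> AGL1_9\<^esub>)) \<and>
       sub G (centralizer (sub G H\<^sub>2s) (center (sub G Q))) \<cong> E3 \<times>\<times> normal_of_index (K2_9 S0) 4) \<and>
      (index (sub G H\<^sub>1) H\<^sub>1s = 2 \<and> index (sub G H\<^sub>2) H\<^sub>2s = 2 \<and> index (sub G H\<^sub>1\<^sub>2) B = 2 \<and>
       quotient_iso (sub G H\<^sub>1) L\<^sub>1 Q8))"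
  unfolding Let_def core_eq largest_normal_eq L_eq conj_closures inter_LB Op_eqs centers centralizers
proof (intro conjI)
  interpret S: sylow_ASL S0 \<kappa> by fact
  show "sub A (f1 ` L1) \<cong> E3 \<times>\<times> ASL2_9" by (rule iso1[OF L1_sub L1_iso])
  show "sub A (f1 ` Z1) \<cong> E3" by (rule iso1[OF Z1_sub Z1_iso])
  show "f1 ` B1 = f1 ` (L1 \<inter> B1) <#>\<^bsub>A\<^esub> f1 ` T21"
    using f1.set_mult_image[of "L1 \<inter> B1" T21] subsets1 prod_B1 by (simp add: le_infI1)
  show "sub A (f1 ` (L1 \<inter> B1)) \<cong> E3 \<times>\<times> ASL2_9_norm S0" by (rule iso1[OF LB_sub S.LB_iso])
  show "quotient_iso (sub A (f1 ` T21)) (f1 ` Z1) (normal_of_index (K2_9 S0) 2)"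
    by (rule S.T21_quotient) (rule f1.quotient_iso_image[OF T21_sub])
  show "\<exists>\<phi> \<in> hom (normal_of_index GL2_9 2) (AutoGroup (elem_abelian 3 5)).
      sub A (f1 ` H1) \<cong> semidirect (elem_abelian 3 5) (normal_of_index GL2_9 2) \<phi>"
    using H1_semidirect iso1[OF H1_sub] by blast
  show "sub A (f1 ` D0) \<cong> E3 \<times>\<times> normal_of_index AGL2_9 4" by (rule iso1[OF D0_sub D0_iso])
  show "\<exists>\<phi> \<in> hom K' (AutoGroup (sub A (f1 ` S1))). \<exists>f \<in> iso (sub A (f2 ` H2)) (semidirect (sub A (f1 ` S1)) K' \<phi>).
      \<forall>q\<in>f1 ` S1. f q = (q, \<one>\<^bsub>K'\<^esub>)"
    unfolding image_f1_f2 by (rule H2_semidirect[OF f2.inj_hom_axioms])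
  show "sub A (f1 ` D1) \<cong> E3 \<times>\<times> normal_of_index (K2_9 S0) 4" by (rule iso1[OF D1_sub S.D1_iso])
  show "quotient_iso (sub A (vstab H x1)) (f1 ` L1) Q8"
    unfolding V1 by (rule f1.quotient_iso_image[OF K1.subgroup_self group_Q8 _ to_Q8(2,3)]) (use to_Q8(1) in \<open>simp add: sub_carrier\<close>)
qed (rule Hg five_arc_transitive pushing_up arc card_nbrs refl Syl_S1 indices)+

end

theorem theorem1p3:
  fixes S\<^sub>0 :: "affine_2_9 set"
  assumes "S\<^sub>0 \<in> Syl 3 ASL2_9"
  shows "\<exists>(\<Gamma> :: nat pair_pre_digraph) H x\<^sub>1 x\<^sub>2.
    H_graph \<Gamma> H \<and> locally_s_arc_transitive 5 \<Gamma> H \<and> pushing_up_type 3 \<Gamma> H \<and>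
    (x\<^sub>1, x\<^sub>2) \<in> parcs \<Gamma> \<and> card (nbrs \<Gamma> x\<^sub>1) = 10 \<and> card (nbrs \<Gamma> x\<^sub>2) = 9 \<and>
    (let G = graph_aut \<Gamma>;
         H\<^sub>1 = vstab H x\<^sub>1;
         H\<^sub>2 = vstab H x\<^sub>2;
         H\<^sub>1\<^sub>2 = H\<^sub>1 \<inter> H\<^sub>2;
         L\<^sub>1 = generate G (\<Union>u\<in>nbrs \<Gamma> x\<^sub>1. Op_ker 3 \<Gamma> H u) <#>\<^bsub>G\<^esub> Op_ker 3 \<Gamma> H x\<^sub>1;
         T\<^sub>2 = largest_normal_in G H\<^sub>2 H\<^sub>1\<^sub>2;
         B = core G H\<^sub>1 H\<^sub>2;
         H\<^sub>1s = conj_closure G B H\<^sub>1;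
         H\<^sub>2s = conj_closure G B H\<^sub>2;
         Z = center (sub G L\<^sub>1);
         Q = Op 3 (sub G T\<^sub>2);
         E3 = elem_abelian 3 1;
         E243 = elem_abelian 3 5
     in
      \<comment> \<open>(i)\<close>
      (sub G L\<^sub>1 \<cong> E3 \<times>\<times> ASL2_9 \<and> sub G Z \<cong> E3 \<and>
       Op 3 (sub G B) = Op 3 (sub G (L\<^sub>1 \<inter> B)) \<and> Op 3 (sub G (L\<^sub>1 \<inter> B)) = Q \<and> Q \<in> Syl 3 (sub G L\<^sub>1)) \<and>
      \<comment> \<open>(ii)\<close>
      (B = (L\<^sub>1 \<inter> B) <#>\<^bsub>G\<^esub> T\<^sub>2 \<and>
       sub G (L\<^sub>1 \<inter> B) \<cong> E3 \<times>\<times> ASL2_9_norm S\<^sub>0 \<and>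
       quotient_iso (sub G T\<^sub>2) Z (normal_of_index (K2_9 S\<^sub>0) 2)) \<and>
      \<comment> \<open>(iii)\<close>
      ((\<exists>\<phi> \<in> hom (normal_of_index GL2_9 2) (AutoGroup E243).
          sub G H\<^sub>1s \<cong> semidirect E243 (normal_of_index GL2_9 2) \<phi>) \<and>
       sub G (centralizer (sub G H\<^sub>1s) Z) \<cong> E3 \<times>\<times> normal_of_index AGL2_9 4) \<and>
      \<comment> \<open>(iv): the normal factor of the semidirect product is the subgroup \<open>O\<^sub>3(T\<^sub>2)\<close> itself\<close>
      ((\<exists>\<phi> \<in> hom (normal_of_index GL1_9 2 \<times>\<times> AGL1_9) (AutoGroup (sub G Q)).
          \<exists>f \<in> iso (sub G H\<^sub>2s) (semidirect (sub G Q) (normal_of_index GL1_9 2 \<times>\<times> AGL1_9) \<phi>).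
            \<forall>q\<in>Q. f q = (q, \<one>\<^bsub>normal_of_index GL1_9 2 \<times>\<times> AGL1_9\<^esub>)) \<and>
       sub G (centralizer (sub G H\<^sub>2s) (center (sub G Q))) \<cong> E3 \<times>\<times> normal_of_index (K2_9 S\<^sub>0) 4) \<and>
      \<comment> \<open>(v)\<close>
      (index (sub G H\<^sub>1) H\<^sub>1s = 2 \<and> index (sub G H\<^sub>2) H\<^sub>2s = 2 \<and> index (sub G H\<^sub>1\<^sub>2) B = 2 \<and>
       quotient_iso (sub G H\<^sub>1) L\<^sub>1 Q8))"
proof -
  obtain g where g: "g \<in> carrier ASL2_9" "S\<^sub>0 = g <#\<^bsub>ASL2_9\<^esub> U0 #>\<^bsub>ASL2_9\<^esub> inv\<^bsub>ASL2_9\<^esub> g"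
    using ASL2.Sylow_conjugate[OF _ _ U0_Syl assms] by auto
  define \<kappa> where "\<kappa> = (\<lambda>x. g \<otimes>\<^bsub>AGL2_9\<^esub> x \<otimes>\<^bsub>AGL2_9\<^esub> inv\<^bsub>AGL2_9\<^esub> g)"
  have gA: "g \<in> AS" "g \<in> carrier AGL2_9" using g(1) subgroup.subset[OF AS_sub] unfolding carrier_ASL by blast+
  \<comment> \<open>Inverses in \<open>ASL2_9\<close> and \<open>AGL2_9\<close> agree, so
    conjugation by \<open>g\<close> is one map that is an automorphism of both groups.\<close>
  have \<kappa>': "\<kappa> = (\<lambda>x. g \<otimes>\<^bsub>ASL2_9\<^esub> x \<otimes>\<^bsub>ASL2_9\<^esub> inv\<^bsub>ASL2_9\<^esub> g)"
    unfolding \<kappa>_def ASL_eq using AGL2.m_inv_consistent[OF AS_sub gA(1)] by simp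
  have "sylow_ASL S\<^sub>0 \<kappa>"
  proof
    show "\<kappa> \<in> iso AGL2_9 AGL2_9" unfolding \<kappa>_def using gA(2) AGL2.is_group by (rule conj_AGL_iso)
    show "\<kappa> \<in> iso ASL2_9 ASL2_9" unfolding \<kappa>' using g(1) ASL2.is_group by (rule conj_AGL_iso)
    show "S\<^sub>0 = \<kappa> ` U0" unfolding g(2) \<kappa>' by (auto simp: l_coset_def r_coset_def)
  qed
  moreover obtain \<Gamma> :: "nat pair_pre_digraph" and H x1 x2 f1 f2 where "H_graph \<Gamma> H"
    "inj_hom K1 (graph_aut \<Gamma>) f1" "inj_hom K2 (graph_aut \<Gamma>) f2" "\<And>c. c \<in> C2 \<Longrightarrow> f1 (to_K1 c) = f2 c"
    "vstab H x1 = f1 ` carrier K1" "vstab H x2 = f2 ` carrier K2" "vstab H x1 \<inter> vstab H x2 = f2 ` C2"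
    "(x1, x2) \<in> parcs \<Gamma>" "\<And>z. z \<in> pverts \<Gamma> \<Longrightarrow> \<exists>h\<in>H. z = h x1 \<or> z = h x2"
    "nbrs \<Gamma> x1 = (\<lambda>h. h x2) ` vstab H x1" "nbrs \<Gamma> x2 = (\<lambda>h. h x1) ` vstab H x2"
  proof (rule amalgam_graph[OF group_K1 group_K2 _ _ subgroup_C1 subgroup_C2 to_K1_iso])
    have "weyl \<notin> C1" by (simp add: weyl_def)
    then show "C1 \<noteq> carrier K1" using weyl_mem by blast
    show "N \<subseteq> {\<one>\<^bsub>K2\<^esub>}" if "N \<subseteq> C2" "N \<lhd> K2" "to_K1 ` N \<lhd> K1" for N
      using that by (rule amalgam_faithful)
  qed simp_all
  then have "amalgam_model \<Gamma> H x1 x2 f1 f2"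
    by (simp add: amalgam_model_def graph_pair_def amalgam_model_axioms_def)
  ultimately show ?thesis by (intro exI) (rule amalgam_model.conclusion)
qed


end
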